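(* Consider a 2D PEPS that is injective (that is, $V_\Lambda$ is injective for every finite region $\Lambda$), with parent Hamiltonians $H_\Lambda$. Suppose there are constants $c>0$, $\alpha>0$, $\beta\in(0,1)$ and $\ell_0$ such that for every square region $\Lambda\subset G$ and every three adjacent rectangles $A,B,C\subset\Lambda$ (with $B$ separating $A$ from $C$) whose dimensions satisfy $\ell_B\ge \ell_0$ and $\ell_B\ge (\max\{\ell_V,\ell_A,\ell_C\})^\beta$, the boundary states of the PEPS on $AB$, $B$, $BC$, $ABC$ are $\epsilon$-approximately factorizable with respect to $ABC$ with $\epsilon\le c\,\ell_B^{-\alpha}$. Then the spectral gap $\lambda(\Lambda)$ of the parent Hamiltonian $H_\Lambda$ on square regions $\Lambda$ is bounded below by a positive constant independent of $|\Lambda|$.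
   Context: PEPS. Let $(G,E)$ be an infinite graph isometrically embedded in $\mathbb{R}^2$ (e.g. the square lattice). Each vertex carries a physical space $\mathbb{C}^d$. Each edge $e$ carries a maximally entangled vector $|\omega_e\rangle=D^{-1/2}\sum_{j=1}^D|j,j\rangle\in\mathbb{C}^D\otimes\mathbb{C}^D$, one factor for each endpoint. Each vertex $v$ of degree $r$ carries a linear map $T_v:(\mathbb{C}^D)^{\otimes r}\to\mathbb{C}^d$ acting on the $r$ factors at $v$ of the incident edges. For a finite region $\Lambda\subset G$ let $\mathcal H_\Lambda=\bigotimes_{v\in\Lambda}\mathbb{C}^d$, let $E_\Lambda$ be the edges with both endpoints in $\Lambda$, let $\partial\Lambda$ be the edges joining $\Lambda$ to its complement, and let $\mathcal H_{\partial\Lambda}=\bigotimes_{e\in\partial\Lambda}\mathbb{C}^D$. Define the linear map $V_\Lambda:\mathcal H_{\partial\Lambda}\to\mathcal H_\Lambda$ by $V_\Lambda|X\rangle=\langle X|\bigotimes_{v\in\Lambda}T_v\bigotimes_{e\in E_\Lambda\cup\partial\Lambda}|\omega_e\rangle$, where $\langle X|$ contracts the factors of the edges of $\partial\Lambda$ at endpoints outside $\Lambda$ (bilinearly in the standard basis, so that $V_\Lambda$ is linear). The boundary state is $\rho_{\partial\Lambda}=V_\Lambda^\dagger V_\Lambda$. Parent Hamiltonian. For each edge $e=(u,v)$ let $h_e$ be the orthogonal projector onto the orthogonal complement of $\operatorname{Im}V_{\{u,v\}}$, and $H_\Lambda=\sum_{e\in E_\Lambda}h_e$. The spectral gap $\lambda(\Lambda)$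 is the difference between the two smallest distinct eigenvalues of $H_\Lambda$. Geometry. $A,B,C$ are three adjacent rectangles side by side, of common height $\ell_V$ and widths $\ell_A,\ell_B,\ell_C$, with $B$ in the middle separating $A$ from $C$; $AB$ denotes $A\cup B$, etc. Let $\ell$ be a length with $\ell_B\ge 3\ell$. The edges joining $B$ to the complement of $ABC$ are split, going from the $A$ side to the $C$ side, into three parts $B_L$ (next to $A$), $z$ (middle), $B_R$ (next to $C$), each of length at least $\ell$. Put $a=(\partial A\cap\partial ABC)\cup B_L$, $d=(\partial A\cap\partial B)\cup B_L$, $b=(\partial C\cap\partial ABC)\cup B_R$, $c=(\partial B\cap\partial C)\cup B_R$. Then $\partial ABC=a\cup z\cup b$, $\partial AB=a\cup z\cup c$, $\partial BC=d\cup z\cup b$, $\partial B=d\cup z\cup c$; juxtaposition of letters denotes union. Approximate factorization. The boundary states $\rho_{\partial AB},\rho_{\partial B},\rho_{\partial BC},\rho_{\partial ABC}$ are $\epsilon$-approximately factorizable with respect to $ABC$ if there are invertible operators $\Delta_{az},\Delta_{zb},\Omega_{dz},\Omega_{zc}$ (not necessarily Hermitian), supported on the regions given by their subscripts, such that with $$\sigma_{\partial ABC}=\Delta_{zb}\Delta_{az},\quad \sigma_{\partial B}=\Omega_{zc}\Omega_{dz},\quad \sigma_{\partial AB}=\Omega_{zc}\Delta_{az},\quad \sigma_{\partial BC}=\Delta_{zb}\Omega_{dz}$$ one has $\|\rho_{\partial R}^{1/2}\sigma_{\partial R}^{-1}\rho_{\partial R}^{1/2}-\mathbb 1\|\le\epsilon$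 for $R\in\{ABC,AB,BC\}$ and $\|\rho_{\partial B}^{-1/2}\sigma_{\partial B}\rho_{\partial B}^{-1/2}-\mathbb 1\|\le\epsilon$ (operator norm).
   Formalization: The condition numbers of the maps T_v are additionally assumed bounded uniformly in v (automatic for translation-invariant PEPS; with arbitrarily varying T_v the claim fails), and "isometrically embedded in R^2" is read in the l1 metric. *)

theory Defs
  imports "HOL-Analysis.Analysis"
begin

section \<open>Linear algebra over a finite index set\<close>

text \<open>
  The Hilbert spaces involved are the spaces of complex functions on finite sets of
  configurations that depend on the region, so they are described by an explicit index set
  \<open>I\<close>. Vectors and matrices vanish outside their index sets, which makes equality of functions
  the equality of vectors and operators; a matrix with rows \<open>I\<close> and columns \<open>J\<close> is a linear map
  from the space over \<open>J\<close> to the space over \<open>I\<close>.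
\<close>

definition cvecs :: "'i set \<Rightarrow> ('i \<Rightarrow> complex) set" where
  "cvecs I = {x. \<forall>i. i \<notin> I \<longrightarrow> x i = 0}"

definition cinner :: "'i set \<Rightarrow> ('i \<Rightarrow> complex) \<Rightarrow> ('i \<Rightarrow> complex) \<Rightarrow> complex" where
  "cinner I x y = (\<Sum>i\<in>I. cnj (x i) * y i)"

definition cnorm :: "'i set \<Rightarrow> ('i \<Rightarrow> complex) \<Rightarrow> real" where
  "cnorm I x = L2_set (\<lambda>i. cmod (x i)) I"

definition cmats :: "'i set \<Rightarrow> 'j set \<Rightarrow> ('i \<Rightarrow> 'j \<Rightarrow> complex) set" where
  "cmats I J = {M. \<forall>i j. i \<notin> I \<or> j \<notin> J \<longrightarrow> M i j = 0}"

definition mapply :: "'j set \<Rightarrow> ('i \<Rightarrow> 'j \<Rightarrow> complex) \<Rightarrow> ('j \<Rightarrow> complex) \<Rightarrow> 'i \<Rightarrow> complex" where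
  "mapply J M x = (\<lambda>i. \<Sum>j\<in>J. M i j * x j)"

definition mmult ::
    "'j set \<Rightarrow> ('i \<Rightarrow> 'j \<Rightarrow> complex) \<Rightarrow> ('j \<Rightarrow> 'k \<Rightarrow> complex) \<Rightarrow> 'i \<Rightarrow> 'k \<Rightarrow> complex" where
  "mmult J M N = (\<lambda>i k. \<Sum>j\<in>J. M i j * N j k)"

definition mminus ::
    "('i \<Rightarrow> 'j \<Rightarrow> complex) \<Rightarrow> ('i \<Rightarrow> 'j \<Rightarrow> complex) \<Rightarrow> 'i \<Rightarrow> 'j \<Rightarrow> complex" where
  "mminus M N = (\<lambda>i j. M i j - N i j)"

definition madjoint :: "('i \<Rightarrow> 'j \<Rightarrow> complex) \<Rightarrow> 'j \<Rightarrow> 'i \<Rightarrow> complex" where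
  "madjoint M = (\<lambda>j i. cnj (M i j))"

definition mone :: "'i set \<Rightarrow> 'i \<Rightarrow> 'i \<Rightarrow> complex" where
  "mone I = (\<lambda>i j. if i \<in> I \<and> i = j then 1 else 0)"

definition is_minv :: "'i set \<Rightarrow> ('i \<Rightarrow> 'i \<Rightarrow> complex) \<Rightarrow> ('i \<Rightarrow> 'i \<Rightarrow> complex) \<Rightarrow> bool" where
  "is_minv I M N \<longleftrightarrow> N \<in> cmats I I \<and> mmult I M N = mone I \<and> mmult I N M = mone I"

definition minvertible :: "'i set \<Rightarrow> ('i \<Rightarrow> 'i \<Rightarrow> complex) \<Rightarrow> bool" where
  "minvertible I M \<longleftrightarrow> M \<in> cmats I I \<and> (\<exists>N. is_minv I M N)"

definition minv :: "'i set \<Rightarrow> ('i \<Rightarrow> 'i \<Rightarrow> complex) \<Rightarrow> 'i \<Rightarrow> 'i \<Rightarrow> complex" where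
  "minv I M = (THE N. is_minv I M N)"

definition mpos_semidef :: "'i set \<Rightarrow> ('i \<Rightarrow> 'i \<Rightarrow> complex) \<Rightarrow> bool" where
  "mpos_semidef I M \<longleftrightarrow> M \<in> cmats I I \<and> madjoint M = M \<and>
     (\<forall>x\<in>cvecs I. 0 \<le> Re (cinner I x (mapply I M x)))"

definition msqrt :: "'i set \<Rightarrow> ('i \<Rightarrow> 'i \<Rightarrow> complex) \<Rightarrow> 'i \<Rightarrow> 'i \<Rightarrow> complex" where
  "msqrt I M = (THE S. mpos_semidef I S \<and> mmult I S S = M)"

definition mopnorm :: "'i set \<Rightarrow> ('i \<Rightarrow> 'i \<Rightarrow> complex) \<Rightarrow> real" where
  "mopnorm I M = Sup {cnorm I (mapply I M x) | x. x \<in> cvecs I \<and> cnorm I x \<le> 1}"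

definition orthocomp :: "'i set \<Rightarrow> ('i \<Rightarrow> complex) set \<Rightarrow> ('i \<Rightarrow> complex) set" where
  "orthocomp I W = {y \<in> cvecs I. \<forall>w\<in>W. cinner I w y = 0}"

definition orthoproj :: "'i set \<Rightarrow> ('i \<Rightarrow> complex) set \<Rightarrow> 'i \<Rightarrow> 'i \<Rightarrow> complex" where
  "orthoproj I W = (THE P. P \<in> cmats I I \<and> mmult I P P = P \<and> madjoint P = P \<and>
     mapply I P ` cvecs I = W)"

text \<open>Only used for Hermitian matrices, whose eigenvalues are real.\<close>

definition eigvals :: "'i set \<Rightarrow> ('i \<Rightarrow> 'i \<Rightarrow> complex) \<Rightarrow> real set" where
  "eigvals I M =
     {\<mu>. \<exists>x\<in>cvecs I. (\<exists>i\<in>I. x i \<noteq> 0) \<and> mapply I M x = (\<lambda>i. complex_of_real \<mu> * x i)}"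

section \<open>Tensor products of copies of one finite-dimensional space\<close>

text \<open>
  The tensor product of copies of \<open>\<complex>\<^sup>n\<close> with \<open>n = CARD('q)\<close>, one for each element of \<open>S\<close>, has the
  standard basis \<open>configs S\<close>.
\<close>

definition configs :: "'s set \<Rightarrow> ('s \<Rightarrow> 'q) set" where
  "configs S = (\<Pi>\<^sub>E s\<in>S. UNIV)"

text \<open>The operator \<open>M \<otimes> 1\<close> on the factors \<open>F\<close>, where \<open>M\<close> acts on the factors \<open>S \<subseteq> F\<close>.\<close>

definition tensor_ext ::
    "'s set \<Rightarrow> 's set \<Rightarrow> (('s \<Rightarrow> 'q) \<Rightarrow> ('s \<Rightarrow> 'q) \<Rightarrow> complex) \<Rightarrow>
      ('s \<Rightarrow> 'q) \<Rightarrow> ('s \<Rightarrow> 'q) \<Rightarrow> complex" where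
  "tensor_ext S F M = (\<lambda>x y.
     if x \<in> configs F \<and> y \<in> configs F \<and> (\<forall>s\<in>F - S. x s = y s)
     then M (restrict x S) (restrict y S) else 0)"

section \<open>Graphs in the plane\<close>

text \<open>The vertices are identified with their images under the embedding.\<close>

type_synonym vertex = "real \<times> real"
type_synonym edge = "vertex set"

definition adj :: "edge set \<Rightarrow> (vertex \<times> vertex) set" where
  "adj E = {(u, v). {u, v} \<in> E}"

definition graph_dist :: "edge set \<Rightarrow> vertex \<Rightarrow> vertex \<Rightarrow> nat" where
  "graph_dist E u v = (LEAST n. (u, v) \<in> adj E ^^ n)"

text \<open>
  The plane carries the \<open>\<ell>\<^sub>1\<close> metric: the square lattice, with its graph metric, embeds
  isometrically for this metric, whereas in the Euclidean plane an infinite set of points with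
  pairwise integer distances is collinear (theorem of Anning and Erdos), so that no genuinely
  two-dimensional graph would qualify.
\<close>

definition l1_dist :: "vertex \<Rightarrow> vertex \<Rightarrow> real" where
  "l1_dist u v = \<bar>fst u - fst v\<bar> + \<bar>snd u - snd v\<bar>"

definition isometric_planar_graph :: "vertex set \<Rightarrow> edge set \<Rightarrow> bool" where
  "isometric_planar_graph G E \<longleftrightarrow>
     infinite G \<and>
     (\<forall>e\<in>E. e \<subseteq> G \<and> card e = 2) \<and>
     (\<forall>u\<in>G. \<forall>v\<in>G. (u, v) \<in> (adj E)\<^sup>* \<and> real (graph_dist E u v) = l1_dist u v)"

definition inner_edges :: "edge set \<Rightarrow> vertex set \<Rightarrow> edge set" where
  "inner_edges E \<Lambda> = {e \<in> E. e \<subseteq> \<Lambda>}"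

definition bdry :: "edge set \<Rightarrow> vertex set \<Rightarrow> edge set" where
  "bdry E \<Lambda> = {e \<in> E. e \<inter> \<Lambda> \<noteq> {} \<and> \<not> e \<subseteq> \<Lambda>}"

definition incident :: "edge set \<Rightarrow> vertex \<Rightarrow> edge set" where
  "incident E v = {e \<in> E. v \<in> e}"

text \<open>
  The vertices in a half-open rectangle with sides \<open>w\<close> and \<open>h\<close>, so that on the square lattice an
  integer side is a number of columns or rows. The map \<open>p\<close> is the identity or the exchange of the
  two coordinates, which turns rectangles side by side into rectangles on top of each other.
\<close>

definition rectangle ::
    "vertex set \<Rightarrow> (vertex \<Rightarrow> real \<times> real) \<Rightarrow> real \<Rightarrow> real \<Rightarrow> real \<Rightarrow> real \<Rightarrow> vertex set" where
  "rectangle G p x w y h =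
     {v \<in> G. x \<le> fst (p v) \<and> fst (p v) < x + w \<and> y \<le> snd (p v) \<and> snd (p v) < y + h}"

definition square_region :: "vertex set \<Rightarrow> vertex set \<Rightarrow> bool" where
  "square_region G \<Lambda> \<longleftrightarrow> (\<exists>x y l. 0 < l \<and> \<Lambda> = rectangle G id x l y l)"

section \<open>Projected entangled pair states\<close>

text \<open>
  The bond dimension is \<open>D = CARD('b)\<close>, the physical dimension \<open>d = CARD('p)\<close>. The entry
  \<open>T v k \<beta>\<close>, for \<open>\<beta> \<in> configs (incident E v)\<close>, is the matrix entry of the map \<open>T\<^sub>v\<close> with row \<open>k\<close>
  and column \<open>\<beta>\<close>. A factor of an edge state is labelled by the edge and one of its endpoints.
\<close>

type_synonym ('p, 'b) peps = "vertex \<Rightarrow> 'p \<Rightarrow> (edge \<Rightarrow> 'b) \<Rightarrow> complex"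

definition half_edges :: "edge set \<Rightarrow> (edge \<times> vertex) set" where
  "half_edges F = {(e, v). e \<in> F \<and> v \<in> e}"

text \<open>The coefficients of \<open>\<omega>\<^sub>e\<close> in the standard basis.\<close>

definition omega_coeff :: "edge \<Rightarrow> (edge \<times> vertex \<Rightarrow> 'b::finite) \<Rightarrow> complex" where
  "omega_coeff e \<eta> =
     (if \<forall>u\<in>e. \<forall>v\<in>e. \<eta> (e, u) = \<eta> (e, v) then complex_of_real (1 / sqrt (real CARD('b))) else 0)"

definition peps_map ::
    "edge set \<Rightarrow> ('p::finite, 'b::finite) peps \<Rightarrow> vertex set \<Rightarrow>
      (vertex \<Rightarrow> 'p) \<Rightarrow> (edge \<Rightarrow> 'b) \<Rightarrow> complex" where
  "peps_map E T \<Lambda> = (\<lambda>k x.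
     if k \<in> configs \<Lambda> \<and> x \<in> configs (bdry E \<Lambda>) then
       (\<Sum>\<eta> \<in> {\<eta> \<in> configs (half_edges (inner_edges E \<Lambda> \<union> bdry E \<Lambda>)).
                \<forall>e\<in>bdry E \<Lambda>. \<forall>w\<in>e - \<Lambda>. \<eta> (e, w) = x e}.
          (\<Prod>v\<in>\<Lambda>. T v (k v) (\<lambda>e\<in>incident E v. \<eta> (e, v))) *
          (\<Prod>e\<in>inner_edges E \<Lambda> \<union> bdry E \<Lambda>. omega_coeff e \<eta>))
     else 0)"

definition peps_image ::
    "edge set \<Rightarrow> ('p::finite, 'b::finite) peps \<Rightarrow> vertex set \<Rightarrow> ((vertex \<Rightarrow> 'p) \<Rightarrow> complex) set" where
  "peps_image E T \<Lambda> =
     mapply (configs (bdry E \<Lambda>)) (peps_map E T \<Lambda>) ` cvecs (configs (bdry E \<Lambda>))"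

definition boundary_state ::
    "edge set \<Rightarrow> ('p::finite, 'b::finite) peps \<Rightarrow> vertex set \<Rightarrow>
      (edge \<Rightarrow> 'b) \<Rightarrow> (edge \<Rightarrow> 'b) \<Rightarrow> complex" where
  "boundary_state E T \<Lambda> = mmult (configs \<Lambda>) (madjoint (peps_map E T \<Lambda>)) (peps_map E T \<Lambda>)"

definition injective_peps ::
    "vertex set \<Rightarrow> edge set \<Rightarrow> ('p::finite, 'b::finite) peps \<Rightarrow> bool" where
  "injective_peps G E T \<longleftrightarrow>
     (\<forall>\<Lambda>. finite \<Lambda> \<and> \<Lambda> \<subseteq> G \<longrightarrow>
        inj_on (mapply (configs (bdry E \<Lambda>)) (peps_map E T \<Lambda>)) (cvecs (configs (bdry E \<Lambda>))))"

text \<open>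
  The condition numbers of the maps \<open>T\<^sub>v\<close> are bounded uniformly in \<open>v\<close>, as they are whenever only
  finitely many different maps occur, in particular under translation invariance. Injectivity
  alone bounds them for each \<open>v\<close> separately; without a uniform bound the gaps of the squares of one
  fixed size may already accumulate at zero.
\<close>

definition uniformly_conditioned ::
    "vertex set \<Rightarrow> edge set \<Rightarrow> ('p::finite, 'b::finite) peps \<Rightarrow> bool" where
  "uniformly_conditioned G E T \<longleftrightarrow>
     (\<exists>\<kappa>. \<forall>v\<in>G. \<forall>x\<in>cvecs (configs (incident E v)). \<forall>y\<in>cvecs (configs (incident E v)).
        cnorm (configs (incident E v)) x = cnorm (configs (incident E v)) y \<longrightarrow>
        cnorm UNIV (mapply (configs (incident E v)) (T v) x)
          \<le> \<kappa> * cnorm UNIV (mapply (configs (incident E v)) (T v) y))"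

section \<open>Parent Hamiltonian\<close>

text \<open>An edge is the set of its endpoints, hence itself a region.\<close>

definition edge_projector ::
    "edge set \<Rightarrow> ('p::finite, 'b::finite) peps \<Rightarrow> edge \<Rightarrow>
      (vertex \<Rightarrow> 'p) \<Rightarrow> (vertex \<Rightarrow> 'p) \<Rightarrow> complex" where
  "edge_projector E T e = orthoproj (configs e) (orthocomp (configs e) (peps_image E T e))"

definition parent_hamiltonian ::
    "edge set \<Rightarrow> ('p::finite, 'b::finite) peps \<Rightarrow> vertex set \<Rightarrow>
      (vertex \<Rightarrow> 'p) \<Rightarrow> (vertex \<Rightarrow> 'p) \<Rightarrow> complex" where
  "parent_hamiltonian E T \<Lambda> =
     (\<lambda>k k'. \<Sum>e\<in>inner_edges E \<Lambda>. tensor_ext e \<Lambda> (edge_projector E T e) k k')"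

definition energies ::
    "edge set \<Rightarrow> ('p::finite, 'b::finite) peps \<Rightarrow> vertex set \<Rightarrow> real set" where
  "energies E T \<Lambda> = eigvals (configs \<Lambda>) (parent_hamiltonian E T \<Lambda>)"

text \<open>Meaningful only if there are at least two distinct eigenvalues.\<close>

definition spectral_gap ::
    "edge set \<Rightarrow> ('p::finite, 'b::finite) peps \<Rightarrow> vertex set \<Rightarrow> real" where
  "spectral_gap E T \<Lambda> =
     Min (energies E T \<Lambda> - {Min (energies E T \<Lambda>)}) - Min (energies E T \<Lambda>)"

section \<open>Approximate factorization\<close>

text \<open>The edges joining \<open>B\<close> to the complement of \<open>ABC\<close> whose endpoint in \<open>B\<close> has its first
  coordinate in the set \<open>X\<close>.\<close>

definition outer_edges ::
    "edge set \<Rightarrow> (vertex \<Rightarrow> real \<times> real) \<Rightarrow> vertex set \<Rightarrow> vertex set \<Rightarrow> vertex set \<Rightarrow> real set \<Rightarrow>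
      edge set" where
  "outer_edges E p A B C X = {e \<in> bdry E B \<inter> bdry E (A \<union> B \<union> C). \<forall>v\<in>e \<inter> B. fst (p v) \<in> X}"

definition approx_factorizable ::
    "edge set \<Rightarrow> ('p::finite, 'b::finite) peps \<Rightarrow> real \<Rightarrow>
      vertex set \<Rightarrow> vertex set \<Rightarrow> vertex set \<Rightarrow> edge set \<Rightarrow> edge set \<Rightarrow> edge set \<Rightarrow> bool" where
  "approx_factorizable E T \<epsilon> A B C BL z BR \<longleftrightarrow>
    (let a = (bdry E A \<inter> bdry E (A \<union> B \<union> C)) \<union> BL;
         d = (bdry E A \<inter> bdry E B) \<union> BL;
         b = (bdry E C \<inter> bdry E (A \<union> B \<union> C)) \<union> BR;
         c = (bdry E B \<inter> bdry E C) \<union> BR;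
         \<rho> = boundary_state E T;
         I = (\<lambda>R. configs (bdry E R));
         prod = (\<lambda>R S\<^sub>1 M\<^sub>1 S\<^sub>2 M\<^sub>2.
                   mmult (I R) (tensor_ext S\<^sub>1 (bdry E R) M\<^sub>1) (tensor_ext S\<^sub>2 (bdry E R) M\<^sub>2));
         close_inv = (\<lambda>R \<sigma>. mopnorm (I R)
                   (mminus (mmult (I R) (mmult (I R) (msqrt (I R) (\<rho> R)) (minv (I R) \<sigma>))
                             (msqrt (I R) (\<rho> R)))
                           (mone (I R))) \<le> \<epsilon>);
         close = (\<lambda>R \<sigma>. mopnorm (I R)
                   (mminus (mmult (I R) (mmult (I R) (minv (I R) (msqrt (I R) (\<rho> R))) \<sigma>)
                             (minv (I R) (msqrt (I R) (\<rho> R))))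
                           (mone (I R))) \<le> \<epsilon>)
     in \<exists>\<Delta>\<^sub>a\<^sub>z \<Delta>\<^sub>z\<^sub>b \<Omega>\<^sub>d\<^sub>z \<Omega>\<^sub>z\<^sub>c.
          minvertible (configs (a \<union> z)) \<Delta>\<^sub>a\<^sub>z \<and>
          minvertible (configs (z \<union> b)) \<Delta>\<^sub>z\<^sub>b \<and>
          minvertible (configs (d \<union> z)) \<Omega>\<^sub>d\<^sub>z \<and>
          minvertible (configs (z \<union> c)) \<Omega>\<^sub>z\<^sub>c \<and>
          close_inv (A \<union> B \<union> C) (prod (A \<union> B \<union> C) (z \<union> b) \<Delta>\<^sub>z\<^sub>b (a \<union> z) \<Delta>\<^sub>a\<^sub>z) \<and>
          close_inv (A \<union> B) (prod (A \<union> B) (z \<union> c) \<Omega>\<^sub>z\<^sub>c (a \<union> z) \<Delta>\<^sub>a\<^sub>z) \<and>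
          close_inv (B \<union> C) (prod (B \<union> C) (z \<union> b) \<Delta>\<^sub>z\<^sub>b (d \<union> z) \<Omega>\<^sub>d\<^sub>z) \<and>
          close B (prod B (z \<union> c) \<Omega>\<^sub>z\<^sub>c (d \<union> z) \<Omega>\<^sub>d\<^sub>z))"

text \<open>
  \<open>A\<close>, \<open>B\<close>, \<open>C\<close> are nonempty adjacent rectangles, next to each other along the first coordinate of
  \<open>p\<close>, the rectangle \<open>A\<close> starting at \<open>x\<close>. No edge joins \<open>A\<close> to \<open>C\<close>.
\<close>

definition adjacent_rectangles ::
    "vertex set \<Rightarrow> edge set \<Rightarrow> (vertex \<Rightarrow> real \<times> real) \<Rightarrow> real \<Rightarrow>
      real \<Rightarrow> real \<Rightarrow> real \<Rightarrow> real \<Rightarrow> vertex set \<Rightarrow> vertex set \<Rightarrow> vertex set \<Rightarrow> bool" where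
  "adjacent_rectangles G E p x l\<^sub>A l\<^sub>B l\<^sub>C l\<^sub>V A B C \<longleftrightarrow>
     p \<in> {id, prod.swap} \<and> 0 < l\<^sub>A \<and> 0 < l\<^sub>B \<and> 0 < l\<^sub>C \<and> 0 < l\<^sub>V \<and>
     (\<exists>y. A = rectangle G p x l\<^sub>A y l\<^sub>V \<and>
          B = rectangle G p (x + l\<^sub>A) l\<^sub>B y l\<^sub>V \<and>
          C = rectangle G p (x + l\<^sub>A + l\<^sub>B) l\<^sub>C y l\<^sub>V) \<and>
     A \<noteq> {} \<and> B \<noteq> {} \<and> C \<noteq> {} \<and>
     (\<forall>e\<in>E. e \<inter> A = {} \<or> e \<inter> C = {})"

text \<open>
  The parts \<open>BL\<close>, \<open>z\<close>, \<open>BR\<close> are cut out by two lines \<open>s\<close> and \<open>t\<close> such that the three resulting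
  strips of \<open>B\<close> have widths at least \<open>l\<close>.
\<close>

definition rectangles_factorizable ::
    "edge set \<Rightarrow> ('p::finite, 'b::finite) peps \<Rightarrow> real \<Rightarrow> (vertex \<Rightarrow> real \<times> real) \<Rightarrow>
      real \<Rightarrow> real \<Rightarrow> real \<Rightarrow> vertex set \<Rightarrow> vertex set \<Rightarrow> vertex set \<Rightarrow> bool" where
  "rectangles_factorizable E T \<epsilon> p x l\<^sub>A l\<^sub>B A B C \<longleftrightarrow>
     (\<exists>l s t. 0 < l \<and> 3 * l \<le> l\<^sub>B \<and>
        x + l\<^sub>A + l \<le> s \<and> s + l \<le> t \<and> t + l \<le> x + l\<^sub>A + l\<^sub>B \<and>
        approx_factorizable E T \<epsilon> A B C
          (outer_edges E p A B C {..<s})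
          (outer_edges E p A B C {s..<t})
          (outer_edges E p A B C {t..}))"

end

(*
  The proof follows the strategy of Kastoryano, Lucia and Perez-Garcia. Write V_R for the PEPS map of
  a region R, P_R for the projection onto its image, and S_R = V_R sigma_R^{-1} V_R^*. Approximate
  factorization says that S_R is close to P_R for R = AB, BC, ABC and that
  X = V_B rho_B^{-1} sigma_B rho_B^{-1} V_B^* is close to P_B. Since the factors of the sigma's act
  on disjoint parts of the boundaries they cancel, and S_AB X S_BC = S_ABC holds exactly. Hence
  P_AB P_BC is within 8 eps of P_ABC, which gives (1 - P_AB) + (1 - P_BC) >= (1 - 8 eps)(1 - P_ABC).
  Averaging over n cuts of a rectangle with disjoint middle parts B_i bounds its gap below by
  (1 - 8 eps) n / (n + 1) times the gap of rectangles whose long side is shorter by the factor 2/3.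
  Along the scales L (3/2)^k both sum(eps_k) and sum(1 / n_k) converge, so the gap does not close.
  The recursion starts from regions with a bounded number of vertices, where the uniform condition
  number gives an explicit lower bound.
*)
theory Submission
  imports Defs "HOL-Library.Function_Algebras"
begin

text \<open>The cancellation behind S_AB X S_BC = S_ABC depends on the order of the factors. V_AB
  and V_BC both arise from V_B by contracting A or C, so the product contains V_B^* X V_B = sigma_B
  = Omega_zc Omega_dz, with the inverse of Omega_zc (from S_AB) on its left and the inverse of
  Omega_dz (from S_BC) on its right. Only contractions with A and C, on other edges, stand in
  between; nothing has to commute on z. What remains is the inverse of Delta_zb Delta_az. The
  obstacle is that each step of this computation lives on a different set of tensor factors. All
  states are therefore functions of one configuration of all vertices and all edges, and a factor is
  absent when the function does not depend on it. The number of cuts at scale k grows like k^2: then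
  the sum of 1 / n_k converges, while the overlaps, of order (3/2)^k / k^2, still exceed the power
  \<beta> < 1 of the scale. Both sides of a rectangle have to grow by 3/2, one after the other, so
  every scale costs its loss factor twice. Gaps are handled as inequalities between quadratic forms;
  eigenvalues enter only at the end.\<close>

subsection \<open>Linear algebra over a finite index set\<close>

lemma cnorm_nonneg [simp]: "0 \<le> cnorm I x"
  by (simp add: cnorm_def L2_set_nonneg)

lemma cnorm_square: "(cnorm I x)\<^sup>2 = (\<Sum>i\<in>I. (cmod (x i))\<^sup>2)"
  unfolding cnorm_def L2_set_def by (simp add: sum_nonneg)

lemma cnorm_cong: "(\<And>i. i \<in> I \<Longrightarrow> x i = y i) \<Longrightarrow> cnorm I x = cnorm I y"
  unfolding cnorm_def by (rule L2_set_cong) auto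

lemma cnorm_zero [simp]: "cnorm I (\<lambda>_. 0) = 0" "cnorm I 0 = 0"
  by (simp_all add: cnorm_def L2_set_def)

lemma cnorm_eq_0: "finite I \<Longrightarrow> cnorm I x = 0 \<longleftrightarrow> (\<forall>i\<in>I. x i = 0)"
  unfolding cnorm_def by (simp add: L2_set_eq_0_iff)

lemma cnorm_triangle: "cnorm I (x + y) \<le> cnorm I x + cnorm I y"
proof -
  have "cnorm I (x + y) \<le> L2_set (\<lambda>i. cmod (x i) + cmod (y i)) I"
    unfolding cnorm_def by (rule L2_set_mono) (auto simp: norm_triangle_ineq)
  also have "\<dots> \<le> cnorm I x + cnorm I y"
    unfolding cnorm_def by (rule L2_set_triangle_ineq)
  finally show ?thesis .
qed

lemma cnorm_minus_commute: "cnorm I (x - y) = cnorm I (y - x)"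
  unfolding cnorm_def by (rule L2_set_cong) (auto simp: norm_minus_commute)

lemma cnorm_diff_triangle: "cnorm I (x - z) \<le> cnorm I (x - y) + cnorm I (y - z)"
  using cnorm_triangle[of I "x - y" "y - z"] by simp

lemma cnorm_scale: "cnorm I (\<lambda>i. a * x i) = cmod a * cnorm I x"
  unfolding cnorm_def by (simp add: L2_set_right_distrib norm_mult)

lemma cnorm_half: "cnorm I (\<lambda>i. (1/2) * (x + y) i) \<le> (cnorm I x + cnorm I y) / 2"
  unfolding cnorm_scale using cnorm_triangle[of I x y] by (simp del: plus_fun_apply)

lemma cmod_le_cnorm: "finite I \<Longrightarrow> i \<in> I \<Longrightarrow> cmod (x i) \<le> cnorm I x"
  unfolding cnorm_def by (rule member_le_L2_set) auto

lemma cnorm_le_sum: "cnorm I x \<le> (\<Sum>i\<in>I. cmod (x i))"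
  unfolding cnorm_def by (rule L2_set_le_sum) auto

lemma cinner_self: "cinner I x x = of_real ((cnorm I x)\<^sup>2)"
proof -
  have "cnj (x i) * x i = of_real ((cmod (x i))\<^sup>2)" for i
    using complex_norm_square[of "x i"] by (simp add: mult.commute)
  then show ?thesis unfolding cinner_def cnorm_square by simp
qed

lemma cinner_Cauchy_Schwarz: "cmod (cinner I x y) \<le> cnorm I x * cnorm I y"
proof -
  have "cmod (cinner I x y) \<le> (\<Sum>i\<in>I. \<bar>cmod (x i)\<bar> * \<bar>cmod (y i)\<bar>)"
    unfolding cinner_def by (rule order_trans[OF norm_sum]) (simp add: norm_mult)
  also have "\<dots> \<le> cnorm I x * cnorm I y"
    unfolding cnorm_def by (rule L2_set_mult_ineq)
  finally show ?thesis .
qed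

lemma cinner_commute: "cinner I y x = cnj (cinner I x y)"
  by (simp add: cinner_def mult.commute)

lemma cinner_diff_right: "cinner I x (y - z) = cinner I x y - cinner I x z"
  by (simp add: cinner_def algebra_simps sum_subtractf)

lemma cinner_diff_left: "cinner I (x - y) z = cinner I x z - cinner I y z"
  by (simp add: cinner_def algebra_simps sum_subtractf)

lemma cinner_add_right: "cinner I x (y + z) = cinner I x y + cinner I x z"
  by (simp add: cinner_def algebra_simps sum.distrib)

lemma cinner_add_left: "cinner I (x + y) z = cinner I x z + cinner I y z"
  by (simp add: cinner_def algebra_simps sum.distrib)

lemma cvecs_diff: "x \<in> cvecs I \<Longrightarrow> y \<in> cvecs I \<Longrightarrow> x - y \<in> cvecs I"
  by (auto simp: cvecs_def)

lemma mapply_in_cvecs: "M \<in> cmats I J \<Longrightarrow> mapply J M x \<in> cvecs I"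
  by (auto simp: mapply_def cmats_def cvecs_def)

lemma mapply_cong: "(\<And>j. j \<in> J \<Longrightarrow> x j = y j) \<Longrightarrow> mapply J M x = mapply J M y"
  by (simp add: mapply_def)

lemma mapply_add: "mapply J M (x + y) = mapply J M x + mapply J M y"
  by (auto simp: mapply_def algebra_simps sum.distrib)

lemma mapply_diff: "mapply J M (x - y) = mapply J M x - mapply J M y"
  by (auto simp: mapply_def algebra_simps sum_subtractf)

lemma mapply_scale: "mapply J M (\<lambda>i. a * x i) = (\<lambda>i. a * mapply J M x i)"
  by (auto simp: mapply_def algebra_simps sum_distrib_left)

lemma mapply_zero [simp]: "mapply J M (\<lambda>_. 0) = (\<lambda>_. 0)" "mapply J M 0 = 0"
  by (auto simp: mapply_def)

lemma mapply_mminus: "mapply J (mminus M N) x = mapply J M x - mapply J N x"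
  by (auto simp: mapply_def mminus_def algebra_simps sum_subtractf)

lemma sum_mone_left:
  "finite I \<Longrightarrow> (\<Sum>j\<in>I. mone I i j * f j) = (if i \<in> I then f i else 0)"
  by (cases "i \<in> I") (simp_all add: mone_def if_distribR sum.delta if_distrib[of "\<lambda>c. c * _"] cong: if_cong)

lemma sum_mone_right:
  "finite I \<Longrightarrow> (\<Sum>j\<in>I. f j * mone I j k) = (if k \<in> I then f k else 0)"
proof -
  assume "finite I"
  have "(\<Sum>j\<in>I. f j * mone I j k) = (\<Sum>j\<in>I. if j = k then f j else 0)"
    by (rule sum.cong) (auto simp: mone_def)
  with \<open>finite I\<close> show ?thesis by simp
qed

lemma mapply_mone: "finite I \<Longrightarrow> x \<in> cvecs I \<Longrightarrow> mapply I (mone I) x = x"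
  by (auto simp: mapply_def sum_mone_left cvecs_def)

lemma mapply_mmult:
  "finite J \<Longrightarrow> finite K \<Longrightarrow> mapply K (mmult J M N) x = mapply J M (mapply K N x)"
  unfolding mapply_def mmult_def
  by (auto simp: sum_distrib_left sum_distrib_right mult.assoc intro!: ext sum.swap)

lemma mmult_assoc:
  "finite J \<Longrightarrow> finite K \<Longrightarrow> mmult J M (mmult K N P) = mmult K (mmult J M N) P"
  unfolding mmult_def
  by (auto simp: sum_distrib_left sum_distrib_right mult.assoc intro!: ext sum.swap)

lemma mmult_in_cmats: "M \<in> cmats I J \<Longrightarrow> N \<in> cmats J K \<Longrightarrow> mmult J M N \<in> cmats I K"
  by (auto simp: mmult_def cmats_def)

lemma mone_in_cmats [simp]: "mone I \<in> cmats I I"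
  by (auto simp: mone_def cmats_def)

lemma madjoint_in_cmats: "M \<in> cmats I J \<Longrightarrow> madjoint M \<in> cmats J I"
  by (auto simp: madjoint_def cmats_def)

lemma mminus_in_cmats: "M \<in> cmats I J \<Longrightarrow> N \<in> cmats I J \<Longrightarrow> mminus M N \<in> cmats I J"
  by (auto simp: mminus_def cmats_def)

lemma madjoint_madjoint [simp]: "madjoint (madjoint M) = M"
  by (simp add: madjoint_def)

lemma madjoint_mmult: "madjoint (mmult J M N) = mmult J (madjoint N) (madjoint M)"
  by (simp add: madjoint_def mmult_def mult.commute)

lemma madjoint_mone [simp]: "madjoint (mone I) = mone I"
  by (auto simp: madjoint_def mone_def fun_eq_iff)

lemma mmult_mone_left: "finite I \<Longrightarrow> M \<in> cmats I J \<Longrightarrow> mmult I (mone I) M = M"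
  by (auto simp: mmult_def sum_mone_left cmats_def fun_eq_iff)

lemma mmult_mone_right: "finite J \<Longrightarrow> M \<in> cmats I J \<Longrightarrow> mmult J M (mone J) = M"
  by (auto simp: mmult_def sum_mone_right cmats_def fun_eq_iff)

lemma cinner_mapply:
  "cinner I (mapply J M x) y = cinner J x (mapply I (madjoint M) y)"
proof -
  have "cinner I (mapply J M x) y = (\<Sum>i\<in>I. \<Sum>j\<in>J. cnj (M i j) * cnj (x j) * y i)"
    by (simp add: cinner_def mapply_def sum_distrib_right)
  also have "\<dots> = (\<Sum>j\<in>J. \<Sum>i\<in>I. cnj (M i j) * cnj (x j) * y i)" by (rule sum.swap)
  also have "\<dots> = cinner J x (mapply I (madjoint M) y)"
    by (simp add: cinner_def mapply_def madjoint_def sum_distrib_left algebra_simps)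
  finally show ?thesis .
qed

text \<open>A bound that grows with the dimensions is good enough, since it is used where the
  dimensions are under control. It combines |x_j| \<le> |x| with the l2 norm being at most the l1
  norm.\<close>

lemma cnorm_mapply_entries:
  assumes "finite I" "finite J" "\<And>i j. i \<in> I \<Longrightarrow> j \<in> J \<Longrightarrow> cmod (M i j) \<le> K"
  shows "cnorm I (mapply J M x) \<le> (real (card I) * real (card J) * K) * cnorm J x"
proof -
  have "cmod (mapply J M x i) \<le> real (card J) * (K * cnorm J x)" if "i \<in> I" for i
  proof -
    have "cmod (mapply J M x i) \<le> (\<Sum>j\<in>J. cmod (M i j * x j))"
      unfolding mapply_def by (rule norm_sum)
    also have "\<dots> \<le> (\<Sum>j\<in>J. K * cnorm J x)"
      unfolding norm_mult
      by (intro sum_mono mult_mono) 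
        (use assms that cmod_le_cnorm in \<open>auto intro: order_trans[OF norm_ge_zero assms(3)]\<close>)
    finally show ?thesis by simp
  qed
  then have "(\<Sum>i\<in>I. cmod (mapply J M x i)) \<le> (\<Sum>i\<in>I. real (card J) * (K * cnorm J x))"
    by (rule sum_mono)
  with cnorm_le_sum[of I "mapply J M x"] show ?thesis by (simp add: algebra_simps)
qed

lemma cnorm_mapply_bounded:
  assumes "finite I" "finite J"
  obtains K where "0 < K" "\<And>x. cnorm I (mapply J M x) \<le> K * cnorm J x"
proof -
  define S where "S = (\<Sum>i\<in>I. \<Sum>j\<in>J. cmod (M i j))"
  have "cmod (M i j) \<le> S" if "i \<in> I" "j \<in> J" for i j
  proof -
    have "cmod (M i j) \<le> (\<Sum>j\<in>J. cmod (M i j))"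
      by (rule member_le_sum[of j J]) (use assms that in auto)
    also have "\<dots> \<le> S" unfolding S_def
      by (rule member_le_sum[of i I "\<lambda>i. \<Sum>j\<in>J. cmod (M i j)"]) (use assms that in \<open>auto intro: sum_nonneg\<close>)
    finally show ?thesis .
  qed
  note b = cnorm_mapply_entries[OF assms this]
  let ?K = "real (card I) * real (card J) * S"
  have "cnorm I (mapply J M x) \<le> (\<bar>?K\<bar> + 1) * cnorm J x" for x
    by (rule order_trans[OF b mult_right_mono]) auto
  then show ?thesis by (intro that[of "\<bar>?K\<bar> + 1"]) auto
qed

text \<open>A supremum of reals bounds its set only if the set is bounded above, which
  \<open>cnorm_mapply_bounded\<close> provides. The vector \<open>x\<close> may be arbitrary because
  neither side sees its values outside \<open>I\<close>; the zero vector gives 0 \<le>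
  \<epsilon>.\<close>

lemma mopnorm_bound:
  assumes "finite I" "mopnorm I M \<le> \<epsilon>"
  shows "cnorm I (mapply I M x) \<le> \<epsilon> * cnorm I x" "0 \<le> \<epsilon>"
proof -
  obtain K where K: "0 < K" "\<And>x. cnorm I (mapply I M x) \<le> K * cnorm I x"
    using cnorm_mapply_bounded[OF assms(1,1), of M] by blast
  have "bdd_above {cnorm I (mapply I M x) | x. x \<in> cvecs I \<and> cnorm I x \<le> 1}"
    by (rule bdd_aboveI[of _ K]) (use K in \<open>auto intro!: order_trans[OF K(2)]\<close>)
  then have 1: "cnorm I (mapply I M x) \<le> \<epsilon>" if "x \<in> cvecs I" "cnorm I x \<le> 1" for x
    using assms(2) that unfolding mopnorm_def by (intro order_trans[OF cSup_upper assms(2)[unfolded mopnorm_def]]) auto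
  from 1[of "\<lambda>_. 0"] show "0 \<le> \<epsilon>" by (simp add: cvecs_def)
  show "cnorm I (mapply I M x) \<le> \<epsilon> * cnorm I x"
  proof (cases "cnorm I x = 0")
    case True
    then show ?thesis using K(2)[of x] by simp
  next
    case False
    define n where "n = cnorm I x"
    define y where "y = (\<lambda>i. if i \<in> I then x i else 0)"
    have n: "n > 0" using False cnorm_nonneg[of I x] unfolding n_def by linarith
    have ny: "cnorm I y = n" unfolding n_def by (rule cnorm_cong) (simp add: y_def)
    have "cnorm I (mapply I M (\<lambda>i. of_real (1 / n) * y i)) \<le> \<epsilon>"
    proof (rule 1)
      show "(\<lambda>i. of_real (1 / n) * y i) \<in> cvecs I" by (auto simp: y_def cvecs_def)
      show "cnorm I (\<lambda>i. of_real (1 / n) * y i) \<le> 1"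
        unfolding cnorm_scale ny using n by (simp add: norm_divide)
    qed
    then have "cnorm I (mapply I M y) / n \<le> \<epsilon>"
      unfolding mapply_scale cnorm_scale using n by (simp add: norm_divide)
    moreover have "mapply I M x = mapply I M y" by (rule mapply_cong) (simp add: y_def)
    ultimately show ?thesis using n by (simp add: n_def[symmetric] field_simps)
  qed
qed

lemma mapply_basis: "finite J \<Longrightarrow> j \<in> J \<Longrightarrow> mapply J M (mone J j) = (\<lambda>i. M i j)"
  by (auto simp: mapply_def mone_def fun_eq_iff if_distrib sum.delta cong: if_cong)

lemma mone_in_cvecs: "mone J j \<in> cvecs J"
  by (auto simp: mone_def cvecs_def)

lemma cnorm_mone: "finite J \<Longrightarrow> j \<in> J \<Longrightarrow> cnorm J (mone J j) = 1"
proof -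
  assume "finite J" "j \<in> J"
  then have "(cnorm J (mone J j))\<^sup>2 = 1"
    unfolding cnorm_square mone_def
    by (simp add: if_distrib[of cmod] if_distrib[of "\<lambda>x. x ^ 2"] sum.delta cong: if_cong)
  then show ?thesis using cnorm_nonneg[of J "mone J j"] by (simp add: power2_eq_1_iff)
qed

lemma mat_eqI:
  assumes "finite J" "M \<in> cmats I J" "N \<in> cmats I J"
    "\<And>x. x \<in> cvecs J \<Longrightarrow> mapply J M x = mapply J N x"
  shows "M = N"
proof (intro ext)
  fix i j
  show "M i j = N i j"
  proof (cases "j \<in> J")
    case True
    then show ?thesis using assms(4)[OF mone_in_cvecs, of j] assms(1)
      by (simp add: mapply_basis fun_eq_iff)
  qed (use assms in \<open>auto simp: cmats_def\<close>)
qed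

lemma sum_fun_apply: "(\<Sum>j\<in>J. f j) i = (\<Sum>j\<in>J. f j i)" for f :: "'a \<Rightarrow> 'b \<Rightarrow> 'c::comm_monoid_add"
  by (induction J rule: infinite_finite_induct) auto

lemma cvecs_expand: "finite J \<Longrightarrow> x \<in> cvecs J \<Longrightarrow> x = (\<Sum>j\<in>J. (\<lambda>i. x j * mone J j i))"
proof -
  assume "finite J" "x \<in> cvecs J"
  then show ?thesis
    by (auto simp: fun_eq_iff sum_fun_apply mone_def cvecs_def if_distrib sum.delta' cong: if_cong)
qed

subsection \<open>Inverses\<close>

text \<open>A linear map that is injective on a subspace has a linear left inverse \<open>g\<close>
  there, and the values of \<open>g\<close> on the basis vectors of \<open>I\<close> are the columns
  of the matrix sought. The pointwise scalings make the function spaces complex vector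
  spaces.\<close>

lemma exists_left_inverse:
  fixes V :: "'i \<Rightarrow> 'j \<Rightarrow> complex"
  assumes fin: "finite I" "finite J" and V: "V \<in> cmats I J"
    and inj: "inj_on (mapply J V) (cvecs J)"
  obtains L where "L \<in> cmats J I" "mmult I L V = mone J"
proof -
  let ?s1 = "\<lambda>c (f :: 'j \<Rightarrow> complex) i. c * f i"
  let ?s2 = "\<lambda>c (f :: 'i \<Rightarrow> complex) i. c * f i"
  interpret s1: vector_space ?s1 by unfold_locales (auto simp: algebra_simps)
  interpret s2: vector_space ?s2 by unfold_locales (auto simp: algebra_simps)
  interpret vector_space_pair ?s1 ?s2 ..
  have lin: "Vector_Spaces.linear ?s1 ?s2 (mapply J V)"
    by unfold_locales (simp_all add: mapply_add mapply_scale)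
  have sub: "s1.subspace (cvecs J)"
    by (auto simp: s1.subspace_def cvecs_def)
  obtain g where g: "Vector_Spaces.linear ?s2 ?s1 g" "\<And>v. v \<in> cvecs J \<Longrightarrow> g (mapply J V v) = v"
    using linear_exists_left_inverse_on[OF lin sub inj] by (auto simp: )
  interpret g: Vector_Spaces.linear ?s2 ?s1 g by (rule g(1))
  have g_sum: "g (\<Sum>i\<in>S. (\<lambda>k. a i * e i k)) = (\<Sum>i\<in>S. (\<lambda>j. a i * g (e i) j))" for S a and e :: "'i \<Rightarrow> 'i \<Rightarrow> complex"
    by (simp add: g.sum g.scale)
  define L where "L = (\<lambda>j i. if j \<in> J \<and> i \<in> I then g (mone I i) j else 0)"
  have "mmult I L V j k = mone J j k" for j k
  proof (cases "j \<in> J \<and> k \<in> J")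
    case True
    have col: "(\<lambda>i. V i k) \<in> cvecs I" using V by (auto simp: cmats_def cvecs_def)
    have "mone J k j = g (mapply J V (mone J k)) j" by (simp add: g(2) mone_in_cvecs)
    also have "mapply J V (mone J k) = (\<lambda>i. V i k)" using True fin by (simp add: mapply_basis)
    also have "\<dots> = (\<Sum>i\<in>I. (\<lambda>l. V i k * mone I i l))" by (rule cvecs_expand[OF fin(1) col])
    also have "g \<dots> j = (\<Sum>i\<in>I. V i k * g (mone I i) j)"
      unfolding g_sum sum_fun_apply ..
    also have "\<dots> = mmult I L V j k"
      using True by (simp add: mmult_def L_def mult.commute)
    finally show ?thesis using True by (auto simp: mone_def split: if_splits)
  qed (use V in \<open>auto simp: mmult_def L_def cmats_def mone_def\<close>)
  then show ?thesis by (intro that[of L]) (auto simp: L_def cmats_def)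
qed

lemma minv_eq:
  assumes "finite I" "M \<in> cmats I I" "is_minv I M N"
  shows "minv I M = N"
  unfolding minv_def
proof (rule the_equality)
  show "is_minv I M N" by fact
next
  fix N' assume N': "is_minv I M N'"
  have "N' = mmult I (mmult I N M) N'"
    using assms N' by (simp add: is_minv_def mmult_mone_left[of I _ I])
  also have "\<dots> = mmult I N (mmult I M N')" using assms(1) by (simp add: mmult_assoc)
  also have "\<dots> = N" using assms N' by (simp add: is_minv_def mmult_mone_right[of I _ I])
  finally show "N' = N" .
qed

lemma is_minv_minv:
  assumes "finite I" "minvertible I M"
  shows "is_minv I M (minv I M)"
  using assms minv_eq unfolding minvertible_def by metis

text \<open>The adjoint of L M = 1 is M L^* = 1, so L^* = L M L^* = L: a left inverse of a Hermitian
  matrix is two-sided and Hermitian.\<close>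

lemma is_minv_hermitian:
  assumes "finite I" "M \<in> cmats I I" "madjoint M = M" "L \<in> cmats I I" "mmult I L M = mone I"
  shows "is_minv I M L" "madjoint L = L"
proof -
  have MLd: "mmult I M (madjoint L) = mone I"
    using arg_cong[OF assms(5), of madjoint] assms(3) by (simp add: madjoint_mmult)
  have "madjoint L = mmult I (mmult I L M) (madjoint L)"
    using assms by (simp add: mmult_mone_left[of I _ I] madjoint_in_cmats)
  also have "\<dots> = mmult I L (mmult I M (madjoint L))" using assms(1) by (simp add: mmult_assoc)
  also have "\<dots> = L" using assms MLd by (simp add: mmult_mone_right[of I _ I])
  finally show "madjoint L = L" .
  with MLd assms show "is_minv I M L" by (simp add: is_minv_def)
qed

lemma inj_imp_minv_hermitian:
  assumes "finite I" "M \<in> cmats I I" "madjoint M = M"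
    "\<And>x. x \<in> cvecs I \<Longrightarrow> mapply I M x = (\<lambda>_. 0) \<Longrightarrow> x = (\<lambda>_. 0)"
  obtains N where "is_minv I M N" "madjoint N = N"
proof -
  have "inj_on (mapply I M) (cvecs I)"
  proof (rule inj_onI)
    fix x y assume xy: "x \<in> cvecs I" "y \<in> cvecs I" "mapply I M x = mapply I M y"
    then have "mapply I M (x - y) = (\<lambda>_. 0)" by (auto simp: mapply_diff)
    then have "x - y = (\<lambda>_. 0)" using assms(4) xy cvecs_diff by blast
    then show "x = y" by (auto simp: fun_eq_iff)
  qed
  then obtain L where "L \<in> cmats I I" "mmult I L M = mone I"
    using exists_left_inverse assms(1,2) by metis
  with is_minv_hermitian[OF assms(1-3)] that show ?thesis by blast
qed

subsection \<open>Square roots\<close>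

lemma Re_cinner_hermitian:
  "madjoint M = M \<Longrightarrow> cinner I x (mapply I M x) = of_real (Re (cinner I x (mapply I M x)))"
  by (metis Reals_cnj_iff cinner_commute cinner_mapply of_real_Re)

text \<open>Polarisation of the form \<open>t \<mapsto> \<langle>x + t y, S (x + t y)\<rangle> \<ge> 0\<close> with \<open>y = - S x\<close> and small \<open>t\<close>.\<close>

lemma mpos_semidef_null:
  assumes fin: "finite I" and S: "mpos_semidef I S"
    and x: "x \<in> cvecs I" and null: "Re (cinner I x (mapply I S x)) = 0"
  shows "mapply I S x = (\<lambda>_. 0)"
proof -
  have S1: "S \<in> cmats I I" and S2: "madjoint S = S" using S by (auto simp: mpos_semidef_def)
  define y where "y = mapply I S x"
  have y: "y \<in> cvecs I" unfolding y_def by (rule mapply_in_cvecs[OF S1])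
  define N where "N = (cnorm I y)\<^sup>2"
  define P where "P = Re (cinner I y (mapply I S y))"
  have yx: "cinner I x (mapply I S y) = of_real N"
    using cinner_mapply[of I I S x y] S2 by (simp add: y_def[symmetric] cinner_self N_def)
  have xy: "cinner I y (mapply I S x) = of_real N"
    by (simp add: y_def[symmetric] cinner_self N_def)
  have main: "0 \<le> - 2 * t * N + t\<^sup>2 * P" for t
  proof -
    define w where "w = (\<lambda>i. of_real t * y i)"
    have sc: "mapply I S w = (\<lambda>i. of_real t * mapply I S y i)" by (simp add: w_def mapply_scale)
    have c1: "cinner I x (\<lambda>i. of_real t * z i) = of_real t * cinner I x z" for x z
      by (simp add: cinner_def sum_distrib_left algebra_simps)
    have c2: "cinner I (\<lambda>i. of_real t * z i) x = of_real t * cinner I z x" for x z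
      by (simp add: cinner_def sum_distrib_left algebra_simps)
    have "w \<in> cvecs I" using y by (auto simp: w_def cvecs_def)
    then have "0 \<le> Re (cinner I (x - w) (mapply I S (x - w)))"
      using S x cvecs_diff unfolding mpos_semidef_def by blast
    also have "\<dots> = - 2 * t * N + t\<^sup>2 * P"
      unfolding mapply_diff cinner_diff_right cinner_diff_left sc
      unfolding w_def c1 c2 yx xy using null
      by (simp add: P_def algebra_simps power2_eq_square)
    finally show ?thesis .
  qed
  have "N \<ge> 0" by (simp add: N_def)
  have "P \<ge> 0" using S y by (auto simp: P_def mpos_semidef_def)
  have "N = 0"
  proof (rule ccontr)
    assume "N \<noteq> 0"
    with \<open>N \<ge> 0\<close> have N: "N > 0" by simp
    \<comment> \<open>Any positive t with t P < 2 N makes the quadratic negative; the summand 1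
      covers the case P = 0.\<close>
    define t where "t = N / (P + 1)"
    have t: "t > 0" "t * (P + 1) = N" using N \<open>P \<ge> 0\<close> by (auto simp: t_def)
    have "- 2 * t * N + t\<^sup>2 * P = t * (t * P - 2 * N)" by (simp add: algebra_simps power2_eq_square)
    moreover have "t * P < 2 * N" using t N by (simp add: algebra_simps)
    ultimately have "- 2 * t * N + t\<^sup>2 * P < 0" using t by (simp add: mult_pos_neg)
    with main[of t] show False by simp
  qed
  then show ?thesis using y fin unfolding N_def y_def[symmetric]
    by (auto simp: cnorm_eq_0 cvecs_def fun_eq_iff)
qed

text \<open>For two roots \<open>S\<close>, \<open>S'\<close> the difference \<open>D\<close> satisfies \<open>S D + D S' = 0\<close>, hence
  \<open>D S D + D\<^sup>2 S' = 0\<close>; taking traces, the positive matrices \<open>D S D\<close> and \<open>D S' D\<close> vanish.\<close>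

lemma psd_root_unique:
  assumes fin: "finite I" and S: "mpos_semidef I S" "mpos_semidef I S'"
    and eq: "mmult I S S = mmult I S' S'"
  shows "S = S'"
proof -
  note [simp] = fin
  have m: "S \<in> cmats I I" "madjoint S = S" "S' \<in> cmats I I" "madjoint S' = S'"
    using S by (auto simp: mpos_semidef_def)
  define D where "D = mminus S S'"
  have D: "D \<in> cmats I I" "madjoint D = D"
    using m by (auto simp: D_def mminus_in_cmats) (simp add: madjoint_def mminus_def fun_eq_iff)
  \<comment> \<open>\<open>q R j\<close> is the j-th diagonal entry of D R D, so its sum over j is a
    trace, while each single term is nonnegative for positive \<open>R\<close>.\<close>
  define q where "q = (\<lambda>R j. cinner I (mapply I D (mone I j)) (mapply I R (mapply I D (mone I j))))"
  have q_entry: "q R j = mmult I D (mmult I R D) j j" if "j \<in> I" for R j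
  proof -
    have "q R j = cinner I (mone I j) (mapply I (mmult I D (mmult I R D)) (mone I j))"
      using D(2) unfolding q_def by (simp add: cinner_mapply mapply_mmult)
    also have "\<dots> = (\<Sum>i\<in>I. cnj (mone I j i) * mmult I D (mmult I R D) i j)"
      unfolding cinner_def mapply_basis[OF fin that] ..
    also have "\<dots> = (\<Sum>i\<in>I. mone I j i * mmult I D (mmult I R D) i j)"
      by (rule sum.cong) (auto simp: mone_def)
    also have "\<dots> = mmult I D (mmult I R D) j j" using that by (simp add: sum_mone_left)
    finally show ?thesis .
  qed
  have trace: "(\<Sum>i\<in>I. mmult I A B i i) = (\<Sum>i\<in>I. mmult I B A i i)" for A B :: "'a \<Rightarrow> 'a \<Rightarrow> complex"
    unfolding mmult_def by (subst sum.swap) (simp add: mult.commute)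
  have SD: "mmult I S D i j = - mmult I D S' i j" for i j
  proof -
    have "mmult I S D i j = mmult I S S i j - mmult I S S' i j"
      by (simp add: D_def mmult_def mminus_def algebra_simps sum_subtractf)
    also have "\<dots> = mmult I S' S' i j - mmult I S S' i j" by (simp add: eq)
    also have "\<dots> = - mmult I D S' i j"
      by (simp add: D_def mmult_def mminus_def algebra_simps sum_subtractf)
    finally show ?thesis .
  qed
  have "(\<Sum>j\<in>I. q S j) = (\<Sum>j\<in>I. mmult I D (mmult I S D) j j)" by (simp add: q_entry)
  also have "\<dots> = - (\<Sum>j\<in>I. mmult I D (mmult I D S') j j)"
    unfolding sum_negf[symmetric]
    by (rule sum.cong) (auto simp: mmult_def[of I D "mmult I S D"] mmult_def[of I D "mmult I D S'"] SD sum_negf)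
  also have "\<dots> = - (\<Sum>j\<in>I. mmult I (mmult I D S') D j j)" by (simp add: trace[of D])
  also have "\<dots> = - (\<Sum>j\<in>I. q S' j)" by (simp add: q_entry mmult_assoc)
  finally have qq: "(\<Sum>j\<in>I. Re (q S j)) + (\<Sum>j\<in>I. Re (q S' j)) = 0"
    by (metis Re_sum add.commute minus_complex.sel(1) neg_eq_iff_add_eq_0 uminus_complex.sel(1))
  have pos: "0 \<le> Re (q S j)" "0 \<le> Re (q S' j)" for j
    using S mapply_in_cvecs[OF D(1)] by (auto simp: q_def mpos_semidef_def)
  have "(\<Sum>j\<in>I. Re (q S j)) \<ge> 0" "(\<Sum>j\<in>I. Re (q S' j)) \<ge> 0" using pos by (auto intro: sum_nonneg)
  with qq have "(\<Sum>j\<in>I. Re (q S j)) = 0" "(\<Sum>j\<in>I. Re (q S' j)) = 0" by linarith+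
  then have z: "Re (q S j) = 0" "Re (q S' j) = 0" if "j \<in> I" for j
    using that pos by (auto simp: sum_nonneg_eq_0_iff)
  have "D i j = 0" if "i \<in> I" "j \<in> I" for i j
  proof -
    let ?x = "mapply I D (mone I j)"
    have x: "?x \<in> cvecs I" by (rule mapply_in_cvecs[OF D(1)])
    have "mapply I S ?x = (\<lambda>_. 0)" "mapply I S' ?x = (\<lambda>_. 0)"
      using mpos_semidef_null[OF fin S(1) x] mpos_semidef_null[OF fin S(2) x] z[OF that(2)]
      by (simp_all add: q_def)
    then have "mapply I D ?x = (\<lambda>_. 0)" unfolding D_def mapply_mminus[of I S S'] by auto
    then have "cinner I ?x ?x = 0" using D(2) cinner_mapply[of I I D "mone I j" ?x]
      by (simp add: cinner_def)
    then have "cnorm I ?x = 0" by (simp add: cinner_self)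
    then show ?thesis using that by (simp add: cnorm_eq_0 mapply_basis)
  qed
  then have "S i j = S' i j" for i j
    using m(1,3) by (cases "i \<in> I \<and> j \<in> I") (auto simp: D_def mminus_def cmats_def)
  then show ?thesis by blast
qed


lemma msqrt_eq:
  assumes "finite I" "mpos_semidef I S" "mmult I S S = M"
  shows "msqrt I M = S"
  unfolding msqrt_def by (rule the_equality) (use assms psd_root_unique in auto)

lemma entry_le_bound:
  assumes "finite I" "\<And>x. cnorm I (mapply I M x) \<le> r * cnorm I x" "i \<in> I" "j \<in> I"
  shows "cmod (M i j) \<le> r"
  using cmod_le_cnorm[OF assms(1,3), of "mapply I M (mone I j)"] assms(2)[of "mone I j"] assms
  by (simp add: cnorm_mone) (simp add: mapply_basis)

text \<open>The limit of the iteration \<open>X \<mapsto> (B + X\<^sup>2) / 2\<close>, a contraction on the ball of radius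
  \<open>(1 + q) / 2\<close>, satisfies \<open>(1 - X)\<^sup>2 = 1 - B\<close>.\<close>

lemma contraction_root:
  assumes fin: "finite I" and B: "B \<in> cmats I I" "madjoint B = B"
    and q: "0 \<le> q" "q < 1" "\<And>x. cnorm I (mapply I B x) \<le> q * cnorm I x"
  obtains X where "X \<in> cmats I I" "madjoint X = X"
    "\<And>i j. 2 * X i j = B i j + mmult I X X i j"
    "\<And>x. Re (cinner I x (mapply I X x)) \<le> (cnorm I x)\<^sup>2"
proof -
  note [simp] = fin
  define step where "step = (\<lambda>X i j. (B i j + mmult I X X i j) / 2)"
  define X where "X = (\<lambda>n. (step ^^ n) (\<lambda>_ _. 0))"
  \<comment> \<open>The iteration preserves the ball of radius r if (q + r^2) / 2 \<le> r, that is
    (1 - r)^2 \<le> 1 - q. For r = (1 + q) / 2 the left side is (1 - q)^2 / 4.\<close>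
  define r where "r = (1 + q) / 2"
  have r: "0 \<le> r" "r < 1" using q by (auto simp: r_def)
  have qr: "(q + r * r) / 2 \<le> r"
  proof -
    have "(1 + q) * (1 + q) \<le> 2 * 2" using q by (intro mult_mono) auto
    then show ?thesis by (simp add: r_def field_simps)
  qed
  have Suc: "X (Suc n) = step (X n)" and X0: "X 0 = (\<lambda>_ _. 0)" for n by (auto simp: X_def)
  have mats: "X n \<in> cmats I I" for n
    by (induction n) (use B in \<open>auto simp: X0 Suc step_def cmats_def mmult_def\<close>)
  have herm: "madjoint (X n) = X n" for n
  proof (induction n)
    case (Suc n)
    have "cnj (X n i j) = X n j i" "cnj (B i j) = B j i" for i j
      using Suc B(2) by (auto simp: madjoint_def fun_eq_iff)
    then show ?case
      by (auto simp: \<open>X (Suc n) = _\<close> step_def madjoint_def mmult_def fun_eq_iff mult.commute)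
  qed (simp add: X0 madjoint_def)
  have step_apply: "mapply I (step Y) x = (\<lambda>i. (1/2) * (mapply I B x + mapply I Y (mapply I Y x)) i)" for Y x
    unfolding mapply_mmult[OF fin fin, symmetric]
    by (simp add: step_def mapply_def sum_divide_distrib[symmetric] sum.distrib[symmetric] algebra_simps fun_eq_iff)
  have bound: "cnorm I (mapply I (X n) x) \<le> r * cnorm I x" for n x
  proof (induction n arbitrary: x)
    case 0
    have "mapply I (X 0) x = (\<lambda>_. 0)" by (simp add: X0 mapply_def)
    then show ?case using r by simp
  next
    case (Suc n)
    have "cnorm I (mapply I (X (Suc n)) x) \<le> (cnorm I (mapply I B x) + cnorm I (mapply I (X n) (mapply I (X n) x))) / 2"
      unfolding \<open>X (Suc n) = _\<close> step_apply by (rule cnorm_half)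
    also have "\<dots> \<le> (q * cnorm I x + r * (r * cnorm I x)) / 2"
      using order_trans[OF Suc mult_left_mono[OF Suc r(1)]] q(3)[of x]
      by (intro divide_right_mono add_mono) auto
    also have "\<dots> = (q + r * r) / 2 * cnorm I x" by (simp add: field_simps)
    also have "\<dots> \<le> r * cnorm I x" by (rule mult_right_mono[OF qr]) simp
    finally show ?case .
  qed
  have diff: "cnorm I (mapply I (mminus (X (Suc n)) (X n)) x) \<le> r ^ n * r * cnorm I x" for n x
  proof (induction n arbitrary: x)
    case 0
    have "mminus (X (Suc 0)) (X 0) = X (Suc 0)" by (simp add: mminus_def X0)
    then show ?case using bound[of "Suc 0" x] by simp
  next
    case (Suc n)
    let ?D = "\<lambda>x. mapply I (mminus (X (Suc n)) (X n)) x"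
    \<comment> \<open>The difference of squares without commutativity: X'^2 - X^2 = X' (X' - X) +
      (X' - X) X. Each summand gains a factor \<open>r\<close>.\<close>
    have "mapply I (mminus (X (Suc (Suc n))) (X (Suc n))) x =
        (\<lambda>i. (1/2) * (mapply I (X (Suc n)) (?D x) + ?D (mapply I (X n) x)) i)"
      unfolding mapply_mminus \<open>\<And>n. X (Suc n) = _\<close>[of "Suc n"]
      unfolding \<open>\<And>n. X (Suc n) = _\<close>[of n] mapply_diff step_apply
      by (auto simp: algebra_simps mapply_diff)
    then have "cnorm I (mapply I (mminus (X (Suc (Suc n))) (X (Suc n))) x)
        \<le> (cnorm I (mapply I (X (Suc n)) (?D x)) + cnorm I (?D (mapply I (X n) x))) / 2"
      by (simp only: cnorm_half)
    also have "\<dots> \<le> (r * (r ^ n * r * cnorm I x) + r ^ n * r * (r * cnorm I x)) / 2"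
    proof (intro divide_right_mono add_mono)
      show "cnorm I (mapply I (X (Suc n)) (?D x)) \<le> r * (r ^ n * r * cnorm I x)"
        by (rule order_trans[OF bound mult_left_mono[OF Suc r(1)]])
      have "r ^ n * r \<ge> 0" using r by simp
      then show "cnorm I (?D (mapply I (X n) x)) \<le> r ^ n * r * (r * cnorm I x)"
        by (rule order_trans[OF Suc mult_left_mono[OF bound]])
    qed simp
    finally show ?case by (simp add: algebra_simps)
  qed
  have "\<exists>l. (\<lambda>n. X n i j) \<longlonglongrightarrow> l" for i j
  proof (cases "i \<in> I \<and> j \<in> I")
    case True
    have "cmod (X (Suc n) i j - X n i j) \<le> r ^ n * r" for n
      using entry_le_bound[OF fin diff[of n]] True by (simp add: mminus_def)
    moreover have "summable (\<lambda>n. r ^ n * r)" using r by (intro summable_mult2 summable_geometric) auto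
    ultimately have "summable (\<lambda>n. X (Suc n) i j - X n i j)"
      using summable_comparison_test'[of "\<lambda>n. r ^ n * r" 0 "\<lambda>n. X (Suc n) i j - X n i j"] by auto
    then have "(\<lambda>n. \<Sum>k<n. X (Suc k) i j - X k i j) \<longlonglongrightarrow> (\<Sum>n. X (Suc n) i j - X n i j)"
      by (rule summable_LIMSEQ)
    moreover have "(\<Sum>k<n. X (Suc k) i j - X k i j) = X n i j" for n
      using sum_lessThan_telescope[of "\<lambda>n. X n i j" n] by (simp add: X0)
    ultimately show ?thesis by auto
  qed (use mats in \<open>auto simp: cmats_def intro!: exI[of _ 0]\<close>)
  then obtain L where L: "\<And>i j. (\<lambda>n. X n i j) \<longlonglongrightarrow> L i j" by metis
  show ?thesis
  proof (rule that[of L])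
    show "L \<in> cmats I I"
    proof -
      have "L i j = 0" if "i \<notin> I \<or> j \<notin> I" for i j
      proof -
        have "X n i j = 0" for n using mats[of n] that by (auto simp: cmats_def)
        then show ?thesis using L[of i j] by (simp add: LIMSEQ_const_iff)
      qed
      then show ?thesis by (auto simp: cmats_def)
    qed
    show "madjoint L = L"
    proof (intro ext)
      fix i j
      have "(\<lambda>n. cnj (X n j i)) \<longlonglongrightarrow> cnj (L j i)" by (intro tendsto_intros L)
      moreover have "(\<lambda>n. cnj (X n j i)) = (\<lambda>n. X n i j)"
        using herm by (auto simp: madjoint_def fun_eq_iff)
      ultimately show "madjoint L i j = L i j" using LIMSEQ_unique[OF L[of i j]] by (simp add: madjoint_def)
    qed
    show "2 * L i j = B i j + mmult I L L i j" for i j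
    proof -
      have "(\<lambda>n. 2 * X (Suc n) i j) \<longlonglongrightarrow> 2 * L i j"
        using L[of i j] by (intro tendsto_intros LIMSEQ_Suc)
      moreover have "(\<lambda>n. B i j + mmult I (X n) (X n) i j) \<longlonglongrightarrow> B i j + mmult I L L i j"
        unfolding mmult_def by (intro tendsto_intros L)
      moreover have "2 * X (Suc n) i j = B i j + mmult I (X n) (X n) i j" for n
        by (simp add: Suc step_def)
      ultimately show ?thesis using LIMSEQ_unique by auto
    qed
    show "Re (cinner I x (mapply I L x)) \<le> (cnorm I x)\<^sup>2" for x
    proof (rule LIMSEQ_le_const2)
      show "(\<lambda>n. Re (cinner I x (mapply I (X n) x))) \<longlonglongrightarrow> Re (cinner I x (mapply I L x))"
        unfolding mapply_def cinner_def by (intro tendsto_intros L)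
      have "Re (cinner I x (mapply I (X n) x)) \<le> (cnorm I x)\<^sup>2" for n
      proof -
        have "Re (cinner I x (mapply I (X n) x)) \<le> cnorm I x * cnorm I (mapply I (X n) x)"
          by (rule order_trans[OF complex_Re_le_cmod cinner_Cauchy_Schwarz])
        also have "\<dots> \<le> cnorm I x * (1 * cnorm I x)"
          by (intro mult_left_mono order_trans[OF bound mult_right_mono]) (use r in auto)
        finally show ?thesis by (simp add: power2_eq_square)
      qed
      then show "\<exists>N. \<forall>n\<ge>N. Re (cinner I x (mapply I (X n) x)) \<le> (cnorm I x)\<^sup>2" by auto
    qed
  qed
qed

text \<open>For B = 1 - A / t the bounds on A give |B x|^2 \<le> (1 - 2 m / t + K^2 / t^2) |x|^2,
  and t = K^2 / m minimises the factor to 1 - m^2 / K^2 < 1. With X from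
  \<open>contraction_root\<close>, A = t (1 - B) = t (1 - X)^2, so sqrt t (1 - X) is a root; it is
  positive because X \<le> 1 as a form.\<close>

lemma exists_psd_root:
  assumes fin: "finite I" and A: "A \<in> cmats I I" "madjoint A = A"
    and m: "0 < m" "\<And>x. m * (cnorm I x)\<^sup>2 \<le> Re (cinner I x (mapply I A x))"
  obtains S where "mpos_semidef I S" "mmult I S S = A"
proof -
  note [simp] = fin
  obtain K0 where K0: "0 < K0" "\<And>x. cnorm I (mapply I A x) \<le> K0 * cnorm I x"
    using cnorm_mapply_bounded[OF fin fin, of A] by blast
  \<comment> \<open>The maximum with \<open>m\<close> keeps \<open>q2\<close> nonnegative.\<close>
  define K where "K = max K0 m"
  have K: "0 < K" "m \<le> K" "\<And>x. cnorm I (mapply I A x) \<le> K * cnorm I x"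
    using K0 by (auto simp: K_def intro!: order_trans[OF K0(2) mult_right_mono])
  define t where "t = K\<^sup>2 / m"
  have t: "t > 0" using K m by (simp add: t_def)
  define q2 where "q2 = 1 - m\<^sup>2 / K\<^sup>2"
  have q2: "0 \<le> q2" "q2 < 1" using K m by (auto simp: q2_def power_mono)
  define B where "B = (\<lambda>i j. mone I i j - A i j / of_real t)"
  have B: "B \<in> cmats I I" "madjoint B = B"
  proof -
    show "B \<in> cmats I I" using A mone_in_cmats[of I] unfolding cmats_def B_def by auto
    have "cnj (A i j) = A j i" for i j using A(2) by (auto simp: madjoint_def fun_eq_iff)
    then show "madjoint B = B" by (auto simp: madjoint_def B_def mone_def fun_eq_iff)
  qed
  have Bx: "cnorm I (mapply I B x) \<le> sqrt q2 * cnorm I x" for x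
  proof -
    define y where "y = (\<lambda>i. if i \<in> I then x i else 0)"
    have y: "y \<in> cvecs I" by (auto simp: y_def cvecs_def)
    have xy: "mapply I B x = mapply I B y" "cnorm I x = cnorm I y"
      by (auto simp: y_def intro!: mapply_cong cnorm_cong)
    define z where "z = (\<lambda>i. of_real (1/t) * mapply I A y i)"
    have By: "mapply I B y = y - z"
    proof -
      have "mapply I B y = mapply I (mone I) y - z"
        by (auto simp: z_def mapply_def B_def algebra_simps sum_subtractf sum_distrib_left)
      with y show ?thesis by (simp add: mapply_mone)
    qed
    have yz: "cinner I y z = of_real (Re (cinner I y (mapply I A y)) / t)"
      using Re_cinner_hermitian[OF A(2), of I y]
      by (simp add: z_def cinner_def sum_distrib_left algebra_simps sum_divide_distrib[symmetric] del: of_real_Re)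
    have "of_real ((cnorm I (y - z))\<^sup>2) = cinner I (y - z) (y - z)" by (simp add: cinner_self)
    also have "\<dots> = of_real ((cnorm I y)\<^sup>2 - 2 * (Re (cinner I y (mapply I A y)) / t) + (cnorm I z)\<^sup>2)"
    proof -
      have "cinner I (y - z) (y - z) = cinner I y y - cinner I y z - (cinner I z y - cinner I z z)"
        by (simp add: cinner_diff_left cinner_diff_right del: minus_apply)
      then show ?thesis unfolding cinner_commute[of I z y] yz by (simp add: cinner_self)
    qed
    finally have e: "(cnorm I (y - z))\<^sup>2 = (cnorm I y)\<^sup>2 - 2 * (Re (cinner I y (mapply I A y)) / t) + (cnorm I z)\<^sup>2"
      using of_real_eq_iff by blast
    have "cnorm I z = cnorm I (mapply I A y) / t"
      unfolding z_def cnorm_scale using t by (simp add: norm_divide)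
    also have "\<dots> \<le> K * cnorm I y / t" using K t by (intro divide_right_mono) auto
    finally have "(cnorm I z)\<^sup>2 \<le> (K * cnorm I y / t)\<^sup>2" by (rule power_mono) simp
    moreover have "m * (cnorm I y)\<^sup>2 / t \<le> Re (cinner I y (mapply I A y)) / t"
      using m t by (intro divide_right_mono) auto
    ultimately have "(cnorm I (y - z))\<^sup>2 \<le> (cnorm I y)\<^sup>2 - 2 * (m * (cnorm I y)\<^sup>2 / t) + (K * cnorm I y / t)\<^sup>2"
      unfolding e by linarith
    also have "\<dots> = q2 * (cnorm I y)\<^sup>2"
      using K m by (simp add: t_def q2_def field_simps power2_eq_square)
    also have "\<dots> = (sqrt q2 * cnorm I y)\<^sup>2" using q2 by (simp add: power_mult_distrib)
    finally show ?thesis unfolding xy By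
      by (rule power2_le_imp_le) (use q2 in simp)
  qed
  obtain X where X: "X \<in> cmats I I" "madjoint X = X"
    "\<And>i j. 2 * X i j = B i j + mmult I X X i j"
    "\<And>x. Re (cinner I x (mapply I X x)) \<le> (cnorm I x)\<^sup>2"
    using contraction_root[OF fin B _ _ Bx] q2 by auto
  define S where "S = (\<lambda>i j. of_real (sqrt t) * mminus (mone I) X i j)"
  have ap: "mapply I S x = (\<lambda>i. of_real (sqrt t) * (mapply I (mone I) x - mapply I X x) i)" for x
    unfolding mapply_mminus[symmetric] by (auto simp: S_def mapply_def sum_distrib_left mult.assoc)
  show ?thesis
  proof (rule that[of S])
    have "cnj (X i j) = X j i" for i j using X(2) by (auto simp: madjoint_def fun_eq_iff)
    then have "madjoint S = S" by (auto simp: madjoint_def S_def mminus_def mone_def fun_eq_iff)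
    moreover have "S \<in> cmats I I" using mminus_in_cmats[OF mone_in_cmats X(1)] by (auto simp: S_def cmats_def)
    moreover have "0 \<le> Re (cinner I x (mapply I S x))" if x: "x \<in> cvecs I" for x
    proof -
      have "cinner I x (mapply I S x) = of_real (sqrt t) * (cinner I x x - cinner I x (mapply I X x))"
        unfolding ap cinner_diff_right[symmetric] using x
        by (simp add: mapply_mone cinner_def sum_distrib_left algebra_simps)
      then show ?thesis using X(4)[of x] t by (simp add: cinner_self)
    qed
    ultimately show "mpos_semidef I S" by (simp add: mpos_semidef_def)
    show "mmult I S S = A"
    proof (intro ext)
      fix i j
      have "mmult I S S i j = of_real t * mmult I (mminus (mone I) X) (mminus (mone I) X) i j"
        using t by (simp add: S_def mmult_def sum_distrib_left mult.left_commute
            of_real_mult[symmetric] mult.assoc[symmetric] del: of_real_mult)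
      also have "mmult I (mminus (mone I) X) (mminus (mone I) X) i j
         = mmult I (mone I) (mone I) i j - mmult I (mone I) X i j - mmult I X (mone I) i j + mmult I X X i j"
        by (simp add: mmult_def mminus_def algebra_simps sum_subtractf sum.distrib)
      also have "\<dots> = mone I i j - 2 * X i j + mmult I X X i j"
        using X(1) by (simp add: mmult_mone_left[of I _ I] mmult_mone_right[of I _ I])
      also have "\<dots> = A i j / of_real t" unfolding X(3) by (simp add: B_def)
      finally show "mmult I S S i j = A i j" using t by simp
    qed
  qed
qed

subsection \<open>Orthogonal projections\<close>

definition is_orthoproj :: "'i set \<Rightarrow> ('i \<Rightarrow> complex) set \<Rightarrow> ('i \<Rightarrow> 'i \<Rightarrow> complex) \<Rightarrow> bool" where
  "is_orthoproj I W P \<longleftrightarrow> P \<in> cmats I I \<and> mmult I P P = P \<and> madjoint P = P \<and> mapply I P ` cvecs I = W"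

lemma is_orthoproj_fixes:
  assumes "finite I" "is_orthoproj I W P" "x \<in> W"
  shows "mapply I P x = x"
  using assms unfolding is_orthoproj_def by (auto simp: mapply_mmult[symmetric])

text \<open>A projection fixes its range, so two projections with the same range satisfy P Q = Q and
  Q P = P; the adjoint of the first equation turns the second into P = Q.\<close>

lemma orthoproj_eq:
  assumes fin: "finite I" and P: "is_orthoproj I W P"
  shows "orthoproj I W = P"
proof -
  have abs: "mmult I P Q = Q" if "is_orthoproj I W P" "is_orthoproj I W Q" for P Q
  proof (rule mat_eqI[OF fin])
    show "mmult I P Q \<in> cmats I I" "Q \<in> cmats I I"
      using that by (auto simp: is_orthoproj_def mmult_in_cmats)
    show "mapply I (mmult I P Q) x = mapply I Q x" if "x \<in> cvecs I" for x
      using \<open>is_orthoproj I W Q\<close> that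
      by (auto simp: mapply_mmult fin is_orthoproj_def intro!: is_orthoproj_fixes[OF fin \<open>is_orthoproj I W P\<close>])
  qed
  have "Q = P" if "is_orthoproj I W Q" for Q
  proof -
    have "mmult I P Q = Q" "mmult I Q P = P" using abs P that by auto
    moreover have "madjoint P = P" "madjoint Q = Q" using P that by (simp_all add: is_orthoproj_def)
    ultimately show ?thesis using madjoint_mmult[of I P Q] by simp
  qed
  then show ?thesis unfolding orthoproj_def is_orthoproj_def[symmetric] by (rule the_equality[of "is_orthoproj I W", OF P])
qed

lemma cnorm_orthoproj_Pythagoras:
  assumes fin: "finite I" and P: "is_orthoproj I W P"
  shows "(cnorm I x)\<^sup>2 = (cnorm I (mapply I P x))\<^sup>2 + (cnorm I (x - mapply I P x))\<^sup>2"
proof -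
  have P1: "madjoint P = P" "mmult I P P = P" using P by (auto simp: is_orthoproj_def)
  let ?p = "mapply I P x"
  have pp: "cinner I ?p ?p = cinner I x ?p" "cinner I ?p x = cinner I ?p ?p"
    using P1 fin by (simp_all add: cinner_mapply mapply_mmult[symmetric])
  then have "cinner I (x - ?p) (x - ?p) = cinner I x x - cinner I ?p ?p"
    by (simp add: cinner_diff_left cinner_diff_right del: minus_apply)
  then have "of_real ((cnorm I (x - ?p))\<^sup>2) = (of_real ((cnorm I x)\<^sup>2 - (cnorm I ?p)\<^sup>2) :: complex)"
    unfolding cinner_self by simp
  then have "(cnorm I (x - ?p))\<^sup>2 = (cnorm I x)\<^sup>2 - (cnorm I ?p)\<^sup>2" by (simp only: of_real_eq_iff)
  then show ?thesis by simp
qed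

lemma cnorm_orthoproj_le:
  assumes "finite I" "is_orthoproj I W P"
  shows "cnorm I (mapply I P x) \<le> cnorm I x" "cnorm I (x - mapply I P x) \<le> cnorm I x"
  by (rule power2_le_imp_le; use cnorm_orthoproj_Pythagoras[OF assms, of x] in simp)+

text \<open>Since P fixes w, x - P x = (1 - P) (x - w), and 1 - P is a contraction.\<close>

lemma cnorm_orthoproj_best:
  assumes "finite I" "is_orthoproj I W P" "w \<in> W"
  shows "cnorm I (x - mapply I P x) \<le> cnorm I (x - w)"
proof -
  have "x - mapply I P x = (x - w) - mapply I P (x - w)"
    using is_orthoproj_fixes[OF assms] by (auto simp: mapply_diff)
  then show ?thesis using cnorm_orthoproj_le(2)[OF assms(1,2), of "x - w"] by metis
qed

text \<open>This is what turns \<open>edge_projector\<close>, defined as the projection onto an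
  orthogonal complement, into 1 minus the projection onto the image.\<close>

lemma is_orthoproj_orthocomp:
  assumes fin: "finite I" and P: "is_orthoproj I W P"
  shows "is_orthoproj I (orthocomp I W) (mminus (mone I) P)"
proof -
  have P1: "P \<in> cmats I I" "madjoint P = P" "mmult I P P = P" and W: "W = mapply I P ` cvecs I"
    using P by (auto simp: is_orthoproj_def)
  let ?Q = "mminus (mone I) P"
  have Q: "?Q \<in> cmats I I" using P1 by (simp add: mminus_in_cmats)
  have Qx: "mapply I ?Q x = x - mapply I P x" if "x \<in> cvecs I" for x
    using that fin by (simp add: mapply_mminus mapply_mone)
  have Px: "mapply I P x \<in> cvecs I" for x by (rule mapply_in_cvecs[OF P1(1)])
  have PP: "mapply I P (mapply I P x) = mapply I P x" for x
    using P1(3) fin by (simp add: mapply_mmult[symmetric])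
  have PQ: "mapply I P (mapply I ?Q x) = (\<lambda>_. 0)" if "x \<in> cvecs I" for x
    using that unfolding Qx[OF that] mapply_diff PP by auto
  have "mmult I ?Q ?Q = ?Q"
  proof (rule mat_eqI[OF fin _ Q])
    show "mmult I ?Q ?Q \<in> cmats I I" using Q by (rule mmult_in_cmats) fact
    fix x assume x: "x \<in> cvecs I"
    have "mapply I ?Q (mapply I ?Q x) = mapply I ?Q x - mapply I P (mapply I ?Q x)"
      by (rule Qx[OF mapply_in_cvecs[OF Q]])
    also have "\<dots> = mapply I ?Q x" using PQ[OF x] by auto
    finally show "mapply I (mmult I ?Q ?Q) x = mapply I ?Q x" using fin by (simp add: mapply_mmult)
  qed
  moreover have "madjoint ?Q = ?Q"
    using P1(2) madjoint_mone[of I] by (simp add: madjoint_def mminus_def fun_eq_iff)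
  moreover have "mapply I ?Q ` cvecs I = orthocomp I W"
  proof (intro equalityI subsetI)
    fix y assume "y \<in> mapply I ?Q ` cvecs I"
    then obtain x where x: "x \<in> cvecs I" and y: "y = mapply I ?Q x" by auto
    have "cinner I (mapply I P w) y = 0" for w
      unfolding cinner_mapply P1(2) y PQ[OF x] by (simp add: cinner_def)
    then show "y \<in> orthocomp I W" using mapply_in_cvecs[OF Q] by (auto simp: orthocomp_def W y)
  next
    fix y assume y: "y \<in> orthocomp I W"
    then have yc: "y \<in> cvecs I" by (simp add: orthocomp_def)
    have "cinner I (mapply I P (mapply I P y)) y = 0" using y Px unfolding orthocomp_def W by blast
    then have "cinner I (mapply I P y) (mapply I P y) = 0" unfolding cinner_mapply[of I I P "mapply I P y"] P1(2) .
    then have "mapply I P y = (\<lambda>_. 0)" using fin Px[of y]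
      by (auto simp: cinner_self cnorm_eq_0 cvecs_def fun_eq_iff)
    then have "y = mapply I ?Q y" using Qx[OF yc] by auto
    then show "y \<in> mapply I ?Q ` cvecs I" using yc by blast
  qed
  ultimately show ?thesis using Q by (simp add: is_orthoproj_def)
qed

lemma isometry_bounds:
  assumes fin: "finite I" "finite J" and U: "mmult I (madjoint U) U = mone J" "U \<in> cmats I J"
  shows "cnorm I (mapply J U y) = cnorm J y" "cnorm J (mapply I (madjoint U) x) \<le> cnorm I x"
    "is_orthoproj I (mapply J U ` cvecs J) (mmult J U (madjoint U))"
proof -
  show iso: "cnorm I (mapply J U y) = cnorm J y" for y
  proof -
    let ?y = "\<lambda>j. if j \<in> J then y j else 0"
    have "cinner I (mapply J U ?y) (mapply J U ?y) = cinner J ?y ?y"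
      unfolding cinner_mapply using fin U by (simp add: mapply_mmult[symmetric] mapply_mone cvecs_def)
    then have "(cnorm I (mapply J U ?y))\<^sup>2 = (cnorm J ?y)\<^sup>2"
      unfolding cinner_self using of_real_eq_iff by blast
    then have "cnorm I (mapply J U ?y) = cnorm J ?y" by (simp add: power2_eq_iff_nonneg)
    moreover have "mapply J U ?y = mapply J U y" "cnorm J ?y = cnorm J y"
      by (auto intro!: mapply_cong cnorm_cong)
    ultimately show ?thesis by simp
  qed
  let ?n = "cnorm J (mapply I (madjoint U) x)"
  \<comment> \<open>|U^* x|^2 = <x, U U^* x> \<le> |x| |U U^* x| = |x| |U^* x|, the last equality
    because U is isometric.\<close>
  have "of_real (?n\<^sup>2) = cinner I x (mapply J U (mapply I (madjoint U) x))"
    unfolding cinner_self[symmetric] by (simp add: cinner_mapply)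
  then have "?n\<^sup>2 = cmod (cinner I x (mapply J U (mapply I (madjoint U) x)))"
    using norm_of_real[of "?n\<^sup>2", where ?'a = complex] by simp
  also have "\<dots> \<le> cnorm I x * ?n" using cinner_Cauchy_Schwarz[of I x "mapply J U (mapply I (madjoint U) x)"] unfolding iso .
  finally show "?n \<le> cnorm I x"
    using cnorm_nonneg[of J "mapply I (madjoint U) x"] cnorm_nonneg[of I x]
    by (cases "?n = 0") (auto simp: power2_eq_square mult_le_cancel_right)
  let ?P = "mmult J U (madjoint U)"
  have "mmult I ?P ?P = mmult J U (mmult J (mmult I (madjoint U) U) (madjoint U))"
    using fin by (simp add: mmult_assoc)
  then have "mmult I ?P ?P = ?P" using U fin by (simp add: mmult_mone_left[of J _ I] madjoint_in_cmats)
  moreover have "mapply I ?P ` cvecs I = mapply J U ` cvecs J"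
  proof (intro equalityI subsetI)
    fix y assume "y \<in> mapply I ?P ` cvecs I"
    then show "y \<in> mapply J U ` cvecs J"
      using fin mapply_in_cvecs[OF madjoint_in_cmats[OF U(2)]] by (auto simp: mapply_mmult)
  next
    fix y assume "y \<in> mapply J U ` cvecs J"
    then obtain x where x: "x \<in> cvecs J" "y = mapply J U x" by auto
    have "mapply I (madjoint U) y = x"
      unfolding x(2) using x(1) U fin by (simp add: mapply_mmult[symmetric] mapply_mone)
    then have "mapply I ?P y = y" using x fin by (simp add: mapply_mmult)
    then show "y \<in> mapply I ?P ` cvecs I" using x(2) mapply_in_cvecs[OF U(2)] by (metis image_eqI)
  qed
  ultimately show "is_orthoproj I (mapply J U ` cvecs J) ?P"
    using U by (simp add: is_orthoproj_def mmult_in_cmats madjoint_in_cmats madjoint_mmult)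
qed

text \<open>The isometry is U = V \<rho>^{-1/2}. A left inverse of V bounds \<rho> from below, which
  is what \<open>exists_psd_root\<close> asks for. The facts about \<open>msqrt\<close> and
  \<open>minv\<close> are collected here because both are definite descriptions, usable only once
  existence and uniqueness are known.\<close>

lemma polar_decomposition:
  assumes fin: "finite I" "finite J" and V: "V \<in> cmats I J" and inj: "inj_on (mapply J V) (cvecs J)"
  defines "\<rho> \<equiv> mmult I (madjoint V) V"
  obtains U where "U \<in> cmats I J" "mmult I (madjoint U) U = mone J"
    "mapply J U ` cvecs J = mapply J V ` cvecs J"
    "V = mmult J U (msqrt J \<rho>)"
    "U = mmult J V (minv J (msqrt J \<rho>))"
    "msqrt J \<rho> \<in> cmats J J" "madjoint (msqrt J \<rho>) = msqrt J \<rho>"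
    "is_minv J (msqrt J \<rho>) (minv J (msqrt J \<rho>))"
    "madjoint (minv J (msqrt J \<rho>)) = minv J (msqrt J \<rho>)"
    "mmult J (msqrt J \<rho>) (msqrt J \<rho>) = \<rho>"
proof -
  note [simp] = fin
  have \<rho>: "\<rho> \<in> cmats J J" "madjoint \<rho> = \<rho>"
    using V by (auto simp: \<rho>_def mmult_in_cmats madjoint_in_cmats madjoint_mmult)
  have \<rho>x: "cinner J x (mapply J \<rho> x) = of_real ((cnorm I (mapply J V x))\<^sup>2)" for x
    unfolding \<rho>_def cinner_self[symmetric] by (simp add: mapply_mmult cinner_mapply)
  obtain L where L: "L \<in> cmats J I" "mmult I L V = mone J"
    using exists_left_inverse[OF fin V inj] .
  obtain K where K: "0 < K" "\<And>x. cnorm J (mapply I L x) \<le> K * cnorm I x"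
    using cnorm_mapply_bounded[OF fin(2,1), of L] by blast
  have low: "1 / K\<^sup>2 * (cnorm J x)\<^sup>2 \<le> Re (cinner J x (mapply J \<rho> x))" for x
  proof -
    have "cnorm J x = cnorm J (mapply J (mone J) x)"
      by (rule cnorm_cong) (simp add: mapply_def sum_mone_left)
    also have "mapply J (mone J) x = mapply I L (mapply J V x)"
      by (simp add: L(2)[symmetric] mapply_mmult)
    also have "cnorm J \<dots> \<le> K * cnorm I (mapply J V x)" by (rule K)
    finally have "(cnorm J x)\<^sup>2 \<le> (K * cnorm I (mapply J V x))\<^sup>2" by (rule power_mono) simp
    then show ?thesis unfolding \<rho>x using K by (simp add: field_simps)
  qed
  obtain R where R: "mpos_semidef J R" "mmult J R R = \<rho>"
    using exists_psd_root[OF fin(2) \<rho> _ low] K by auto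
  then have sq: "msqrt J \<rho> = R" using msqrt_eq fin by blast
  have R1: "R \<in> cmats J J" "madjoint R = R" using R by (auto simp: mpos_semidef_def)
  have "x = (\<lambda>_. 0)" if "x \<in> cvecs J" "mapply J R x = (\<lambda>_. 0)" for x
  proof -
    have "mapply J \<rho> x = (\<lambda>_. 0)" using that by (simp add: R(2)[symmetric] mapply_mmult)
    then have "cinner J x (mapply J \<rho> x) = 0" by (simp add: cinner_def)
    then have "1 / K\<^sup>2 * (cnorm J x)\<^sup>2 \<le> 0" using low[of x] by simp
    then have "cnorm J x = 0" using K by (simp add: divide_le_0_iff)
    then show ?thesis using that by (auto simp: cnorm_eq_0 cvecs_def)
  qed
  then obtain N where N: "is_minv J R N" "madjoint N = N"
    using inj_imp_minv_hermitian[OF fin(2) R1] by blast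
  have mi: "minv J R = N" using minv_eq[OF fin(2) R1(1) N(1)] .
  have N1: "N \<in> cmats J J" "mmult J R N = mone J" "mmult J N R = mone J" using N by (auto simp: is_minv_def)
  define U where "U = mmult J V N"
  have U: "U \<in> cmats I J" using V N1 by (simp add: U_def mmult_in_cmats)
  have VU: "V = mmult J U R"
    using N1 V by (simp add: U_def mmult_assoc[symmetric] mmult_mone_right[of J _ I])
  have "mmult I (madjoint U) U = mmult J N (mmult J \<rho> N)"
    by (simp add: U_def \<rho>_def madjoint_mmult N(2) mmult_assoc)
  also have "\<dots> = mmult J (mmult J N R) (mmult J R N)" by (simp add: R(2)[symmetric] mmult_assoc)
  also have "\<dots> = mone J" using N1 by (simp add: mmult_mone_left[of J _ J])
  finally have UU: "mmult I (madjoint U) U = mone J" .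
  have im: "mapply J U ` cvecs J = mapply J V ` cvecs J"
  proof (intro equalityI subsetI)
    fix y assume "y \<in> mapply J U ` cvecs J"
    then show "y \<in> mapply J V ` cvecs J"
      using mapply_in_cvecs[OF N1(1)] by (auto simp: U_def mapply_mmult)
  next
    fix y assume "y \<in> mapply J V ` cvecs J"
    then obtain x where "x \<in> cvecs J" "y = mapply J V x" by auto
    then have "y = mapply J U (mapply J R x)" by (simp add: VU mapply_mmult)
    then show "y \<in> mapply J U ` cvecs J" using mapply_in_cvecs[OF R1(1)] by blast
  qed
  show ?thesis
    by (rule that[of U, unfolded sq mi, OF U UU im VU U_def R1 N R(2)])
qed

section \<open>Operators on tensor products with factors labelled by vertices and edges\<close>

subsection \<open>Configurations\<close>

lemma configs_eq_extensional: "configs S = extensional S"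
  by (auto simp: configs_def PiE_def)

lemma configs_iff: "x \<in> configs S \<longleftrightarrow> (\<forall>s. s \<notin> S \<longrightarrow> x s = undefined)"
  by (auto simp: configs_eq_extensional extensional_def)

lemma finite_configs [simp]: "finite S \<Longrightarrow> finite (configs S :: ('s \<Rightarrow> 'q::finite) set)"
  unfolding configs_def by (rule finite_PiE) auto

lemma configs_empty [simp]: "configs {} = {\<lambda>_. undefined}"
  by (simp add: configs_def)

lemma restrict_in_configs [simp]: "restrict x S \<in> configs S"
  by (simp add: configs_eq_extensional)

lemma restrict_configs: "x \<in> configs S \<Longrightarrow> restrict x S = x"
  by (simp add: configs_eq_extensional extensional_restrict)

lemma override_on_in_configs:
  "S \<subseteq> F \<Longrightarrow> r \<in> configs F \<Longrightarrow> override_on r j S \<in> configs F"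
  by (auto simp: configs_iff override_on_def)

lemma sum_configs_Un:
  fixes f :: "('s \<Rightarrow> 'q) \<Rightarrow> 'a::comm_monoid_add"
  assumes "A \<inter> B = {}"
  shows "(\<Sum>x\<in>configs (A \<union> B). f x) = (\<Sum>a\<in>configs A. \<Sum>b\<in>configs B. f (override_on a b B))"
proof -
  have "(\<Sum>a\<in>configs A. \<Sum>b\<in>configs B. f (override_on a b B))
      = (\<Sum>(a, b)\<in>configs A \<times> configs B. f (override_on a b B))"
    by (simp add: sum.cartesian_product)
  also have "\<dots> = (\<Sum>x\<in>configs (A \<union> B). f x)"
    by (rule sum.reindex_bij_witness[of _ "\<lambda>x. (restrict x A, restrict x B)" "\<lambda>(a, b). override_on a b B"])
       (use assms in \<open>auto simp: configs_iff override_on_def restrict_def fun_eq_iff\<close>)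
  finally show ?thesis ..
qed

lemma sum_configs_split:
  fixes f :: "('s \<Rightarrow> 'q) \<Rightarrow> 'a::comm_monoid_add"
  assumes "S \<subseteq> F"
  shows "(\<Sum>x\<in>configs F. f x) = (\<Sum>r\<in>configs (F - S). \<Sum>j\<in>configs S. f (override_on r j S))"
  using sum_configs_Un[of "F - S" S f] assms by (simp add: Un_absorb2 Int_commute)

lemma tensor_ext_in_cmats [simp]: "tensor_ext S F M \<in> cmats (configs F) (configs F)"
  by (auto simp: tensor_ext_def cmats_def)

text \<open>The working form of \<open>tensor_ext\<close>: of all configurations outside
  \<open>S\<close> only the one that agrees with \<open>x\<close> contributes.\<close>

lemma mapply_tensor_ext:
  fixes M :: "('s \<Rightarrow> 'q::finite) \<Rightarrow> ('s \<Rightarrow> 'q) \<Rightarrow> complex"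
  assumes "finite F" "S \<subseteq> F" "x \<in> configs F"
  shows "mapply (configs F) (tensor_ext S F M) \<psi> x
    = (\<Sum>j\<in>configs S. M (restrict x S) j * \<psi> (override_on x j S))"
proof -
  have "mapply (configs F) (tensor_ext S F M) \<psi> x
      = (\<Sum>r\<in>configs (F - S). \<Sum>j\<in>configs S.
          tensor_ext S F M x (override_on r j S) * \<psi> (override_on r j S))"
    unfolding mapply_def by (rule sum_configs_split[OF assms(2)])
  also have "\<dots> = (\<Sum>r\<in>configs (F - S). if r = restrict x (F - S)
       then \<Sum>j\<in>configs S. M (restrict x S) j * \<psi> (override_on x j S) else 0)"
  proof (rule sum.cong[OF refl])
    fix r :: "'s \<Rightarrow> 'q" assume r: "r \<in> configs (F - S)"
    show "(\<Sum>j\<in>configs S. tensor_ext S F M x (override_on r j S) * \<psi> (override_on r j S))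
      = (if r = restrict x (F - S) then \<Sum>j\<in>configs S. M (restrict x S) j * \<psi> (override_on x j S) else 0)"
    proof (cases "r = restrict x (F - S)")
      case True
      have "tensor_ext S F M x (override_on r j S) = M (restrict x S) j"
        and "override_on r j S = override_on x j S" if "j \<in> configs S" for j
      proof -
        show *: "override_on r j S = override_on x j S"
          using assms by (auto simp: True override_on_def configs_iff fun_eq_iff)
        have "restrict (override_on x j S) S = j"
          using that by (auto simp: override_on_def configs_iff fun_eq_iff)
        then show "tensor_ext S F M x (override_on r j S) = M (restrict x S) j"
          unfolding * tensor_ext_def using assms by (auto simp: override_on_in_configs)
      qed
      then show ?thesis using True by simp
    next
      case False
      then have "\<exists>s. r s \<noteq> restrict x (F - S) s" by (simp add: fun_eq_iff)
      then obtain s where "s \<in> F - S" "x s \<noteq> r s" using r by (force simp: configs_iff split: if_splits)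
      then have "tensor_ext S F M x (override_on r j S) = 0" for j
        by (auto simp: tensor_ext_def override_on_def)
      with False show ?thesis by simp
    qed
  qed
  also have "\<dots> = (\<Sum>j\<in>configs S. M (restrict x S) j * \<psi> (override_on x j S))"
    using assms by simp
  finally show ?thesis .
qed

lemma tensor_ext_mmult:
  fixes M N :: "('s \<Rightarrow> 'q::finite) \<Rightarrow> ('s \<Rightarrow> 'q) \<Rightarrow> complex"
  assumes "finite F" "S \<subseteq> F"
  shows "mmult (configs F) (tensor_ext S F M) (tensor_ext S F N) = tensor_ext S F (mmult (configs S) M N)"
proof (rule mat_eqI)
  have S: "finite S" using assms finite_subset by blast
  note [simp] = assms(1) S
  show "finite (configs F :: ('s \<Rightarrow> 'q) set)" by simp
  show "mmult (configs F) (tensor_ext S F M) (tensor_ext S F N) \<in> cmats (configs F) (configs F)"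
    by (simp add: mmult_in_cmats)
  show "tensor_ext S F (mmult (configs S) M N) \<in> cmats (configs F) (configs F)" by simp
  fix \<psi> :: "('s \<Rightarrow> 'q) \<Rightarrow> complex"
  show "mapply (configs F) (mmult (configs F) (tensor_ext S F M) (tensor_ext S F N)) \<psi>
      = mapply (configs F) (tensor_ext S F (mmult (configs S) M N)) \<psi>" (is "?L = ?R")
  proof
    fix x
    show "?L x = ?R x"
    proof (cases "x \<in> configs F")
      case True
      have r: "restrict (override_on x j S) S = j" if "j \<in> configs S" for j
        using that by (auto simp: override_on_def configs_iff fun_eq_iff)
      have o: "override_on (override_on x j S) i S = override_on x i S" for i j
        by (auto simp: override_on_def)
      have "?L x = (\<Sum>j\<in>configs S. M (restrict x S) j * (\<Sum>i\<in>configs S. N j i * \<psi> (override_on x i S)))"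
        using True assms by (simp add: mapply_mmult mapply_tensor_ext override_on_in_configs r o)
      also have "\<dots> = (\<Sum>j\<in>configs S. \<Sum>i\<in>configs S. M (restrict x S) j * N j i * \<psi> (override_on x i S))"
        by (simp add: sum_distrib_left mult.assoc)
      also have "\<dots> = ?R x"
        using True assms
        by (subst sum.swap) (simp add: mapply_tensor_ext mmult_def sum_distrib_right)
      finally show ?thesis .
    next
      case False
      have "mapply (configs F) M' \<psi> x = 0"
        if "M' \<in> cmats (configs F) (configs F)" for M' :: "('s \<Rightarrow> 'q) \<Rightarrow> ('s \<Rightarrow> 'q) \<Rightarrow> complex"
        using mapply_in_cvecs[OF that] False by (auto simp: cvecs_def)
      then show ?thesis by (simp add: mmult_in_cmats)
    qed
  qed
qed

lemma tensor_ext_mone: "S \<subseteq> F \<Longrightarrow> tensor_ext S F (mone (configs S)) = mone (configs F)"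
proof (intro ext)
  fix x y :: "'a \<Rightarrow> 'b" assume "S \<subseteq> F"
  show "tensor_ext S F (mone (configs S)) x y = mone (configs F) x y"
  proof (cases "x \<in> configs F \<and> y \<in> configs F")
    case True
    then have "(\<forall>s\<in>F - S. x s = y s) \<and> restrict x S = restrict y S \<longleftrightarrow> x = y"
      by (auto simp: configs_iff fun_eq_iff restrict_def) (metis DiffI)
    with True show ?thesis by (auto simp: tensor_ext_def mone_def)
  qed (auto simp: tensor_ext_def mone_def)
qed

lemma is_minv_tensor_product:
  fixes M\<^sub>1 M\<^sub>2 :: "('s \<Rightarrow> 'q::finite) \<Rightarrow> ('s \<Rightarrow> 'q) \<Rightarrow> complex"
  assumes "finite F" "S\<^sub>1 \<subseteq> F" "S\<^sub>2 \<subseteq> F"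
    and "is_minv (configs S\<^sub>1) M\<^sub>1 N\<^sub>1" "is_minv (configs S\<^sub>2) M\<^sub>2 N\<^sub>2"
  shows "is_minv (configs F) (mmult (configs F) (tensor_ext S\<^sub>1 F M\<^sub>1) (tensor_ext S\<^sub>2 F M\<^sub>2))
     (mmult (configs F) (tensor_ext S\<^sub>2 F N\<^sub>2) (tensor_ext S\<^sub>1 F N\<^sub>1))"
proof -
  let ?I = "configs F :: ('s \<Rightarrow> 'q) set"
  let ?M1 = "tensor_ext S\<^sub>1 F M\<^sub>1" and ?M2 = "tensor_ext S\<^sub>2 F M\<^sub>2"
    and ?N1 = "tensor_ext S\<^sub>1 F N\<^sub>1" and ?N2 = "tensor_ext S\<^sub>2 F N\<^sub>2"
  have fin: "finite ?I" using assms by simp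
  have one: "mmult ?I ?M1 ?N1 = mone ?I" "mmult ?I ?N1 ?M1 = mone ?I"
      "mmult ?I ?M2 ?N2 = mone ?I" "mmult ?I ?N2 ?M2 = mone ?I"
    using assms by (simp_all add: tensor_ext_mmult tensor_ext_mone is_minv_def)
  have "mmult ?I (mmult ?I ?M1 ?M2) (mmult ?I ?N2 ?N1) = mmult ?I ?M1 (mmult ?I (mmult ?I ?M2 ?N2) ?N1)"
    using fin by (simp add: mmult_assoc)
  moreover have "mmult ?I (mmult ?I ?N2 ?N1) (mmult ?I ?M1 ?M2) = mmult ?I ?N2 (mmult ?I (mmult ?I ?N1 ?M1) ?M2)"
    using fin by (simp add: mmult_assoc)
  ultimately show ?thesis unfolding is_minv_def one
    using fin by (simp add: one mmult_in_cmats mmult_mone_left[of ?I _ ?I])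
qed

subsection \<open>Operators with a partially specified support\<close>

text \<open>
  The intermediate spaces \<open>\<H>\<^bsub>C\<^esub> \<otimes> \<H>\<^bsub>\<partial>AB\<^esub>\<close> etc. all embed into the functions of a
  configuration \<open>k\<close> of all vertices and a configuration \<open>x\<close> of all edges; an operator replaces the
  values on the sites that it sums over and reads others. The identity on the remaining factors is
  then implicit, and operators on disjoint sites commute.
\<close>

type_synonym ('v, 'p, 'e, 'b) state = "('v \<Rightarrow> 'p) \<Rightarrow> ('e \<Rightarrow> 'b) \<Rightarrow> complex"

definition gop :: "'v set \<Rightarrow> 'e set \<Rightarrow>
    (('v \<Rightarrow> 'p) \<Rightarrow> ('e \<Rightarrow> 'b) \<Rightarrow> ('v \<Rightarrow> 'p) \<Rightarrow> ('e \<Rightarrow> 'b) \<Rightarrow> complex) \<Rightarrow>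
    ('v, 'p, 'e, 'b) state \<Rightarrow> ('v, 'p, 'e, 'b) state" where
  "gop K X M f = (\<lambda>k x. \<Sum>j\<in>configs K. \<Sum>y\<in>configs X.
     M k x j y * f (override_on k j K) (override_on x y X))"

text \<open>A state with this property does not involve the factors at \<open>K\<close> and
  \<open>X\<close>: it encodes a vector of the tensor product of the other factors. The property
  takes the place of recording in a type which factors are present.\<close>

definition indep :: "'v set \<Rightarrow> 'e set \<Rightarrow> (('v \<Rightarrow> 'p) \<Rightarrow> ('e \<Rightarrow> 'b) \<Rightarrow> 'c) \<Rightarrow> bool" where
  "indep K X f \<longleftrightarrow> (\<forall>k x k' x'. (\<forall>v. v \<notin> K \<longrightarrow> k v = k' v) \<longrightarrow> (\<forall>e. e \<notin> X \<longrightarrow> x e = x' e) \<longrightarrow> f k x = f k' x')"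

lemma indepD:
  "indep K X f \<Longrightarrow> (\<And>v. v \<notin> K \<Longrightarrow> k v = k' v) \<Longrightarrow> (\<And>e. e \<notin> X \<Longrightarrow> x e = x' e) \<Longrightarrow> f k x = f k' x'"
  unfolding indep_def by blast

text \<open>The sites that are summed over are overwritten before \<open>f\<close> sees them, hence
  the differences in the assumption on \<open>f\<close>.\<close>

lemma indep_gop:
  fixes f :: "('v, 'p, 'e, 'b) state"
  assumes M: "indep K' X' M" and f: "indep (K' - K) (X' - X) f"
  shows "indep K' X' (gop K X M f)"
  unfolding indep_def
proof (intro allI impI)
  fix k k' :: "'v \<Rightarrow> 'p" and x x' :: "'e \<Rightarrow> 'b" assume eq: "\<forall>v. v \<notin> K' \<longrightarrow> k v = k' v" "\<forall>e. e \<notin> X' \<longrightarrow> x e = x' e"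
  have "M k x = M k' x'" using M eq by (auto simp: indep_def)
  moreover have "f (override_on k j K) (override_on x y X) = f (override_on k' j K) (override_on x' y X)" for j y
    by (rule indepD[OF f]) (use eq in \<open>auto simp: override_on_def\<close>)
  ultimately show "gop K X M f k x = gop K X M f k' x'" by (simp add: gop_def)
qed

lemma gop_commute:
  assumes "K\<^sub>1 \<inter> K\<^sub>2 = {}" "X\<^sub>1 \<inter> X\<^sub>2 = {}" and M: "indep K\<^sub>2 X\<^sub>2 M\<^sub>1" "indep K\<^sub>1 X\<^sub>1 M\<^sub>2"
  shows "gop K\<^sub>1 X\<^sub>1 M\<^sub>1 (gop K\<^sub>2 X\<^sub>2 M\<^sub>2 f) = gop K\<^sub>2 X\<^sub>2 M\<^sub>2 (gop K\<^sub>1 X\<^sub>1 M\<^sub>1 f)"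
proof (intro ext)
  fix k x
  have m2: "M\<^sub>2 (override_on k j K\<^sub>1) (override_on x y X\<^sub>1) = M\<^sub>2 k x" for j y
    by (rule indepD[OF M(2)]) auto
  have m1: "M\<^sub>1 (override_on k j K\<^sub>2) (override_on x y X\<^sub>2) = M\<^sub>1 k x" for j y
    by (rule indepD[OF M(1)]) auto
  have o: "override_on (override_on k j K\<^sub>1) j' K\<^sub>2 = override_on (override_on k j' K\<^sub>2) j K\<^sub>1"
      "override_on (override_on x y X\<^sub>1) y' X\<^sub>2 = override_on (override_on x y' X\<^sub>2) y X\<^sub>1" for j j' y y'
    using assms(1,2) by (auto simp: override_on_def fun_eq_iff)
  let ?t = "\<lambda>j y j' y'. M\<^sub>1 k x j y * M\<^sub>2 k x j' y' * 
     f (override_on (override_on k j' K\<^sub>2) j K\<^sub>1) (override_on (override_on x y' X\<^sub>2) y X\<^sub>1)"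
  have "gop K\<^sub>1 X\<^sub>1 M\<^sub>1 (gop K\<^sub>2 X\<^sub>2 M\<^sub>2 f) k x = (\<Sum>j\<in>configs K\<^sub>1. \<Sum>y\<in>configs X\<^sub>1. \<Sum>j'\<in>configs K\<^sub>2. \<Sum>y'\<in>configs X\<^sub>2. ?t j y j' y')"
    by (simp add: gop_def m2 o sum_distrib_left mult.assoc)
  also have "\<dots> = (\<Sum>(j,y)\<in>configs K\<^sub>1 \<times> configs X\<^sub>1. \<Sum>(j',y')\<in>configs K\<^sub>2 \<times> configs X\<^sub>2. ?t j y j' y')"
    by (simp only: sum.cartesian_product[symmetric])
  also have "\<dots> = (\<Sum>(j',y')\<in>configs K\<^sub>2 \<times> configs X\<^sub>2. \<Sum>(j,y)\<in>configs K\<^sub>1 \<times> configs X\<^sub>1. ?t j y j' y')"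
    unfolding split_def by (rule sum.swap)
  also have "\<dots> = (\<Sum>j'\<in>configs K\<^sub>2. \<Sum>y'\<in>configs X\<^sub>2. \<Sum>j\<in>configs K\<^sub>1. \<Sum>y\<in>configs X\<^sub>1. ?t j y j' y')"
    by (simp only: sum.cartesian_product[symmetric])
  also have "\<dots> = gop K\<^sub>2 X\<^sub>2 M\<^sub>2 (gop K\<^sub>1 X\<^sub>1 M\<^sub>1 f) k x"
    by (simp add: gop_def m1 sum_distrib_left algebra_simps)
  finally show "gop K\<^sub>1 X\<^sub>1 M\<^sub>1 (gop K\<^sub>2 X\<^sub>2 M\<^sub>2 f) k x = gop K\<^sub>2 X\<^sub>2 M\<^sub>2 (gop K\<^sub>1 X\<^sub>1 M\<^sub>1 f) k x" .
qed

text \<open>\<open>wop K X Z W\<close> is \<open>W\<close> read as a map from the edges \<open>X\<close> to the vertices \<open>K\<close> and the edges \<open>Z\<close>,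
  and \<open>wadj K X Z W\<close> is its adjoint.\<close>

definition wop :: "'v set \<Rightarrow> 'e set \<Rightarrow> 'e set \<Rightarrow> (('v \<Rightarrow> 'p) \<Rightarrow> ('e \<Rightarrow> 'b) \<Rightarrow> complex) \<Rightarrow>
    ('v, 'p, 'e, 'b) state \<Rightarrow> ('v, 'p, 'e, 'b) state" where
  "wop K X Z W = gop {} X (\<lambda>k x j y. W (restrict k K) (override_on (restrict x (X \<union> Z)) y X))"

definition wadj :: "'v set \<Rightarrow> 'e set \<Rightarrow> 'e set \<Rightarrow> (('v \<Rightarrow> 'p) \<Rightarrow> ('e \<Rightarrow> 'b) \<Rightarrow> complex) \<Rightarrow>
    ('v, 'p, 'e, 'b) state \<Rightarrow> ('v, 'p, 'e, 'b) state" where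
  "wadj K X Z W = gop K Z (\<lambda>k x j y. cnj (W j (override_on (restrict x (X \<union> Z)) y Z)))"

definition eop :: "'e set \<Rightarrow> (('e \<Rightarrow> 'b) \<Rightarrow> ('e \<Rightarrow> 'b) \<Rightarrow> complex) \<Rightarrow>
    ('v, 'p, 'e, 'b) state \<Rightarrow> ('v, 'p, 'e, 'b) state" where
  "eop X M = gop {} X (\<lambda>k x j y. M (restrict x X) y)"

definition pop :: "'v set \<Rightarrow> (('v \<Rightarrow> 'p) \<Rightarrow> ('v \<Rightarrow> 'p) \<Rightarrow> complex) \<Rightarrow>
    ('v, 'p, 'e, 'b) state \<Rightarrow> ('v, 'p, 'e, 'b) state" where
  "pop K M = gop K {} (\<lambda>k x j y. M (restrict k K) j)"

lemma indep_wop_kernel: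
  "K' \<inter> K = {} \<Longrightarrow> X' \<inter> Z = {} \<Longrightarrow>
    indep K' X' (\<lambda>k x j y. W (restrict k K) (override_on (restrict x (X \<union> Z)) y X))"
  unfolding indep_def
  by (intro allI impI ext arg_cong2[of _ _ _ _ W]) (auto simp: override_on_def restrict_def fun_eq_iff)

lemma indep_wadj_kernel:
  "X' \<inter> X \<subseteq> Z \<Longrightarrow> indep K' X' (\<lambda>k x j y. cnj (W j (override_on (restrict x (X \<union> Z)) y Z)))"
  unfolding indep_def
  by (intro allI impI ext arg_cong[of _ _ cnj] arg_cong2[of _ _ _ _ W]) (auto simp: override_on_def restrict_def fun_eq_iff)

lemma indep_eop_kernel: "X' \<inter> X = {} \<Longrightarrow> indep K' X' (\<lambda>k x j y. M (restrict x X) y)"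
  unfolding indep_def
  by (intro allI impI ext arg_cong2[of _ _ _ _ M]) (auto simp: restrict_def fun_eq_iff)

lemma indep_wop:
  "K' \<inter> K = {} \<Longrightarrow> X' \<inter> Z = {} \<Longrightarrow> indep K' (X' - X) f \<Longrightarrow> indep K' X' (wop K X Z W f)"
  unfolding wop_def by (rule indep_gop[OF indep_wop_kernel]) auto

lemma indep_wadj:
  "X' \<inter> X \<subseteq> Z \<Longrightarrow> indep (K' - K) (X' - Z) f \<Longrightarrow> indep K' X' (wadj K X Z W f)"
  unfolding wadj_def by (rule indep_gop[OF indep_wadj_kernel]) auto

lemma indep_eop:
  "X' \<inter> X = {} \<Longrightarrow> indep K' X' f \<Longrightarrow> indep K' X' (eop X M f)"
  unfolding eop_def by (rule indep_gop[OF indep_eop_kernel]) (auto simp: Diff_triv)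

lemma wadj_wop_commute:
  assumes "X' \<inter> Z = {}" "K \<inter> K' = {}" "Z \<inter> Z' = {}" "X \<inter> X' = {}"
  shows "wadj K X Z W (wop K' X' Z' W' f) = wop K' X' Z' W' (wadj K X Z W f)"
  unfolding wadj_def wop_def
  by (rule gop_commute[OF _ _ indep_wadj_kernel indep_wop_kernel]) (use assms in auto)

lemma wadj_wadj_commute:
  assumes "K \<inter> K' = {}" "Z \<inter> Z' = {}" "X \<inter> Z' = {}" "X' \<inter> Z = {}"
  shows "wadj K X Z W (wadj K' X' Z' W' f) = wadj K' X' Z' W' (wadj K X Z W f)"
  unfolding wadj_def
  by (rule gop_commute[OF _ _ indep_wadj_kernel indep_wadj_kernel]) (use assms in auto)

lemma wop_eop_commute:
  assumes "X \<inter> S = {}" "Z \<inter> S = {}"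
  shows "wop K X Z W (eop S M f) = eop S M (wop K X Z W f)"
  unfolding eop_def wop_def
  by (rule gop_commute[OF _ _ indep_wop_kernel indep_eop_kernel]) (use assms in auto)

lemma wadj_eop_commute:
  assumes "X \<inter> S = {}" "Z \<inter> S = {}"
  shows "wadj K X Z W (eop S M f) = eop S M (wadj K X Z W f)"
  unfolding eop_def wadj_def
  by (rule gop_commute[OF _ _ indep_wadj_kernel indep_eop_kernel]) (use assms in auto)

lemma override_restrict_self: "y \<in> configs X \<Longrightarrow> override_on (restrict x X) y X = y"
  by (auto simp: override_on_def configs_iff fun_eq_iff)

lemma restrict_override_self: "y \<in> configs X \<Longrightarrow> restrict (override_on x y X) X = y"
  by (auto simp: override_on_def configs_iff fun_eq_iff)

lemma override_override_self: "override_on (override_on x y X) z X = override_on x z X"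
  by (auto simp: override_on_def)

lemma wop_apply:
  "wop K X {} V f k x = (\<Sum>y\<in>configs X. V (restrict k K) y * f k (override_on x y X))"
  by (simp add: wop_def gop_def override_restrict_self)

lemma wop_restrict_apply:
  "wop K X Z W f k x = (\<Sum>y\<in>configs X. W (restrict k K) (override_on (restrict x (X \<union> Z)) y X) * f k (override_on x y X))"
  by (simp add: wop_def gop_def)

lemma wadj_apply:
  "wadj K X {} V f k x = (\<Sum>j\<in>configs K. cnj (V j (restrict x X)) * f (override_on k j K) x)"
  by (simp add: wadj_def gop_def)

lemma eop_apply:
  "eop X M f k x = (\<Sum>y\<in>configs X. M (restrict x X) y * f k (override_on x y X))"
  by (simp add: eop_def gop_def)

lemma pop_apply:
  "pop K M f k x = (\<Sum>j\<in>configs K. M (restrict k K) j * f (override_on k j K) x)"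
  by (simp add: pop_def gop_def)

lemma eop_eop: "eop X M (eop X N f) = eop X (mmult (configs X) M N) f"
proof (intro ext)
  fix k x
  have "eop X M (eop X N f) k x = (\<Sum>y\<in>configs X. \<Sum>z\<in>configs X. M (restrict x X) y * N y z * f k (override_on x z X))"
    by (simp add: eop_apply restrict_override_self override_override_self sum_distrib_left mult.assoc)
  also have "\<dots> = eop X (mmult (configs X) M N) f k x"
    by (subst sum.swap) (simp add: eop_apply mmult_def sum_distrib_right)
  finally show "eop X M (eop X N f) k x = eop X (mmult (configs X) M N) f k x" .
qed

lemma eop_mone:
  assumes "finite X"
  shows "eop X (mone (configs X)) f = (f :: ('v, 'p, 'e, 'b::finite) state)"
proof (intro ext)
  fix k x
  have "eop X (mone (configs X)) f k x = f k (override_on x (restrict x X) X)"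
    using assms by (simp add: eop_apply sum_mone_left)
  also have "override_on x (restrict x X) X = x" by (auto simp: override_on_def)
  finally show "eop X (mone (configs X)) f k x = f k x" .
qed

lemma eop_tensor_ext:
  fixes f :: "('v, 'p, 'e, 'b::finite) state"
  assumes "finite F" "S \<subseteq> F"
  shows "eop F (tensor_ext S F M) f = eop S M f"
proof (intro ext)
  fix k x
  have "eop F (tensor_ext S F M) f k x = mapply (configs F) (tensor_ext S F M) (\<lambda>y. f k (override_on x y F)) (restrict x F)"
    by (simp add: eop_apply mapply_def)
  also have "\<dots> = (\<Sum>j\<in>configs S. M (restrict (restrict x F) S) j * f k (override_on x (override_on (restrict x F) j S) F))"
    using assms by (simp add: mapply_tensor_ext)
  also have "\<dots> = eop S M f k x"
    unfolding eop_apply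
  proof (intro sum.cong refl arg_cong2[of _ _ _ _ "(*)"] arg_cong2[of _ _ _ _ M] arg_cong[of _ _ "f k"])
    show "restrict (restrict x F) S = restrict x S" using assms by (auto simp: fun_eq_iff)
    show "override_on x (override_on (restrict x F) j S) F = override_on x j S" for j
      using assms by (auto simp: override_on_def fun_eq_iff)
  qed
  finally show "eop F (tensor_ext S F M) f k x = eop S M f k x" .
qed

text \<open>\<open>f\<close> must not yet have factors at \<open>K\<close>: then V creates them, the
  adjoint removes them again, and the boundary state on the edges is all that is left.\<close>

lemma wadj_wop_Gram:
  assumes "indep K {} f"
  shows "wadj K X {} V (wop K X {} V f) = eop X (mmult (configs K) (madjoint V) V) f"
proof (intro ext)
  fix k x
  have f: "f (override_on k j K) z = f k z" for j z
    by (rule indepD[OF assms]) auto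
  have "wadj K X {} V (wop K X {} V f) k x
      = (\<Sum>j\<in>configs K. \<Sum>y\<in>configs X. cnj (V j (restrict x X)) * V j y * f k (override_on x y X))"
    by (simp add: wadj_apply wop_apply restrict_override_self f sum_distrib_left mult.assoc)
  also have "\<dots> = eop X (mmult (configs K) (madjoint V) V) f k x"
    by (subst sum.swap) (simp add: eop_apply mmult_def madjoint_def sum_distrib_right)
  finally show "wadj K X {} V (wop K X {} V f) k x = eop X (mmult (configs K) (madjoint V) V) f k x" .
qed

text \<open>Read from right to left, the adjoint of V replaces the physical factors at
  \<open>K\<close> by edge factors at \<open>X\<close>, on which M acts, and V turns them back. For
  this \<open>f\<close> must have no factors at \<open>X\<close> of its own.\<close>

lemma pop_sandwich:
  assumes "indep {} X f"
  shows "pop K (mmult (configs X) V (mmult (configs X) M (madjoint V))) f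
     = wop K X {} V (eop X M (wadj K X {} V f))"
proof (intro ext)
  fix k x
  have f: "f j (override_on z y X) = f j z" for j y z
    by (rule indepD[OF assms]) auto
  have "wop K X {} V (eop X M (wadj K X {} V f)) k x
      = (\<Sum>y\<in>configs X. \<Sum>z\<in>configs X. \<Sum>j\<in>configs K. V (restrict k K) y * M y z * cnj (V j z) * f (override_on k j K) x)"
    by (simp add: wadj_apply wop_apply eop_apply restrict_override_self f sum_distrib_left mult.assoc)
  also have "\<dots> = (\<Sum>y\<in>configs X. \<Sum>j\<in>configs K. \<Sum>z\<in>configs X. V (restrict k K) y * M y z * cnj (V j z) * f (override_on k j K) x)"
    by (intro sum.cong refl sum.swap)
  also have "\<dots> = (\<Sum>j\<in>configs K. \<Sum>y\<in>configs X. \<Sum>z\<in>configs X. V (restrict k K) y * M y z * cnj (V j z) * f (override_on k j K) x)"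
    by (rule sum.swap)
  also have "\<dots> = pop K (mmult (configs X) V (mmult (configs X) M (madjoint V))) f k x"
    by (simp add: pop_apply mmult_def madjoint_def sum_distrib_left sum_distrib_right mult.assoc)
  finally show "pop K (mmult (configs X) V (mmult (configs X) M (madjoint V))) f k x
     = wop K X {} V (eop X M (wadj K X {} V f)) k x" ..
qed

text \<open>A physical vector as a state without edge factors. The embedding is injective on
  \<open>cvecs\<close>, so operator identities between physical vectors can be proved among
  states.\<close>

definition embed :: "'v set \<Rightarrow> (('v \<Rightarrow> 'p) \<Rightarrow> complex) \<Rightarrow> ('v, 'p, 'e, 'b) state" where
  "embed F \<psi> = (\<lambda>k x. \<psi> (restrict k F))"

lemma embed_eq_iff:
  assumes "\<psi> \<in> cvecs (configs F)" "\<phi> \<in> cvecs (configs F)"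
    and "embed F \<psi> = (embed F \<phi> :: ('v, 'p, 'e, 'b) state)"
  shows "\<psi> = \<phi>"
proof
  fix k
  show "\<psi> k = \<phi> k"
  proof (cases "k \<in> configs F")
    case True
    then show ?thesis using fun_cong[OF fun_cong[OF assms(3)], of k "undefined"]
      by (simp add: embed_def restrict_configs)
  qed (use assms in \<open>auto simp: cvecs_def\<close>)
qed

lemma indep_embed: "K \<inter> F = {} \<Longrightarrow> indep K X (embed F \<psi>)"
  unfolding indep_def embed_def
  by (intro allI impI arg_cong[of _ _ \<psi>]) (auto simp: fun_eq_iff restrict_def)

lemma embed_tensor_ext:
  fixes M :: "('v \<Rightarrow> 'p::finite) \<Rightarrow> ('v \<Rightarrow> 'p) \<Rightarrow> complex"
  assumes "finite F" "K \<subseteq> F"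
  shows "embed F (mapply (configs F) (tensor_ext K F M) \<psi>) = pop K M (embed F \<psi> :: ('v, 'p, 'e, 'b) state)"
proof (intro ext)
  fix k :: "'v \<Rightarrow> 'p" and x :: "'e \<Rightarrow> 'b"
  have "restrict (restrict k F) K = restrict k K" using assms by (auto simp: fun_eq_iff)
  moreover have "restrict (override_on k j K) F = override_on (restrict k F) j K" for j
    using assms by (auto simp: fun_eq_iff override_on_def)
  ultimately show "embed F (mapply (configs F) (tensor_ext K F M) \<psi>) k x = pop K M (embed F \<psi>) k x"
    using assms by (simp add: embed_def pop_apply mapply_tensor_ext)
qed

subsection \<open>Slices\<close>

text \<open>The component of \<psi> along the basis vector \<open>r\<close> of the factors outside
  \<open>S\<close>. Operators on \<open>S\<close> act slice by slice and squared norms add up, which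
  reduces estimates on a large region to estimates on \<open>S\<close>.\<close>

definition slice :: "'s set \<Rightarrow> (('s \<Rightarrow> 'q) \<Rightarrow> complex) \<Rightarrow> ('s \<Rightarrow> 'q) \<Rightarrow> ('s \<Rightarrow> 'q) \<Rightarrow> complex" where
  "slice S \<psi> r = (\<lambda>j. if j \<in> configs S then \<psi> (override_on r j S) else 0)"

lemma slice_in_cvecs [simp]: "slice S \<psi> r \<in> cvecs (configs S)"
  by (simp add: slice_def cvecs_def)

lemma slice_diff: "slice S (\<psi> - \<phi>) r = slice S \<psi> r - slice S \<phi> r"
  by (auto simp: slice_def)

lemma cnorm_slices:
  assumes "S \<subseteq> F"
  shows "(cnorm (configs F) \<psi>)\<^sup>2 = (\<Sum>r\<in>configs (F - S). (cnorm (configs S) (slice S \<psi> r))\<^sup>2)"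
  unfolding cnorm_square sum_configs_split[OF assms] by (simp add: slice_def)

lemma slice_tensor_ext:
  fixes M :: "('s \<Rightarrow> 'q::finite) \<Rightarrow> ('s \<Rightarrow> 'q) \<Rightarrow> complex"
  assumes fin: "finite F" and sub: "S \<subseteq> L" "L \<subseteq> F" and r: "r \<in> configs (F - L)"
  shows "slice L (mapply (configs F) (tensor_ext S F M) \<psi>) r
    = mapply (configs L) (tensor_ext S L M) (slice L \<psi> r)"
proof
  fix j
  have finL: "finite L" using fin sub finite_subset by blast
  show "slice L (mapply (configs F) (tensor_ext S F M) \<psi>) r j
      = mapply (configs L) (tensor_ext S L M) (slice L \<psi> r) j"
  proof (cases "j \<in> configs L")
    case True
    have m: "override_on r j L \<in> configs F"
      using r True sub by (auto simp: configs_iff override_on_def)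
    have e1: "restrict (override_on r j L) S = restrict j S"
      using sub by (auto simp: fun_eq_iff override_on_def)
    have e2: "override_on (override_on r j L) i S = override_on r (override_on j i S) L" for i
      using sub by (auto simp: fun_eq_iff override_on_def)
    have e3: "override_on j i S \<in> configs L" for i
      using sub True by (auto simp: configs_iff override_on_def)
    show ?thesis
      using True m sub fin finL
      by (simp add: slice_def mapply_tensor_ext e1 e2 e3)
  next
    case False
    then show ?thesis using mapply_in_cvecs[OF tensor_ext_in_cmats, of L S M "slice L \<psi> r"]
      by (simp add: slice_def cvecs_def)
  qed
qed

lemma tensor_ext_self: "M \<in> cmats (configs S) (configs S) \<Longrightarrow> tensor_ext S S M = M"
  by (auto simp: tensor_ext_def cmats_def restrict_configs fun_eq_iff)

lemma slice_tensor_ext_self: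
  fixes M :: "('s \<Rightarrow> 'q::finite) \<Rightarrow> ('s \<Rightarrow> 'q) \<Rightarrow> complex"
  assumes "finite F" "S \<subseteq> F" "r \<in> configs (F - S)" "M \<in> cmats (configs S) (configs S)"
  shows "slice S (mapply (configs F) (tensor_ext S F M) \<psi>) r = mapply (configs S) M (slice S \<psi> r)"
  using slice_tensor_ext[OF assms(1) _ assms(2,3), of S M] assms(4) by (simp add: tensor_ext_self)

text \<open>Tensoring with an identity does not worsen an operator bound: the squared bounds for the
  slices add up.\<close>

lemma cnorm_tensor_ext_le:
  fixes M N :: "('s \<Rightarrow> 'q::finite) \<Rightarrow> ('s \<Rightarrow> 'q) \<Rightarrow> complex"
  assumes fin: "finite F" "S \<subseteq> F" and MN: "M \<in> cmats (configs S) (configs S)" "N \<in> cmats (configs S) (configs S)"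
    and r: "0 \<le> r" "\<And>x. cnorm (configs S) (mapply (configs S) M x - mapply (configs S) N x) \<le> r * cnorm (configs S) x"
  shows "cnorm (configs F) (mapply (configs F) (tensor_ext S F M) \<psi> - mapply (configs F) (tensor_ext S F N) \<psi>)
    \<le> r * cnorm (configs F) \<psi>"
proof (rule power2_le_imp_le)
  have "(cnorm (configs F) (mapply (configs F) (tensor_ext S F M) \<psi> - mapply (configs F) (tensor_ext S F N) \<psi>))\<^sup>2
     = (\<Sum>s\<in>configs (F - S). (cnorm (configs S) (mapply (configs S) M (slice S \<psi> s) - mapply (configs S) N (slice S \<psi> s)))\<^sup>2)"
    unfolding cnorm_slices[OF fin(2)] slice_diff using fin MN
    by (simp add: slice_tensor_ext_self)
  also have "\<dots> \<le> (\<Sum>s\<in>configs (F - S). (r * cnorm (configs S) (slice S \<psi> s))\<^sup>2)"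
    by (rule sum_mono) (rule power_mono[OF r(2)], simp)
  also have "\<dots> = (r * cnorm (configs F) \<psi>)\<^sup>2"
    unfolding power_mult_distrib cnorm_slices[OF fin(2)] by (simp add: sum_distrib_left)
  finally show "(cnorm (configs F) (mapply (configs F) (tensor_ext S F M) \<psi> - mapply (configs F) (tensor_ext S F N) \<psi>))\<^sup>2 \<le> (r * cnorm (configs F) \<psi>)\<^sup>2" .
qed (use r in simp)

lemma madjoint_tensor_ext: "madjoint M = M \<Longrightarrow> madjoint (tensor_ext S F M) = tensor_ext S F M"
proof (intro ext)
  fix x y
  assume "madjoint M = M"
  then have "cnj (M i j) = M j i" for i j by (auto simp: madjoint_def fun_eq_iff)
  then show "madjoint (tensor_ext S F M) x y = tensor_ext S F M x y"
    by (auto simp: madjoint_def tensor_ext_def)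
qed

lemma is_orthoproj_tensor_ext:
  fixes P :: "('s \<Rightarrow> 'q::finite) \<Rightarrow> ('s \<Rightarrow> 'q) \<Rightarrow> complex"
  assumes "finite F" "S \<subseteq> F" "is_orthoproj (configs S) W P"
  shows "is_orthoproj (configs F) (mapply (configs F) (tensor_ext S F P) ` cvecs (configs F)) (tensor_ext S F P)"
  using assms by (simp add: is_orthoproj_def tensor_ext_mmult madjoint_tensor_ext)

section \<open>From approximate factorization to almost commuting projections\<close>

subsection \<open>Projections and approximate inverses of the boundary state\<close>

text \<open>With V = U \<rho>^{1/2} the projection is U U^*, while V \<sigma> V^* = U (\<rho>^{1/2}
  \<sigma> \<rho>^{1/2}) U^* and V \<rho>^{-1} \<sigma> \<rho>^{-1} V^* = U (\<rho>^{-1/2} \<sigma>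
  \<rho>^{-1/2}) U^*. So both kinds of closeness to 1 in the definition of approximate factorization
  become closeness to the projection. In the first of the two estimates \<sigma> will be the inverse
  of the factorized operator.\<close>

lemma orthoproj_Gram:
  assumes fin: "finite I" "finite J" and V: "V \<in> cmats I J" and inj: "inj_on (mapply J V) (cvecs J)"
  defines "\<rho> \<equiv> mmult I (madjoint V) V" and "P \<equiv> orthoproj I (mapply J V ` cvecs J)"
  shows "is_minv J \<rho> (minv J \<rho>)"
    and "P = mmult J V (mmult J (minv J \<rho>) (madjoint V))"
    and "is_orthoproj I (mapply J V ` cvecs J) P"
    and "\<And>\<sigma> \<epsilon> x. mopnorm J (mminus (mmult J (mmult J (msqrt J \<rho>) \<sigma>) (msqrt J \<rho>)) (mone J)) \<le> \<epsilon> \<Longrightarrow>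
      cnorm I (mapply I (mmult J V (mmult J \<sigma> (madjoint V))) x - mapply I P x) \<le> \<epsilon> * cnorm I x"
    and "\<And>\<sigma> \<epsilon> x. mopnorm J (mminus (mmult J (mmult J (minv J (msqrt J \<rho>)) \<sigma>) (minv J (msqrt J \<rho>))) (mone J)) \<le> \<epsilon> \<Longrightarrow>
      cnorm I (mapply I (mmult J V (mmult J (mmult J (minv J \<rho>) (mmult J \<sigma> (minv J \<rho>))) (madjoint V))) x - mapply I P x) \<le> \<epsilon> * cnorm I x"
proof -
  note [simp] = fin
  define R where "R = msqrt J \<rho>"
  define N where "N = minv J R"
  obtain U where U: "U \<in> cmats I J" "mmult I (madjoint U) U = mone J"
    "mapply J U ` cvecs J = mapply J V ` cvecs J"
    and VU: "V = mmult J U R" and UV: "U = mmult J V N"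
    and R: "R \<in> cmats J J" "madjoint R = R" and N: "is_minv J R N" "madjoint N = N"
    and RR: "mmult J R R = \<rho>"
    using polar_decomposition[OF fin V inj] unfolding R_def N_def \<rho>_def by blast
  have N1: "N \<in> cmats J J" "mmult J R N = mone J" "mmult J N R = mone J" using N by (auto simp: is_minv_def)
  have Ua: "madjoint U \<in> cmats J I" using U(1) by (rule madjoint_in_cmats)
  have \<rho>: "\<rho> \<in> cmats J J" using R RR mmult_in_cmats by metis
  have "mmult J \<rho> (mmult J N N) = mmult J R (mmult J (mmult J R N) N)"
      "mmult J (mmult J N N) \<rho> = mmult J N (mmult J (mmult J N R) R)"
    unfolding RR[symmetric] by (simp_all add: mmult_assoc)
  then have inv: "is_minv J \<rho> (mmult J N N)"
    using N1 R by (simp add: is_minv_def mmult_in_cmats mmult_mone_left[of J _ J])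
  then have mi: "minv J \<rho> = mmult J N N" using \<rho> by (simp add: minv_eq)
  with inv show "is_minv J \<rho> (minv J \<rho>)" by simp
  have Vadj: "madjoint V = mmult J R (madjoint U)" using VU R by (metis madjoint_mmult)
  have iso: "is_orthoproj I (mapply J V ` cvecs J) (mmult J U (madjoint U))"
    using isometry_bounds(3)[OF fin U(2,1)] U(3) by simp
  then have P: "P = mmult J U (madjoint U)" unfolding P_def by (simp add: orthoproj_eq)
  with iso show "is_orthoproj I (mapply J V ` cvecs J) P" by simp
  have VNN: "mmult J V (mmult J N N) = mmult J U N" by (simp add: UV mmult_assoc)
  have NNV: "mmult J (mmult J N N) (madjoint V) = mmult J N (madjoint U)"
  proof -
    have "mmult J (mmult J N N) (madjoint V) = mmult J N (mmult J (mmult J N R) (madjoint U))"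
      unfolding Vadj by (simp add: mmult_assoc)
    then show ?thesis using N1 Ua by (simp add: mmult_mone_left[of J _ I])
  qed
  have "mmult J V (mmult J N (madjoint U)) = P" unfolding P by (simp add: UV mmult_assoc)
  then show "P = mmult J V (mmult J (minv J \<rho>) (madjoint V))" unfolding mi NNV ..
  have est: "cnorm I (mapply I (mmult J U (mmult J M (madjoint U))) x - mapply I P x) \<le> \<epsilon> * cnorm I x"
    if M: "mopnorm J (mminus M (mone J)) \<le> \<epsilon>" for M \<epsilon> x
  proof -
    let ?y = "mapply I (madjoint U) x"
    have y: "?y \<in> cvecs J" by (rule mapply_in_cvecs[OF Ua])
    have b: "cnorm J (mapply J (mminus M (mone J)) z) \<le> \<epsilon> * cnorm J z" for z
      by (rule mopnorm_bound(1)[OF fin(2) M])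
    have "mapply I (mmult J U (mmult J M (madjoint U))) x - mapply I P x = mapply J U (mapply J (mminus M (mone J)) ?y)"
      using y by (simp add: P mapply_mmult mapply_mminus mapply_mone mapply_diff)
    then have "cnorm I (mapply I (mmult J U (mmult J M (madjoint U))) x - mapply I P x) \<le> \<epsilon> * cnorm J ?y"
      using b by (simp only: isometry_bounds(1)[OF fin U(2,1)])
    also have "\<epsilon> * cnorm J ?y \<le> \<epsilon> * cnorm I x"
      using isometry_bounds(2)[OF fin U(2,1), of x] mopnorm_bound(2)[OF fin(2) M] by (rule mult_left_mono)
    finally show ?thesis .
  qed
  show "cnorm I (mapply I (mmult J V (mmult J \<sigma> (madjoint V))) x - mapply I P x) \<le> \<epsilon> * cnorm I x"
    if "mopnorm J (mminus (mmult J (mmult J (msqrt J \<rho>) \<sigma>) (msqrt J \<rho>)) (mone J)) \<le> \<epsilon>" for \<sigma> \<epsilon> x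
  proof -
    have "mmult J V (mmult J \<sigma> (madjoint V)) = mmult J U (mmult J (mmult J (mmult J R \<sigma>) R) (madjoint U))"
      unfolding Vadj by (simp add: VU mmult_assoc)
    with est that show ?thesis unfolding R_def by simp
  qed
  show "cnorm I (mapply I (mmult J V (mmult J (mmult J (minv J \<rho>) (mmult J \<sigma> (minv J \<rho>))) (madjoint V))) x - mapply I P x) \<le> \<epsilon> * cnorm I x"
    if "mopnorm J (mminus (mmult J (mmult J (minv J (msqrt J \<rho>)) \<sigma>) (minv J (msqrt J \<rho>))) (mone J)) \<le> \<epsilon>" for \<sigma> \<epsilon> x
  proof -
    have "mmult J V (mmult J (mmult J (minv J \<rho>) (mmult J \<sigma> (minv J \<rho>))) (madjoint V))
      = mmult J (mmult J V (minv J \<rho>)) (mmult J \<sigma> (mmult J (minv J \<rho>) (madjoint V)))"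
      by (simp add: mmult_assoc)
    also have "\<dots> = mmult J U (mmult J (mmult J (mmult J N \<sigma>) N) (madjoint U))"
      unfolding mi VNN NNV by (simp add: mmult_assoc)
    finally show ?thesis using est that unfolding R_def N_def by simp
  qed
qed

subsection \<open>Gluing regions\<close>

text \<open>\<open>WZ\<close> uses up the boundary \<open>bz\<close> of \<open>Z\<close> and
  produces the physical factors of \<open>Z\<close> together with the edges \<open>m\<close>, which
  \<open>VY\<close> then uses up. The edges \<open>m\<close> must be absent from \<open>f\<close>,
  because they are created and destroyed on the way.\<close>

lemma wop_glue:
  fixes f :: "('v, 'p, 'e, 'b) state"
  assumes disj: "Y \<inter> Z = {}" "by \<inter> bz = {}" "by \<inter> m = {}" "bz \<inter> m = {}"
    and V: "\<And>k u. k \<in> configs (Y \<union> Z) \<Longrightarrow> u \<in> configs (by \<union> bz) \<Longrightarrow>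
      V k u = (\<Sum>w\<in>configs m. WZ (restrict k Z) (override_on (restrict u bz) w m) * VY (restrict k Y) (override_on (restrict u by) w m))"
    and f: "indep {} m f"
  shows "wop (Y \<union> Z) (by \<union> bz) {} V f = wop Y (by \<union> m) {} VY (wop Z bz m WZ f)"
proof (intro ext)
  fix k :: "'v \<Rightarrow> 'p" and x :: "'e \<Rightarrow> 'b"
  let ?t = "\<lambda>a y w. WZ (restrict k Z) (override_on y w m) * VY (restrict k Y) (override_on a w m)
      * f k (override_on x (override_on a y bz) (by \<union> bz))"
  have "wop (Y \<union> Z) (by \<union> bz) {} V f k x
      = (\<Sum>a\<in>configs by. \<Sum>y\<in>configs bz. \<Sum>w\<in>configs m. ?t a y w)"
    unfolding wop_apply sum_configs_Un[OF disj(2)]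
  proof (intro sum.cong refl)
    fix a y :: "'e \<Rightarrow> 'b" assume ay: "a \<in> configs by" "y \<in> configs bz"
    have u: "override_on a y bz \<in> configs (by \<union> bz)" using ay by (auto simp: configs_iff override_on_def)
    have r: "restrict (override_on a y bz) bz = y" "restrict (override_on a y bz) by = a"
      using ay disj by (auto simp: configs_iff override_on_def fun_eq_iff)
    have k: "restrict (restrict k (Y \<union> Z)) Z = restrict k Z" "restrict (restrict k (Y \<union> Z)) Y = restrict k Y"
      by (auto simp: fun_eq_iff)
    show "V (restrict k (Y \<union> Z)) (override_on a y bz) * f k (override_on x (override_on a y bz) (by \<union> bz))
      = (\<Sum>w\<in>configs m. ?t a y w)"
      by (subst V[OF restrict_in_configs u]) (simp add: r k sum_distrib_right)
  qed
  also have "\<dots> = (\<Sum>a\<in>configs by. \<Sum>w\<in>configs m. \<Sum>y\<in>configs bz. ?t a y w)"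
    by (intro sum.cong refl sum.swap)
  also have "\<dots> = (\<Sum>a\<in>configs by. \<Sum>w\<in>configs m. VY (restrict k Y) (override_on a w m)
      * wop Z bz m WZ f k (override_on x (override_on a w m) (by \<union> m)))"
    unfolding wop_restrict_apply sum_distrib_left
  proof (intro sum.cong refl)
    fix a w y :: "'e \<Rightarrow> 'b" assume aw: "a \<in> configs by" "w \<in> configs m" "y \<in> configs bz"
    have "override_on (restrict (override_on x (override_on a w m) (by \<union> m)) (bz \<union> m)) y bz = override_on y w m"
      using aw disj by (auto simp: configs_iff override_on_def fun_eq_iff)
    moreover have "f k (override_on (override_on x (override_on a w m) (by \<union> m)) y bz)
       = f k (override_on x (override_on a y bz) (by \<union> bz))"
      by (rule indepD[OF f]) (use disj in \<open>auto simp: override_on_def\<close>)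
    ultimately show "?t a y w = VY (restrict k Y) (override_on a w m) *
          (WZ (restrict k Z) (override_on (restrict (override_on x (override_on a w m) (by \<union> m)) (bz \<union> m)) y bz)
          * f k (override_on (override_on x (override_on a w m) (by \<union> m)) y bz))"
      by simp
  qed
  also have "\<dots> = wop Y (by \<union> m) {} VY (wop Z bz m WZ f) k x"
    by (simp only: wop_apply[of Y] sum_configs_Un[OF disj(3)])
  finally show "wop (Y \<union> Z) (by \<union> bz) {} V f k x = wop Y (by \<union> m) {} VY (wop Z bz m WZ f) k x" .
qed

text \<open>The adjoints act in the opposite order: that of \<open>VY\<close> creates the edges
  \<open>m\<close> and that of \<open>WZ\<close> removes them.\<close>

lemma wadj_glue:
  fixes f :: "('v, 'p, 'e, 'b) state"
  assumes disj: "Y \<inter> Z = {}" "by \<inter> bz = {}" "by \<inter> m = {}" "bz \<inter> m = {}"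
    and V: "\<And>k u. k \<in> configs (Y \<union> Z) \<Longrightarrow> u \<in> configs (by \<union> bz) \<Longrightarrow>
      V k u = (\<Sum>w\<in>configs m. WZ (restrict k Z) (override_on (restrict u bz) w m) * VY (restrict k Y) (override_on (restrict u by) w m))"
    and f: "indep {} m f"
  shows "wadj (Y \<union> Z) (by \<union> bz) {} V f = wadj Z bz m WZ (wadj Y (by \<union> m) {} VY f)"
proof (intro ext)
  fix k :: "'v \<Rightarrow> 'p" and x :: "'e \<Rightarrow> 'b"
  let ?t = "\<lambda>a z w. cnj (WZ z (override_on (restrict x bz) w m)) * cnj (VY a (override_on (restrict x by) w m))
      * f (override_on k (override_on a z Z) (Y \<union> Z)) x"
  have "wadj (Y \<union> Z) (by \<union> bz) {} V f k x
      = (\<Sum>a\<in>configs Y. \<Sum>z\<in>configs Z. \<Sum>w\<in>configs m. ?t a z w)"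
    unfolding wadj_apply sum_configs_Un[OF disj(1)]
  proof (intro sum.cong refl)
    fix a z :: "'v \<Rightarrow> 'p" assume ay: "a \<in> configs Y" "z \<in> configs Z"
    have u: "override_on a z Z \<in> configs (Y \<union> Z)" using ay by (auto simp: configs_iff override_on_def)
    have r: "restrict (override_on a z Z) Z = z" "restrict (override_on a z Z) Y = a"
      using ay disj by (auto simp: configs_iff override_on_def fun_eq_iff)
    have k: "restrict (restrict x (by \<union> bz)) bz = restrict x bz" "restrict (restrict x (by \<union> bz)) by = restrict x by"
      by (auto simp: fun_eq_iff)
    show "cnj (V (override_on a z Z) (restrict x (by \<union> bz))) * f (override_on k (override_on a z Z) (Y \<union> Z)) x
      = (\<Sum>w\<in>configs m. ?t a z w)"
      by (subst V[OF u restrict_in_configs]) (simp add: r k sum_distrib_right)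
  qed
  also have "\<dots> = (\<Sum>z\<in>configs Z. \<Sum>a\<in>configs Y. \<Sum>w\<in>configs m. ?t a z w)"
    by (rule sum.swap)
  also have "\<dots> = (\<Sum>z\<in>configs Z. \<Sum>w\<in>configs m. \<Sum>a\<in>configs Y. ?t a z w)"
    by (intro sum.cong refl sum.swap)
  also have "\<dots> = (\<Sum>z\<in>configs Z. \<Sum>w\<in>configs m. cnj (WZ z (override_on (restrict x (bz \<union> m)) w m))
      * wadj Y (by \<union> m) {} VY f (override_on k z Z) (override_on x w m))"
    unfolding wadj_apply sum_distrib_left
  proof (intro sum.cong refl)
    fix a z :: "'v \<Rightarrow> 'p" and w :: "'e \<Rightarrow> 'b" assume aw: "z \<in> configs Z" "w \<in> configs m" "a \<in> configs Y"
    have "override_on (restrict x (bz \<union> m)) w m = override_on (restrict x bz) w m"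
        "restrict (override_on x w m) (by \<union> m) = override_on (restrict x by) w m"
      using aw disj by (auto simp: configs_iff override_on_def fun_eq_iff)
    moreover have "f (override_on (override_on k z Z) a Y) (override_on x w m)
       = f (override_on k (override_on a z Z) (Y \<union> Z)) x"
      by (rule indepD[OF f]) (use disj in \<open>auto simp: override_on_def\<close>)
    ultimately show "?t a z w = cnj (WZ z (override_on (restrict x (bz \<union> m)) w m)) *
         (cnj (VY a (restrict (override_on x w m) (by \<union> m))) * f (override_on (override_on k z Z) a Y) (override_on x w m))"
      by simp
  qed
  also have "\<dots> = wadj Z bz m WZ (wadj Y (by \<union> m) {} VY f) k x"
    by (simp only: wadj_def[of Z] gop_def)
  finally show "wadj (Y \<union> Z) (by \<union> bz) {} V f k x = wadj Z bz m WZ (wadj Y (by \<union> m) {} VY f) k x" .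
qed

subsection \<open>The martingale condition\<close>

lemma indep_mono: "indep K X f \<Longrightarrow> K' \<subseteq> K \<Longrightarrow> X' \<subseteq> X \<Longrightarrow> indep K' X' f"
  unfolding indep_def by blast

text \<open>The boundaries are cut into pieces that are pairwise disjoint: \<open>xe\<close> joins A
  to B, \<open>yc\<close> joins B to C, \<open>al\<close> and \<open>ga\<close> lead from A and from
  C out of ABC, and \<open>bl\<close>, \<open>z\<close>, \<open>br\<close> lead out from B. The sets
  a, d, c, b of the factorization are \<open>al\<close> or \<open>xe\<close> with \<open>bl\<close>,
  and \<open>yc\<close> or \<open>ga\<close> with \<open>br\<close>. \<open>WA\<close> and
  \<open>WC\<close> stand for the maps of A and C up to the normalisation of the glued edges, and
  the same \<open>WC\<close> extends both B and AB.\<close>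

locale glued_triple =
  fixes A B C :: "'v set" and al xe bl z br yc ga :: "'e set"
    and VB VAB VBC VABC WA WC :: "('v \<Rightarrow> 'p::finite) \<Rightarrow> ('e \<Rightarrow> 'b::finite) \<Rightarrow> complex"
    and dB dAB dBC dABC :: "'e set"
  assumes fin: "finite A" "finite B" "finite C" "finite al" "finite xe" "finite bl" "finite z"
      "finite br" "finite yc" "finite ga"
    and disjV: "A \<inter> B = {}" "B \<inter> C = {}" "A \<inter> C = {}"
    and disjE: "al \<inter> xe = {}" "al \<inter> bl = {}" "al \<inter> z = {}" "al \<inter> br = {}" "al \<inter> yc = {}" "al \<inter> ga = {}"
      "xe \<inter> bl = {}" "xe \<inter> z = {}" "xe \<inter> br = {}" "xe \<inter> yc = {}" "xe \<inter> ga = {}"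
      "bl \<inter> z = {}" "bl \<inter> br = {}" "bl \<inter> yc = {}" "bl \<inter> ga = {}"
      "z \<inter> br = {}" "z \<inter> yc = {}" "z \<inter> ga = {}" "br \<inter> yc = {}" "br \<inter> ga = {}" "yc \<inter> ga = {}"
    and dB: "dB = xe \<union> bl \<union> z \<union> br \<union> yc"
    and dAB: "dAB = al \<union> bl \<union> z \<union> br \<union> yc"
    and dBC: "dBC = xe \<union> bl \<union> z \<union> br \<union> ga"
    and dABC: "dABC = al \<union> bl \<union> z \<union> br \<union> ga"
    and VB: "VB \<in> cmats (configs B) (configs dB)" "inj_on (mapply (configs dB) VB) (cvecs (configs dB))"
    and VAB: "VAB \<in> cmats (configs (A \<union> B)) (configs dAB)" "inj_on (mapply (configs dAB) VAB) (cvecs (configs dAB))"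
    and VBC: "VBC \<in> cmats (configs (B \<union> C)) (configs dBC)" "inj_on (mapply (configs dBC) VBC) (cvecs (configs dBC))"
    and VABC: "VABC \<in> cmats (configs (A \<union> B \<union> C)) (configs dABC)" "inj_on (mapply (configs dABC) VABC) (cvecs (configs dABC))"
    and glueAB: "\<And>k u. k \<in> configs (A \<union> B) \<Longrightarrow> u \<in> configs dAB \<Longrightarrow> VAB k u =
      (\<Sum>w\<in>configs xe. WA (restrict k A) (override_on (restrict u al) w xe) *
         VB (restrict k B) (override_on (restrict u (bl \<union> z \<union> br \<union> yc)) w xe))"
    and glueBC: "\<And>k u. k \<in> configs (B \<union> C) \<Longrightarrow> u \<in> configs dBC \<Longrightarrow> VBC k u =
      (\<Sum>w\<in>configs yc. WC (restrict k C) (override_on (restrict u ga) w yc) *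
         VB (restrict k B) (override_on (restrict u (xe \<union> bl \<union> z \<union> br)) w yc))"
    and glueABC: "\<And>k u. k \<in> configs (A \<union> B \<union> C) \<Longrightarrow> u \<in> configs dABC \<Longrightarrow> VABC k u =
      (\<Sum>w\<in>configs yc. WC (restrict k C) (override_on (restrict u ga) w yc) *
         VAB (restrict k (A \<union> B)) (override_on (restrict u (al \<union> bl \<union> z \<union> br)) w yc))"
begin

lemmas disj = disjV disjE disjV[THEN trans[OF Int_commute]] disjE[THEN trans[OF Int_commute]]

lemmas set_simps = disj Int_Un_distrib Int_Un_distrib2 Un_Diff Diff_triv

lemma finite_d: "finite dB" "finite dAB" "finite dBC" "finite dABC"
  using fin by (simp_all add: dB dAB dBC dABC)

abbreviation "oA \<equiv> wop A al xe WA"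
abbreviation "oA' \<equiv> wadj A al xe WA"
abbreviation "oC \<equiv> wop C ga yc WC"
abbreviation "oC' \<equiv> wadj C ga yc WC"
abbreviation "oB \<equiv> wop B dB {} VB"
abbreviation "oB' \<equiv> wadj B dB {} VB"

lemma wop_AB: "indep {} xe f \<Longrightarrow> wop (A \<union> B) dAB {} VAB f = oB (oA f)"
  and wadj_AB: "indep {} xe f \<Longrightarrow> wadj (A \<union> B) dAB {} VAB f = oA' (oB' f)"
proof -
  have s: "B \<union> A = A \<union> B" "bl \<union> z \<union> br \<union> yc \<union> al = dAB" "bl \<union> z \<union> br \<union> yc \<union> xe = dB"
    by (auto simp: dAB dB)
  note g = wop_glue[of B A "bl \<union> z \<union> br \<union> yc" al xe VAB WA VB, unfolded s]
    wadj_glue[of B A "bl \<union> z \<union> br \<union> yc" al xe VAB WA VB, unfolded s]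
  show "indep {} xe f \<Longrightarrow> wop (A \<union> B) dAB {} VAB f = oB (oA f)"
    by (rule g) (simp_all add: set_simps glueAB)
  show "indep {} xe f \<Longrightarrow> wadj (A \<union> B) dAB {} VAB f = oA' (oB' f)"
    by (rule g) (simp_all add: set_simps glueAB)
qed

lemma wop_BC: "indep {} yc f \<Longrightarrow> wop (B \<union> C) dBC {} VBC f = oB (oC f)"
  and wadj_BC: "indep {} yc f \<Longrightarrow> wadj (B \<union> C) dBC {} VBC f = oC' (oB' f)"
proof -
  have s: "xe \<union> bl \<union> z \<union> br \<union> ga = dBC" "xe \<union> bl \<union> z \<union> br \<union> yc = dB"
    by (auto simp: dBC dB)
  note g = wop_glue[of B C "xe \<union> bl \<union> z \<union> br" ga yc VBC WC VB, unfolded s]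
    wadj_glue[of B C "xe \<union> bl \<union> z \<union> br" ga yc VBC WC VB, unfolded s]
  show "indep {} yc f \<Longrightarrow> wop (B \<union> C) dBC {} VBC f = oB (oC f)"
    by (rule g) (simp_all add: set_simps glueBC)
  show "indep {} yc f \<Longrightarrow> wadj (B \<union> C) dBC {} VBC f = oC' (oB' f)"
    by (rule g) (simp_all add: set_simps glueBC)
qed

lemma wop_ABC': "indep {} yc f \<Longrightarrow> wop (A \<union> B \<union> C) dABC {} VABC f = wop (A \<union> B) dAB {} VAB (oC f)"
  and wadj_ABC': "indep {} yc f \<Longrightarrow> wadj (A \<union> B \<union> C) dABC {} VABC f = oC' (wadj (A \<union> B) dAB {} VAB f)"
proof -
  have s: "al \<union> bl \<union> z \<union> br \<union> ga = dABC" "al \<union> bl \<union> z \<union> br \<union> yc = dAB"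
    by (auto simp: dABC dAB)
  note g = wop_glue[of "A \<union> B" C "al \<union> bl \<union> z \<union> br" ga yc VABC WC VAB, unfolded s]
    wadj_glue[of "A \<union> B" C "al \<union> bl \<union> z \<union> br" ga yc VABC WC VAB, unfolded s]
  show "indep {} yc f \<Longrightarrow> wop (A \<union> B \<union> C) dABC {} VABC f = wop (A \<union> B) dAB {} VAB (oC f)"
    by (rule g) (simp_all add: set_simps glueABC)
  show "indep {} yc f \<Longrightarrow> wadj (A \<union> B \<union> C) dABC {} VABC f = oC' (wadj (A \<union> B) dAB {} VAB f)"
    by (rule g) (simp_all add: set_simps glueABC)
qed

text \<open>Both copies of V_B^* V_B cancel an inverse of \<rho>_B, which exposes \<sigma>_B. The
  rest is a matter of sliding operators past contractions that use other edges until each \<Omega>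
  meets its inverse. \<open>NAB\<close>, \<open>NBC\<close>, \<open>NABC\<close> are the inverses of
  the factorized operators, multiplied out in reversed order.\<close>

lemma key_identity:
  fixes f :: "('v, 'p, 'e, 'b) state"
    and Dazi Dzbi Odz Odzi Ozc Ozci \<rho>i :: "('e \<Rightarrow> 'b) \<Rightarrow> ('e \<Rightarrow> 'b) \<Rightarrow> complex"
  assumes f: "indep {} UNIV f"
    and inv: "is_minv (configs (xe \<union> bl \<union> z)) Odz Odzi" "is_minv (configs (z \<union> yc \<union> br)) Ozc Ozci"
    and \<rho>i: "is_minv (configs dB) (mmult (configs B) (madjoint VB) VB) \<rho>i"
  defines "NAB \<equiv> mmult (configs dAB) (tensor_ext (al \<union> bl \<union> z) dAB Dazi) (tensor_ext (z \<union> yc \<union> br) dAB Ozci)"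
    and "NBC \<equiv> mmult (configs dBC) (tensor_ext (xe \<union> bl \<union> z) dBC Odzi) (tensor_ext (z \<union> ga \<union> br) dBC Dzbi)"
    and "NABC \<equiv> mmult (configs dABC) (tensor_ext (al \<union> bl \<union> z) dABC Dazi) (tensor_ext (z \<union> ga \<union> br) dABC Dzbi)"
    and "\<sigma>B \<equiv> mmult (configs dB) (tensor_ext (z \<union> yc \<union> br) dB Ozc) (tensor_ext (xe \<union> bl \<union> z) dB Odz)"
  shows "pop (A \<union> B) (mmult (configs dAB) VAB (mmult (configs dAB) NAB (madjoint VAB)))
      (pop B (mmult (configs dB) VB (mmult (configs dB) (mmult (configs dB) \<rho>i (mmult (configs dB) \<sigma>B \<rho>i)) (madjoint VB)))
        (pop (B \<union> C) (mmult (configs dBC) VBC (mmult (configs dBC) NBC (madjoint VBC))) f))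
    = pop (A \<union> B \<union> C) (mmult (configs dABC) VABC (mmult (configs dABC) NABC (madjoint VABC))) f"
proof -
  let ?D1 = "eop (al \<union> bl \<union> z) Dazi" and ?D2 = "eop (z \<union> ga \<union> br) Dzbi"
  let ?O1 = "eop (xe \<union> bl \<union> z) Odz" and ?O1i = "eop (xe \<union> bl \<union> z) Odzi"
  let ?O2 = "eop (z \<union> yc \<union> br) Ozc" and ?O2i = "eop (z \<union> yc \<union> br) Ozci"
  have subs: "al \<union> bl \<union> z \<subseteq> dAB" "z \<union> yc \<union> br \<subseteq> dAB" "xe \<union> bl \<union> z \<subseteq> dBC" "z \<union> ga \<union> br \<subseteq> dBC"
    "al \<union> bl \<union> z \<subseteq> dABC" "z \<union> ga \<union> br \<subseteq> dABC" "z \<union> yc \<union> br \<subseteq> dB" "xe \<union> bl \<union> z \<subseteq> dB"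
    by (auto simp: dAB dBC dABC dB)
  have eAB: "eop dAB NAB h = ?D1 (?O2i h)" and eBC: "eop dBC NBC h = ?O1i (?D2 h)"
    and eABC: "eop dABC NABC h = ?D1 (?D2 h)" and eB: "eop dB \<sigma>B h = ?O2 (?O1 h)" for h :: "('v, 'p, 'e, 'b) state"
    unfolding NAB_def NBC_def NABC_def \<sigma>B_def eop_eop[symmetric]
    using subs finite_d by (simp_all add: eop_tensor_ext)
  have O1i: "?O1 (?O1i h) = h" and O2i: "?O2i (?O2 h) = h" for h :: "('v, 'p, 'e, 'b) state"
    using inv fin by (simp_all add: eop_eop is_minv_def eop_mone)
  have \<rho>1: "eop dB \<rho>i (eop dB (mmult (configs B) (madjoint VB) VB) h) = h"
    and \<rho>2: "eop dB (mmult (configs B) (madjoint VB) VB) (eop dB \<rho>i h) = h" for h :: "('v, 'p, 'e, 'b) state"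
    using \<rho>i finite_d by (simp_all add: eop_eop is_minv_def eop_mone)
  note indep_intros = indep_wop indep_wadj indep_eop indep_mono[OF f]
  define g where "g = oC' (oB' f)"
  define h where "h = ?O1i (?D2 g)"
  have "pop (B \<union> C) (mmult (configs dBC) VBC (mmult (configs dBC) NBC (madjoint VBC))) f = wop (B \<union> C) dBC {} VBC (eop dBC NBC (wadj (B \<union> C) dBC {} VBC f))"
    by (rule pop_sandwich) (rule indep_mono[OF f], auto)
  also have "wadj (B \<union> C) dBC {} VBC f = g"
    unfolding g_def by (rule wadj_BC) (rule indep_mono[OF f], auto)
  also have "wop (B \<union> C) dBC {} VBC (eop dBC NBC g) = oB (oC h)"
    unfolding eBC h_def
    by (rule wop_BC) (unfold g_def, intro indep_intros; auto simp: set_simps Diff_Int_distrib2)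
  finally have 1: "pop (B \<union> C) (mmult (configs dBC) VBC (mmult (configs dBC) NBC (madjoint VBC))) f = oB (oC h)" .
  have "pop B (mmult (configs dB) VB (mmult (configs dB) (mmult (configs dB) \<rho>i (mmult (configs dB) \<sigma>B \<rho>i)) (madjoint VB))) (oB (oC h))
     = oB (eop dB (mmult (configs dB) \<rho>i (mmult (configs dB) \<sigma>B \<rho>i)) (oB' (oB (oC h))))"
    by (rule pop_sandwich) (unfold h_def g_def, intro indep_intros; auto simp: set_simps Diff_Int_distrib2 dB)
  also have "oB' (oB (oC h)) = eop dB (mmult (configs B) (madjoint VB) VB) (oC h)"
    by (rule wadj_wop_Gram) (unfold h_def g_def, intro indep_intros; auto simp: set_simps Diff_Int_distrib2 dB)
  also have "eop dB (mmult (configs dB) \<rho>i (mmult (configs dB) \<sigma>B \<rho>i)) \<dots> = eop dB \<rho>i (eop dB \<sigma>B (oC h))"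
    unfolding eop_eop[symmetric] \<rho>1 ..
  finally have 2: "pop B (mmult (configs dB) VB (mmult (configs dB) (mmult (configs dB) \<rho>i (mmult (configs dB) \<sigma>B \<rho>i)) (madjoint VB))) (oB (oC h))
    = oB (eop dB \<rho>i (eop dB \<sigma>B (oC h)))" .
  define t where "t = eop dB \<rho>i (eop dB \<sigma>B (oC h))"
  have "pop (A \<union> B) (mmult (configs dAB) VAB (mmult (configs dAB) NAB (madjoint VAB))) (oB t)
     = wop (A \<union> B) dAB {} VAB (eop dAB NAB (wadj (A \<union> B) dAB {} VAB (oB t)))"
    by (rule pop_sandwich) (unfold t_def eop_eop h_def g_def dAB, intro indep_intros; auto simp: set_simps Diff_Int_distrib2 dB)
  also have "wadj (A \<union> B) dAB {} VAB (oB t) = oA' (oB' (oB t))"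
    by (rule wadj_AB) (unfold t_def eop_eop h_def g_def, intro indep_intros; auto simp: set_simps Diff_Int_distrib2 dB)
  also have "oB' (oB t) = eop dB (mmult (configs B) (madjoint VB) VB) t"
    by (rule wadj_wop_Gram) (unfold t_def h_def g_def, intro indep_intros; auto simp: set_simps Diff_Int_distrib2 dB)
  also have "\<dots> = ?O2 (?O1 (oC h))"
    unfolding t_def \<rho>2 eB ..
  \<comment> \<open>\<Omega>_dz lives on \<open>xe\<close>, \<open>bl\<close>, \<open>z\<close>,
    while C is glued along \<open>yc\<close> and replaces it by \<open>ga\<close>. Moved past the
    contraction with C, \<Omega>_dz meets its inverse inside \<open>h\<close>.\<close>
  also have "?O1 (oC h) = oC (?O1 h)"
    by (rule wop_eop_commute[symmetric]) (simp_all add: set_simps)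
  also have "?O1 h = ?D2 g" unfolding h_def O1i ..
  \<comment> \<open>\<Omega>_zc lives on \<open>z\<close>, \<open>yc\<close>, \<open>br\<close>,
    away from \<open>al\<close> and \<open>xe\<close>, so it moves outwards to its inverse in
    \<open>NAB\<close>.\<close>
  also have "oA' (?O2 (oC (?D2 g))) = ?O2 (oA' (oC (?D2 g)))"
    by (rule wadj_eop_commute) (simp_all add: set_simps)
  also have "eop dAB NAB \<dots> = ?D1 (oA' (oC (?D2 g)))"
    unfolding eAB O2i ..
  \<comment> \<open>The contractions with A and C use disjoint sites. The adjoint for A travels
    inwards to complete the adjoint of V_ABC, and the contraction with C travels outwards to
    complete V_ABC.\<close>
  also have "oA' (oC (?D2 g)) = oC (oA' (?D2 g))"
    by (rule wadj_wop_commute) (simp_all add: set_simps)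
  also have "oA' (?D2 g) = ?D2 (oA' g)"
    by (rule wadj_eop_commute) (simp_all add: set_simps)
  also have "?D1 (oC (?D2 (oA' g))) = oC (?D1 (?D2 (oA' g)))"
    by (rule wop_eop_commute[symmetric]) (simp_all add: set_simps)
  also have "oA' g = oC' (oA' (oB' f))"
    unfolding g_def by (rule wadj_wadj_commute) (simp_all add: set_simps)
  also have "oA' (oB' f) = wadj (A \<union> B) dAB {} VAB f"
    by (rule wadj_AB[symmetric]) (rule indep_mono[OF f], auto)
  also have "oC' \<dots> = wadj (A \<union> B \<union> C) dABC {} VABC f"
    by (rule wadj_ABC'[symmetric]) (rule indep_mono[OF f], auto)
  also have "?D1 (?D2 \<dots>) = eop dABC NABC \<dots>" unfolding eABC ..
  also have "wop (A \<union> B) dAB {} VAB (oC \<dots>) = wop (A \<union> B \<union> C) dABC {} VABC (eop dABC NABC (wadj (A \<union> B \<union> C) dABC {} VABC f))"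
  proof (rule wop_ABC'[symmetric])
    have "wadj (A \<union> B \<union> C) dABC {} VABC f = oC' (wadj (A \<union> B) dAB {} VAB f)"
      by (rule wadj_ABC') (rule indep_mono[OF f], auto)
    then show "indep {} yc (eop dABC NABC (wadj (A \<union> B \<union> C) dABC {} VABC f))"
      by (simp only: eABC) (intro indep_intros; auto simp: set_simps Diff_Int_distrib2)
  qed
  also have "\<dots> = pop (A \<union> B \<union> C) (mmult (configs dABC) VABC (mmult (configs dABC) NABC (madjoint VABC))) f"
    by (rule pop_sandwich[symmetric]) (rule indep_mono[OF f], auto)
  finally show ?thesis unfolding 1 2 t_def .
qed

end

text \<open>V \<rho>^{-1} V^* V = V. This is how an operator whose output factors through V is
  recognised as lying in the range of the projection.\<close>

lemma pop_projection_fixes: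
  assumes "finite D" and \<rho>: "is_minv (configs D) (mmult (configs Y) (madjoint V) V) \<rho>i"
    and g: "indep Y {} (g :: ('v, 'p, 'e, 'b::finite) state)"
  shows "pop Y (mmult (configs D) V (mmult (configs D) \<rho>i (madjoint V))) (wop Y D {} V g) = wop Y D {} V g"
proof -
  have "pop Y (mmult (configs D) V (mmult (configs D) \<rho>i (madjoint V))) (wop Y D {} V g)
     = wop Y D {} V (eop D \<rho>i (wadj Y D {} V (wop Y D {} V g)))"
    by (rule pop_sandwich, rule indep_wop) (auto intro: indep_mono[OF g])
  also have "wadj Y D {} V (wop Y D {} V g) = eop D (mmult (configs Y) (madjoint V) V) g"
    by (rule wadj_wop_Gram) (rule indep_mono[OF g], auto)
  also have "eop D \<rho>i \<dots> = g"
    using assms by (simp add: eop_eop is_minv_def eop_mone)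
  finally show ?thesis .
qed

lemma wop_wop_commute:
  assumes "X \<inter> X' = {}" "X' \<inter> Z = {}" "X \<inter> Z' = {}"
  shows "wop K X Z W (wop K' X' Z' W' f) = wop K' X' Z' W' (wop K X Z W f)"
  unfolding wop_def
  by (rule gop_commute[OF _ _ indep_wop_kernel indep_wop_kernel]) (use assms in auto)

context glued_triple
begin

abbreviation "F \<equiv> A \<union> B \<union> C"
abbreviation "lift K M \<psi> \<equiv> mapply (configs F) (tensor_ext K F M) \<psi>"
abbreviation "PB \<equiv> orthoproj (configs B) (mapply (configs dB) VB ` cvecs (configs dB))"
abbreviation "PAB \<equiv> orthoproj (configs (A \<union> B)) (mapply (configs dAB) VAB ` cvecs (configs dAB))"
abbreviation "PBC \<equiv> orthoproj (configs (B \<union> C)) (mapply (configs dBC) VBC ` cvecs (configs dBC))"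
abbreviation "PABC \<equiv> orthoproj (configs F) (mapply (configs dABC) VABC ` cvecs (configs dABC))"

lemma finite_all:
  "finite (configs B :: ('v \<Rightarrow> 'p) set)" "finite (configs (A \<union> B) :: ('v \<Rightarrow> 'p) set)"
  "finite (configs (B \<union> C) :: ('v \<Rightarrow> 'p) set)" "finite (configs F :: ('v \<Rightarrow> 'p) set)"
  "finite (configs dB :: ('e \<Rightarrow> 'b) set)" "finite (configs dAB :: ('e \<Rightarrow> 'b) set)"
  "finite (configs dBC :: ('e \<Rightarrow> 'b) set)" "finite (configs dABC :: ('e \<Rightarrow> 'b) set)"
  using fin finite_d by auto

lemmas Gram_B = orthoproj_Gram[OF finite_all(1,5) VB]
lemmas Gram_AB = orthoproj_Gram[OF finite_all(2,6) VAB]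
lemmas Gram_BC = orthoproj_Gram[OF finite_all(3,7) VBC]
lemmas Gram_ABC = orthoproj_Gram[OF finite_all(4,8) VABC]

lemma lift_eqI:
  assumes "embed F \<psi> = (embed F \<phi> :: ('v, 'p, 'e, 'b) state)" "\<psi> \<in> cvecs (configs F)" "\<phi> \<in> cvecs (configs F)"
  shows "\<psi> = \<phi>"
  using embed_eq_iff assms by blast

lemma lift_in_cvecs: "lift K M \<psi> \<in> cvecs (configs F)"
  by (rule mapply_in_cvecs) simp

lemma embed_lift:
  "K \<subseteq> F \<Longrightarrow> embed F (lift K M \<psi>) = (pop K M (embed F \<psi>) :: ('v, 'p, 'e, 'b) state)"
  using fin by (simp add: embed_tensor_ext)

lemma indep_embed_F: "indep {} X (embed F \<psi>)"
  by (rule indep_embed) simp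

text \<open>V_BC factors through V_B, so everything in the range of S_BC is already fixed by P_B.
  Thus P_B can be inserted in front of S_BC at no cost and then replaced by its approximation
  X.\<close>

lemma PB_absorbs:
  "lift B PB (lift (B \<union> C) (mmult (configs dBC) VBC (mmult (configs dBC)
     (mmult (configs dBC) (tensor_ext (xe \<union> bl \<union> z) dBC M) (tensor_ext (z \<union> ga \<union> br) dBC N)) (madjoint VBC))) \<psi>)
   = lift (B \<union> C) (mmult (configs dBC) VBC (mmult (configs dBC)
     (mmult (configs dBC) (tensor_ext (xe \<union> bl \<union> z) dBC M) (tensor_ext (z \<union> ga \<union> br) dBC N)) (madjoint VBC))) \<psi>"
  (is "lift B PB (lift (B \<union> C) ?S \<psi>) = _")
proof (rule lift_eqI[OF _ lift_in_cvecs lift_in_cvecs])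
  let ?f = "embed F \<psi> :: ('v, 'p, 'e, 'b) state"
  note indep_intros = indep_wop indep_wadj indep_eop indep_mono[OF indep_embed_F]
  define h where "h = eop (xe \<union> bl \<union> z) M (eop (z \<union> ga \<union> br) N (oC' (oB' ?f)))"
  have subs: "xe \<union> bl \<union> z \<subseteq> dBC" "z \<union> ga \<union> br \<subseteq> dBC" by (auto simp: dBC)
  have "pop (B \<union> C) ?S ?f = wop (B \<union> C) dBC {} VBC (eop dBC (mmult (configs dBC) (tensor_ext (xe \<union> bl \<union> z) dBC M) (tensor_ext (z \<union> ga \<union> br) dBC N)) (wadj (B \<union> C) dBC {} VBC ?f))"
    by (rule pop_sandwich[OF indep_embed_F])
  also have "wadj (B \<union> C) dBC {} VBC ?f = oC' (oB' ?f)"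
    by (rule wadj_BC[OF indep_embed_F])
  also have "eop dBC (mmult (configs dBC) (tensor_ext (xe \<union> bl \<union> z) dBC M) (tensor_ext (z \<union> ga \<union> br) dBC N)) \<dots> = h"
    unfolding h_def eop_eop[symmetric] using subs finite_d by (simp add: eop_tensor_ext)
  also have "wop (B \<union> C) dBC {} VBC h = oB (oC h)"
    by (rule wop_BC) (unfold h_def, intro indep_intros; auto simp: set_simps Diff_Int_distrib2)
  finally have e: "pop (B \<union> C) ?S ?f = oB (oC h)" .
  have "pop B PB (oB (oC h)) = oB (oC h)"
    unfolding Gram_B(2)
    by (rule pop_projection_fixes[OF finite_d(1) Gram_B(1)])
       (unfold h_def, intro indep_intros; auto simp: set_simps Diff_Int_distrib2)
  then have "pop B PB (pop (B \<union> C) ?S ?f) = pop (B \<union> C) ?S ?f" unfolding e .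
  moreover have "B \<subseteq> F" "B \<union> C \<subseteq> F" by auto
  ultimately show "embed F (lift B PB (lift (B \<union> C) ?S \<psi>)) = (embed F (lift (B \<union> C) ?S \<psi>) :: ('v, 'p, 'e, 'b) state)"
    by (simp only: embed_lift)
qed

text \<open>V_ABC factors through V_AB and, contracting A and C in the other order, through V_BC;
  hence its range lies in the ranges of both projections.\<close>

lemma PAB_PBC_absorb:
  "mmult (configs F) (tensor_ext (A \<union> B) F PAB) PABC = PABC"
  "mmult (configs F) (tensor_ext (B \<union> C) F PBC) PABC = PABC"
proof -
  have P: "PABC \<in> cmats (configs F) (configs F)" using Gram_ABC(3) by (simp add: is_orthoproj_def)
  note indep_intros = indep_wop indep_wadj indep_eop indep_mono[OF indep_embed_F]
  have main: "lift (A \<union> B) PAB (mapply (configs F) PABC \<psi>) = mapply (configs F) PABC \<psi> \<and>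
     lift (B \<union> C) PBC (mapply (configs F) PABC \<psi>) = mapply (configs F) PABC \<psi>" for \<psi>
  proof -
    let ?f = "embed F \<psi> :: ('v, 'p, 'e, 'b) state"
    define \<rho>i where "\<rho>i = minv (configs dABC) (mmult (configs F) (madjoint VABC) VABC)"
    define g where "g = wadj F dABC {} VABC ?f"
    define h where "h = eop dABC \<rho>i g"
    have g: "g = oC' (oA' (oB' ?f))"
      unfolding g_def wadj_ABC'[OF indep_embed_F] wadj_AB[OF indep_embed_F] ..
    have h_xe: "indep {} xe h"
      unfolding h_def g by (intro indep_intros; auto simp: set_simps Diff_Int_distrib2 dABC)
    have h_yc: "indep {} yc h"
      unfolding h_def g by (intro indep_intros; auto simp: set_simps Diff_Int_distrib2 dABC)
    have h_V: "indep (B \<union> A) {} h" "indep (B \<union> C) {} h"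
      unfolding h_def g_def by (intro indep_intros; auto simp: set_simps Diff_Int_distrib2 dABC)+
    have i1: "indep {} xe (oC h)"
      by (rule indep_wop) (auto simp: set_simps intro: indep_mono[OF h_xe])
    have i2: "indep {} yc (oA h)"
      by (rule indep_wop) (auto simp: set_simps intro: indep_mono[OF h_yc])
    have i3: "indep (A \<union> B) {} (oC h)"
      by (rule indep_wop) (auto simp: set_simps intro: indep_mono[OF h_V(1)])
    have i4: "indep (B \<union> C) {} (oA h)"
      by (rule indep_wop) (auto simp: set_simps intro: indep_mono[OF h_V(2)])
    have self: "tensor_ext F F PABC = PABC" using P by (rule tensor_ext_self)
    have "embed F (mapply (configs F) PABC \<psi>) = pop F PABC ?f"
      using embed_lift[of F PABC \<psi>] unfolding self by simp
    also have "\<dots> = wop F dABC {} VABC h"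
      unfolding Gram_ABC(2) h_def g_def \<rho>i_def by (rule pop_sandwich[OF indep_embed_F])
    finally have em: "embed F (mapply (configs F) PABC \<psi>) = wop F dABC {} VABC h" .
    have e1: "wop F dABC {} VABC h = wop (A \<union> B) dAB {} VAB (oC h)"
      by (rule wop_ABC'[OF h_yc])
    have "\<dots> = oB (oA (oC h))" by (rule wop_AB[OF i1])
    also have "oA (oC h) = oC (oA h)" by (rule wop_wop_commute) (simp_all add: set_simps)
    also have "oB \<dots> = wop (B \<union> C) dBC {} VBC (oA h)" by (rule wop_BC[OF i2, symmetric])
    finally have e2: "wop F dABC {} VABC h = wop (B \<union> C) dBC {} VBC (oA h)" using e1 by simp
    have "pop (A \<union> B) PAB (wop F dABC {} VABC h) = wop F dABC {} VABC h"
      unfolding e1 unfolding Gram_AB(2) by (rule pop_projection_fixes[OF finite_d(2) Gram_AB(1) i3])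
    moreover have "pop (B \<union> C) PBC (wop F dABC {} VABC h) = wop F dABC {} VABC h"
      unfolding e2 unfolding Gram_BC(2) by (rule pop_projection_fixes[OF finite_d(3) Gram_BC(1) i4])
    moreover have "A \<union> B \<subseteq> F" "B \<union> C \<subseteq> F" by auto
    ultimately have "embed F (lift (A \<union> B) PAB (mapply (configs F) PABC \<psi>)) = (embed F (mapply (configs F) PABC \<psi>) :: ('v, 'p, 'e, 'b) state)"
      "embed F (lift (B \<union> C) PBC (mapply (configs F) PABC \<psi>)) = (embed F (mapply (configs F) PABC \<psi>) :: ('v, 'p, 'e, 'b) state)"
      by (simp_all only: embed_lift em)
    then show ?thesis using lift_eqI[OF _ lift_in_cvecs mapply_in_cvecs[OF P]] by blast
  qed
  show "mmult (configs F) (tensor_ext (A \<union> B) F PAB) PABC = PABC"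
    by (rule mat_eqI[OF finite_all(4) _ P]) (use main finite_all(4) P in \<open>simp_all add: mapply_mmult mmult_in_cmats\<close>)
  show "mmult (configs F) (tensor_ext (B \<union> C) F PBC) PABC = PABC"
    by (rule mat_eqI[OF finite_all(4) _ P]) (use main finite_all(4) P in \<open>simp_all add: mapply_mmult mmult_in_cmats\<close>)
qed

text \<open>
  Writing \<open>S\<^sub>R = V\<^sub>R \<sigma>\<^sub>R\<^sup>-\<^sup>1 V\<^sub>R\<^sup>\<dagger>\<close> and \<open>X = V\<^sub>B \<rho>\<^sub>B\<^sup>-\<^sup>1 \<sigma>\<^sub>B \<rho>\<^sub>B\<^sup>-\<^sup>1 V\<^sub>B\<^sup>\<dagger>\<close>, the hypotheses say that
  \<open>S\<^sub>R\<close> and \<open>X\<close> are \<open>\<epsilon>\<close>-close to the projections, and the exact identity is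
  \<open>S\<^bsub>AB\<^esub> X S\<^bsub>BC\<^esub> = S\<^bsub>ABC\<^esub>\<close>.
\<close>

lemma projections_almost_commute:
  fixes \<epsilon> :: real
  assumes inv: "minvertible (configs (al \<union> bl \<union> z)) Daz" "minvertible (configs (z \<union> ga \<union> br)) Dzb"
      "minvertible (configs (xe \<union> bl \<union> z)) Odz" "minvertible (configs (z \<union> yc \<union> br)) Ozc"
  defines "\<sigma>AB \<equiv> mmult (configs dAB) (tensor_ext (z \<union> yc \<union> br) dAB Ozc) (tensor_ext (al \<union> bl \<union> z) dAB Daz)"
    and "\<sigma>BC \<equiv> mmult (configs dBC) (tensor_ext (z \<union> ga \<union> br) dBC Dzb) (tensor_ext (xe \<union> bl \<union> z) dBC Odz)"
    and "\<sigma>ABC \<equiv> mmult (configs dABC) (tensor_ext (z \<union> ga \<union> br) dABC Dzb) (tensor_ext (al \<union> bl \<union> z) dABC Daz)"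
    and "\<sigma>B \<equiv> mmult (configs dB) (tensor_ext (z \<union> yc \<union> br) dB Ozc) (tensor_ext (xe \<union> bl \<union> z) dB Odz)"
    and "\<rho>AB \<equiv> mmult (configs (A \<union> B)) (madjoint VAB) VAB"
    and "\<rho>BC \<equiv> mmult (configs (B \<union> C)) (madjoint VBC) VBC"
    and "\<rho>ABC \<equiv> mmult (configs F) (madjoint VABC) VABC"
    and "\<rho>B \<equiv> mmult (configs B) (madjoint VB) VB"
  assumes close:
    "mopnorm (configs dABC) (mminus (mmult (configs dABC) (mmult (configs dABC) (msqrt (configs dABC) \<rho>ABC) (minv (configs dABC) \<sigma>ABC)) (msqrt (configs dABC) \<rho>ABC)) (mone (configs dABC))) \<le> \<epsilon>"
    "mopnorm (configs dAB) (mminus (mmult (configs dAB) (mmult (configs dAB) (msqrt (configs dAB) \<rho>AB) (minv (configs dAB) \<sigma>AB)) (msqrt (configs dAB) \<rho>AB)) (mone (configs dAB))) \<le> \<epsilon>"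
    "mopnorm (configs dBC) (mminus (mmult (configs dBC) (mmult (configs dBC) (msqrt (configs dBC) \<rho>BC) (minv (configs dBC) \<sigma>BC)) (msqrt (configs dBC) \<rho>BC)) (mone (configs dBC))) \<le> \<epsilon>"
    "mopnorm (configs dB) (mminus (mmult (configs dB) (mmult (configs dB) (minv (configs dB) (msqrt (configs dB) \<rho>B)) \<sigma>B) (minv (configs dB) (msqrt (configs dB) \<rho>B))) (mone (configs dB))) \<le> \<epsilon>"
    and \<epsilon>: "\<epsilon> \<le> 1"
  shows "cnorm (configs F) (lift (A \<union> B) PAB (lift (B \<union> C) PBC \<psi>) - mapply (configs F) PABC \<psi>) \<le> 8 * \<epsilon> * cnorm (configs F) \<psi>"
proof -
  have \<epsilon>0: "0 \<le> \<epsilon>" by (rule mopnorm_bound(2)[OF finite_all(5) close(4)])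
  have fin': "finite (configs (al \<union> bl \<union> z) :: ('e \<Rightarrow> 'b) set)" "finite (configs (z \<union> ga \<union> br) :: ('e \<Rightarrow> 'b) set)"
    "finite (configs (xe \<union> bl \<union> z) :: ('e \<Rightarrow> 'b) set)" "finite (configs (z \<union> yc \<union> br) :: ('e \<Rightarrow> 'b) set)"
    using fin by auto
  define Dazi where "Dazi = minv (configs (al \<union> bl \<union> z)) Daz"
  define Dzbi where "Dzbi = minv (configs (z \<union> ga \<union> br)) Dzb"
  define Odzi where "Odzi = minv (configs (xe \<union> bl \<union> z)) Odz"
  define Ozci where "Ozci = minv (configs (z \<union> yc \<union> br)) Ozc"
  note invs = is_minv_minv[OF fin'(1) inv(1), folded Dazi_def] is_minv_minv[OF fin'(2) inv(2), folded Dzbi_def]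
    is_minv_minv[OF fin'(3) inv(3), folded Odzi_def] is_minv_minv[OF fin'(4) inv(4), folded Ozci_def]
  define NAB where "NAB = mmult (configs dAB) (tensor_ext (al \<union> bl \<union> z) dAB Dazi) (tensor_ext (z \<union> yc \<union> br) dAB Ozci)"
  define NBC where "NBC = mmult (configs dBC) (tensor_ext (xe \<union> bl \<union> z) dBC Odzi) (tensor_ext (z \<union> ga \<union> br) dBC Dzbi)"
  define NABC where "NABC = mmult (configs dABC) (tensor_ext (al \<union> bl \<union> z) dABC Dazi) (tensor_ext (z \<union> ga \<union> br) dABC Dzbi)"
  have subs: "al \<union> bl \<union> z \<subseteq> dAB" "z \<union> yc \<union> br \<subseteq> dAB" "xe \<union> bl \<union> z \<subseteq> dBC" "z \<union> ga \<union> br \<subseteq> dBC"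
    "al \<union> bl \<union> z \<subseteq> dABC" "z \<union> ga \<union> br \<subseteq> dABC" "z \<union> yc \<union> br \<subseteq> dB" "xe \<union> bl \<union> z \<subseteq> dB"
    by (auto simp: dAB dBC dABC dB)
  have mAB: "minv (configs dAB) \<sigma>AB = NAB" unfolding \<sigma>AB_def NAB_def
    by (rule minv_eq[OF finite_all(6) mmult_in_cmats is_minv_tensor_product]) (use subs in \<open>simp_all add: finite_d invs\<close>)
  have mBC: "minv (configs dBC) \<sigma>BC = NBC" unfolding \<sigma>BC_def NBC_def
    by (rule minv_eq[OF finite_all(7) mmult_in_cmats is_minv_tensor_product]) (use subs in \<open>simp_all add: finite_d invs\<close>)
  have mABC: "minv (configs dABC) \<sigma>ABC = NABC" unfolding \<sigma>ABC_def NABC_def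
    by (rule minv_eq[OF finite_all(8) mmult_in_cmats is_minv_tensor_product]) (use subs in \<open>simp_all add: finite_d invs\<close>)
  define \<rho>i where "\<rho>i = minv (configs dB) \<rho>B"
  have \<rho>i: "is_minv (configs dB) \<rho>B \<rho>i" unfolding \<rho>i_def \<rho>B_def by (rule Gram_B(1))
  define SAB where "SAB = mmult (configs dAB) VAB (mmult (configs dAB) NAB (madjoint VAB))"
  define SBC where "SBC = mmult (configs dBC) VBC (mmult (configs dBC) NBC (madjoint VBC))"
  define SABC where "SABC = mmult (configs dABC) VABC (mmult (configs dABC) NABC (madjoint VABC))"
  define X where "X = mmult (configs dB) VB (mmult (configs dB) (mmult (configs dB) \<rho>i (mmult (configs dB) \<sigma>B \<rho>i)) (madjoint VB))"
  have cS: "SAB \<in> cmats (configs (A \<union> B)) (configs (A \<union> B))" "SBC \<in> cmats (configs (B \<union> C)) (configs (B \<union> C))"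
    "SABC \<in> cmats (configs F) (configs F)" "X \<in> cmats (configs B) (configs B)"
    unfolding SAB_def SBC_def SABC_def X_def NAB_def NBC_def NABC_def \<sigma>B_def
    using VAB(1) VBC(1) VABC(1) VB(1) \<rho>i
    by (auto intro!: mmult_in_cmats madjoint_in_cmats simp: is_minv_def)
  have cP: "PAB \<in> cmats (configs (A \<union> B)) (configs (A \<union> B))" "PBC \<in> cmats (configs (B \<union> C)) (configs (B \<union> C))"
    "PABC \<in> cmats (configs F) (configs F)" "PB \<in> cmats (configs B) (configs B)"
    using Gram_AB(3) Gram_BC(3) Gram_ABC(3) Gram_B(3) by (simp_all add: is_orthoproj_def)
  have finF: "finite F" using fin by simp
  have dAB': "cnorm (configs F) (lift (A \<union> B) SAB \<phi> - lift (A \<union> B) PAB \<phi>) \<le> \<epsilon> * cnorm (configs F) \<phi>" for \<phi>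
    by (rule cnorm_tensor_ext_le[OF finF _ cS(1) cP(1) \<epsilon>0], blast)
       (unfold SAB_def, rule Gram_AB(4), use close(2) in \<open>simp add: \<rho>AB_def mAB\<close>)
  have dBC': "cnorm (configs F) (lift (B \<union> C) SBC \<phi> - lift (B \<union> C) PBC \<phi>) \<le> \<epsilon> * cnorm (configs F) \<phi>" for \<phi>
    by (rule cnorm_tensor_ext_le[OF finF _ cS(2) cP(2) \<epsilon>0], blast)
       (unfold SBC_def, rule Gram_BC(4), use close(3) in \<open>simp add: \<rho>BC_def mBC\<close>)
  have dB': "cnorm (configs F) (lift B X \<phi> - lift B PB \<phi>) \<le> \<epsilon> * cnorm (configs F) \<phi>" for \<phi>
    by (rule cnorm_tensor_ext_le[OF finF _ cS(4) cP(4) \<epsilon>0], blast)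
       (unfold X_def \<rho>i_def \<rho>B_def, rule Gram_B(5), use close(4) in \<open>simp add: \<rho>B_def\<close>)
  have dABC': "cnorm (configs F) (mapply (configs F) SABC \<psi> - mapply (configs F) PABC \<psi>) \<le> \<epsilon> * cnorm (configs F) \<psi>"
    by (unfold SABC_def, rule Gram_ABC(4), use close(1) in \<open>simp add: \<rho>ABC_def mABC\<close>)
  define n where "n = cnorm (configs F) \<psi>"
  define \<phi> where "\<phi> = lift (B \<union> C) SBC \<psi>"
  have ab_contr: "cnorm (configs F) (lift (A \<union> B) PAB \<phi>) \<le> cnorm (configs F) \<phi>"
    and bc_contr: "cnorm (configs F) (lift (B \<union> C) PBC \<phi>) \<le> cnorm (configs F) \<phi>" for \<phi>
    using cnorm_orthoproj_le(1)[OF finite_all(4) is_orthoproj_tensor_ext[OF finF _ Gram_AB(3)]]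
      cnorm_orthoproj_le(1)[OF finite_all(4) is_orthoproj_tensor_ext[OF finF _ Gram_BC(3)]] by blast+
  have tri: "cnorm (configs F) x \<le> cnorm (configs F) y + cnorm (configs F) (x - y)" for x y :: "('v \<Rightarrow> 'p) \<Rightarrow> complex"
    using cnorm_triangle[of "configs F" y "x - y"] by simp
  \<comment> \<open>S_BC is within \<epsilon> \<le> 1 of a projection, so its norm is at most 2; the
    same holds for S_AB in the third estimate below.\<close>
  have \<phi>n: "cnorm (configs F) \<phi> \<le> 2 * n"
  proof -
    have "cnorm (configs F) \<phi> \<le> n + \<epsilon> * n"
      using tri[of \<phi> "lift (B \<union> C) PBC \<psi>"] dBC'[of \<psi>] bc_contr[of \<psi>] unfolding \<phi>_def n_def by linarith
    also have "\<dots> \<le> 2 * n" using mult_right_mono[OF \<epsilon>, of n] by (simp add: n_def)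
    finally show ?thesis .
  qed
  have \<phi>fix: "lift B PB \<phi> = \<phi>" unfolding \<phi>_def SBC_def NBC_def by (rule PB_absorbs)
  have ident: "lift (A \<union> B) SAB (lift B X \<phi>) = mapply (configs F) SABC \<psi>"
  proof (rule lift_eqI[OF _ lift_in_cvecs mapply_in_cvecs[OF cS(3)]])
    have self: "tensor_ext F F SABC = SABC" by (rule tensor_ext_self[OF cS(3)])
    have sub: "A \<union> B \<subseteq> F" "B \<subseteq> F" "B \<union> C \<subseteq> F" "F \<subseteq> F" by auto
    have "embed F (lift (A \<union> B) SAB (lift B X \<phi>)) = (pop F SABC (embed F \<psi>) :: ('v, 'p, 'e, 'b) state)"
      unfolding embed_lift[OF sub(1)] embed_lift[OF sub(2)] \<phi>_def embed_lift[OF sub(3)]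
      unfolding SAB_def SBC_def SABC_def X_def NAB_def NBC_def NABC_def \<sigma>B_def
      by (rule key_identity[OF indep_embed_F invs(3,4) \<rho>i[unfolded \<rho>B_def]])
    also have "\<dots> = embed F (mapply (configs F) SABC \<psi>)"
      using embed_lift[OF sub(4), of SABC \<psi>] unfolding self by simp
    finally show "embed F (lift (A \<union> B) SAB (lift B X \<phi>)) = (embed F (mapply (configs F) SABC \<psi>) :: ('v, 'p, 'e, 'b) state)" .
  qed
  \<comment> \<open>The constant 8 = 1 + 2 + 4 + 1 comes from the chain P_AB P_BC, P_AB S_BC, S_AB
    S_BC = S_AB P_B S_BC, S_AB X S_BC = S_ABC, P_ABC: each replacement costs \<epsilon> times the
    norms, at most 2, of the other approximate projections in the product.\<close>
  let ?x0 = "lift (A \<union> B) PAB (lift (B \<union> C) PBC \<psi>)" and ?x1 = "lift (A \<union> B) PAB \<phi>" and ?x2 = "lift (A \<union> B) SAB \<phi>"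
    and ?x3 = "mapply (configs F) SABC \<psi>" and ?x4 = "mapply (configs F) PABC \<psi>"
  have s1: "cnorm (configs F) (?x0 - ?x1) \<le> \<epsilon> * n"
  proof -
    have "?x0 - ?x1 = lift (A \<union> B) PAB (lift (B \<union> C) PBC \<psi> - \<phi>)" by (simp add: mapply_diff)
    then show ?thesis using ab_contr[of "lift (B \<union> C) PBC \<psi> - \<phi>"] dBC'[of \<psi>]
      unfolding \<phi>_def n_def by (simp add: cnorm_minus_commute[of _ "lift (B \<union> C) PBC \<psi>"])
  qed
  have s2: "cnorm (configs F) (?x1 - ?x2) \<le> 2 * (\<epsilon> * n)"
    using dAB'[of \<phi>] mult_left_mono[OF \<phi>n \<epsilon>0] by (simp add: cnorm_minus_commute[of _ ?x1])
  have s3: "cnorm (configs F) (?x2 - ?x3) \<le> 4 * (\<epsilon> * n)"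
  proof -
    let ?d = "lift B PB \<phi> - lift B X \<phi>"
    have "?x2 - ?x3 = lift (A \<union> B) SAB ?d"
      unfolding ident[symmetric] mapply_diff \<phi>fix ..
    moreover have "cnorm (configs F) (lift (A \<union> B) SAB ?d) \<le> 2 * cnorm (configs F) ?d"
      using tri[of "lift (A \<union> B) SAB ?d" "lift (A \<union> B) PAB ?d"] dAB'[of ?d] ab_contr[of ?d]
        mult_right_mono[OF \<epsilon> cnorm_nonneg[of "configs F" ?d]] by linarith
    moreover have "cnorm (configs F) ?d \<le> \<epsilon> * cnorm (configs F) \<phi>"
      using dB'[of \<phi>] cnorm_minus_commute[of "configs F" "lift B PB \<phi>"] by simp
    moreover have "\<epsilon> * cnorm (configs F) \<phi> \<le> \<epsilon> * (2 * n)" by (rule mult_left_mono[OF \<phi>n \<epsilon>0])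
    ultimately show ?thesis by simp
  qed
  have "cnorm (configs F) (?x0 - ?x4) \<le> cnorm (configs F) (?x0 - ?x1) + (cnorm (configs F) (?x1 - ?x2)
      + (cnorm (configs F) (?x2 - ?x3) + cnorm (configs F) (?x3 - ?x4)))"
    using cnorm_diff_triangle[of "configs F" ?x0 ?x4 ?x1] cnorm_diff_triangle[of "configs F" ?x1 ?x4 ?x2]
      cnorm_diff_triangle[of "configs F" ?x2 ?x4 ?x3] by linarith
  also have "\<dots> \<le> \<epsilon> * n + (2 * (\<epsilon> * n) + (4 * (\<epsilon> * n) + \<epsilon> * n))"
    using s1 s2 s3 dABC' unfolding n_def by linarith
  finally show ?thesis by (simp add: n_def)
qed

end

text \<open>Let y = (1 - r) x, a = p y and b = q y. Then r a = 0, so <a, b> = <a, (p q - r) b> is at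
  most \<delta> |a| |b|, and S = |a|^2 + |b|^2 satisfies S = <y, a + b> \<le> |y| |a + b| with |a +
  b|^2 \<le> (1 + \<delta>) S. Hence S \<le> (1 + \<delta>) |y|^2, and the right-hand side of the
  claim is 2 |y|^2 - S because 1 - p and 1 - q do not see r x.\<close>

lemma martingale_inequality:
  fixes \<delta> :: real
  assumes fin: "finite I" and p: "is_orthoproj I Wp p" and q: "is_orthoproj I Wq q" and r: "is_orthoproj I Wr r"
    and pr: "mmult I p r = r" and qr: "mmult I q r = r"
    and \<delta>: "0 \<le> \<delta>" "\<And>x. cnorm I (mapply I p (mapply I q x) - mapply I r x) \<le> \<delta> * cnorm I x"
  shows "(1 - \<delta>) * (cnorm I (x - mapply I r x))\<^sup>2
    \<le> (cnorm I (x - mapply I p x))\<^sup>2 + (cnorm I (x - mapply I q x))\<^sup>2"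
proof -
  have P: "madjoint p = p" "mmult I p p = p" and Q: "madjoint q = q" "mmult I q q = q"
    and R: "madjoint r = r" "mmult I r r = r"
    using p q r by (auto simp: is_orthoproj_def)
  have rp: "mmult I r p = r"
    using arg_cong[OF pr, of madjoint] P R by (simp add: madjoint_mmult)
  define y where "y = x - mapply I r x"
  have ry: "mapply I r y = (\<lambda>_. 0)"
    unfolding y_def mapply_diff mapply_mmult[OF fin fin, symmetric] R by auto
  have yp: "y - mapply I p y = x - mapply I p x" and yq: "y - mapply I q y = x - mapply I q x"
    unfolding y_def mapply_diff mapply_mmult[OF fin fin, symmetric] pr qr by auto
  define a b where "a = mapply I p y" and "b = mapply I q y"
  have pa: "cinner I a w = cinner I a (mapply I p w)" for w
    unfolding a_def cinner_mapply P(1) using fin P by (simp add: mapply_mmult[symmetric])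
  have qb: "mapply I q b = b" unfolding b_def using fin Q by (simp add: mapply_mmult[symmetric])
  have ra: "cinner I a (mapply I r w) = 0" for w
  proof -
    have "cinner I a (mapply I r w) = cinner I (mapply I r a) w" using cinner_mapply[of I I r a w] R by simp
    also have "mapply I r a = (\<lambda>_. 0)"
      unfolding a_def using fin rp ry by (simp add: mapply_mmult[symmetric])
    finally show ?thesis by (simp add: cinner_def)
  qed
  have "cinner I a b = cinner I a (mapply I p (mapply I q b) - mapply I r b)"
    unfolding cinner_diff_right ra qb using pa[of b] by simp
  then have "cmod (cinner I a b) \<le> cnorm I a * (\<delta> * cnorm I b)"
    using cinner_Cauchy_Schwarz[of I a "mapply I p (mapply I q b) - mapply I r b"]
      mult_left_mono[OF \<delta>(2)[of b] cnorm_nonneg[of I a]] by simp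
  then have Re: "Re (cinner I a b) \<le> \<delta> * (cnorm I a * cnorm I b)"
    using complex_Re_le_cmod[of "cinner I a b"] by (simp add: mult.left_commute)
  define S where "S = (cnorm I a)\<^sup>2 + (cnorm I b)\<^sup>2"
  have S0: "S \<ge> 0" by (simp add: S_def)
  have "2 * (cnorm I a * cnorm I b) \<le> S"
    using sum_squares_bound[of "cnorm I a" "cnorm I b"] by (simp add: S_def)
  from mult_left_mono[OF this \<delta>(1)] Re have Re2: "2 * Re (cinner I a b) \<le> \<delta> * S" by simp
  have "complex_of_real ((cnorm I (a + b))\<^sup>2) = of_real ((cnorm I a)\<^sup>2) + of_real ((cnorm I b)\<^sup>2) + (cinner I a b + cnj (cinner I a b))"
    unfolding cinner_self[symmetric] cinner_add_left cinner_add_right by (simp add: cinner_commute[of I b a])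
  also have "\<dots> = of_real (S + 2 * Re (cinner I a b))"
    unfolding complex_add_cnj by (simp add: S_def)
  finally have "(cnorm I (a + b))\<^sup>2 = S + 2 * Re (cinner I a b)" by (simp only: of_real_eq_iff)
  with Re2 have ab: "(cnorm I (a + b))\<^sup>2 \<le> (1 + \<delta>) * S" by (simp add: algebra_simps)
  have "cinner I y a = of_real ((cnorm I a)\<^sup>2)" "cinner I y b = of_real ((cnorm I b)\<^sup>2)"
    unfolding cinner_self[symmetric] a_def b_def cinner_mapply P(1) Q(1)
    using fin P Q by (simp_all add: mapply_mmult[symmetric])
  then have "cinner I y (a + b) = of_real S" unfolding cinner_add_right by (simp add: S_def)
  then have "S \<le> cnorm I y * cnorm I (a + b)"
    using cinner_Cauchy_Schwarz[of I y "a + b"] S0 by simp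
  then have "S\<^sup>2 \<le> (cnorm I y * cnorm I (a + b))\<^sup>2" using S0 by (rule power_mono)
  also have "\<dots> \<le> (cnorm I y)\<^sup>2 * ((1 + \<delta>) * S)"
    unfolding power_mult_distrib by (rule mult_left_mono[OF ab]) simp
  finally have "S * S \<le> ((1 + \<delta>) * (cnorm I y)\<^sup>2) * S" by (simp add: power2_eq_square algebra_simps)
  then have S: "S \<le> (1 + \<delta>) * (cnorm I y)\<^sup>2"
    using S0 \<delta>(1) by (cases "S = 0") auto
  have "(cnorm I (y - a))\<^sup>2 + (cnorm I (y - b))\<^sup>2 = 2 * (cnorm I y)\<^sup>2 - S"
    using cnorm_orthoproj_Pythagoras[OF fin p, of y] cnorm_orthoproj_Pythagoras[OF fin q, of y]
    by (simp add: S_def a_def b_def)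
  with S show ?thesis unfolding yp[symmetric] yq[symmetric] a_def[symmetric] b_def[symmetric] y_def[symmetric]
    by (simp add: algebra_simps)
qed

section \<open>PEPS maps of unions, and the gap inequality for three adjacent regions\<close>

subsection \<open>Gluing of PEPS maps\<close>

definition touching :: "edge set \<Rightarrow> vertex set \<Rightarrow> edge set" where
  "touching E \<Lambda> = inner_edges E \<Lambda> \<union> bdry E \<Lambda>"

text \<open>Here an edge carries a single value, seen from both of its ends, whereas the
  configurations in \<open>peps_map\<close> carry one value per half-edge.\<close>

definition vertex_prod :: "edge set \<Rightarrow> ('p, 'b) peps \<Rightarrow> vertex set \<Rightarrow> (vertex \<Rightarrow> 'p) \<Rightarrow> (edge \<Rightarrow> 'b) \<Rightarrow> complex" where
  "vertex_prod E T \<Lambda> k \<zeta> = (\<Prod>v\<in>\<Lambda>. T v (k v) (restrict \<zeta> (incident E v)))"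

lemma incident_subset_touching: "v \<in> \<Lambda> \<Longrightarrow> incident E v \<subseteq> touching E \<Lambda>"
  by (auto simp: incident_def touching_def inner_edges_def bdry_def)

lemma inner_bdry_disjoint: "inner_edges E \<Lambda> \<inter> bdry E \<Lambda> = {}"
  by (auto simp: inner_edges_def bdry_def)

lemma peps_map_in_cmats: "peps_map E T \<Lambda> \<in> cmats (configs \<Lambda>) (configs (bdry E \<Lambda>))"
  by (auto simp: peps_map_def cmats_def)

text \<open>Each \<omega>_e vanishes unless the two half-edge values agree, and then contributes
  D^{-1/2}. So only configurations with one value per edge survive; on the boundary that value is
  prescribed by \<open>x\<close>, and every edge touching the region gives one factor
  D^{-1/2}.\<close>

lemma peps_map_eq:
  fixes T :: "('p::finite, 'b::finite) peps"
  assumes card2: "\<And>e. e \<in> E \<Longrightarrow> card e = 2" and fin: "finite (touching E \<Lambda>)"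
    and k: "k \<in> configs \<Lambda>" and x: "x \<in> configs (bdry E \<Lambda>)"
  shows "peps_map E T \<Lambda> k x = complex_of_real (1 / sqrt (real CARD('b))) ^ card (touching E \<Lambda>) *
     (\<Sum>y\<in>configs (inner_edges E \<Lambda>). vertex_prod E T \<Lambda> k (override_on x y (inner_edges E \<Lambda>)))"
proof -
  let ?I = "inner_edges E \<Lambda>" and ?B = "bdry E \<Lambda>" and ?N = "touching E \<Lambda>"
  define c where "c = complex_of_real (1 / sqrt (real CARD('b)))"
  define S where "S = {\<eta> \<in> configs (half_edges ?N). \<forall>e\<in>?B. \<forall>w\<in>e - \<Lambda>. \<eta> (e, w) = (x e :: 'b)}"
  define diag where "diag = (\<lambda>\<eta> :: edge \<times> vertex \<Rightarrow> 'b. \<forall>e\<in>?N. \<forall>u\<in>e. \<forall>v\<in>e. \<eta> (e, u) = \<eta> (e, v))"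
  define t where "t = (\<lambda>\<eta>. (\<Prod>v\<in>\<Lambda>. T v (k v) (\<lambda>e\<in>incident E v. \<eta> (e, v))) * (\<Prod>e\<in>?N. omega_coeff e \<eta>))"
  have NE: "?N \<subseteq> E" by (auto simp: touching_def inner_edges_def bdry_def)
  have finh: "finite (half_edges ?N)"
  proof -
    have "half_edges ?N = (SIGMA e:?N. e)" by (auto simp: half_edges_def)
    moreover have "finite e" if "e \<in> ?N" for e using card2 NE that card.infinite by force
    ultimately show ?thesis using fin by auto
  qed
  then have finS: "finite S" unfolding S_def by simp
  have "peps_map E T \<Lambda> k x = (\<Sum>\<eta>\<in>S. t \<eta>)"
    using k x by (simp add: peps_map_def S_def t_def touching_def)
  also have "\<dots> = (\<Sum>\<eta>\<in>{\<eta>\<in>S. diag \<eta>}. t \<eta>)"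
  proof (rule sum.mono_neutral_right[OF finS])
    show "\<forall>\<eta>\<in>S - {\<eta> \<in> S. diag \<eta>}. t \<eta> = 0"
    proof
      fix \<eta> assume "\<eta> \<in> S - {\<eta> \<in> S. diag \<eta>}"
      then have "\<not> diag \<eta>" by blast
      then obtain e u v where "e \<in> ?N" "u \<in> e" "v \<in> e" "\<eta> (e, u) \<noteq> \<eta> (e, v)"
        unfolding diag_def by blast
      then have "e \<in> ?N" "omega_coeff e \<eta> = 0"
        unfolding omega_coeff_def by auto
      then show "t \<eta> = 0" using fin by (auto simp: t_def prod_zero_iff)
    qed
  qed auto
  also have "\<dots> = (\<Sum>y\<in>configs ?I. c ^ card ?N * vertex_prod E T \<Lambda> k (override_on x y ?I))"
  proof (rule sum.reindex_bij_witness)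
    let ?to = "\<lambda>y. \<lambda>(e, v)\<in>half_edges ?N. override_on x y ?I e"
    \<comment> \<open>The choice of the endpoint is immaterial for diagonal configurations.\<close>
    let ?from = "\<lambda>\<eta>. \<lambda>e\<in>?I. \<eta> (e, SOME v. v \<in> e)"
    have some: "(SOME v. v \<in> e) \<in> e" if "e \<in> ?N" for e
    proof -
      have "e \<noteq> {}" using card2 NE that by fastforce
      then show ?thesis by (simp add: some_in_eq)
    qed
    show "?from (?to y) = y" if "y \<in> configs ?I" for y
      using that some by (auto simp: fun_eq_iff configs_iff half_edges_def touching_def override_on_def)
    show "?to y \<in> {\<eta> \<in> S. diag \<eta>}" if "y \<in> configs ?I" for y
      using inner_bdry_disjoint[of E \<Lambda>] 
      by (auto simp: S_def diag_def half_edges_def touching_def override_on_def)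
    show "?from \<eta> \<in> configs ?I" for \<eta> by simp
    have val: "override_on x (?from \<eta>) ?I e = \<eta> (e, v)" if "\<eta> \<in> S" "diag \<eta>" "e \<in> ?N" "v \<in> e" for \<eta> e v
    proof (cases "e \<in> ?I")
      case True
      have "\<eta> (e, SOME v. v \<in> e) = \<eta> (e, v)"
        using that some[OF that(3)] unfolding diag_def by blast
      with True show ?thesis by simp
    next
      case False
      then have e: "e \<in> ?B" using that by (simp add: touching_def)
      then obtain w where w: "w \<in> e - \<Lambda>" by (auto simp: bdry_def)
      then have "\<eta> (e, w) = x e" using that e unfolding S_def by blast
      moreover have "\<eta> (e, w) = \<eta> (e, v)" using that w unfolding diag_def by blast
      ultimately show ?thesis using False by simp
    qed
    show "?to (?from \<eta>) = \<eta>" if "\<eta> \<in> {\<eta> \<in> S. diag \<eta>}" for \<eta>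
    proof
      fix p :: "edge \<times> vertex"
      obtain e v where p: "p = (e, v)" by (cases p)
      show "?to (?from \<eta>) p = \<eta> p"
      proof (cases "p \<in> half_edges ?N")
        case True
        then show ?thesis using val[of \<eta> e v] that by (simp add: p half_edges_def)
      next
        case False
        then show ?thesis using that by (cases p) (auto simp: S_def configs_iff)
      qed
    qed
    show "c ^ card ?N * vertex_prod E T \<Lambda> k (override_on x (?from \<eta>) ?I) = t \<eta>" if "\<eta> \<in> {\<eta> \<in> S. diag \<eta>}" for \<eta>
    proof -
      have "restrict (override_on x (?from \<eta>) ?I) (incident E v) = (\<lambda>e\<in>incident E v. \<eta> (e, v))" if v: "v \<in> \<Lambda>" for v
      proof (rule restrict_ext)
        fix e assume "e \<in> incident E v"
        then show "override_on x (?from \<eta>) ?I e = \<eta> (e, v)"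
          using val[of \<eta> e v] \<open>\<eta> \<in> _\<close> incident_subset_touching[OF v, of E] by (auto simp: incident_def)
      qed
      then have "vertex_prod E T \<Lambda> k (override_on x (?from \<eta>) ?I) = (\<Prod>v\<in>\<Lambda>. T v (k v) (\<lambda>e\<in>incident E v. \<eta> (e, v)))"
        unfolding vertex_prod_def by (simp cong: prod.cong)
      moreover have "(\<Prod>e\<in>?N. omega_coeff e \<eta>) = (\<Prod>e\<in>?N. c)"
      proof (rule prod.cong[OF refl])
        fix e assume "e \<in> ?N"
        then have "\<forall>u\<in>e. \<forall>v\<in>e. \<eta> (e, u) = \<eta> (e, v)" using that unfolding diag_def by blast
        then show "omega_coeff e \<eta> = c" unfolding omega_coeff_def c_def by (rule if_P)
      qed
      ultimately show ?thesis unfolding t_def by (simp only: prod_constant mult.commute)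
    qed
  qed
  finally show ?thesis by (simp add: c_def sum_distrib_left)
qed

lemma touching_eq:
  assumes "\<And>e. e \<in> E \<Longrightarrow> card e = 2"
  shows "touching E \<Lambda> = {e \<in> E. e \<inter> \<Lambda> \<noteq> {}}"
proof -
  have "e \<noteq> {}" if "e \<in> E" for e using assms[OF that] by auto
  then show ?thesis by (auto simp: touching_def inner_edges_def bdry_def)
qed

lemma vertex_prod_cong:
  assumes "\<And>e. e \<in> touching E \<Lambda> \<Longrightarrow> \<zeta> e = \<zeta>' e" "\<And>v. v \<in> \<Lambda> \<Longrightarrow> k v = k' v"
  shows "vertex_prod E T \<Lambda> k \<zeta> = vertex_prod E T \<Lambda> k' \<zeta>'"
  unfolding vertex_prod_def
proof (rule prod.cong[OF refl])
  fix v assume v: "v \<in> \<Lambda>"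
  have "restrict \<zeta> (incident E v) = restrict \<zeta>' (incident E v)"
    using incident_subset_touching[OF v, of E] assms(1) by (intro restrict_ext) blast
  then show "T v (k v) (restrict \<zeta> (incident E v)) = T v (k' v) (restrict \<zeta>' (incident E v))"
    using assms(2)[OF v] by simp
qed

lemma edge_cases2:
  assumes "card e = 2" obtains u v where "u \<noteq> v" "e = {u, v}"
  using assms by (auto simp: card_2_iff)

lemma bdry_Un:
  assumes "\<And>e. e \<in> E \<Longrightarrow> card e = 2" "Y \<inter> Z = {}"
  shows "bdry E (Y \<union> Z) = (bdry E Y - bdry E Z) \<union> (bdry E Z - bdry E Y)" (is ?b)
    and "inner_edges E (Y \<union> Z) = inner_edges E Y \<union> inner_edges E Z \<union> (bdry E Y \<inter> bdry E Z)" (is ?i)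
    and "touching E Y \<inter> touching E Z = bdry E Y \<inter> bdry E Z" (is ?t)
    and "touching E (Y \<union> Z) = touching E Y \<union> touching E Z" (is ?u)
proof -
  have *: "(e \<in> bdry E (Y \<union> Z) \<longleftrightarrow> e \<in> (bdry E Y - bdry E Z) \<union> (bdry E Z - bdry E Y)) \<and>
    (e \<in> inner_edges E (Y \<union> Z) \<longleftrightarrow> e \<in> inner_edges E Y \<union> inner_edges E Z \<union> (bdry E Y \<inter> bdry E Z)) \<and>
    (e \<in> touching E Y \<inter> touching E Z \<longleftrightarrow> e \<in> bdry E Y \<inter> bdry E Z) \<and>
    (e \<in> touching E (Y \<union> Z) \<longleftrightarrow> e \<in> touching E Y \<union> touching E Z)" for e
  proof (cases "e \<in> E")
    case True
    then obtain u v where "u \<noteq> v" "e = {u, v}" using assms(1) edge_cases2 by metis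
    with True assms(2) show ?thesis
      by (auto simp: bdry_def inner_edges_def touching_def)
  qed (auto simp: bdry_def inner_edges_def touching_def)
  then show ?b ?i ?t ?u by blast+
qed

text \<open>The sum over \<open>w\<close> identifies the two values at each glued edge. Such an edge
  contributes D^{-1/2} to the map of \<open>Y\<close> and again to that of \<open>Z\<close>, but
  only once to the map of the union; the power of sqrt D restores the balance.\<close>

lemma peps_map_Un:
  fixes T :: "('p::finite, 'b::finite) peps"
  assumes card2: "\<And>e. e \<in> E \<Longrightarrow> card e = 2" and disj: "Y \<inter> Z = {}" and fin: "finite Y" "finite Z"
    and finN: "finite (touching E Y)" "finite (touching E Z)"
    and k: "k \<in> configs (Y \<union> Z)" and u: "u \<in> configs (bdry E (Y \<union> Z))"
  defines "m \<equiv> bdry E Y \<inter> bdry E Z"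
  shows "peps_map E T (Y \<union> Z) k u = (\<Sum>w\<in>configs m.
     (complex_of_real (sqrt (real CARD('b))) ^ card m * peps_map E T Z (restrict k Z) (override_on (restrict u (bdry E Z - m)) w m)) *
     peps_map E T Y (restrict k Y) (override_on (restrict u (bdry E Y - m)) w m))"
proof -
  note B = bdry_Un[OF card2 disj]
  let ?c = "complex_of_real (1 / sqrt (real CARD('b)))" and ?s = "complex_of_real (sqrt (real CARD('b)))"
  let ?iY = "inner_edges E Y" and ?iZ = "inner_edges E Z"
  have finU: "finite (touching E (Y \<union> Z))" using B(4) finN by simp
  have "card (touching E Y) + card (touching E Z) = card (touching E (Y \<union> Z)) + card m"
    using card_Un_Int[OF finN] by (simp add: B(3,4) m_def)
  then have "?c ^ card (touching E (Y \<union> Z)) * ?c ^ card m = ?c ^ card (touching E Y) * ?c ^ card (touching E Z)"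
    unfolding power_add[symmetric] by simp
  moreover have "?c ^ card m * ?s ^ card m = 1"
    unfolding power_mult_distrib[symmetric] by (simp flip: of_real_mult)
  moreover have "a = s * q * p" if "a * t = p * q" "t * s = 1" for a p q s t :: complex
  proof -
    have "a = (a * t) * s" using that(2) by (simp add: mult.assoc)
    then show ?thesis unfolding that(1) by (simp add: mult_ac)
  qed
  ultimately have cc: "?c ^ card (touching E (Y \<union> Z)) = ?s ^ card m * ?c ^ card (touching E Z) * ?c ^ card (touching E Y)"
    by blast
  have d1: "(m \<union> ?iY) \<inter> ?iZ = {}" and d2: "m \<inter> ?iY = {}"
  proof -
    have "?iY \<inter> ?iZ = {}"
    proof (rule ccontr)
      assume "?iY \<inter> ?iZ \<noteq> {}"
      then obtain e where e: "e \<in> E" "e \<subseteq> Y \<inter> Z" by (auto simp: inner_edges_def)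
      then have "e = {}" using disj by simp
      then show False using card2[OF e(1)] by simp
    qed
    then show "(m \<union> ?iY) \<inter> ?iZ = {}" "m \<inter> ?iY = {}" by (auto simp: m_def inner_edges_def bdry_def)
  qed
  let ?fY = "\<lambda>w y. vertex_prod E T Y k (override_on (override_on (restrict u (bdry E Y - m)) w m) y ?iY)"
  let ?fZ = "\<lambda>w y. vertex_prod E T Z k (override_on (override_on (restrict u (bdry E Z - m)) w m) y ?iZ)"
  have split: "vertex_prod E T (Y \<union> Z) k (override_on u (override_on (override_on w y ?iY) y' ?iZ) (inner_edges E (Y \<union> Z))) = ?fY w y * ?fZ w y'"
    for w y y'
  proof -
    let ?\<zeta> = "override_on u (override_on (override_on w y ?iY) y' ?iZ) (inner_edges E (Y \<union> Z))"
    have "vertex_prod E T (Y \<union> Z) k ?\<zeta> = vertex_prod E T Y k ?\<zeta> * vertex_prod E T Z k ?\<zeta>"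
      unfolding vertex_prod_def by (rule prod.union_disjoint[OF fin disj])
    moreover have "vertex_prod E T Y k ?\<zeta> = ?fY w y"
    proof (rule vertex_prod_cong)
      fix e assume "e \<in> touching E Y"
      then consider "e \<in> ?iY" | "e \<in> m" | "e \<in> bdry E Y - m" by (auto simp: touching_def)
      then show "?\<zeta> e = override_on (override_on (restrict u (bdry E Y - m)) w m) y ?iY e"
      proof cases
        case 1
        then show ?thesis using d1 by (auto simp: override_on_def B(2))
      next
        case 2
        then show ?thesis using d1 d2 by (auto simp: override_on_def B(2) m_def)
      next
        case 3
        then have "e \<notin> inner_edges E (Y \<union> Z)" "e \<notin> ?iY"
          using B(1) inner_bdry_disjoint[of E "Y \<union> Z"] inner_bdry_disjoint[of E Y] by (auto simp: m_def)
        with 3 show ?thesis by (auto simp: override_on_def)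
      qed
    qed simp
    moreover have "vertex_prod E T Z k ?\<zeta> = ?fZ w y'"
    proof (rule vertex_prod_cong)
      fix e assume "e \<in> touching E Z"
      then consider "e \<in> ?iZ" | "e \<in> m" | "e \<in> bdry E Z - m" by (auto simp: touching_def)
      then show "?\<zeta> e = override_on (override_on (restrict u (bdry E Z - m)) w m) y' ?iZ e"
      proof cases
        case 1
        then show ?thesis by (auto simp: override_on_def B(2))
      next
        case 2
        then show ?thesis using d1 d2 by (auto simp: override_on_def B(2) m_def)
      next
        case 3
        then have "e \<notin> inner_edges E (Y \<union> Z)" "e \<notin> ?iZ"
          using B(1) inner_bdry_disjoint[of E "Y \<union> Z"] inner_bdry_disjoint[of E Z] by (auto simp: m_def)
        with 3 show ?thesis by (auto simp: override_on_def)
      qed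
    qed simp
    ultimately show ?thesis by simp
  qed
  have inU: "inner_edges E (Y \<union> Z) = (m \<union> ?iY) \<union> ?iZ" using B(2) m_def by blast
  have "peps_map E T (Y \<union> Z) k u = ?c ^ card (touching E (Y \<union> Z)) *
     (\<Sum>y\<in>configs ((m \<union> ?iY) \<union> ?iZ). vertex_prod E T (Y \<union> Z) k (override_on u y (inner_edges E (Y \<union> Z))))"
    using peps_map_eq[OF card2 finU k u, of T] inU by simp
  also have "\<dots> = ?c ^ card (touching E (Y \<union> Z)) *
     (\<Sum>w\<in>configs m. \<Sum>y\<in>configs ?iY. \<Sum>y'\<in>configs ?iZ. ?fY w y * ?fZ w y')"
    unfolding sum_configs_Un[OF d1] sum_configs_Un[OF d2] split ..
  also have "\<dots> = (\<Sum>w\<in>configs m. (?s ^ card m * (?c ^ card (touching E Z) * (\<Sum>y'\<in>configs ?iZ. ?fZ w y')))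
      * (?c ^ card (touching E Y) * (\<Sum>y\<in>configs ?iY. ?fY w y)))"
    unfolding sum_product[symmetric] cc by (simp add: sum_distrib_left mult_ac)
  also have "\<dots> = (\<Sum>w\<in>configs m.
     (?s ^ card m * peps_map E T Z (restrict k Z) (override_on (restrict u (bdry E Z - m)) w m)) *
     peps_map E T Y (restrict k Y) (override_on (restrict u (bdry E Y - m)) w m))"
  proof (intro sum.cong refl)
    fix w :: "edge \<Rightarrow> 'b" assume w: "w \<in> configs m"
    have "override_on (restrict u (bdry E Z - m)) w m \<in> configs (bdry E Z)"
      "override_on (restrict u (bdry E Y - m)) w m \<in> configs (bdry E Y)"
      using w by (auto simp: configs_iff override_on_def m_def)
    then have "peps_map E T Z (restrict k Z) (override_on (restrict u (bdry E Z - m)) w m)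
        = ?c ^ card (touching E Z) * (\<Sum>y'\<in>configs ?iZ. vertex_prod E T Z (restrict k Z) (override_on (override_on (restrict u (bdry E Z - m)) w m) y' ?iZ))"
      "peps_map E T Y (restrict k Y) (override_on (restrict u (bdry E Y - m)) w m)
        = ?c ^ card (touching E Y) * (\<Sum>y\<in>configs ?iY. vertex_prod E T Y (restrict k Y) (override_on (override_on (restrict u (bdry E Y - m)) w m) y ?iY))"
      using peps_map_eq[OF card2 finN(2) restrict_in_configs] peps_map_eq[OF card2 finN(1) restrict_in_configs] by blast+
    moreover have "vertex_prod E T Z (restrict k Z) \<zeta> = vertex_prod E T Z k \<zeta>"
      "vertex_prod E T Y (restrict k Y) \<zeta> = vertex_prod E T Y k \<zeta>" for \<zeta>
      by (intro vertex_prod_cong; simp)+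
    ultimately show "(?s ^ card m * (?c ^ card (touching E Z) * (\<Sum>y'\<in>configs ?iZ. ?fZ w y')))
        * (?c ^ card (touching E Y) * (\<Sum>y\<in>configs ?iY. ?fY w y)) =
      (?s ^ card m * peps_map E T Z (restrict k Z) (override_on (restrict u (bdry E Z - m)) w m)) *
      peps_map E T Y (restrict k Y) (override_on (restrict u (bdry E Y - m)) w m)"
      by simp
  qed
  finally show ?thesis .
qed

subsection \<open>Local gaps and the recursion step\<close>

locale injective_network =
  fixes G :: "vertex set" and E :: "edge set" and T :: "('p::finite, 'b::finite) peps"
  assumes edges: "\<And>e. e \<in> E \<Longrightarrow> e \<subseteq> G" "\<And>e. e \<in> E \<Longrightarrow> card e = 2"
    and locally_finite: "\<And>\<Lambda>. finite \<Lambda> \<Longrightarrow> \<Lambda> \<subseteq> G \<Longrightarrow> finite (touching E \<Lambda>)"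
    and inj: "injective_peps G E T"
begin

abbreviation "V R \<equiv> peps_map E T R"
abbreviation "D R \<equiv> configs (bdry E R) :: (edge \<Rightarrow> 'b) set"
abbreviation "Q R \<equiv> configs R :: (vertex \<Rightarrow> 'p) set"

definition P :: "vertex set \<Rightarrow> (vertex \<Rightarrow> 'p) \<Rightarrow> (vertex \<Rightarrow> 'p) \<Rightarrow> complex" where
  "P R = orthoproj (Q R) (peps_image E T R)"

lemma finite_bdry:
  assumes "finite R" "R \<subseteq> G"
  shows "finite (bdry E R)" "finite (inner_edges E R)" "finite (D R)" "finite (Q R)"
  using locally_finite[OF assms] assms by (auto simp: touching_def)

lemma inj_V: "finite R \<Longrightarrow> R \<subseteq> G \<Longrightarrow> inj_on (mapply (D R) (V R)) (cvecs (D R))"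
  using inj by (auto simp: injective_peps_def)

lemma is_orthoproj_P:
  assumes "finite R" "R \<subseteq> G"
  shows "is_orthoproj (Q R) (peps_image E T R) (P R)"
  unfolding P_def peps_image_def
  by (rule orthoproj_Gram(3)) (use assms finite_bdry inj_V peps_map_in_cmats in auto)

lemma P_in_cmats: "finite R \<Longrightarrow> R \<subseteq> G \<Longrightarrow> P R \<in> cmats (Q R) (Q R)"
  using is_orthoproj_P by (auto simp: is_orthoproj_def)

lemma finite_edge: "e \<in> E \<Longrightarrow> finite e"
  using edges(2) card.infinite by fastforce

lemma edge_projector_eq:
  assumes "e \<in> E"
  shows "edge_projector E T e = mminus (mone (Q e)) (P e)"
  unfolding edge_projector_def
  by (rule orthoproj_eq[OF _ is_orthoproj_orthocomp[OF _ is_orthoproj_P]])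
     (use assms edges finite_edge in auto)

lemma edge_projector_is_orthoproj:
  assumes "e \<in> E"
  shows "is_orthoproj (Q e) (orthocomp (Q e) (peps_image E T e)) (edge_projector E T e)"
  unfolding edge_projector_eq[OF assms]
  by (rule is_orthoproj_orthocomp[OF _ is_orthoproj_P]) (use assms edges finite_edge in auto)

text \<open>The local terms are projections, so this is the quadratic form of the part of the
  Hamiltonian with edges in \<open>S\<close>, acting on the space of \<open>F\<close> (see
  \<open>energy_eq_form\<close>).\<close>

definition energy :: "vertex set \<Rightarrow> edge set \<Rightarrow> ((vertex \<Rightarrow> 'p) \<Rightarrow> complex) \<Rightarrow> real" where
  "energy F S \<psi> = (\<Sum>e\<in>S. (cnorm (Q F) (mapply (Q F) (tensor_ext e F (edge_projector E T e)) \<psi>))\<^sup>2)"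

text \<open>The form inequality \<gamma> (1 - P) \<le> H. In contrast to a statement about
  eigenvalues it passes to larger regions and can be added up.\<close>

definition gapped :: "vertex set \<Rightarrow> real \<Rightarrow> bool" where
  "gapped R \<gamma> \<longleftrightarrow> (\<forall>\<psi>\<in>cvecs (Q R). \<gamma> * (cnorm (Q R) (\<psi> - mapply (Q R) (P R) \<psi>))\<^sup>2 \<le> energy R (inner_edges E R) \<psi>)"

lemma energy_nonneg: "0 \<le> energy F S \<psi>"
  by (simp add: energy_def sum_nonneg)

lemma energy_mono: "finite S' \<Longrightarrow> S \<subseteq> S' \<Longrightarrow> energy F S \<psi> \<le> energy F S' \<psi>"
  unfolding energy_def by (rule sum_mono2) auto

lemma gapped_mono: "gapped R \<gamma> \<Longrightarrow> \<gamma>' \<le> \<gamma> \<Longrightarrow> gapped R \<gamma>'"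
  unfolding gapped_def by (meson mult_right_mono order_trans zero_le_power2)

text \<open>Both sides decompose into slices over the configurations outside \<open>R\<close>, and
  each slice satisfies the inequality on \<open>R\<close>.\<close>

lemma gapped_lift:
  assumes fin: "finite F" and F: "F \<subseteq> G" and R: "R \<subseteq> F" and g: "gapped R \<gamma>"
  shows "\<gamma> * (cnorm (Q F) (\<psi> - mapply (Q F) (tensor_ext R F (P R)) \<psi>))\<^sup>2 \<le> energy F (inner_edges E R) \<psi>"
proof -
  have R': "finite R" "R \<subseteq> G" using fin F R finite_subset by auto
  have "\<gamma> * (cnorm (Q F) (\<psi> - mapply (Q F) (tensor_ext R F (P R)) \<psi>))\<^sup>2
    = (\<Sum>r\<in>configs (F - R). \<gamma> * (cnorm (Q R) (slice R \<psi> r - mapply (Q R) (P R) (slice R \<psi> r)))\<^sup>2)"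
    unfolding cnorm_slices[OF R] slice_diff sum_distrib_left
    by (simp add: slice_tensor_ext_self[OF fin R _ P_in_cmats[OF R']] cong: sum.cong)
  also have "\<dots> \<le> (\<Sum>r\<in>configs (F - R). energy R (inner_edges E R) (slice R \<psi> r))"
    by (rule sum_mono) (use g in \<open>simp add: gapped_def\<close>)
  also have "\<dots> = energy F (inner_edges E R) \<psi>"
    unfolding energy_def
  proof (subst sum.swap, intro sum.cong refl)
    fix e assume "e \<in> inner_edges E R"
    then have e: "e \<subseteq> R" by (simp add: inner_edges_def)
    show "(\<Sum>r\<in>configs (F - R). (cnorm (Q R) (mapply (Q R) (tensor_ext e R (edge_projector E T e)) (slice R \<psi> r)))\<^sup>2)
      = (cnorm (Q F) (mapply (Q F) (tensor_ext e F (edge_projector E T e)) \<psi>))\<^sup>2"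
      unfolding cnorm_slices[OF R] by (simp add: slice_tensor_ext[OF fin e R] cong: sum.cong)
  qed
  finally show ?thesis .
qed

text \<open>The martingale inequality for AB and BC meets the gaps of these two regions. As no edge
  joins A to C, the two energies add up to that of ABC plus that of B, whose edges are counted
  twice; averaging over cuts will absorb the second term.\<close>

lemma three_regions:
  assumes fin: "finite A" "finite B" "finite C" and G: "A \<subseteq> G" "B \<subseteq> G" "C \<subseteq> G"
    and disj: "A \<inter> B = {}" "B \<inter> C = {}" "A \<inter> C = {}"
    and noAC: "\<And>e. e \<in> E \<Longrightarrow> e \<inter> A = {} \<or> e \<inter> C = {}"
    and parts: "bl \<union> z \<union> br = bdry E B \<inter> bdry E (A \<union> B \<union> C)" "bl \<inter> z = {}" "bl \<inter> br = {}" "z \<inter> br = {}"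
    and fact: "approx_factorizable E T \<epsilon> A B C bl z br" and \<epsilon>: "\<epsilon> \<le> 1"
    and gap: "gapped (A \<union> B) \<gamma>" "gapped (B \<union> C) \<gamma>" "0 \<le> \<gamma>"
  shows "\<gamma> * ((1 - 8 * \<epsilon>) * (cnorm (Q (A \<union> B \<union> C)) (\<psi> - mapply (Q (A \<union> B \<union> C)) (P (A \<union> B \<union> C)) \<psi>))\<^sup>2)
    \<le> energy (A \<union> B \<union> C) (inner_edges E (A \<union> B \<union> C)) \<psi> + energy (A \<union> B \<union> C) (inner_edges E B) \<psi>"
proof -
  define al xe yc ga where "al = bdry E A \<inter> bdry E (A \<union> B \<union> C)" and "xe = bdry E A \<inter> bdry E B"
    and "yc = bdry E B \<inter> bdry E C" and "ga = bdry E C \<inter> bdry E (A \<union> B \<union> C)"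
  note pdefs = al_def xe_def yc_def ga_def
  let ?F = "A \<union> B \<union> C"
  let ?m = "bl \<union> z \<union> br"
  have sub: "A \<union> B \<subseteq> G" "B \<union> C \<subseteq> G" "?F \<subseteq> G" and fins: "finite (A \<union> B)" "finite (B \<union> C)" "finite ?F"
    using G fin by auto
  \<comment> \<open>All relations between the boundaries are decided edge by edge, by placing each
    of the two endpoints in A, B, C or outside; the placement of one endpoint in A and the other in
    C is excluded.\<close>
  have all: "(e \<in> bdry E B \<longleftrightarrow> e \<in> xe \<or> e \<in> ?m \<or> e \<in> yc) \<and> (e \<in> bdry E (A \<union> B) \<longleftrightarrow> e \<in> al \<or> e \<in> ?m \<or> e \<in> yc) \<and>
     (e \<in> bdry E (B \<union> C) \<longleftrightarrow> e \<in> xe \<or> e \<in> ?m \<or> e \<in> ga) \<and> (e \<in> bdry E ?F \<longleftrightarrow> e \<in> al \<or> e \<in> ?m \<or> e \<in> ga) \<and>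
     (e \<in> bdry E A \<longleftrightarrow> e \<in> al \<or> e \<in> xe) \<and> (e \<in> bdry E C \<longleftrightarrow> e \<in> ga \<or> e \<in> yc) \<and>
     (e \<in> inner_edges E ?F \<longleftrightarrow> e \<in> inner_edges E (A \<union> B) \<or> e \<in> inner_edges E (B \<union> C)) \<and>
     (e \<in> inner_edges E B \<longleftrightarrow> e \<in> inner_edges E (A \<union> B) \<and> e \<in> inner_edges E (B \<union> C)) \<and>
     \<not> (e \<in> al \<and> e \<in> xe) \<and> \<not> (e \<in> al \<and> e \<in> ?m) \<and> \<not> (e \<in> al \<and> e \<in> yc) \<and> \<not> (e \<in> al \<and> e \<in> ga) \<and>
     \<not> (e \<in> xe \<and> e \<in> ?m) \<and> \<not> (e \<in> xe \<and> e \<in> yc) \<and> \<not> (e \<in> xe \<and> e \<in> ga) \<and> \<not> (e \<in> yc \<and> e \<in> ?m) \<and>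
     \<not> (e \<in> yc \<and> e \<in> ga) \<and> \<not> (e \<in> ga \<and> e \<in> ?m)" for e
  proof (cases "e \<in> E")
    case True
    then obtain u v where e: "u \<noteq> v" "e = {u, v}" using edges edge_cases2 by metis
    have cu: "u \<in> A \<and> u \<notin> B \<and> u \<notin> C \<or> u \<notin> A \<and> u \<in> B \<and> u \<notin> C \<or> u \<notin> A \<and> u \<notin> B \<and> u \<in> C \<or> u \<notin> A \<and> u \<notin> B \<and> u \<notin> C"
      using disj by blast
    have cv: "v \<in> A \<and> v \<notin> B \<and> v \<notin> C \<or> v \<notin> A \<and> v \<in> B \<and> v \<notin> C \<or> v \<notin> A \<and> v \<notin> B \<and> v \<in> C \<or> v \<notin> A \<and> v \<notin> B \<and> v \<notin> C"
      using disj by blast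
    have ac: "\<not> (u \<in> A \<and> v \<in> C)" "\<not> (v \<in> A \<and> u \<in> C)"
      using noAC[OF True] unfolding e(2) by blast+
    have E: "{u, v} \<in> E" using True e by simp
    show ?thesis using cu cv ac unfolding e(2) parts(1) pdefs bdry_def inner_edges_def
      by (elim disjE conjE; simp add: E)
  qed (auto simp: parts(1) pdefs bdry_def inner_edges_def)
  have decomp: "bdry E B = xe \<union> bl \<union> z \<union> br \<union> yc" "bdry E (A \<union> B) = al \<union> bl \<union> z \<union> br \<union> yc"
     "bdry E (B \<union> C) = xe \<union> bl \<union> z \<union> br \<union> ga" "bdry E ?F = al \<union> bl \<union> z \<union> br \<union> ga"
     "bdry E A = al \<union> xe" "bdry E C = ga \<union> yc"
    and inner: "inner_edges E ?F = inner_edges E (A \<union> B) \<union> inner_edges E (B \<union> C)"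
     "inner_edges E B = inner_edges E (A \<union> B) \<inter> inner_edges E (B \<union> C)"
  proof -
    have a: "e \<in> bdry E B \<longleftrightarrow> e \<in> xe \<or> e \<in> ?m \<or> e \<in> yc" "e \<in> bdry E (A \<union> B) \<longleftrightarrow> e \<in> al \<or> e \<in> ?m \<or> e \<in> yc"
     "e \<in> bdry E (B \<union> C) \<longleftrightarrow> e \<in> xe \<or> e \<in> ?m \<or> e \<in> ga" "e \<in> bdry E ?F \<longleftrightarrow> e \<in> al \<or> e \<in> ?m \<or> e \<in> ga"
     "e \<in> bdry E A \<longleftrightarrow> e \<in> al \<or> e \<in> xe" "e \<in> bdry E C \<longleftrightarrow> e \<in> ga \<or> e \<in> yc"
     "e \<in> inner_edges E ?F \<longleftrightarrow> e \<in> inner_edges E (A \<union> B) \<or> e \<in> inner_edges E (B \<union> C)"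
     "e \<in> inner_edges E B \<longleftrightarrow> e \<in> inner_edges E (A \<union> B) \<and> e \<in> inner_edges E (B \<union> C)" for e
      using all[of e] by simp_all
    show "bdry E B = xe \<union> bl \<union> z \<union> br \<union> yc" using a(1) by auto
    show "bdry E (A \<union> B) = al \<union> bl \<union> z \<union> br \<union> yc" using a(2) by auto
    show "bdry E (B \<union> C) = xe \<union> bl \<union> z \<union> br \<union> ga" using a(3) by auto
    show "bdry E ?F = al \<union> bl \<union> z \<union> br \<union> ga" using a(4) by auto
    show "bdry E A = al \<union> xe" using a(5) by auto
    show "bdry E C = ga \<union> yc" using a(6) by auto
    show "inner_edges E ?F = inner_edges E (A \<union> B) \<union> inner_edges E (B \<union> C)" using a(7) by auto
    show "inner_edges E B = inner_edges E (A \<union> B) \<inter> inner_edges E (B \<union> C)" using a(8) by auto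
  qed
  have dE: "al \<inter> xe = {}" "al \<inter> bl = {}" "al \<inter> z = {}" "al \<inter> br = {}" "al \<inter> yc = {}" "al \<inter> ga = {}"
      "xe \<inter> bl = {}" "xe \<inter> z = {}" "xe \<inter> br = {}" "xe \<inter> yc = {}" "xe \<inter> ga = {}"
      "bl \<inter> z = {}" "bl \<inter> br = {}" "bl \<inter> yc = {}" "bl \<inter> ga = {}"
      "z \<inter> br = {}" "z \<inter> yc = {}" "z \<inter> ga = {}" "br \<inter> yc = {}" "br \<inter> ga = {}" "yc \<inter> ga = {}"
  proof -
    have n: "\<not> (e \<in> al \<and> e \<in> ?m)" "\<not> (e \<in> al \<and> e \<in> xe)" "\<not> (e \<in> al \<and> e \<in> yc)" "\<not> (e \<in> al \<and> e \<in> ga)"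
      "\<not> (e \<in> xe \<and> e \<in> ?m)" "\<not> (e \<in> xe \<and> e \<in> yc)" "\<not> (e \<in> xe \<and> e \<in> ga)"
      "\<not> (e \<in> yc \<and> e \<in> ?m)" "\<not> (e \<in> yc \<and> e \<in> ga)" "\<not> (e \<in> ga \<and> e \<in> ?m)" for e
      using all[of e] by simp_all
    have disjI: "X \<inter> Y = {}" if "\<And>e. \<not> (e \<in> X \<and> e \<in> Y)" for X Y :: "edge set" using that by blast
    note d = n[THEN disjI]
    show "al \<inter> xe = {}" "al \<inter> bl = {}" "al \<inter> z = {}" "al \<inter> br = {}" "al \<inter> yc = {}" "al \<inter> ga = {}"
      "xe \<inter> bl = {}" "xe \<inter> z = {}" "xe \<inter> br = {}" "xe \<inter> yc = {}" "xe \<inter> ga = {}"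
      "bl \<inter> z = {}" "bl \<inter> br = {}" "bl \<inter> yc = {}" "bl \<inter> ga = {}"
      "z \<inter> br = {}" "z \<inter> yc = {}" "z \<inter> ga = {}" "br \<inter> yc = {}" "br \<inter> ga = {}" "yc \<inter> ga = {}"
      using d parts(2-4) by (simp_all add: Int_Un_distrib Int_Un_distrib2 Int_commute)
  qed
  \<comment> \<open>The normalisation factors come from \<open>peps_map_Un\<close>.\<close>
  define WA WC where
    "WA = (\<lambda>k u. complex_of_real (sqrt (real CARD('b))) ^ card xe * V A k u)" and
    "WC = (\<lambda>k u. complex_of_real (sqrt (real CARD('b))) ^ card yc * V C k u)"
  have tf: "finite (touching E A)" "finite (touching E B)" "finite (touching E C)" "finite (touching E (A \<union> B))"
    using locally_finite fin G sub fins by auto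
  have glue1: "V (A \<union> B) k u = (\<Sum>w\<in>configs xe. WA (restrict k A) (override_on (restrict u al) w xe) *
         V B (restrict k B) (override_on (restrict u (bl \<union> z \<union> br \<union> yc)) w xe))"
    if "k \<in> configs (A \<union> B)" "u \<in> configs (bdry E (A \<union> B))" for k u
  proof -
    have s: "bdry E B \<inter> bdry E A = xe" "bdry E A - xe = al" "bdry E B - xe = bl \<union> z \<union> br \<union> yc" "B \<union> A = A \<union> B" "B \<inter> A = {}"
    proof -
      show "bdry E B \<inter> bdry E A = xe" unfolding xe_def by blast
      show "bdry E A - xe = al" unfolding decomp using dE(1) by blast
      show "bdry E B - xe = bl \<union> z \<union> br \<union> yc" unfolding decomp using dE(7-10) by blast
      show "B \<union> A = A \<union> B" "B \<inter> A = {}" using disj(1) by blast+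
    qed
    show ?thesis
      using peps_map_Un[OF edges(2) s(5) fin(2,1) tf(2,1), of k u T] that unfolding s by (simp add: WA_def)
  qed
  have glue2: "V (B \<union> C) k u = (\<Sum>w\<in>configs yc. WC (restrict k C) (override_on (restrict u ga) w yc) *
         V B (restrict k B) (override_on (restrict u (xe \<union> bl \<union> z \<union> br)) w yc))"
    if "k \<in> configs (B \<union> C)" "u \<in> configs (bdry E (B \<union> C))" for k u
  proof -
    have s: "bdry E B \<inter> bdry E C = yc" "bdry E C - yc = ga" "bdry E B - yc = xe \<union> bl \<union> z \<union> br"
    proof -
      show "bdry E B \<inter> bdry E C = yc" unfolding yc_def by blast
      show "bdry E C - yc = ga" unfolding decomp using dE(21) by blast
      show "bdry E B - yc = xe \<union> bl \<union> z \<union> br" unfolding decomp using dE(10,14,17,19) by blast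
    qed
    show ?thesis
      using peps_map_Un[OF edges(2) disj(2) fin(2,3) tf(2,3), of k u T] that unfolding s by (simp add: WC_def)
  qed
  have glue3: "V ?F k u = (\<Sum>w\<in>configs yc. WC (restrict k C) (override_on (restrict u ga) w yc) *
         V (A \<union> B) (restrict k (A \<union> B)) (override_on (restrict u (al \<union> bl \<union> z \<union> br)) w yc))"
    if "k \<in> configs ?F" "u \<in> configs (bdry E ?F)" for k u
  proof -
    have s: "bdry E (A \<union> B) \<inter> bdry E C = yc" "bdry E C - yc = ga" "bdry E (A \<union> B) - yc = al \<union> bl \<union> z \<union> br"
      and d: "(A \<union> B) \<inter> C = {}"
    proof -
      show "bdry E (A \<union> B) \<inter> bdry E C = yc" unfolding decomp using dE(5,6,14,15,17,18,19,20,21) by blast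
      show "bdry E C - yc = ga" unfolding decomp using dE(21) by blast
      show "bdry E (A \<union> B) - yc = al \<union> bl \<union> z \<union> br" unfolding decomp using dE(5,14,17,19) by blast
      show "(A \<union> B) \<inter> C = {}" using disj(2,3) by blast
    qed
    show ?thesis
      using peps_map_Un[OF edges(2) d fins(1) fin(3) tf(4,3), of k u T] that unfolding s by (simp add: WC_def)
  qed
  have finE: "finite al" "finite xe" "finite bl" "finite z" "finite br" "finite yc" "finite ga"
    using finite_bdry(1)[OF fin(1) G(1)] finite_bdry(1)[OF fin(2) G(2)] finite_bdry(1)[OF fin(3) G(3)]
    unfolding decomp by auto
  interpret gt: glued_triple A B C al xe bl z br yc ga "V B" "V (A \<union> B)" "V (B \<union> C)" "V ?F" WA WC
    "bdry E B" "bdry E (A \<union> B)" "bdry E (B \<union> C)" "bdry E ?F"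
    by unfold_locales
       (fact fin finE disj dE decomp peps_map_in_cmats inj_V[OF fin(2) G(2)] inj_V[OF fins(1) sub(1)]
        inj_V[OF fins(2) sub(2)] inj_V[OF fins(3) sub(3)] glue1 glue2 glue3)+
  have Un3: "z \<union> ga \<union> br = z \<union> (ga \<union> br)" "z \<union> yc \<union> br = z \<union> (yc \<union> br)" by auto
  obtain Daz Dzb Odz Ozc where inv: "minvertible (configs (al \<union> bl \<union> z)) Daz" "minvertible (configs (z \<union> ga \<union> br)) Dzb"
      "minvertible (configs (xe \<union> bl \<union> z)) Odz" "minvertible (configs (z \<union> yc \<union> br)) Ozc"
    and close: "mopnorm (D ?F) (mminus (mmult (D ?F) (mmult (D ?F) (msqrt (D ?F) (boundary_state E T ?F))
         (minv (D ?F) (mmult (D ?F) (tensor_ext (z \<union> ga \<union> br) (bdry E ?F) Dzb) (tensor_ext (al \<union> bl \<union> z) (bdry E ?F) Daz))))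
         (msqrt (D ?F) (boundary_state E T ?F))) (mone (D ?F))) \<le> \<epsilon>"
     "mopnorm (D (A \<union> B)) (mminus (mmult (D (A \<union> B)) (mmult (D (A \<union> B)) (msqrt (D (A \<union> B)) (boundary_state E T (A \<union> B)))
         (minv (D (A \<union> B)) (mmult (D (A \<union> B)) (tensor_ext (z \<union> yc \<union> br) (bdry E (A \<union> B)) Ozc) (tensor_ext (al \<union> bl \<union> z) (bdry E (A \<union> B)) Daz))))
         (msqrt (D (A \<union> B)) (boundary_state E T (A \<union> B)))) (mone (D (A \<union> B)))) \<le> \<epsilon>"
     "mopnorm (D (B \<union> C)) (mminus (mmult (D (B \<union> C)) (mmult (D (B \<union> C)) (msqrt (D (B \<union> C)) (boundary_state E T (B \<union> C)))
         (minv (D (B \<union> C)) (mmult (D (B \<union> C)) (tensor_ext (z \<union> ga \<union> br) (bdry E (B \<union> C)) Dzb) (tensor_ext (xe \<union> bl \<union> z) (bdry E (B \<union> C)) Odz))))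
         (msqrt (D (B \<union> C)) (boundary_state E T (B \<union> C)))) (mone (D (B \<union> C)))) \<le> \<epsilon>"
     "mopnorm (D B) (mminus (mmult (D B) (mmult (D B) (minv (D B) (msqrt (D B) (boundary_state E T B)))
         (mmult (D B) (tensor_ext (z \<union> yc \<union> br) (bdry E B) Ozc) (tensor_ext (xe \<union> bl \<union> z) (bdry E B) Odz)))
         (minv (D B) (msqrt (D B) (boundary_state E T B)))) (mone (D B))) \<le> \<epsilon>"
    using fact unfolding approx_factorizable_def Let_def pdefs[symmetric] Un3 by blast
  have \<epsilon>0: "0 \<le> \<epsilon>" by (rule mopnorm_bound(2)[OF finite_bdry(3)[OF fin(2) G(2)] close(4)])
  have Peq: "orthoproj (Q R) (mapply (D R) (V R) ` cvecs (D R)) = P R" for R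
    by (simp add: P_def peps_image_def)
  let ?p = "tensor_ext (A \<union> B) ?F (P (A \<union> B))" and ?q = "tensor_ext (B \<union> C) ?F (P (B \<union> C))" and ?r = "P ?F"
  have pq: "cnorm (Q ?F) (mapply (Q ?F) ?p (mapply (Q ?F) ?q \<phi>) - mapply (Q ?F) ?r \<phi>) \<le> (8 * \<epsilon>) * cnorm (Q ?F) \<phi>" for \<phi>
    using gt.projections_almost_commute[OF inv close[unfolded boundary_state_def] \<epsilon>, of \<phi>] unfolding Peq .
  have absorb: "mmult (Q ?F) ?p ?r = ?r" "mmult (Q ?F) ?q ?r = ?r"
    using gt.PAB_PBC_absorb unfolding Peq by blast+
  have "(1 - 8 * \<epsilon>) * (cnorm (Q ?F) (\<psi> - mapply (Q ?F) ?r \<psi>))\<^sup>2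
     \<le> (cnorm (Q ?F) (\<psi> - mapply (Q ?F) ?p \<psi>))\<^sup>2 + (cnorm (Q ?F) (\<psi> - mapply (Q ?F) ?q \<psi>))\<^sup>2"
    by (rule martingale_inequality[OF finite_bdry(4)[OF fins(3) sub(3)]
          is_orthoproj_tensor_ext[OF fins(3) _ is_orthoproj_P[OF fins(1) sub(1)]]
          is_orthoproj_tensor_ext[OF fins(3) _ is_orthoproj_P[OF fins(2) sub(2)]]
          is_orthoproj_P[OF fins(3) sub(3)] absorb _ pq]) (use \<epsilon>0 in auto)
  from mult_left_mono[OF this gap(3)]
  have "\<gamma> * ((1 - 8 * \<epsilon>) * (cnorm (Q ?F) (\<psi> - mapply (Q ?F) ?r \<psi>))\<^sup>2)
     \<le> energy ?F (inner_edges E (A \<union> B)) \<psi> + energy ?F (inner_edges E (B \<union> C)) \<psi>"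
    using gapped_lift[OF fins(3) sub(3) _ gap(1), of \<psi>] gapped_lift[OF fins(3) sub(3) _ gap(2), of \<psi>]
    by (simp add: distrib_left le_supI1)
  also have "\<dots> = energy ?F (inner_edges E ?F) \<psi> + energy ?F (inner_edges E B) \<psi>"
    unfolding inner energy_def
    by (rule sum.union_inter[symmetric]) (use finite_bdry(2) fins sub in auto)
  finally show ?thesis .
qed

end

section \<open>Plane geometry and the cutting of rectangles\<close>

subsection \<open>Geometry of isometric graphs\<close>

text \<open>Equality in the triangle inequality for the l1 metric puts \<open>w\<close> into the
  bounding box of \<open>u\<close> and \<open>v\<close>. This makes rectangles geodesically convex
  in an isometric graph.\<close>

lemma l1_between:
  assumes "l1_dist u w + l1_dist w v \<le> l1_dist u v"
  shows "min (fst u) (fst v) \<le> fst w" "fst w \<le> max (fst u) (fst v)"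
    "min (snd u) (snd v) \<le> snd w" "snd w \<le> max (snd u) (snd v)"
  using assms unfolding l1_dist_def by linarith+

locale isometric_graph =
  fixes G :: "vertex set" and E :: "edge set"
  assumes isometric: "isometric_planar_graph G E"
begin

lemma edge_subset: "e \<in> E \<Longrightarrow> e \<subseteq> G" and card_edge: "e \<in> E \<Longrightarrow> card e = 2"
  using isometric by (auto simp: isometric_planar_graph_def)

lemma graph_dist_path:
  assumes "u \<in> G" "v \<in> G"
  shows "(u, v) \<in> adj E ^^ graph_dist E u v" "l1_dist u v = real (graph_dist E u v)"
proof -
  have "(u, v) \<in> (adj E)\<^sup>*" using isometric assms by (simp add: isometric_planar_graph_def)
  then obtain n where "(u, v) \<in> adj E ^^ n" using rtrancl_power by blast
  then show "(u, v) \<in> adj E ^^ graph_dist E u v" unfolding graph_dist_def by (rule LeastI)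
  show "l1_dist u v = real (graph_dist E u v)"
    using isometric assms by (simp add: isometric_planar_graph_def)
qed

lemma graph_dist_le: "(u, v) \<in> adj E ^^ n \<Longrightarrow> graph_dist E u v \<le> n"
  unfolding graph_dist_def by (rule Least_le)

lemma graph_dist_pos: "u \<in> G \<Longrightarrow> v \<in> G \<Longrightarrow> u \<noteq> v \<Longrightarrow> 0 < graph_dist E u v"
  using graph_dist_path(1)[of u v] by (cases "graph_dist E u v") auto

lemma l1_dist_ge_1: "u \<in> G \<Longrightarrow> v \<in> G \<Longrightarrow> u \<noteq> v \<Longrightarrow> 1 \<le> l1_dist u v"
  using graph_dist_pos[of u v] graph_dist_path(2)[of u v] by simp

lemma l1_dist_edge:
  assumes "{u, v} \<in> E"
  shows "l1_dist u v = 1"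
proof -
  have G: "u \<in> G" "v \<in> G" using edge_subset[OF assms] by auto
  have ne: "u \<noteq> v" using card_edge[OF assms] by auto
  have "(u, v) \<in> adj E ^^ 1" using assms by (simp add: adj_def)
  from graph_dist_le[OF this] graph_dist_pos[OF G ne] show ?thesis using graph_dist_path(2)[OF G] by simp
qed

text \<open>The first step of a shortest path. Lengths of paths are l1 distances, so the triangle
  inequality is tight at \<open>w\<close>.\<close>

lemma geodesic_step:
  assumes G: "u \<in> G" "v \<in> G" and ne: "u \<noteq> v"
  obtains w where "{u, w} \<in> E" "w \<in> G" "graph_dist E w v < graph_dist E u v"
    "l1_dist u w + l1_dist w v \<le> l1_dist u v"
proof -
  obtain m where m: "graph_dist E u v = Suc m" using graph_dist_pos[OF assms] by (cases "graph_dist E u v") auto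
  then have "(u, v) \<in> adj E ^^ Suc m" using graph_dist_path(1)[OF G] by simp
  then obtain w where w: "(u, w) \<in> adj E" "(w, v) \<in> adj E ^^ m" by (rule relpow_Suc_E2)
  then have uw: "{u, w} \<in> E" by (simp add: adj_def)
  then have wG: "w \<in> G" using edge_subset by blast
  have "graph_dist E w v \<le> m" using w(2) by (rule graph_dist_le)
  then show ?thesis using that[OF uw wG] l1_dist_edge[OF uw] graph_dist_path(2)[OF wG G(2)] graph_dist_path(2)[OF G] m by simp
qed

subsection \<open>Rectangles\<close>

lemma rectangle_subset: "rectangle G p x w y h \<subseteq> G"
  by (auto simp: rectangle_def)

lemma rectangle_swap: "rectangle G p x w y h = rectangle G (prod.swap \<circ> p) y h x w"
  by (auto simp: rectangle_def)

lemma between_in_rectangle: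
  assumes "u \<in> rectangle G p x w y h" "v \<in> rectangle G p x w y h" "z \<in> G" "p \<in> {id, prod.swap}"
    and "l1_dist u z + l1_dist z v \<le> l1_dist u v"
  shows "z \<in> rectangle G p x w y h"
  using assms(1-4) l1_between[OF assms(5)] by (auto simp: rectangle_def min_def max_def split: if_splits)

text \<open>On a half-open interval of length at most L the function floor (2 t) takes at most
  \<open>nat \<lceil>2 * L\<rceil> + 2\<close> values; the square is for the two
  coordinates.\<close>

definition cells :: "real \<Rightarrow> nat" where
  "cells L = (nat \<lceil>2 * L\<rceil> + 2) * (nat \<lceil>2 * L\<rceil> + 2)"

text \<open>A half-open square of side \<open>1/2\<close> contains at most one vertex.\<close>

lemma rectangle_card:
  assumes p: "p \<in> {id, prod.swap}" and w: "w \<le> L" and h: "h \<le> L"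
  shows "finite (rectangle G p x w y h)" "card (rectangle G p x w y h) \<le> cells L"
proof -
  let ?R = "rectangle G p x w y h"
  let ?f = "\<lambda>v. (\<lfloor>2 * fst (p v)\<rfloor>, \<lfloor>2 * snd (p v)\<rfloor>)"
  have inj: "inj_on ?f ?R"
  proof (rule inj_onI, rule ccontr)
    fix u v assume u: "u \<in> ?R" and v: "v \<in> ?R" and eq: "?f u = ?f v" and ne: "u \<noteq> v"
    from eq have "\<lfloor>2 * fst (p u)\<rfloor> = \<lfloor>2 * fst (p v)\<rfloor>" "\<lfloor>2 * snd (p u)\<rfloor> = \<lfloor>2 * snd (p v)\<rfloor>" by simp_all
    \<comment> \<open>Both coordinates differ by less than 1/2, so the l1 distance is below 1,
      whereas distinct vertices have graph distance at least 1.\<close>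
    then have "\<bar>2 * fst (p u) - 2 * fst (p v)\<bar> < 1" "\<bar>2 * snd (p u) - 2 * snd (p v)\<bar> < 1" by linarith+
    then have "l1_dist u v < 1" using p by (auto simp: l1_dist_def)
    moreover have "1 \<le> l1_dist u v" using u v ne l1_dist_ge_1 rectangle_subset by blast
    ultimately show False by simp
  qed
  let ?n = "int (nat \<lceil>2 * L\<rceil>)"
  let ?box = "\<lambda>x. {\<lfloor>2 * x\<rfloor>..\<lfloor>2 * x\<rfloor> + ?n + 1}"
  have sub: "?f ` ?R \<subseteq> ?box x \<times> ?box y"
  proof
    fix q assume "q \<in> ?f ` ?R"
    then obtain v where v: "v \<in> ?R" "q = ?f v" by blast
    have "\<lfloor>2 * t\<rfloor> \<in> ?box a" if "a \<le> t" "t < a + w'" "w' \<le> L" for a t w'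
    proof -
      have "0 \<le> 2 * L" using that by simp
      then have "2 * L \<le> real_of_int ?n" by (simp add: le_of_int_ceiling)
      then have "2 * t < 2 * a + real_of_int ?n" using that by linarith
      then show ?thesis using that by (auto intro: floor_mono) linarith
    qed
    then show "q \<in> ?box x \<times> ?box y" using v w h unfolding rectangle_def by auto
  qed
  have fin: "finite (?box x \<times> ?box y)" by simp
  note c = card_mono[OF fin sub]
  show "finite ?R" using finite_subset[OF sub fin] inj finite_image_iff by blast
  have "card {a..a + int m + 1} = m + 2" for a :: int and m :: nat by simp
  then show "card ?R \<le> cells L"
    using c card_image[OF inj] unfolding cells_def card_cartesian_product by (simp only:)
qed

text \<open>The factorization hypothesis speaks about rectangles inside a square region; this
  supplies the square.\<close>

lemma rectangle_in_square:
  assumes p: "p \<in> {id, prod.swap}"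
  obtains \<Lambda> where "square_region G \<Lambda>" "rectangle G p x w y h \<subseteq> \<Lambda>"
proof -
  define l where "l = \<bar>x\<bar> + \<bar>y\<bar> + \<bar>w\<bar> + \<bar>h\<bar> + 1"
  have "rectangle G p x w y h \<subseteq> rectangle G id (- l) (2 * l) (- l) (2 * l)"
    using p unfolding rectangle_def l_def by auto
  moreover have "square_region G (rectangle G id (- l) (2 * l) (- l) (2 * l))"
    unfolding square_region_def by (intro exI[of _ "- l"] exI[of _ "2 * l"]) (auto simp: l_def)
  ultimately show ?thesis by (rule that[rotated])
qed

text \<open>The first step of a geodesic towards another vertex of the rectangle stays in the
  rectangle. The bound for small regions needs this, since a vertex without an inner edge would not
  be constrained by any local term.\<close>

lemma rectangle_vertex_covered:
  assumes p: "p \<in> {id, prod.swap}" and c: "2 \<le> card (rectangle G p x w y h)" and v: "v \<in> rectangle G p x w y h"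
  obtains e where "e \<in> inner_edges E (rectangle G p x w y h)" "v \<in> e"
proof -
  have "rectangle G p x w y h \<noteq> {v}" using c by auto
  then obtain u where u: "u \<in> rectangle G p x w y h" "u \<noteq> v" using v by blast
  have G: "u \<in> G" "v \<in> G" using u v rectangle_subset by blast+
  obtain z where z: "{v, z} \<in> E" "z \<in> G" "l1_dist v z + l1_dist z u \<le> l1_dist v u"
    using geodesic_step[OF G(2,1)] u(2) by metis
  then have "z \<in> rectangle G p x w y h" using between_in_rectangle[OF v u(1) z(2) p] by simp
  then show ?thesis using that[of "{v, z}"] z(1) v by (simp add: inner_edges_def)
qed

lemma fst_edge:
  assumes "p \<in> {id, prod.swap}" "{u, v} \<in> E"
  shows "\<bar>fst (p u) - fst (p v)\<bar> \<le> 1"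
  using l1_dist_edge[OF assms(2)] assms(1) by (auto simp: l1_dist_def)

text \<open>Along an edge a coordinate changes by at most 1, but from the left to the right
  rectangle it must grow by more than \<open>b\<close>.\<close>

lemma no_edge_across:
  assumes p: "p \<in> {id, prod.swap}" and b: "1 \<le> b" and e: "e \<in> E"
  shows "e \<inter> rectangle G p x w y h = {} \<or> e \<inter> rectangle G p (x + w + b) w' y h = {}"
proof (rule ccontr)
  assume "\<not> ?thesis"
  then obtain u v where u: "u \<in> e" "u \<in> rectangle G p x w y h" and v: "v \<in> e" "v \<in> rectangle G p (x + w + b) w' y h"
    by blast
  then have lt: "fst (p u) < x + w" "x + w + b \<le> fst (p v)" by (auto simp: rectangle_def)
  then have "u \<noteq> v" using b by auto
  obtain a a' where "e = {a, a'}" "a \<noteq> a'" using card_edge[OF e] by (auto simp: card_2_iff)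
  then have "e = {u, v}" using u v \<open>u \<noteq> v\<close> by auto
  then show False using fst_edge[OF p, of u v] e lt b by simp
qed

text \<open>A geodesic from left to right stays in the large rectangle and moves by at most 1 \<le>
  \<open>b\<close> per step, so it cannot jump over the middle strip. The induction follows it until
  it leaves the left part.\<close>

lemma middle_nonempty:
  assumes p: "p \<in> {id, prod.swap}" and b: "1 \<le> b" and u: "u \<in> rectangle G p x w y h"
    and v: "v \<in> rectangle G p (x + w + b) w' y h" and w': "0 < w" "0 < w'"
  shows "rectangle G p (x + w) b y h \<noteq> {}"
  using u
proof (induction "graph_dist E u v" arbitrary: u rule: less_induct)
  case less
  have uv: "u \<noteq> v" using less.prems v b by (auto simp: rectangle_def)
  have G: "u \<in> G" "v \<in> G" using less.prems v rectangle_subset by blast+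
  obtain z where z: "{u, z} \<in> E" "z \<in> G" "graph_dist E z v < graph_dist E u v"
    "l1_dist u z + l1_dist z v \<le> l1_dist u v" using geodesic_step[OF G uv] .
  have "u \<in> rectangle G p x (w + b + w') y h" "v \<in> rectangle G p x (w + b + w') y h"
    using less.prems v b w' by (auto simp: rectangle_def)
  then have zr: "z \<in> rectangle G p x (w + b + w') y h" using between_in_rectangle z p by metis
  show ?case
  proof (cases "fst (p z) < x + w")
    case True
    then have "z \<in> rectangle G p x w y h" using zr by (auto simp: rectangle_def)
    then show ?thesis using less.hyps[OF z(3)] by blast
  next
    case False
    have "fst (p u) < x + w" using less.prems by (auto simp: rectangle_def)
    then have "fst (p z) < x + w + b" using fst_edge[OF p z(1)] b by linarith
    then have "z \<in> rectangle G p (x + w) b y h" using False zr by (auto simp: rectangle_def)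
    then show ?thesis by blast
  qed
qed

lemma incident_card:
  assumes v: "v \<in> G"
  shows "finite (incident E v)" "card (incident E v) \<le> cells 3"
proof -
  \<comment> \<open>The side is 3 and not 2 because the rectangle is half-open and has to contain
    the neighbours at distance 1 above and to the right.\<close>
  let ?R = "rectangle G id (fst v - 1) 3 (snd v - 1) 3"
  have sub: "incident E v \<subseteq> (\<lambda>w. {v, w}) ` ?R"
  proof
    fix e assume "e \<in> incident E v"
    then have e: "e \<in> E" "v \<in> e" by (auto simp: incident_def)
    obtain a b where "e = {a, b}" using edge_cases2[OF card_edge[OF e(1)]] by metis
    then have "e = {v, a} \<or> e = {v, b}" using e(2) by auto
    then obtain w where w: "e = {v, w}" by blast
    have "l1_dist v w = 1" using l1_dist_edge e(1) w by simp
    then have "w \<in> ?R" using edge_subset[OF e(1)] w unfolding rectangle_def l1_dist_def by auto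
    then show "e \<in> (\<lambda>w. {v, w}) ` ?R" using w by blast
  qed
  have R: "finite ?R" "card ?R \<le> cells 3" using rectangle_card[of id 3 3 3] by auto
  show "finite (incident E v)" using sub R(1) finite_subset by blast
  have "card (incident E v) \<le> card ?R"
    using sub R(1) card_image_le[OF R(1), of "\<lambda>w. {v, w}"] card_mono[OF finite_imageI[OF R(1)] sub] by linarith
  with R(2) show "card (incident E v) \<le> cells 3" by simp
qed

lemma finite_touching:
  assumes "finite \<Lambda>" "\<Lambda> \<subseteq> G"
  shows "finite (touching E \<Lambda>)"
proof -
  have "touching E \<Lambda> = {e \<in> E. e \<inter> \<Lambda> \<noteq> {}}" by (rule touching_eq) (rule card_edge)
  then have "touching E \<Lambda> \<subseteq> (\<Union>v\<in>\<Lambda>. incident E v)" by (auto simp: incident_def)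
  moreover have "finite (\<Union>v\<in>\<Lambda>. incident E v)" using assms incident_card by blast
  ultimately show ?thesis by (rule finite_subset)
qed

end

subsection \<open>Cutting a rectangle\<close>

locale isometric_network = isometric_graph G E for G E +
  fixes T :: "('p::finite, 'b::finite) peps"
  assumes injective: "injective_peps G E T"
begin

sublocale injective_network G E T
  by unfold_locales (use edge_subset card_edge finite_touching injective in auto)

text \<open>An edge leaving B has exactly one endpoint in B, and the position of that endpoint
  selects exactly one of the three strips.\<close>

lemma outer_edges_partition:
  assumes "s \<le> t"
  shows "outer_edges E p A B C {..<s} \<union> outer_edges E p A B C {s..<t} \<union> outer_edges E p A B C {t..}
      = bdry E B \<inter> bdry E (A \<union> B \<union> C)"
    and "outer_edges E p A B C {..<s} \<inter> outer_edges E p A B C {s..<t} = {}"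
    and "outer_edges E p A B C {..<s} \<inter> outer_edges E p A B C {t..} = {}"
    and "outer_edges E p A B C {s..<t} \<inter> outer_edges E p A B C {t..} = {}"
proof -
  have one: "\<exists>u. e \<inter> B = {u}" if e: "e \<in> bdry E B \<inter> bdry E (A \<union> B \<union> C)" for e
  proof -
    have "e \<in> E" using e by (simp add: bdry_def)
    then obtain u v where uv: "e = {u, v}" using edge_cases2[OF card_edge] by metis
    then show ?thesis using e unfolding bdry_def by auto
  qed
  have iff: "e \<in> outer_edges E p A B C X \<longleftrightarrow> e \<in> bdry E B \<inter> bdry E (A \<union> B \<union> C) \<and> fst (p u) \<in> X"
    if "e \<inter> B = {u}" for e u X
    using that by (simp add: outer_edges_def)
  have sub: "e \<in> outer_edges E p A B C X \<Longrightarrow> e \<in> bdry E B \<inter> bdry E (A \<union> B \<union> C)" for e X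
    by (simp add: outer_edges_def)
  have dj: "outer_edges E p A B C X \<inter> outer_edges E p A B C Y = {}" if "X \<inter> Y = {}" for X Y
  proof (rule ccontr)
    assume "outer_edges E p A B C X \<inter> outer_edges E p A B C Y \<noteq> {}"
    then obtain e where e: "e \<in> outer_edges E p A B C X" "e \<in> outer_edges E p A B C Y" by blast
    obtain u where u: "e \<inter> B = {u}" using one[OF sub[OF e(1)]] by blast
    have "fst (p u) \<in> X \<inter> Y" using e unfolding iff[OF u] by simp
    with that show False by simp
  qed
  show "outer_edges E p A B C {..<s} \<inter> outer_edges E p A B C {s..<t} = {}"
    "outer_edges E p A B C {..<s} \<inter> outer_edges E p A B C {t..} = {}"
    "outer_edges E p A B C {s..<t} \<inter> outer_edges E p A B C {t..} = {}"
    by (rule dj; use assms(1) in auto)+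
  show "outer_edges E p A B C {..<s} \<union> outer_edges E p A B C {s..<t} \<union> outer_edges E p A B C {t..}
      = bdry E B \<inter> bdry E (A \<union> B \<union> C)"
  proof (intro equalityI subsetI)
    fix e assume e: "e \<in> bdry E B \<inter> bdry E (A \<union> B \<union> C)"
    obtain u where u: "e \<inter> B = {u}" using one[OF e] by blast
    show "e \<in> outer_edges E p A B C {..<s} \<union> outer_edges E p A B C {s..<t} \<union> outer_edges E p A B C {t..}"
      unfolding Un_iff iff[OF u] using e by auto
  qed (use sub in blast)
qed

lemma energy_disjoint_sum:
  assumes "finite N" "finite S" "\<And>i. i \<in> N \<Longrightarrow> X i \<subseteq> S"
    and "\<And>i j. i \<in> N \<Longrightarrow> j \<in> N \<Longrightarrow> i \<noteq> j \<Longrightarrow> X i \<inter> X j = {}"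
  shows "(\<Sum>i\<in>N. energy F (X i) \<psi>) \<le> energy F S \<psi>"
proof -
  have "(\<Sum>i\<in>N. energy F (X i) \<psi>) = energy F (\<Union>i\<in>N. X i) \<psi>"
    unfolding energy_def by (rule sum.UNION_disjoint[symmetric]) (use assms finite_subset in blast)+
  also have "\<dots> \<le> energy F S \<psi>" by (rule energy_mono) (use assms in auto)
  finally show ?thesis .
qed

text \<open>The overlaps are n consecutive strips of width w / (3 n) that fill the middle third, so
  both pieces of every cut have width at most 2 w / 3. The half-open strips are disjoint and share
  no inner edge; hence the doubly counted energies of all n cuts together are at most the energy H
  of the rectangle. Adding the n inequalities gives n times the lower bound on the left and (n + 1)
  H on the right.\<close>

lemma cut_rectangle:
  fixes n :: nat and \<gamma> \<eta> x y w h :: real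
  assumes p: "p \<in> {id, prod.swap}" and card: "2 \<le> card (rectangle G p x w y h)"
    and n: "0 < n" and \<gamma>: "0 \<le> \<gamma>" and \<eta>: "\<eta> \<le> 1" "8 * \<eta> \<le> 1"
    and wide: "3 * real n \<le> w"
    and IH: "\<And>x' w'. w' \<le> 2 / 3 * w \<Longrightarrow> 2 \<le> card (rectangle G p x' w' y h) \<Longrightarrow> gapped (rectangle G p x' w' y h) \<gamma>"
    and fact: "\<And>l\<^sub>A l\<^sub>C A B C. l\<^sub>A \<le> w \<Longrightarrow> l\<^sub>C \<le> w \<Longrightarrow>
       adjacent_rectangles G E p x l\<^sub>A (w / (3 * real n)) l\<^sub>C h A B C \<Longrightarrow>
       \<exists>\<epsilon>\<le>\<eta>. rectangles_factorizable E T \<epsilon> p x l\<^sub>A (w / (3 * real n)) A B C"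
    and \<eta>0: "0 \<le> \<eta>"
  shows "gapped (rectangle G p x w y h) (\<gamma> * ((1 - 8 * \<eta>) * (real n / (real n + 1))))"
proof -
  define R where "R = rectangle G p x w y h"
  define b where "b = w / (3 * real n)"
  have b1: "1 \<le> b" using wide n by (simp add: b_def field_simps)
  have w0: "0 < w" using wide n by linarith
  have nb: "real n * b = w / 3" using n by (simp add: b_def)
  have R: "finite R" "R \<subseteq> G" using card rectangle_subset by (auto simp: R_def intro: card_ge_0_finite)
  have h0: "0 < h"
  proof (rule ccontr)
    assume "\<not> 0 < h"
    then have "rectangle G p x w y h = {}" by (auto simp: rectangle_def)
    with card show False by simp
  qed
  \<comment> \<open>Left of the i-th strip lie the first third and the strips before it.\<close>
  define lA :: "nat \<Rightarrow> real" where "lA = (\<lambda>i. w / 3 + real i * b)"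
  define lC :: "nat \<Rightarrow> real" where "lC = (\<lambda>i. w - lA i - b)"
  define A B C where "A i = rectangle G p x (lA i) y h" and "B i = rectangle G p (x + lA i) b y h"
    and "C i = rectangle G p (x + lA i + b) (lC i) y h" for i
  have ib: "real i * b + b \<le> w / 3" if "i < n" for i
  proof -
    have "(real i + 1) * b \<le> real n * b" using that b1 by (intro mult_right_mono) auto
    then show ?thesis using nb by (simp add: algebra_simps)
  qed
  have ib0: "0 \<le> real i * b" for i using b1 by simp
  have pos: "0 < lA i" "0 < lC i" "lA i \<le> w" "lC i \<le> w" "lA i + b \<le> 2 / 3 * w" "lC i + b \<le> 2 / 3 * w" if "i < n" for i
    unfolding lA_def lC_def using ib[OF that] ib0[of i] w0 b1 by linarith+
  have AB: "A i \<union> B i = rectangle G p x (lA i + b) y h" and BC: "B i \<union> C i = rectangle G p (x + lA i) (lC i + b) y h"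
    and ABC: "A i \<union> B i \<union> C i = R" if "i < n" for i
    using pos[OF that] b1 by (auto simp: A_def B_def C_def rectangle_def R_def lC_def)
  have f: "0 \<le> 1 - 8 * \<eta>" "1 - 8 * \<eta> \<le> 1" using \<eta> \<eta>0 by auto
  have "(1 - 8 * \<eta>) * (real n / (real n + 1)) \<le> 1 * 1"
    using f by (intro mult_mono) auto
  from mult_left_mono[OF this \<gamma>] have fac: "\<gamma> * ((1 - 8 * \<eta>) * (real n / (real n + 1))) \<le> \<gamma>" by simp
  show ?thesis
  proof (cases "\<exists>i<n. A i = {} \<or> C i = {}")
    case True
    \<comment> \<open>In a sparse graph an outer piece may contain no vertex. Then the rectangle
      equals, as a set of vertices, one of the narrower rectangles of the induction
      hypothesis.\<close>
    then obtain i where i: "i < n" "A i = {} \<or> C i = {}" by blast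
    have "gapped R \<gamma>"
    proof (cases "A i = {}")
      case True
      then have "R = rectangle G p (x + lA i) (lC i + b) y h" using ABC[OF i(1)] BC[OF i(1)] by simp
      then show ?thesis using IH[OF pos(6)[OF i(1)], of "x + lA i"] card by (simp add: R_def)
    next
      case False
      then have "R = rectangle G p x (lA i + b) y h" using i ABC[OF i(1)] AB[OF i(1)] by simp
      then show ?thesis using IH[OF pos(5)[OF i(1)], of x] card by (simp add: R_def)
    qed
    then show ?thesis using gapped_mono[OF _ fac] by (simp add: R_def)
  next
    case False
    then have ne: "A i \<noteq> {}" "C i \<noteq> {}" if "i < n" for i using that by blast+
    have main: "\<gamma> * ((1 - 8 * \<eta>) * (cnorm (Q R) (\<psi> - mapply (Q R) (P R) \<psi>))\<^sup>2)
        \<le> energy R (inner_edges E R) \<psi> + energy R (inner_edges E (B i)) \<psi>"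
      if i: "i < n" and \<psi>: "\<psi> \<in> cvecs (Q R)" for i \<psi>
    proof -
      have Bne: "B i \<noteq> {}"
      proof -
        obtain u v where "u \<in> A i" "v \<in> C i" using ne[OF i] by blast
        then show ?thesis unfolding A_def B_def C_def
          by (rule middle_nonempty[OF p b1 _ _ pos(1,2)[OF i]])
      qed
      have disj: "A i \<inter> B i = {}" "B i \<inter> C i = {}" "A i \<inter> C i = {}"
        using b1 by (auto simp: A_def B_def C_def rectangle_def)
      have noAC: "e \<inter> A i = {} \<or> e \<inter> C i = {}" if "e \<in> E" for e
        unfolding A_def C_def by (rule no_edge_across[OF p b1 that])
      have adj: "adjacent_rectangles G E p x (lA i) b (lC i) h (A i) (B i) (C i)"
        unfolding adjacent_rectangles_def
        using p pos[OF i] b1 h0 ne[OF i] Bne noAC by (auto simp: A_def B_def C_def)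
      obtain \<epsilon> where \<epsilon>: "\<epsilon> \<le> \<eta>" "rectangles_factorizable E T \<epsilon> p x (lA i) b (A i) (B i) (C i)"
        using fact[OF pos(3,4)[OF i] adj[unfolded b_def]] unfolding b_def by blast
      obtain l s t where lst: "0 < l" "s + l \<le> t" and af: "approx_factorizable E T \<epsilon> (A i) (B i) (C i)
          (outer_edges E p (A i) (B i) (C i) {..<s}) (outer_edges E p (A i) (B i) (C i) {s..<t}) (outer_edges E p (A i) (B i) (C i) {t..})"
        using \<epsilon>(2) unfolding rectangles_factorizable_def by blast
      have st: "s \<le> t" using lst by simp
      have fin: "finite (A i)" "finite (B i)" "finite (C i)" and sub: "A i \<subseteq> G" "B i \<subseteq> G" "C i \<subseteq> G"
        using R ABC[OF i] finite_subset[of _ R] by auto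
      have two: "2 \<le> card (X \<union> Y)" if "X \<noteq> {}" "Y \<noteq> {}" "X \<inter> Y = {}" "finite X" "finite Y" for X Y :: "vertex set"
      proof -
        have "card X > 0" "card Y > 0" using that by (simp_all add: card_gt_0_iff)
        then show ?thesis using that by (simp add: card_Un_disjoint)
      qed
      have g1: "gapped (A i \<union> B i) \<gamma>"
        using IH[OF pos(5)[OF i], of x] two[OF ne(1)[OF i] Bne disj(1) fin(1,2)] unfolding AB[OF i] by simp
      have g2: "gapped (B i \<union> C i) \<gamma>"
        using IH[OF pos(6)[OF i], of "x + lA i"] two[OF Bne ne(2)[OF i] disj(2) fin(2,3)] unfolding BC[OF i] by simp
      have "\<epsilon> \<le> 1" using \<epsilon> \<eta> by simp
      have "\<gamma> * ((1 - 8 * \<epsilon>) * (cnorm (Q R) (\<psi> - mapply (Q R) (P R) \<psi>))\<^sup>2)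
          \<le> energy R (inner_edges E R) \<psi> + energy R (inner_edges E (B i)) \<psi>"
        using three_regions[OF fin sub disj noAC outer_edges_partition[OF st] af \<open>\<epsilon> \<le> 1\<close> g1 g2 \<gamma>, of \<psi>]
        unfolding ABC[OF i] by simp
      moreover have "\<gamma> * ((1 - 8 * \<eta>) * (cnorm (Q R) (\<psi> - mapply (Q R) (P R) \<psi>))\<^sup>2)
         \<le> \<gamma> * ((1 - 8 * \<epsilon>) * (cnorm (Q R) (\<psi> - mapply (Q R) (P R) \<psi>))\<^sup>2)"
        using \<epsilon> by (intro mult_left_mono[OF _ \<gamma>] mult_right_mono) auto
      ultimately show ?thesis by linarith
    qed
    have "gapped R (\<gamma> * ((1 - 8 * \<eta>) * (real n / (real n + 1))))"
      unfolding gapped_def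
    proof
      fix \<psi> assume \<psi>: "\<psi> \<in> cvecs (Q R)"
      define N where "N = (cnorm (Q R) (\<psi> - mapply (Q R) (P R) \<psi>))\<^sup>2"
      define H where "H = energy R (inner_edges E R) \<psi>"
      \<comment> \<open>All n cuts are used at once; dividing by n + 1 at the end yields the factor
        n / (n + 1).\<close>
      have "(\<Sum>i<n. \<gamma> * ((1 - 8 * \<eta>) * N)) \<le> (\<Sum>i<n. H + energy R (inner_edges E (B i)) \<psi>)"
        by (rule sum_mono) (use main \<psi> in \<open>simp add: N_def H_def\<close>)
      also have "\<dots> = real n * H + (\<Sum>i<n. energy R (inner_edges E (B i)) \<psi>)" by (simp add: sum.distrib)
      also have "(\<Sum>i<n. energy R (inner_edges E (B i)) \<psi>) \<le> H"
        unfolding H_def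
      proof (rule energy_disjoint_sum)
        show "finite (inner_edges E R)" using finite_bdry(2)[OF R] .
        show "inner_edges E (B i) \<subseteq> inner_edges E R" if "i \<in> {..<n}" for i
          using ABC[of i] that unfolding inner_edges_def by auto
        show "inner_edges E (B i) \<inter> inner_edges E (B j) = {}" if "i \<noteq> j" for i j
        proof -
          have less: "B i \<inter> B j = {}" if "i < j" for i j
          proof -
            have "(real i + 1) * b \<le> real j * b" using that b1 by (intro mult_right_mono) auto
            then have "lA i + b \<le> lA j" by (simp add: lA_def algebra_simps)
            then show ?thesis by (auto simp: B_def rectangle_def)
          qed
          have "B i \<inter> B j = {}" using less[of i j] less[of j i] that by (cases "i < j") auto
          moreover have "e \<noteq> {}" if "e \<in> E" for e using card_edge[OF that] by auto
          ultimately show ?thesis unfolding inner_edges_def by blast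
        qed
      qed simp
      finally have "real n * (\<gamma> * ((1 - 8 * \<eta>) * N)) \<le> (real n + 1) * H" by (simp add: algebra_simps)
      then show "\<gamma> * ((1 - 8 * \<eta>) * (real n / (real n + 1))) * N \<le> H"
        by (simp add: field_simps)
    qed
    then show ?thesis by (simp add: R_def)
  qed
qed

end

section \<open>The initial gap: explicit constants for regions of bounded size\<close>

subsection \<open>A quantitative gap for bounded regions\<close>

text \<open>
  Let \<open>L\<^sub>v\<close> be a left inverse of \<open>T\<^sub>v\<close>. On the virtual level the operators \<open>w\<^sub>e\<close> with
  \<open>(w\<^sub>e g) \<eta> = g (\<eta> with both values at e reset)\<close> if the two values of \<open>\<eta>\<close> at \<open>e\<close> agree, and \<open>0\<close>
  otherwise, are commuting idempotents, and the range of \<open>w\<^sub>e\<close> is \<open>\<omega>\<^sub>e \<otimes> (anything)\<close>. Hence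
  \<open>(\<Otimes> T) (\<Prod> w\<^sub>e) (\<Otimes> L)\<close> maps into the ground space, and it is reached from the identity by
  finitely many steps each of which kills the ground space of one edge term.
\<close>

locale covered_region = injective_network G E T
  for G E and T :: "('p::finite, 'b::finite) peps" +
  fixes \<Lambda> :: "vertex set" and L :: "vertex \<Rightarrow> (edge \<Rightarrow> 'b) \<Rightarrow> 'p \<Rightarrow> complex" and K :: real
  assumes fin: "finite \<Lambda>" and sub: "\<Lambda> \<subseteq> G"
    and covered: "\<And>v. v \<in> \<Lambda> \<Longrightarrow> \<exists>e\<in>inner_edges E \<Lambda>. v \<in> e"
    and LT: "\<And>v \<beta> \<beta>'. v \<in> \<Lambda> \<Longrightarrow> \<beta> \<in> configs (incident E v) \<Longrightarrow> \<beta>' \<in> configs (incident E v) \<Longrightarrow>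
      (\<Sum>k\<in>UNIV. L v \<beta> k * T v k \<beta>') = (if \<beta> = \<beta>' then 1 else 0)"
    and K: "\<And>v k k' \<beta> \<beta>'. v \<in> \<Lambda> \<Longrightarrow> \<beta> \<in> configs (incident E v) \<Longrightarrow> \<beta>' \<in> configs (incident E v) \<Longrightarrow>
      cmod (T v k \<beta>) * cmod (L v \<beta>' k') \<le> K" "1 \<le> K"
begin

abbreviation "I v \<equiv> configs (incident E v) :: (edge \<Rightarrow> 'b) set"
abbreviation "Q\<^sub>\<Lambda> \<equiv> configs \<Lambda> :: (vertex \<Rightarrow> 'p) set"

text \<open>Half-edge configurations grouped by vertex: \<eta> v e is the value at the end of e at
  v, so it can be fed to the map of v directly.\<close>

definition "VC = (\<Pi>\<^sub>E v\<in>\<Lambda>. I v)"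

text \<open>\<open>undefined\<close> is merely one fixed element of the edge space, serving as
  reference value at both ends of every edge in \<open>S\<close>.\<close>

definition reset :: "edge set \<Rightarrow> (vertex \<Rightarrow> edge \<Rightarrow> 'b) \<Rightarrow> vertex \<Rightarrow> edge \<Rightarrow> 'b" where
  "reset S \<eta> = (\<lambda>v\<in>\<Lambda>. \<lambda>e\<in>incident E v. if e \<in> S then undefined else \<eta> v e)"

definition diag :: "edge set \<Rightarrow> (vertex \<Rightarrow> edge \<Rightarrow> 'b) \<Rightarrow> bool" where
  "diag S \<eta> \<longleftrightarrow> (\<forall>e\<in>S. \<forall>u\<in>e. \<forall>v\<in>e. \<eta> u e = \<eta> v e)"

definition virt :: "((vertex \<Rightarrow> 'p) \<Rightarrow> complex) \<Rightarrow> (vertex \<Rightarrow> edge \<Rightarrow> 'b) \<Rightarrow> complex" where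
  "virt \<psi> \<eta> = (\<Sum>k\<in>Q\<^sub>\<Lambda>. (\<Prod>v\<in>\<Lambda>. L v (\<eta> v) (k v)) * \<psi> k)"

definition glued :: "edge set \<Rightarrow> ((vertex \<Rightarrow> 'p) \<Rightarrow> complex) \<Rightarrow> (vertex \<Rightarrow> 'p) \<Rightarrow> complex" where
  "glued S \<psi> = (\<lambda>k. if k \<in> Q\<^sub>\<Lambda> then \<Sum>\<eta>\<in>{\<eta>\<in>VC. diag S \<eta>}. (\<Prod>v\<in>\<Lambda>. T v (k v) (\<eta> v)) * virt \<psi> (reset S \<eta>) else 0)"

definition q :: "vertex \<Rightarrow> 'p \<Rightarrow> 'p \<Rightarrow> complex" where
  "q v k k' = (\<Sum>\<beta>\<in>I v. T v k \<beta> * L v \<beta> k')"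

definition factor :: "vertex set \<Rightarrow> vertex \<Rightarrow> 'p \<Rightarrow> 'p \<Rightarrow> complex" where
  "factor S v a b = (if v \<in> S then q v a b else if a = b then 1 else 0)"

text \<open>The product of the operators q_v = T_v L_v over v in \<open>S\<close>. Growing
  \<open>S\<close> from the empty set to \<Lambda> leads from the identity to (\<Otimes> T)
  (\<Otimes> L), where \<open>glued\<close> takes over with no edge glued.\<close>

definition supp :: "vertex set \<Rightarrow> ((vertex \<Rightarrow> 'p) \<Rightarrow> complex) \<Rightarrow> (vertex \<Rightarrow> 'p) \<Rightarrow> complex" where
  "supp S \<psi> = (\<lambda>k. if k \<in> Q\<^sub>\<Lambda> then \<Sum>k'\<in>Q\<^sub>\<Lambda>. (\<Prod>v\<in>\<Lambda>. factor S v (k v) (k' v)) * \<psi> k' else 0)"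

definition prodvec :: "(vertex \<Rightarrow> 'p \<Rightarrow> complex) \<Rightarrow> (vertex \<Rightarrow> 'p) \<Rightarrow> complex" where
  "prodvec t = (\<lambda>k. if k \<in> Q\<^sub>\<Lambda> then \<Prod>v\<in>\<Lambda>. t v (k v) else 0)"

lemma finite_I: "v \<in> \<Lambda> \<Longrightarrow> finite (incident E v)" "v \<in> \<Lambda> \<Longrightarrow> finite (I v)"
proof -
  assume v: "v \<in> \<Lambda>"
  then have "incident E v \<subseteq> touching E \<Lambda>" by (rule incident_subset_touching)
  then show "finite (incident E v)" using locally_finite[OF fin sub] finite_subset by blast
  then show "finite (I v)" by simp
qed

lemma finite_VC: "finite VC"
  unfolding VC_def using fin finite_I by (intro finite_PiE) auto

lemma finite_Q: "finite Q\<^sub>\<Lambda>"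
  using fin by simp

lemma sum_prod_Q: "(\<Sum>k\<in>Q\<^sub>\<Lambda>. \<Prod>v\<in>\<Lambda>. f v (k v)) = (\<Prod>v\<in>\<Lambda>. \<Sum>a\<in>UNIV. f v a)"
  for f :: "vertex \<Rightarrow> 'p \<Rightarrow> complex"
  unfolding configs_def by (rule prod_sum_PiE[symmetric]) (use fin in auto)

lemma sum_prod_VC: "(\<Sum>\<eta>\<in>VC. \<Prod>v\<in>\<Lambda>. f v (\<eta> v)) = (\<Prod>v\<in>\<Lambda>. \<Sum>\<beta>\<in>I v. f v \<beta>)"
  for f :: "vertex \<Rightarrow> (edge \<Rightarrow> 'b) \<Rightarrow> complex"
  unfolding VC_def by (rule prod_sum_PiE[symmetric]) (use fin finite_I in auto)

lemma reset_in_VC: "reset S \<eta> \<in> VC"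
  by (auto simp: reset_def VC_def)

lemma VC_I: "\<eta> \<in> VC \<Longrightarrow> v \<in> \<Lambda> \<Longrightarrow> \<eta> v \<in> I v"
  by (auto simp: VC_def)

lemma VC_eqI:
  assumes "\<eta> \<in> VC" "\<eta>' \<in> VC" "\<And>v e. v \<in> \<Lambda> \<Longrightarrow> e \<in> incident E v \<Longrightarrow> \<eta> v e = \<eta>' v e"
  shows "\<eta> = \<eta>'"
proof (rule PiE_ext[OF assms(1,2)[unfolded VC_def]])
  fix v assume v: "v \<in> \<Lambda>"
  show "\<eta> v = \<eta>' v"
  proof
    fix e
    show "\<eta> v e = \<eta>' v e"
    proof (cases "e \<in> incident E v")
      case False
      then show ?thesis using VC_I[OF assms(1) v] VC_I[OF assms(2) v] by (simp add: configs_iff)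
    qed (use assms(3) v in auto)
  qed
qed

subsubsection \<open>Product vectors\<close>

lemma supp_prodvec: "supp S (prodvec t) = prodvec (\<lambda>v a. \<Sum>b\<in>UNIV. factor S v a b * t v b)"
proof
  fix k
  show "supp S (prodvec t) k = prodvec (\<lambda>v a. \<Sum>b\<in>UNIV. factor S v a b * t v b) k"
  proof (cases "k \<in> Q\<^sub>\<Lambda>")
    case True
    have "supp S (prodvec t) k = (\<Sum>k'\<in>Q\<^sub>\<Lambda>. \<Prod>v\<in>\<Lambda>. factor S v (k v) (k' v) * t v (k' v))"
      using True by (simp add: supp_def prodvec_def prod.distrib)
    also have "\<dots> = (\<Prod>v\<in>\<Lambda>. \<Sum>b\<in>UNIV. factor S v (k v) b * t v b)"
      by (rule sum_prod_Q[of "\<lambda>v b. factor S v (k v) b * t v b"])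
    finally show ?thesis using True by (simp add: prodvec_def)
  qed (simp add: supp_def prodvec_def)
qed

lemma virt_prodvec: "virt (prodvec t) \<eta> = (\<Prod>v\<in>\<Lambda>. \<Sum>a\<in>UNIV. L v (\<eta> v) a * t v a)"
  unfolding virt_def prodvec_def sum_prod_Q[of "\<lambda>v a. L v (\<eta> v) a * t v a", symmetric]
  by (simp add: prod.distrib)

lemma virt_linear:
  "virt (\<lambda>k. \<Sum>i\<in>X. c i * f i k) \<eta> = (\<Sum>i\<in>X. c i * virt (f i) \<eta>)"
  unfolding virt_def sum_distrib_left by (subst sum.swap) (simp add: mult.left_commute)

lemma supp_linear:
  "supp S (\<lambda>k. \<Sum>i\<in>X. c i * f i k) = (\<lambda>k. \<Sum>i\<in>X. c i * supp S (f i) k)"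
proof
  fix k
  show "supp S (\<lambda>k. \<Sum>i\<in>X. c i * f i k) k = (\<Sum>i\<in>X. c i * supp S (f i) k)"
  proof (cases "k \<in> Q\<^sub>\<Lambda>")
    case True
    then show ?thesis unfolding supp_def if_P[OF True] sum_distrib_left
      by (subst sum.swap) (simp add: mult.left_commute)
  qed (simp add: supp_def)
qed

lemma q_T:
  assumes "v \<in> \<Lambda>" "\<beta> \<in> I v"
  shows "(\<Sum>b\<in>UNIV. q v a b * T v b \<beta>) = T v a \<beta>"
proof -
  have "(\<Sum>b\<in>UNIV. q v a b * T v b \<beta>) = (\<Sum>b\<in>UNIV. \<Sum>\<beta>'\<in>I v. T v a \<beta>' * (L v \<beta>' b * T v b \<beta>))"
    by (simp add: q_def sum_distrib_right mult.assoc)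
  also have "\<dots> = (\<Sum>\<beta>'\<in>I v. T v a \<beta>' * (\<Sum>b\<in>UNIV. L v \<beta>' b * T v b \<beta>))"
    by (subst sum.swap) (simp add: sum_distrib_left)
  also have "\<dots> = (\<Sum>\<beta>'\<in>I v. if \<beta>' = \<beta> then T v a \<beta> else 0)"
    by (rule sum.cong) (use assms LT in auto)
  also have "\<dots> = T v a \<beta>" using assms finite_I by simp
  finally show ?thesis .
qed

subsubsection \<open>Ground states of one edge\<close>

text \<open>The tensors at the two ends of \<open>e\<close> with outer legs fixed to
  \<open>x\<close> and the common leg fixed to \<open>y\<close>, times the basis vector
  \<open>r\<close> elsewhere. Summed over \<open>y\<close>, this is up to a constant a vector of the
  image of the map of \<open>e\<close>, tensored with \<open>r\<close>.\<close>

definition edge_vec :: "edge \<Rightarrow> (vertex \<Rightarrow> 'p) \<Rightarrow> (edge \<Rightarrow> 'b) \<Rightarrow> (edge \<Rightarrow> 'b) \<Rightarrow> vertex \<Rightarrow> 'p \<Rightarrow> complex" where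
  "edge_vec e r x y = (\<lambda>v a. if v \<in> e then T v a (restrict (override_on x y {e}) (incident E v)) else if a = r v then 1 else 0)"

lemma inner_edges_self: "e \<in> E \<Longrightarrow> inner_edges E e = {e}"
proof -
  assume e: "e \<in> E"
  have "f = e" if "f \<in> E" "f \<subseteq> e" for f
    using card_subset_eq[OF finite_edge[OF e] that(2)] edges(2) e that by simp
  then show ?thesis using e by (auto simp: inner_edges_def)
qed

text \<open>Each slice outside \<open>e\<close> lies in the image of the map of \<open>e\<close>,
  which \<open>peps_map_eq\<close> expands into product vectors. Only this shape matters later, so
  the coefficients stay abstract.\<close>

lemma edge_ground_state:
  assumes e: "e \<in> inner_edges E \<Lambda>"
  obtains c where "mapply Q\<^sub>\<Lambda> (tensor_ext e \<Lambda> (P e)) \<psi>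
    = (\<lambda>k. \<Sum>(r, x)\<in>configs (\<Lambda> - e) \<times> D e. c (r, x) * (\<Sum>y\<in>configs {e}. prodvec (edge_vec e r x y) k))"
proof -
  have eE: "e \<in> E" "e \<subseteq> \<Lambda>" using e by (auto simp: inner_edges_def)
  have e': "finite e" "e \<subseteq> G" using finite_edge edges eE by auto
  let ?\<phi> = "mapply Q\<^sub>\<Lambda> (tensor_ext e \<Lambda> (P e)) \<psi>"
  define C where "C = complex_of_real (1 / sqrt (real CARD('b))) ^ card (touching E e)"
  have "slice e ?\<phi> r \<in> peps_image E T e" if "r \<in> configs (\<Lambda> - e)" for r
  proof -
    have "slice e ?\<phi> r = mapply (Q e) (P e) (slice e \<psi> r)"
      by (rule slice_tensor_ext_self[OF fin eE(2) that P_in_cmats[OF e']])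
    then show ?thesis using is_orthoproj_P[OF e'] unfolding is_orthoproj_def by (metis imageI slice_in_cvecs)
  qed
  then have "\<forall>r\<in>configs (\<Lambda> - e). \<exists>a. slice e ?\<phi> r = mapply (D e) (V e) a"
    unfolding peps_image_def by blast
  then obtain a where a: "\<And>r. r \<in> configs (\<Lambda> - e) \<Longrightarrow> slice e ?\<phi> r = mapply (D e) (V e) (a r)" by metis
  have Ve: "V e (restrict k e) x = C * (\<Sum>y\<in>configs {e}. \<Prod>v\<in>e. T v (k v) (restrict (override_on x y {e}) (incident E v)))"
    if "x \<in> D e" for k x
  proof -
    have "V e (restrict k e) x = C * (\<Sum>y\<in>configs (inner_edges E e). vertex_prod E T e (restrict k e) (override_on x y (inner_edges E e)))"
      unfolding C_def by (rule peps_map_eq[OF _ locally_finite[OF e'] restrict_in_configs that]) (rule edges(2))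
    then show ?thesis unfolding inner_edges_self[OF eE(1)] vertex_prod_def by (simp cong: prod.cong)
  qed
  have pv: "prodvec (edge_vec e r x y) k = (if r = restrict k (\<Lambda> - e) then \<Prod>v\<in>e. T v (k v) (restrict (override_on x y {e}) (incident E v)) else 0)"
    if k: "k \<in> Q\<^sub>\<Lambda>" and r: "r \<in> configs (\<Lambda> - e)" for r x y k
  proof -
    have "prodvec (edge_vec e r x y) k = (\<Prod>v\<in>\<Lambda> - e. if k v = r v then 1 else 0) * (\<Prod>v\<in>e. T v (k v) (restrict (override_on x y {e}) (incident E v)))"
    proof -
      have "prodvec (edge_vec e r x y) k = (\<Prod>v\<in>\<Lambda> - e. edge_vec e r x y v (k v)) * (\<Prod>v\<in>e. edge_vec e r x y v (k v))"
        using k unfolding prodvec_def by (simp add: prod.subset_diff[OF eE(2) fin])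
      also have "(\<Prod>v\<in>\<Lambda> - e. edge_vec e r x y v (k v)) = (\<Prod>v\<in>\<Lambda> - e. if k v = r v then 1 else 0)"
        by (rule prod.cong) (auto simp: edge_vec_def)
      also have "(\<Prod>v\<in>e. edge_vec e r x y v (k v)) = (\<Prod>v\<in>e. T v (k v) (restrict (override_on x y {e}) (incident E v)))"
        by (rule prod.cong) (auto simp: edge_vec_def)
      finally show ?thesis .
    qed
    moreover have "(\<Prod>v\<in>\<Lambda> - e. if k v = r v then 1 else 0) = (if r = restrict k (\<Lambda> - e) then 1 else (0::complex))"
    proof (cases "r = restrict k (\<Lambda> - e)")
      case False
      then obtain v where "r v \<noteq> restrict k (\<Lambda> - e) v" by (meson ext)
      moreover have "v \<in> \<Lambda> - e"
      proof (rule ccontr)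
        assume v: "v \<notin> \<Lambda> - e"
        then have "r v = undefined" using r unfolding configs_iff by blast
        with v \<open>r v \<noteq> restrict k (\<Lambda> - e) v\<close> show False by auto
      qed
      ultimately have "v \<in> \<Lambda> - e" "k v \<noteq> r v" by auto
      with False show ?thesis using fin by (auto simp: prod_zero_iff)
    qed simp
    ultimately show ?thesis by simp
  qed
  define c where "c = (\<lambda>(r, x). a r x * C)"
  have "?\<phi> k = (\<Sum>(r, x)\<in>configs (\<Lambda> - e) \<times> D e. c (r, x) * (\<Sum>y\<in>configs {e}. prodvec (edge_vec e r x y) k))" for k
  proof (cases "k \<in> Q\<^sub>\<Lambda>")
    case True
    let ?r = "restrict k (\<Lambda> - e)"
    have "override_on ?r (restrict k e) e = k"
      using True eE(2) by (auto simp: configs_iff override_on_def fun_eq_iff)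
    then have "?\<phi> k = slice e ?\<phi> ?r (restrict k e)" by (simp add: slice_def)
    also have "\<dots> = (\<Sum>x\<in>D e. V e (restrict k e) x * a ?r x)"
      unfolding a[OF restrict_in_configs] by (simp add: mapply_def)
    also have "\<dots> = (\<Sum>x\<in>D e. c (?r, x) * (\<Sum>y\<in>configs {e}. prodvec (edge_vec e ?r x y) k))"
      by (rule sum.cong[OF refl]) (simp add: Ve pv[OF True] c_def)
    also have "\<dots> = (\<Sum>r\<in>configs (\<Lambda> - e). if r = ?r then \<Sum>x\<in>D e. c (r, x) * (\<Sum>y\<in>configs {e}. prodvec (edge_vec e r x y) k) else 0)"
      using fin by (simp add: sum.delta)
    also have "\<dots> = (\<Sum>r\<in>configs (\<Lambda> - e). \<Sum>x\<in>D e. c (r, x) * (\<Sum>y\<in>configs {e}. prodvec (edge_vec e r x y) k))"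
    proof (rule sum.cong[OF refl])
      fix r :: "vertex \<Rightarrow> 'p" assume r: "r \<in> configs (\<Lambda> - e)"
      have "r \<noteq> ?r \<Longrightarrow> prodvec (edge_vec e r x y) k = 0" for x y using pv[OF True r] by simp
      then show "(if r = ?r then \<Sum>x\<in>D e. c (r, x) * (\<Sum>y\<in>configs {e}. prodvec (edge_vec e r x y) k) else 0)
        = (\<Sum>x\<in>D e. c (r, x) * (\<Sum>y\<in>configs {e}. prodvec (edge_vec e r x y) k))" by simp
    qed
    finally show ?thesis by (simp add: sum.cartesian_product)
  next
    case False
    have "?\<phi> k = 0" using False mapply_in_cvecs[OF tensor_ext_in_cmats, of \<Lambda> e "P e" \<psi>] by (simp add: cvecs_def)
    then show ?thesis using False by (simp add: prodvec_def)
  qed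
  then show ?thesis using that by blast
qed

text \<open>In a ground state of the edge the factor at its end v lies in the range of T_v, and T_v
  L_v T_v = T_v.\<close>

lemma supp_fixes_edge:
  assumes e: "e \<in> inner_edges E \<Lambda>" and v: "v \<in> e"
  shows "supp {v} (mapply Q\<^sub>\<Lambda> (tensor_ext e \<Lambda> (P e)) \<psi>) = mapply Q\<^sub>\<Lambda> (tensor_ext e \<Lambda> (P e)) \<psi>"
proof -
  have v': "v \<in> \<Lambda>" using assms by (auto simp: inner_edges_def)
  obtain c where c: "mapply Q\<^sub>\<Lambda> (tensor_ext e \<Lambda> (P e)) \<psi>
    = (\<lambda>k. \<Sum>(r, x)\<in>configs (\<Lambda> - e) \<times> D e. c (r, x) * (\<Sum>y\<in>configs {e}. prodvec (edge_vec e r x y) k))"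
    using edge_ground_state[OF e] .
  have fx: "supp {v} (prodvec (edge_vec e r x y)) = prodvec (edge_vec e r x y)" for r x y
  proof -
    have "(\<Sum>b\<in>UNIV. factor {v} w a b * edge_vec e r x y w b) = edge_vec e r x y w a" for w a
    proof (cases "w = v")
      case True
      then show ?thesis using v v' by (simp add: factor_def edge_vec_def q_T)
    next
      case False
      then show ?thesis by (simp add: factor_def if_distribR if_distrib[of "\<lambda>z. z * _"] sum.delta cong: if_cong)
    qed
    then show ?thesis by (simp add: supp_prodvec)
  qed
  have "supp {v} (\<lambda>k. \<Sum>i\<in>X. c i * (\<Sum>y\<in>configs {e}. f i y k)) = (\<lambda>k. \<Sum>i\<in>X. c i * (\<Sum>y\<in>configs {e}. f i y k))"
    if "\<And>i y. supp {v} (f i y) = f i y" for X c and f :: "_ \<Rightarrow> (edge \<Rightarrow> 'b) \<Rightarrow> (vertex \<Rightarrow> 'p) \<Rightarrow> complex"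
  proof -
    have "supp {v} (\<lambda>k. \<Sum>y\<in>configs {e}. f i y k) = (\<lambda>k. \<Sum>y\<in>configs {e}. f i y k)" for i
      using supp_linear[of "{v}" "\<lambda>_. 1" "f i" "configs {e}"] by (simp add: that)
    then show ?thesis by (simp only: supp_linear)
  qed
  from this[of "\<lambda>(r, x) y. prodvec (edge_vec e r x y)" c] show ?thesis
    unfolding c by (simp add: split_def fx)
qed

text \<open>\<open>g\<close> is fixed by the idempotent w_e, that is, \<open>g\<close> is \<omega>_e
  times a function of the other half-edges.\<close>

definition edge_closed :: "edge \<Rightarrow> ((vertex \<Rightarrow> edge \<Rightarrow> 'b) \<Rightarrow> complex) \<Rightarrow> bool" where
  "edge_closed e g \<longleftrightarrow> (\<forall>\<eta>\<in>VC. g \<eta> = (if diag {e} \<eta> then g (reset {e} \<eta>) else 0))"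

text \<open>At the ends of \<open>e\<close> the left inverses cancel the tensors and leave delta
  functions, which force both half-edge values at \<open>e\<close> to equal \<open>y\<close>.
  Summing over \<open>y\<close>, what remains is the condition that the two values agree, with no
  dependence on which value they share.\<close>

lemma virt_edge_vec_closed:
  assumes e: "e \<in> inner_edges E \<Lambda>"
  shows "edge_closed e (\<lambda>\<eta>. \<Sum>y\<in>configs {e}. virt (prodvec (edge_vec e r x y)) \<eta>)"
proof -
  have eE: "e \<in> E" "e \<subseteq> \<Lambda>" using e by (auto simp: inner_edges_def)
  have inc: "e \<in> incident E v \<longleftrightarrow> v \<in> e" for v using eE by (simp add: incident_def)
  have "e \<noteq> {}" using edges(2)[OF eE(1)] by auto
  then obtain u where u: "u \<in> e" by blast
  define R where "R = (\<lambda>\<eta>. \<Prod>v\<in>\<Lambda> - e. L v (\<eta> v) (r v))"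
  define cond where "cond = (\<lambda>\<eta> :: vertex \<Rightarrow> edge \<Rightarrow> 'b. \<forall>v\<in>e. \<forall>f\<in>incident E v - {e}. \<eta> v f = x f)"
  have val: "(\<Sum>y\<in>configs {e}. virt (prodvec (edge_vec e r x y)) \<eta>) = (if diag {e} \<eta> \<and> cond \<eta> then R \<eta> else 0)"
    if \<eta>: "\<eta> \<in> VC" for \<eta>
  proof -
    have "virt (prodvec (edge_vec e r x y)) \<eta> = (if y = (\<lambda>f\<in>{e}. \<eta> u e) then if diag {e} \<eta> \<and> cond \<eta> then R \<eta> else 0 else 0)"
      if y: "y \<in> configs {e}" for y
    proof -
      have "virt (prodvec (edge_vec e r x y)) \<eta> = R \<eta> * (\<Prod>v\<in>e. \<Sum>a\<in>UNIV. L v (\<eta> v) a * T v a (restrict (override_on x y {e}) (incident E v)))"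
      proof -
        have "(\<Prod>v\<in>\<Lambda> - e. \<Sum>a\<in>UNIV. L v (\<eta> v) a * edge_vec e r x y v a) = R \<eta>"
          unfolding R_def by (rule prod.cong) (auto simp: edge_vec_def if_distrib[of "\<lambda>z. _ * z"] sum.delta cong: if_cong)
        moreover have "(\<Prod>v\<in>e. \<Sum>a\<in>UNIV. L v (\<eta> v) a * edge_vec e r x y v a)
            = (\<Prod>v\<in>e. \<Sum>a\<in>UNIV. L v (\<eta> v) a * T v a (restrict (override_on x y {e}) (incident E v)))"
          by (rule prod.cong) (auto simp: edge_vec_def)
        ultimately show ?thesis unfolding virt_prodvec prod.subset_diff[OF eE(2) fin] by simp
      qed
      also have "(\<Prod>v\<in>e. \<Sum>a\<in>UNIV. L v (\<eta> v) a * T v a (restrict (override_on x y {e}) (incident E v)))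
         = (\<Prod>v\<in>e. if \<eta> v = restrict (override_on x y {e}) (incident E v) then 1 else 0)"
        by (rule prod.cong[OF refl], rule LT) (use \<eta> eE VC_I in auto)
      also have "\<dots> = (if \<forall>v\<in>e. \<eta> v = restrict (override_on x y {e}) (incident E v) then 1 else 0)"
        using finite_edge[OF eE(1)] by (auto simp: prod_zero_iff)
      also have "(\<forall>v\<in>e. \<eta> v = restrict (override_on x y {e}) (incident E v)) \<longleftrightarrow> y = (\<lambda>f\<in>{e}. \<eta> u e) \<and> diag {e} \<eta> \<and> cond \<eta>"
      proof
        assume *: "\<forall>v\<in>e. \<eta> v = restrict (override_on x y {e}) (incident E v)"
        then have ve: "\<eta> v e = y e" if "v \<in> e" for v using that inc[of v] by (simp add: override_on_def)
        then have "y = (\<lambda>f\<in>{e}. \<eta> u e)" using y u by (auto simp: configs_iff fun_eq_iff)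
        moreover have "diag {e} \<eta>" using ve by (simp add: diag_def)
        moreover have "cond \<eta>" unfolding cond_def using * by (simp add: override_on_def)
        ultimately show "y = (\<lambda>f\<in>{e}. \<eta> u e) \<and> diag {e} \<eta> \<and> cond \<eta>" by blast
      next
        assume *: "y = (\<lambda>f\<in>{e}. \<eta> u e) \<and> diag {e} \<eta> \<and> cond \<eta>"
        show "\<forall>v\<in>e. \<eta> v = restrict (override_on x y {e}) (incident E v)"
        proof (intro ballI ext)
          fix v f assume v: "v \<in> e"
          have "\<eta> v e = \<eta> u e" using * u v unfolding diag_def by blast
          moreover have "f \<notin> incident E v \<Longrightarrow> \<eta> v f = undefined"
            using VC_I[OF \<eta>, of v] v eE by (auto simp: configs_iff)
          ultimately show "\<eta> v f = restrict (override_on x y {e}) (incident E v) f"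
            using * v by (auto simp: cond_def override_on_def)
        qed
      qed
      finally show ?thesis by simp
    qed
    then have "(\<Sum>y\<in>configs {e}. virt (prodvec (edge_vec e r x y)) \<eta>)
       = (\<Sum>y\<in>configs {e}. if y = (\<lambda>f\<in>{e}. \<eta> u e) then if diag {e} \<eta> \<and> cond \<eta> then R \<eta> else 0 else 0)"
      by (rule sum.cong[OF refl])
    also have "\<dots> = (if diag {e} \<eta> \<and> cond \<eta> then R \<eta> else 0)" by (simp add: sum.delta)
    finally show ?thesis .
  qed
  show ?thesis unfolding edge_closed_def
  proof
    fix \<eta> assume \<eta>: "\<eta> \<in> VC"
    have d: "diag {e} (reset {e} \<eta>)" using eE by (auto simp: diag_def reset_def inc)
    have c: "cond (reset {e} \<eta>) = cond \<eta>" using eE by (auto simp: cond_def reset_def)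
    have R: "R (reset {e} \<eta>) = R \<eta>"
      unfolding R_def
    proof (rule prod.cong[OF refl])
      fix v assume v: "v \<in> \<Lambda> - e"
      have "reset {e} \<eta> v = \<eta> v"
        using v VC_I[OF \<eta>, of v] inc[of v] by (auto simp: reset_def configs_iff fun_eq_iff)
      then show "L v (reset {e} \<eta> v) (r v) = L v (\<eta> v) (r v)" by simp
    qed
    show "(\<Sum>y\<in>configs {e}. virt (prodvec (edge_vec e r x y)) \<eta>) =
      (if diag {e} \<eta> then \<Sum>y\<in>configs {e}. virt (prodvec (edge_vec e r x y)) (reset {e} \<eta>) else 0)"
      unfolding val[OF \<eta>] val[OF reset_in_VC] by (simp add: d c R)
  qed
qed

lemma virt_edge_closed:
  assumes e: "e \<in> inner_edges E \<Lambda>"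
  shows "edge_closed e (virt (mapply Q\<^sub>\<Lambda> (tensor_ext e \<Lambda> (P e)) \<psi>))"
proof -
  obtain c where c: "mapply Q\<^sub>\<Lambda> (tensor_ext e \<Lambda> (P e)) \<psi>
    = (\<lambda>k. \<Sum>(r, x)\<in>configs (\<Lambda> - e) \<times> D e. c (r, x) * (\<Sum>y\<in>configs {e}. prodvec (edge_vec e r x y) k))"
    using edge_ground_state[OF e] .
  have "virt (\<lambda>k. \<Sum>y\<in>configs {e}. prodvec (edge_vec e r x y) k) \<eta> = (\<Sum>y\<in>configs {e}. virt (prodvec (edge_vec e r x y)) \<eta>)" for r x \<eta>
    using virt_linear[of "\<lambda>_. 1" "\<lambda>y. prodvec (edge_vec e r x y)" "configs {e}"] by simp
  then have v: "virt (mapply Q\<^sub>\<Lambda> (tensor_ext e \<Lambda> (P e)) \<psi>) \<eta> =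
    (\<Sum>i\<in>configs (\<Lambda> - e) \<times> D e. c i * (\<Sum>y\<in>configs {e}. virt (prodvec (edge_vec e (fst i) (snd i) y)) \<eta>))" for \<eta>
    unfolding c split_def by (simp add: virt_linear)
  show ?thesis unfolding edge_closed_def v
  proof
    fix \<eta> assume \<eta>: "\<eta> \<in> VC"
    have "(\<Sum>y\<in>configs {e}. virt (prodvec (edge_vec e (fst i) (snd i) y)) \<eta>)
      = (if diag {e} \<eta> then \<Sum>y\<in>configs {e}. virt (prodvec (edge_vec e (fst i) (snd i) y)) (reset {e} \<eta>) else 0)" for i
      using virt_edge_vec_closed[OF e] \<eta> unfolding edge_closed_def by blast
    then show "(\<Sum>i\<in>configs (\<Lambda> - e) \<times> D e. c i * (\<Sum>y\<in>configs {e}. virt (prodvec (edge_vec e (fst i) (snd i) y)) \<eta>))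
      = (if diag {e} \<eta> then \<Sum>i\<in>configs (\<Lambda> - e) \<times> D e. c i * (\<Sum>y\<in>configs {e}. virt (prodvec (edge_vec e (fst i) (snd i) y)) (reset {e} \<eta>)) else 0)"
      by simp
  qed
qed

text \<open>The extra operator w_e acts on a function that it fixes. Since \<open>e\<close> is not
  in \<open>S\<close>, resetting \<open>S\<close> leaves the values at \<open>e\<close> alone, so
  the test of equality at \<open>e\<close> is the same before and after.\<close>

lemma glued_insert:
  assumes e: "e \<in> inner_edges E \<Lambda>" "e \<notin> S" and g: "edge_closed e (virt \<psi>)"
  shows "glued (insert e S) \<psi> = glued S \<psi>"
proof -
  have sum: "(\<Sum>\<eta>\<in>{\<eta>\<in>VC. diag (insert e S) \<eta>}. t \<eta> * virt \<psi> (reset (insert e S) \<eta>))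
     = (\<Sum>\<eta>\<in>{\<eta>\<in>VC. diag S \<eta>}. t \<eta> * virt \<psi> (reset S \<eta>))" for t
  proof (rule sum.mono_neutral_cong_left)
    show "finite {\<eta>\<in>VC. diag S \<eta>}" using finite_VC by simp
    show "{\<eta>\<in>VC. diag (insert e S) \<eta>} \<subseteq> {\<eta>\<in>VC. diag S \<eta>}" by (auto simp: diag_def)
    have "reset S \<eta> v e = \<eta> v e" if "v \<in> e" for v \<eta>
    proof -
      have "v \<in> \<Lambda>" "e \<in> incident E v" using e(1) that by (auto simp: inner_edges_def incident_def)
      then show ?thesis using e(2) by (simp add: reset_def)
    qed
    then have de: "diag {e} (reset S \<eta>) \<longleftrightarrow> diag {e} \<eta>" for \<eta> by (simp add: diag_def)
    have re: "reset {e} (reset S \<eta>) = reset (insert e S) \<eta>" for \<eta>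
      by (auto simp: reset_def fun_eq_iff)
    have cl: "virt \<psi> (reset S \<eta>) = (if diag {e} \<eta> then virt \<psi> (reset (insert e S) \<eta>) else 0)" for \<eta>
    proof -
      have "virt \<psi> (reset S \<eta>) = (if diag {e} (reset S \<eta>) then virt \<psi> (reset {e} (reset S \<eta>)) else 0)"
        using g reset_in_VC[of S \<eta>] unfolding edge_closed_def by blast
      then show ?thesis unfolding de re .
    qed
    show "\<forall>\<eta>\<in>{\<eta>\<in>VC. diag S \<eta>} - {\<eta>\<in>VC. diag (insert e S) \<eta>}. t \<eta> * virt \<psi> (reset S \<eta>) = 0"
    proof
      fix \<eta> assume "\<eta> \<in> {\<eta>\<in>VC. diag S \<eta>} - {\<eta>\<in>VC. diag (insert e S) \<eta>}"
      then have "\<not> diag {e} \<eta>" unfolding diag_def by blast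
      then show "t \<eta> * virt \<psi> (reset S \<eta>) = 0" using cl[of \<eta>] by simp
    qed
    show "t \<eta> * virt \<psi> (reset (insert e S) \<eta>) = t \<eta> * virt \<psi> (reset S \<eta>)" if "\<eta> \<in> {\<eta>\<in>VC. diag (insert e S) \<eta>}" for \<eta>
    proof -
      have "diag {e} \<eta>" using that unfolding diag_def by blast
      then show ?thesis using cl[of \<eta>] by simp
    qed
  qed
  show ?thesis unfolding glued_def sum ..
qed

lemma supp_supp:
  assumes "v \<notin> S"
  shows "supp S (supp {v} \<psi>) = supp (insert v S) \<psi>"
proof
  have delta: "(\<Sum>a\<in>UNIV. (if x = a then 1 else 0) * f a) = f x" "(\<Sum>a\<in>UNIV. f a * (if a = x then 1 else 0)) = f x"
    for x :: 'p and f :: "'p \<Rightarrow> complex"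
  proof -
    have "(\<Sum>a\<in>UNIV. (if x = a then 1 else 0) * f a) = (\<Sum>a\<in>UNIV. if x = a then f a else 0)"
      "(\<Sum>a\<in>UNIV. f a * (if a = x then 1 else 0)) = (\<Sum>a\<in>UNIV. if a = x then f a else 0)"
      by (rule sum.cong; simp)+
    then show "(\<Sum>a\<in>UNIV. (if x = a then 1 else 0) * f a) = f x" "(\<Sum>a\<in>UNIV. f a * (if a = x then 1 else 0)) = f x"
      by simp_all
  qed
  fix k
  show "supp S (supp {v} \<psi>) k = supp (insert v S) \<psi> k"
  proof (cases "k \<in> Q\<^sub>\<Lambda>")
    case True
    have "supp S (supp {v} \<psi>) k = (\<Sum>k'\<in>Q\<^sub>\<Lambda>. \<Sum>k''\<in>Q\<^sub>\<Lambda>. (\<Prod>w\<in>\<Lambda>. factor S w (k w) (k' w) * factor {v} w (k' w) (k'' w)) * \<psi> k'')"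
      using True by (simp add: supp_def sum_distrib_left prod.distrib mult.assoc)
    also have "\<dots> = (\<Sum>k''\<in>Q\<^sub>\<Lambda>. (\<Sum>k'\<in>Q\<^sub>\<Lambda>. \<Prod>w\<in>\<Lambda>. factor S w (k w) (k' w) * factor {v} w (k' w) (k'' w)) * \<psi> k'')"
      by (subst sum.swap) (simp add: sum_distrib_right)
    also have "\<dots> = (\<Sum>k''\<in>Q\<^sub>\<Lambda>. (\<Prod>w\<in>\<Lambda>. \<Sum>a\<in>UNIV. factor S w (k w) a * factor {v} w a (k'' w)) * \<psi> k'')"
      by (subst sum_prod_Q) simp
    also have "(\<lambda>w c. \<Sum>a\<in>UNIV. factor S w (k w) a * factor {v} w a c) = (\<lambda>w c. factor (insert v S) w (k w) c)"
    proof (intro ext)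
      fix w c
      show "(\<Sum>a\<in>UNIV. factor S w (k w) a * factor {v} w a c) = factor (insert v S) w (k w) c"
        using assms by (cases "w = v"; cases "w \<in> S") (simp_all add: factor_def delta)
    qed
    finally show ?thesis using True by (simp add: supp_def fun_eq_iff)
  qed (simp add: supp_def)
qed

end

context covered_region
begin

lemma supp_empty: "\<psi> \<in> cvecs Q\<^sub>\<Lambda> \<Longrightarrow> supp {} \<psi> = \<psi>"
proof
  fix k assume \<psi>: "\<psi> \<in> cvecs Q\<^sub>\<Lambda>"
  show "supp {} \<psi> k = \<psi> k"
  proof (cases "k \<in> Q\<^sub>\<Lambda>")
    case True
    have "(\<Prod>v\<in>\<Lambda>. factor {} v (k v) (k' v)) = (if k' = k then 1 else 0)" if k': "k' \<in> Q\<^sub>\<Lambda>" for k'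
    proof (cases "k' = k")
      case False
      then obtain v where v: "k v \<noteq> k' v" by (metis ext)
      have "v \<in> \<Lambda>"
      proof (rule ccontr)
        assume "v \<notin> \<Lambda>"
        then have "k v = undefined" "k' v = undefined" using True k' unfolding configs_iff by blast+
        with v show False by simp
      qed
      then show ?thesis using v False fin by (auto simp: prod_zero_iff factor_def)
    qed (simp add: factor_def)
    then have "supp {} \<psi> k = (\<Sum>k'\<in>Q\<^sub>\<Lambda>. if k' = k then \<psi> k else 0)"
      using True by (auto simp: supp_def intro!: sum.cong)
    then show ?thesis using True finite_Q by simp
  qed (use \<psi> in \<open>auto simp: supp_def cvecs_def\<close>)
qed

lemma reset_empty: "\<eta> \<in> VC \<Longrightarrow> reset {} \<eta> = \<eta>"
  by (rule VC_eqI[OF reset_in_VC]) (auto simp: reset_def)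

text \<open>The junction of the two telescopes: all vertices projected is the same as no edge
  glued.\<close>

lemma supp_full: "supp \<Lambda> \<psi> = glued {} \<psi>"
proof
  fix k
  show "supp \<Lambda> \<psi> k = glued {} \<psi> k"
  proof (cases "k \<in> Q\<^sub>\<Lambda>")
    case True
    have "glued {} \<psi> k = (\<Sum>\<eta>\<in>VC. (\<Prod>v\<in>\<Lambda>. T v (k v) (\<eta> v)) * virt \<psi> \<eta>)"
      using True by (simp add: glued_def diag_def reset_empty)
    also have "\<dots> = (\<Sum>\<eta>\<in>VC. \<Sum>k'\<in>Q\<^sub>\<Lambda>. (\<Prod>v\<in>\<Lambda>. T v (k v) (\<eta> v) * L v (\<eta> v) (k' v)) * \<psi> k')"
      by (simp add: virt_def sum_distrib_left prod.distrib mult.assoc)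
    also have "\<dots> = (\<Sum>k'\<in>Q\<^sub>\<Lambda>. (\<Sum>\<eta>\<in>VC. \<Prod>v\<in>\<Lambda>. T v (k v) (\<eta> v) * L v (\<eta> v) (k' v)) * \<psi> k')"
      by (subst sum.swap) (simp add: sum_distrib_right)
    also have "\<dots> = (\<Sum>k'\<in>Q\<^sub>\<Lambda>. (\<Prod>v\<in>\<Lambda>. factor \<Lambda> v (k v) (k' v)) * \<psi> k')"
    proof (rule sum.cong[OF refl])
      fix k'
      have "(\<Sum>\<eta>\<in>VC. \<Prod>v\<in>\<Lambda>. T v (k v) (\<eta> v) * L v (\<eta> v) (k' v)) = (\<Prod>v\<in>\<Lambda>. q v (k v) (k' v))"
        unfolding q_def by (rule sum_prod_VC[of "\<lambda>v \<beta>. T v (k v) \<beta> * L v \<beta> (k' v)"])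
      also have "\<dots> = (\<Prod>v\<in>\<Lambda>. factor \<Lambda> v (k v) (k' v))" by (simp add: factor_def)
      finally show "(\<Sum>\<eta>\<in>VC. \<Prod>v\<in>\<Lambda>. T v (k v) (\<eta> v) * L v (\<eta> v) (k' v)) * \<psi> k' = (\<Prod>v\<in>\<Lambda>. factor \<Lambda> v (k v) (k' v)) * \<psi> k'"
        by simp
    qed
    finally show ?thesis using True by (simp add: supp_def)
  qed (simp add: supp_def glued_def)
qed

text \<open>One constant for both families of operators: the last bracket bounds the matrix entries,
  and the two cardinalities come from \<open>cnorm_mapply_entries\<close>.\<close>

definition op_const :: real where
  "op_const = real (card Q\<^sub>\<Lambda>) * real (card Q\<^sub>\<Lambda>) * (real (card VC) * K ^ card \<Lambda>)"

lemma op_const_nonneg: "0 \<le> op_const"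
  using K(2) by (simp add: op_const_def)

lemma supp_bounded: "cnorm Q\<^sub>\<Lambda> (supp S \<psi>) \<le> op_const * cnorm Q\<^sub>\<Lambda> \<psi>"
proof -
  \<comment> \<open>Vertices outside \<open>S\<close> contribute entries 0 or 1, which obey the same
    bound because \<open>K\<close> and the number of configurations at a vertex are at least
    1.\<close>
  have cI: "1 \<le> real (card (I v))" if "v \<in> \<Lambda>" for v
  proof -
    have "I v \<noteq> {}" using restrict_in_configs by blast
    then have "card (I v) > 0" using finite_I[OF that] by (simp add: card_gt_0_iff)
    then show ?thesis by simp
  qed
  have "cmod (factor S v a b) \<le> real (card (I v)) * K" if v: "v \<in> \<Lambda>" for v a b
  proof (cases "v \<in> S")
    case True
    have "cmod (q v a b) \<le> (\<Sum>\<beta>\<in>I v. cmod (T v a \<beta> * L v \<beta> b))" unfolding q_def by (rule norm_sum)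
    also have "\<dots> \<le> (\<Sum>\<beta>\<in>I v. K)" by (rule sum_mono) (use K(1)[OF v] in \<open>simp add: norm_mult\<close>)
    finally show ?thesis using True by (simp add: factor_def)
  next
    case False
    have "1 * 1 \<le> real (card (I v)) * K" by (rule mult_mono) (use cI[OF v] K(2) in auto)
    then show ?thesis using False by (simp add: factor_def)
  qed
  then have "cmod (\<Prod>v\<in>\<Lambda>. factor S v (k v) (k' v)) \<le> (\<Prod>v\<in>\<Lambda>. real (card (I v)) * K)" for k k'
    unfolding prod_norm[symmetric] by (intro prod_mono) auto
  also have "(\<Prod>v\<in>\<Lambda>. real (card (I v)) * K) = real (card VC) * K ^ card \<Lambda>"
    using fin by (simp add: prod.distrib VC_def card_PiE)
  finally have b: "cmod (\<Prod>v\<in>\<Lambda>. factor S v (k v) (k' v)) \<le> real (card VC) * K ^ card \<Lambda>" for k k' .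
  have "cnorm Q\<^sub>\<Lambda> (supp S \<psi>) = cnorm Q\<^sub>\<Lambda> (mapply Q\<^sub>\<Lambda> (\<lambda>k k'. \<Prod>v\<in>\<Lambda>. factor S v (k v) (k' v)) \<psi>)"
    by (rule cnorm_cong) (simp add: supp_def mapply_def)
  also have "\<dots> \<le> op_const * cnorm Q\<^sub>\<Lambda> \<psi>"
    unfolding op_const_def by (rule cnorm_mapply_entries[OF finite_Q finite_Q b])
  finally show ?thesis .
qed

lemma glued_bounded: "cnorm Q\<^sub>\<Lambda> (glued S \<psi>) \<le> op_const * cnorm Q\<^sub>\<Lambda> \<psi>"
proof -
  let ?V = "{\<eta>\<in>VC. diag S \<eta>}"
  define M where "M = (\<lambda>k k'. \<Sum>\<eta>\<in>?V. \<Prod>v\<in>\<Lambda>. T v (k v) (\<eta> v) * L v (reset S \<eta> v) (k' v))"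
  have b: "cmod (M k k') \<le> real (card VC) * K ^ card \<Lambda>" for k k'
  proof -
    have "cmod (M k k') \<le> (\<Sum>\<eta>\<in>?V. cmod (\<Prod>v\<in>\<Lambda>. T v (k v) (\<eta> v) * L v (reset S \<eta> v) (k' v)))"
      unfolding M_def by (rule norm_sum)
    also have "\<dots> \<le> (\<Sum>\<eta>\<in>?V. K ^ card \<Lambda>)"
    proof (rule sum_mono)
      fix \<eta> assume \<eta>: "\<eta> \<in> ?V"
      have "cmod (\<Prod>v\<in>\<Lambda>. T v (k v) (\<eta> v) * L v (reset S \<eta> v) (k' v)) \<le> (\<Prod>v\<in>\<Lambda>. K)"
        unfolding prod_norm[symmetric]
      proof (rule prod_mono)
        fix v assume v: "v \<in> \<Lambda>"
        show "0 \<le> cmod (T v (k v) (\<eta> v) * L v (reset S \<eta> v) (k' v)) \<and> cmod (T v (k v) (\<eta> v) * L v (reset S \<eta> v) (k' v)) \<le> K"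
          using K(1)[OF v VC_I[OF _ v] VC_I[OF reset_in_VC v]] \<eta> by (simp add: norm_mult)
      qed
      then show "cmod (\<Prod>v\<in>\<Lambda>. T v (k v) (\<eta> v) * L v (reset S \<eta> v) (k' v)) \<le> K ^ card \<Lambda>" by simp
    qed
    also have "\<dots> = real (card ?V) * K ^ card \<Lambda>" by simp
    also have "\<dots> \<le> real (card VC) * K ^ card \<Lambda>"
      using K(2) by (intro mult_right_mono) (auto intro!: card_mono finite_VC)
    finally show ?thesis .
  qed
  have "cnorm Q\<^sub>\<Lambda> (glued S \<psi>) = cnorm Q\<^sub>\<Lambda> (mapply Q\<^sub>\<Lambda> M \<psi>)"
  proof (rule cnorm_cong)
    fix k assume k: "k \<in> Q\<^sub>\<Lambda>"
    have "glued S \<psi> k = (\<Sum>\<eta>\<in>?V. \<Sum>k'\<in>Q\<^sub>\<Lambda>. (\<Prod>v\<in>\<Lambda>. T v (k v) (\<eta> v) * L v (reset S \<eta> v) (k' v)) * \<psi> k')"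
      using k by (simp add: glued_def virt_def sum_distrib_left prod.distrib mult.assoc)
    also have "\<dots> = mapply Q\<^sub>\<Lambda> M \<psi> k"
      by (subst sum.swap) (simp add: mapply_def M_def sum_distrib_right)
    finally show "glued S \<psi> k = mapply Q\<^sub>\<Lambda> M \<psi> k" .
  qed
  also have "\<dots> \<le> op_const * cnorm Q\<^sub>\<Lambda> \<psi>"
    unfolding op_const_def by (rule cnorm_mapply_entries[OF finite_Q finite_Q b])
  finally show ?thesis .
qed

lemma supp_diff: "supp S (\<psi> - \<phi>) = supp S \<psi> - supp S \<phi>"
  by (auto simp: supp_def algebra_simps sum_subtractf)

lemma glued_diff: "glued S (\<psi> - \<phi>) = glued S \<psi> - glued S \<phi>"
  by (auto simp: glued_def virt_def algebra_simps sum_subtractf)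

abbreviation "term_vec e \<psi> \<equiv> mapply Q\<^sub>\<Lambda> (tensor_ext e \<Lambda> (edge_projector E T e)) \<psi>"

lemma term_vec_eq:
  assumes e: "e \<in> inner_edges E \<Lambda>" and \<psi>: "\<psi> \<in> cvecs Q\<^sub>\<Lambda>"
  shows "\<psi> - term_vec e \<psi> = mapply Q\<^sub>\<Lambda> (tensor_ext e \<Lambda> (P e)) \<psi>"
proof -
  have eE: "e \<in> E" "e \<subseteq> \<Lambda>" using e by (auto simp: inner_edges_def)
  have "tensor_ext e \<Lambda> (edge_projector E T e) = mminus (tensor_ext e \<Lambda> (mone (Q e))) (tensor_ext e \<Lambda> (P e))"
    unfolding edge_projector_eq[OF eE(1)] by (auto simp: tensor_ext_def mminus_def fun_eq_iff)
  then have "tensor_ext e \<Lambda> (edge_projector E T e) = mminus (mone Q\<^sub>\<Lambda>) (tensor_ext e \<Lambda> (P e))"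
    by (simp add: tensor_ext_mone[OF eE(2)])
  then have "term_vec e \<psi> = \<psi> - mapply Q\<^sub>\<Lambda> (tensor_ext e \<Lambda> (P e)) \<psi>"
    using \<psi> finite_Q by (simp add: mapply_mminus mapply_mone)
  then show ?thesis by simp
qed

text \<open>\<open>A\<close> and \<open>B\<close> agree on the part of \<psi> in the ground space of
  \<open>e\<close>, so their difference sees only h_e \<psi>, whose norm is at most the square root
  of the energy.\<close>

lemma telescope_step:
  assumes lin: "\<And>\<psi> \<phi>. A (\<psi> - \<phi>) = A \<psi> - A \<phi>" "\<And>\<psi> \<phi>. B (\<psi> - \<phi>) = B \<psi> - B \<phi>"
    and bnd: "\<And>\<psi>. cnorm Q\<^sub>\<Lambda> (A \<psi>) \<le> op_const * cnorm Q\<^sub>\<Lambda> \<psi>" "\<And>\<psi>. cnorm Q\<^sub>\<Lambda> (B \<psi>) \<le> op_const * cnorm Q\<^sub>\<Lambda> \<psi>"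
    and e: "e \<in> inner_edges E \<Lambda>" and \<psi>: "\<psi> \<in> cvecs Q\<^sub>\<Lambda>"
    and eq: "A (mapply Q\<^sub>\<Lambda> (tensor_ext e \<Lambda> (P e)) \<psi>) = B (mapply Q\<^sub>\<Lambda> (tensor_ext e \<Lambda> (P e)) \<psi>)"
  shows "cnorm Q\<^sub>\<Lambda> (A \<psi> - B \<psi>) \<le> 2 * op_const * sqrt (energy \<Lambda> (inner_edges E \<Lambda>) \<psi>)"
proof -
  let ?h = "term_vec e \<psi>"
  have "A \<psi> - A ?h = B \<psi> - B ?h" using eq lin unfolding term_vec_eq[OF e \<psi>, symmetric] by simp
  then have AB: "A \<psi> - B \<psi> = A ?h - B ?h" by (simp add: algebra_simps)
  have "cnorm Q\<^sub>\<Lambda> (A ?h - B ?h) \<le> cnorm Q\<^sub>\<Lambda> (A ?h) + cnorm Q\<^sub>\<Lambda> (B ?h)"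
    using cnorm_diff_triangle[of Q\<^sub>\<Lambda> "A ?h" "B ?h" 0] cnorm_minus_commute[of Q\<^sub>\<Lambda> 0 "B ?h"] by simp
  also have "\<dots> \<le> 2 * op_const * cnorm Q\<^sub>\<Lambda> ?h" using bnd[of ?h] by simp
  also have "\<dots> \<le> 2 * op_const * sqrt (energy \<Lambda> (inner_edges E \<Lambda>) \<psi>)"
  proof (rule mult_left_mono)
    have "(cnorm Q\<^sub>\<Lambda> ?h)\<^sup>2 \<le> energy \<Lambda> (inner_edges E \<Lambda>) \<psi>"
      unfolding energy_def
      by (rule member_le_sum[OF e, of "\<lambda>e. (cnorm Q\<^sub>\<Lambda> (term_vec e \<psi>))\<^sup>2"]) (use finite_bdry(2)[OF fin sub] in auto)
    then show "cnorm Q\<^sub>\<Lambda> ?h \<le> sqrt (energy \<Lambda> (inner_edges E \<Lambda>) \<psi>)" by (simp add: real_le_rsqrt)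
  qed (use op_const_nonneg in simp)
  finally show ?thesis unfolding AB .
qed

lemma supp_telescope:
  assumes \<psi>: "\<psi> \<in> cvecs Q\<^sub>\<Lambda>" and S: "S \<subseteq> \<Lambda>"
  shows "cnorm Q\<^sub>\<Lambda> (\<psi> - supp S \<psi>) \<le> real (card S) * (2 * op_const * sqrt (energy \<Lambda> (inner_edges E \<Lambda>) \<psi>))"
proof -
  have "finite S" using S fin finite_subset by blast
  then show ?thesis using S
  proof (induction S)
    case empty
    then show ?case using supp_empty[OF \<psi>] by simp
  next
    case (insert v S)
    obtain e where e: "e \<in> inner_edges E \<Lambda>" "v \<in> e" using covered insert.prems by blast
    have "cnorm Q\<^sub>\<Lambda> (supp S \<psi> - supp (insert v S) \<psi>) \<le> 2 * op_const * sqrt (energy \<Lambda> (inner_edges E \<Lambda>) \<psi>)"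
      by (rule telescope_step[OF supp_diff supp_diff supp_bounded supp_bounded e(1) \<psi>])
         (simp only: supp_supp[OF insert.hyps(2), symmetric] supp_fixes_edge[OF e])
    moreover have S': "S \<subseteq> \<Lambda>" using insert.prems by simp
    moreover have c: "real (card (insert v S)) * X = real (card S) * X + X" for X
      by (simp add: insert.hyps distrib_right)
    ultimately show ?case
      using insert.IH[OF S'] cnorm_diff_triangle[of Q\<^sub>\<Lambda> \<psi> "supp (insert v S) \<psi>" "supp S \<psi>"]
      unfolding c by linarith
  qed
qed

lemma glued_telescope:
  assumes \<psi>: "\<psi> \<in> cvecs Q\<^sub>\<Lambda>" and S: "S \<subseteq> inner_edges E \<Lambda>"
  shows "cnorm Q\<^sub>\<Lambda> (glued {} \<psi> - glued S \<psi>) \<le> real (card S) * (2 * op_const * sqrt (energy \<Lambda> (inner_edges E \<Lambda>) \<psi>))"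
proof -
  have "finite S" using S finite_bdry(2)[OF fin sub] finite_subset by blast
  then show ?thesis using S
  proof (induction S)
    case empty
    then show ?case by simp
  next
    case (insert e S)
    have e: "e \<in> inner_edges E \<Lambda>" and S': "S \<subseteq> inner_edges E \<Lambda>" using insert.prems by auto
    have "cnorm Q\<^sub>\<Lambda> (glued S \<psi> - glued (insert e S) \<psi>) \<le> 2 * op_const * sqrt (energy \<Lambda> (inner_edges E \<Lambda>) \<psi>)"
      by (rule telescope_step[OF glued_diff glued_diff glued_bounded glued_bounded e \<psi>])
         (rule glued_insert[OF e insert.hyps(2) virt_edge_closed[OF e], symmetric])
    moreover have c: "real (card (insert e S)) * X = real (card S) * X + X" for X
      by (simp add: insert.hyps distrib_right)
    ultimately show ?case
      using insert.IH[OF S'] cnorm_diff_triangle[of Q\<^sub>\<Lambda> "glued {} \<psi>" "glued (insert e S) \<psi>" "glued S \<psi>"]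
      unfolding c by linarith
  qed
qed

text \<open>With all inner edges glued, the tensors are contracted along them, and the reset leaves
  a coefficient that depends on the boundary values alone; this is the PEPS map applied to that
  coefficient, divided by the normalisation \<open>C\<close>.\<close>

lemma glued_in_image: "glued (inner_edges E \<Lambda>) \<psi> \<in> peps_image E T \<Lambda>"
proof -
  let ?I = "inner_edges E \<Lambda>" and ?B = "bdry E \<Lambda>"
  let ?N = "?B \<union> ?I"
  define forth where "forth = (\<lambda>\<zeta> :: edge \<Rightarrow> 'b. \<lambda>v\<in>\<Lambda>. restrict \<zeta> (incident E v))"
  \<comment> \<open>An inner edge of a diagonal configuration has the same value at both ends, and a
    boundary edge has a single end in the region, so the choice does not matter.\<close>
  define unglue where "unglue = (\<lambda>\<eta> :: vertex \<Rightarrow> edge \<Rightarrow> 'b. \<lambda>e\<in>?N. \<eta> (SOME v. v \<in> e \<inter> \<Lambda>) e)"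
  define h where "h = (\<lambda>u. virt \<psi> (reset ?I (forth u)))"
  define C where "C = complex_of_real (1 / sqrt (real CARD('b))) ^ card (touching E \<Lambda>)"
  have C: "C \<noteq> 0" by (simp add: C_def)
  have N: "touching E \<Lambda> = ?N" by (auto simp: touching_def)
  have some: "(SOME v. v \<in> e \<inter> \<Lambda>) \<in> e \<inter> \<Lambda>" if "e \<in> ?N" for e
  proof -
    have "e \<in> touching E \<Lambda>" using that by (simp only: N)
    then have "e \<inter> \<Lambda> \<noteq> {}" using touching_eq[of E \<Lambda>] edges(2) by blast
    then show ?thesis using someI_ex[of "\<lambda>v. v \<in> e \<inter> \<Lambda>"] by blast
  qed
  have EN: "e \<in> E" if "e \<in> ?N" for e using that by (auto simp: inner_edges_def bdry_def)
  have main: "glued ?I \<psi> k = mapply (D \<Lambda>) (V \<Lambda>) (\<lambda>u. if u \<in> D \<Lambda> then h u / C else 0) k" for k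
  proof (cases "k \<in> Q\<^sub>\<Lambda>")
    case k: True
    have "glued ?I \<psi> k = (\<Sum>\<eta>\<in>{\<eta>\<in>VC. diag ?I \<eta>}. (\<Prod>v\<in>\<Lambda>. T v (k v) (\<eta> v)) * virt \<psi> (reset ?I \<eta>))"
      using k by (simp add: glued_def)
    also have "\<dots> = (\<Sum>\<zeta>\<in>configs ?N. vertex_prod E T \<Lambda> k \<zeta> * h (restrict \<zeta> ?B))"
    proof (rule sum.reindex_bij_witness[of _ forth unglue])
      show "forth \<zeta> \<in> {\<eta>\<in>VC. diag ?I \<eta>}" if "\<zeta> \<in> configs ?N" for \<zeta>
      proof -
        have "forth \<zeta> \<in> VC" by (auto simp: forth_def VC_def)
        moreover have "diag ?I (forth \<zeta>)"
          unfolding diag_def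
        proof (intro ballI)
          fix e u v assume e: "e \<in> ?I" "u \<in> e" "v \<in> e"
          then have "u \<in> \<Lambda>" "v \<in> \<Lambda>" "e \<in> incident E u" "e \<in> incident E v" by (auto simp: inner_edges_def incident_def)
          then show "forth \<zeta> u e = forth \<zeta> v e" by (simp add: forth_def)
        qed
        ultimately show ?thesis by simp
      qed
      show "unglue \<eta> \<in> configs ?N" for \<eta> by (simp add: unglue_def)
      show "unglue (forth \<zeta>) = \<zeta>" if \<zeta>: "\<zeta> \<in> configs ?N" for \<zeta>
      proof
        fix e
        show "unglue (forth \<zeta>) e = \<zeta> e"
        proof (cases "e \<in> ?N")
          case True
          have "(SOME v. v \<in> e \<inter> \<Lambda>) \<in> \<Lambda>" "e \<in> incident E (SOME v. v \<in> e \<inter> \<Lambda>)"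
            using some[OF True] EN[OF True] by (auto simp: incident_def)
          then show ?thesis using True by (simp add: unglue_def forth_def)
        next
          case False
          then show ?thesis using \<zeta> unfolding configs_iff unglue_def by auto
        qed
      qed
      have val: "unglue \<eta> e = \<eta> v e" if "diag ?I \<eta>" "v \<in> \<Lambda>" "e \<in> incident E v" for \<eta> v e
      proof -
        have eN: "e \<in> ?N" using incident_subset_touching[OF that(2), of E] that(3) unfolding N by blast
        show ?thesis
        proof (cases "e \<in> ?I")
          case True
          have "\<eta> (SOME v. v \<in> e \<inter> \<Lambda>) e = \<eta> v e"
            using that(1,3) True some[OF eN] unfolding diag_def incident_def by blast
          then show ?thesis using eN by (simp add: unglue_def)
        next
          case False
          then have nsub: "\<not> e \<subseteq> \<Lambda>" using EN[OF eN] by (simp add: inner_edges_def)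
          obtain a b where ab: "e = {a, b}" using edge_cases2[OF edges(2)[OF EN[OF eN]]] by metis
          have "v \<in> e" using that(3) by (simp add: incident_def)
          then have "(SOME v. v \<in> e \<inter> \<Lambda>) = v" using some[OF eN] nsub that(2) unfolding ab by blast
          then show ?thesis using eN by (simp add: unglue_def)
        qed
      qed
      show tf: "forth (unglue \<eta>) = \<eta>" if \<eta>: "\<eta> \<in> {\<eta>\<in>VC. diag ?I \<eta>}" for \<eta>
      proof (rule VC_eqI)
        show "forth (unglue \<eta>) \<in> VC" by (auto simp: forth_def VC_def)
        show "\<eta> \<in> VC" using \<eta> by simp
        show "forth (unglue \<eta>) v e = \<eta> v e" if "v \<in> \<Lambda>" "e \<in> incident E v" for v e
          using that val[OF _ that] \<eta> by (simp add: forth_def)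
      qed
      show "vertex_prod E T \<Lambda> k (unglue \<eta>) * h (restrict (unglue \<eta>) ?B)
         = (\<Prod>v\<in>\<Lambda>. T v (k v) (\<eta> v)) * virt \<psi> (reset ?I \<eta>)" if \<eta>: "\<eta> \<in> {\<eta>\<in>VC. diag ?I \<eta>}" for \<eta>
      proof -
        have "vertex_prod E T \<Lambda> k (unglue \<eta>) = (\<Prod>v\<in>\<Lambda>. T v (k v) (forth (unglue \<eta>) v))"
          unfolding vertex_prod_def by (rule prod.cong) (simp_all add: forth_def)
        moreover have "reset ?I (forth (restrict (unglue \<eta>) ?B)) = reset ?I (forth (unglue \<eta>))"
        proof (rule VC_eqI[OF reset_in_VC reset_in_VC])
          fix v e assume v: "v \<in> \<Lambda>" "e \<in> incident E v"
          have "e \<in> ?N" using incident_subset_touching[OF v(1), of E] v(2) unfolding N by blast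
          then show "reset ?I (forth (restrict (unglue \<eta>) ?B)) v e = reset ?I (forth (unglue \<eta>)) v e"
            using v by (auto simp: reset_def forth_def)
        qed
        ultimately show ?thesis unfolding h_def tf[OF \<eta>] by simp
      qed
    qed
    also have "\<dots> = (\<Sum>u\<in>configs ?B. \<Sum>y\<in>configs ?I. vertex_prod E T \<Lambda> k (override_on u y ?I) * h (restrict (override_on u y ?I) ?B))"
      by (rule sum_configs_Un) (use inner_bdry_disjoint[of E \<Lambda>] in blast)
    also have "\<dots> = (\<Sum>u\<in>configs ?B. V \<Lambda> k u * (h u / C))"
    proof (rule sum.cong[OF refl])
      fix u :: "edge \<Rightarrow> 'b" assume u: "u \<in> configs ?B"
      have "restrict (override_on u y ?I) ?B = u" for y
        using u inner_bdry_disjoint[of E \<Lambda>] unfolding configs_iff override_on_def restrict_def fun_eq_iff by auto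
      moreover have "V \<Lambda> k u = C * (\<Sum>y\<in>configs ?I. vertex_prod E T \<Lambda> k (override_on u y ?I))"
        unfolding C_def by (rule peps_map_eq[OF _ locally_finite[OF fin sub] k u]) (rule edges(2))
      ultimately show "(\<Sum>y\<in>configs ?I. vertex_prod E T \<Lambda> k (override_on u y ?I) * h (restrict (override_on u y ?I) ?B)) = V \<Lambda> k u * (h u / C)"
        using C by (simp add: sum_distrib_right)
    qed
    finally show ?thesis by (simp add: mapply_def)
  next
    case False
    then show ?thesis using peps_map_in_cmats[of E T \<Lambda>] by (simp add: glued_def mapply_def cmats_def)
  qed
  have "glued ?I \<psi> = mapply (D \<Lambda>) (V \<Lambda>) (\<lambda>u. if u \<in> D \<Lambda> then h u / C else 0)" using main by blast
  moreover have "(\<lambda>u. if u \<in> D \<Lambda> then h u / C else 0) \<in> cvecs (D \<Lambda>)" by (simp add: cvecs_def)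
  ultimately show ?thesis unfolding peps_image_def by blast
qed

text \<open>The path runs from \<psi> through \<open>supp\<close>, one vertex at a time, then
  through \<open>glued\<close>, one edge at a time, into the ground space; the orthogonal projection
  is at least as close to \<psi> as its end.\<close>

lemma ground_distance:
  assumes \<psi>: "\<psi> \<in> cvecs Q\<^sub>\<Lambda>"
  shows "cnorm Q\<^sub>\<Lambda> (\<psi> - mapply Q\<^sub>\<Lambda> (P \<Lambda>) \<psi>)
    \<le> real (card \<Lambda> + card (inner_edges E \<Lambda>)) * (2 * op_const * sqrt (energy \<Lambda> (inner_edges E \<Lambda>) \<psi>))"
proof -
  have "cnorm Q\<^sub>\<Lambda> (\<psi> - mapply Q\<^sub>\<Lambda> (P \<Lambda>) \<psi>) \<le> cnorm Q\<^sub>\<Lambda> (\<psi> - glued (inner_edges E \<Lambda>) \<psi>)"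
    by (rule cnorm_orthoproj_best[OF finite_Q is_orthoproj_P[OF fin sub] glued_in_image])
  also have "\<dots> \<le> cnorm Q\<^sub>\<Lambda> (\<psi> - supp \<Lambda> \<psi>) + cnorm Q\<^sub>\<Lambda> (glued {} \<psi> - glued (inner_edges E \<Lambda>) \<psi>)"
    using cnorm_diff_triangle[of Q\<^sub>\<Lambda> \<psi> "glued (inner_edges E \<Lambda>) \<psi>" "supp \<Lambda> \<psi>"] by (simp add: supp_full)
  also have "\<dots> \<le> real (card \<Lambda> + card (inner_edges E \<Lambda>)) * (2 * op_const * sqrt (energy \<Lambda> (inner_edges E \<Lambda>) \<psi>))"
    using supp_telescope[OF \<psi> order_refl] glued_telescope[OF \<psi> order_refl] by (simp add: distrib_right)
  finally show ?thesis .
qed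

lemma gapped_if_bounded:
  assumes B: "real (card \<Lambda> + card (inner_edges E \<Lambda>)) * (2 * op_const) \<le> B" "0 < B"
  shows "gapped \<Lambda> (1 / B\<^sup>2)"
  unfolding gapped_def
proof
  fix \<psi> assume \<psi>: "\<psi> \<in> cvecs Q\<^sub>\<Lambda>"
  let ?e = "energy \<Lambda> (inner_edges E \<Lambda>) \<psi>"
  have e: "0 \<le> ?e" by (rule energy_nonneg)
  have "cnorm Q\<^sub>\<Lambda> (\<psi> - mapply Q\<^sub>\<Lambda> (P \<Lambda>) \<psi>) \<le> B * sqrt ?e"
    using order_trans[OF ground_distance[OF \<psi>]] mult_right_mono[OF B(1), of "sqrt ?e"] e
    by (simp add: mult.assoc)
  then have "(cnorm Q\<^sub>\<Lambda> (\<psi> - mapply Q\<^sub>\<Lambda> (P \<Lambda>) \<psi>))\<^sup>2 \<le> (B * sqrt ?e)\<^sup>2" by (rule power_mono) simp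
  also have "\<dots> = B\<^sup>2 * ?e" using e by (simp add: power_mult_distrib)
  finally show "1 / B\<^sup>2 * (cnorm Q\<^sub>\<Lambda> (\<psi> - mapply Q\<^sub>\<Lambda> (P \<Lambda>) \<psi>))\<^sup>2 \<le> ?e"
    using B(2) by (simp add: field_simps)
qed

end

context isometric_network
begin

text \<open>The single tensor is injective because the region consisting of v alone is. For L =
  \<rho>^{-1} T^* the product T L is an orthogonal projection, so y = L e_k' has |T y| \<le> 1. The
  bound concerns products of entries of T and L because only these are invariant under rescaling
  T.\<close>

lemma left_inverse_conditioned:
  assumes v: "v \<in> G"
    and cond: "\<And>x y. x \<in> cvecs (configs (incident E v)) \<Longrightarrow> y \<in> cvecs (configs (incident E v)) \<Longrightarrow>
        cnorm (configs (incident E v)) x = cnorm (configs (incident E v)) y \<Longrightarrow>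
        cnorm UNIV (mapply (configs (incident E v)) (T v) x) \<le> \<kappa> * cnorm UNIV (mapply (configs (incident E v)) (T v) y)"
    and \<kappa>: "0 \<le> \<kappa>"
  obtains L where "\<And>\<beta> \<beta>'. \<beta> \<in> configs (incident E v) \<Longrightarrow> \<beta>' \<in> configs (incident E v) \<Longrightarrow>
      (\<Sum>k\<in>UNIV. L \<beta> k * T v k \<beta>') = (if \<beta> = \<beta>' then 1 else 0)"
    "\<And>k k' \<beta> \<beta>'. \<beta> \<in> configs (incident E v) \<Longrightarrow> \<beta>' \<in> configs (incident E v) \<Longrightarrow> cmod (T v k \<beta>) * cmod (L \<beta>' k') \<le> \<kappa>"
proof -
  let ?J = "configs (incident E v) :: (edge \<Rightarrow> 'b) set"
  have finJ: "finite ?J" using incident_card[OF v] by simp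
  have finU: "finite (UNIV :: 'p set)" by simp
  define M where "M = (\<lambda>k \<beta>. if \<beta> \<in> ?J then T v k \<beta> else 0)"
  have M: "M \<in> cmats UNIV ?J" by (auto simp: M_def cmats_def)
  have MT: "mapply ?J M x = mapply ?J (T v) x" for x by (simp add: mapply_def M_def cong: sum.cong)
  have ine: "inner_edges E {v} = {}"
  proof -
    have "\<not> e \<subseteq> {v}" if "e \<in> E" for e
    proof
      assume "e \<subseteq> {v}"
      then have "card e \<le> 1" using card_mono[of "{v}" e] by simp
      with card_edge[OF that] show False by simp
    qed
    then show ?thesis by (auto simp: inner_edges_def)
  qed
  have bd: "bdry E {v} = incident E v"
  proof -
    have "e \<in> E \<Longrightarrow> \<not> e \<subseteq> {v}" for e using ine by (auto simp: inner_edges_def)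
    then show ?thesis by (auto simp: bdry_def incident_def)
  qed
  define C where "C = complex_of_real (1 / sqrt (real CARD('b))) ^ card (touching E {v})"
  have Vv: "V {v} k x = C * T v (k v) x" if k: "k \<in> configs {v}" and x: "x \<in> ?J" for k x
  proof -
    have "V {v} k x = C * (\<Sum>y\<in>configs (inner_edges E {v}). vertex_prod E T {v} k (override_on x y (inner_edges E {v})))"
      unfolding C_def by (rule peps_map_eq) (use v k x bd card_edge finite_touching[of "{v}"] in auto)
    then show ?thesis using x by (simp add: ine vertex_prod_def restrict_configs)
  qed
  have inj: "inj_on (mapply ?J M) (cvecs ?J)"
  proof (rule inj_onI)
    fix x y assume xy: "x \<in> cvecs ?J" "y \<in> cvecs ?J" "mapply ?J M x = mapply ?J M y"
    have eq: "mapply ?J (V {v}) z k = (if k \<in> configs {v} then C * mapply ?J M z (k v) else 0)" for z k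
    proof (cases "k \<in> configs {v}")
      case True
      then show ?thesis by (simp add: MT) (simp add: mapply_def Vv sum_distrib_left mult.assoc cong: sum.cong)
    next
      case False
      then show ?thesis using peps_map_in_cmats[of E T "{v}"] by (simp add: mapply_def cmats_def)
    qed
    have "mapply ?J (V {v}) x = mapply ?J (V {v}) y" using xy(3) by (simp add: eq fun_eq_iff)
    then show "x = y" using inj_V[of "{v}"] v xy(1,2) unfolding bd inj_on_def by blast
  qed
  define \<rho> where "\<rho> = mmult UNIV (madjoint M) M"
  define L where "L = mmult ?J (minv ?J \<rho>) (madjoint M)"
  note Gram = orthoproj_Gram[OF finU finJ M inj, folded \<rho>_def]
  have mi: "minv ?J \<rho> \<in> cmats ?J ?J" "mmult ?J (minv ?J \<rho>) \<rho> = mone ?J" using Gram(1) by (auto simp: is_minv_def)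
  have Lc: "L \<in> cmats ?J UNIV" unfolding L_def by (rule mmult_in_cmats[OF mi(1) madjoint_in_cmats[OF M]])
  have LM: "mmult UNIV L M = mone ?J"
  proof -
    have "mmult UNIV L M = mmult ?J (minv ?J \<rho>) \<rho>"
      unfolding L_def \<rho>_def using finJ by (simp add: mmult_assoc)
    then show ?thesis using mi by simp
  qed
  have MLP: "is_orthoproj UNIV (mapply ?J M ` cvecs ?J) (mmult ?J M L)"
    using Gram(2,3) unfolding L_def by simp
  show ?thesis
  proof (rule that[of L])
    fix \<beta> \<beta>' assume b: "\<beta> \<in> ?J" "\<beta>' \<in> ?J"
    have "(\<Sum>k\<in>UNIV. L \<beta> k * T v k \<beta>') = mmult UNIV L M \<beta> \<beta>'" using b by (simp add: mmult_def M_def)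
    then show "(\<Sum>k\<in>UNIV. L \<beta> k * T v k \<beta>') = (if \<beta> = \<beta>' then 1 else 0)" using b by (simp add: LM mone_def)
  next
    fix k k' \<beta> \<beta>' assume b: "\<beta> \<in> ?J" "\<beta>' \<in> ?J"
    define y where "y = mapply UNIV L (mone UNIV k')"
    define t where "t = cnorm ?J y"
    have y: "y \<in> cvecs ?J" unfolding y_def by (rule mapply_in_cvecs[OF Lc])
    have t0: "0 \<le> t" by (simp add: t_def)
    have yL: "y = (\<lambda>i. L i k')" unfolding y_def by (rule mapply_basis) auto
    have "mapply ?J M y = mapply UNIV (mmult ?J M L) (mone UNIV k')"
      unfolding y_def using finJ by (simp add: mapply_mmult)
    then have My: "cnorm UNIV (mapply ?J M y) \<le> 1"
      using cnorm_orthoproj_le(1)[OF finU MLP, of "mone UNIV k'"] by (simp add: cnorm_mone)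
    \<comment> \<open>A multiple of the basis vector at \<beta> with the norm of \<open>y\<close>,
      so that the condition number compares T x with T y.\<close>
    define x where "x = (\<lambda>i. complex_of_real t * mone ?J \<beta> i)"
    have x: "x \<in> cvecs ?J" using mone_in_cvecs[of ?J \<beta>] by (simp add: x_def cvecs_def)
    have nx: "cnorm ?J x = cnorm ?J y" unfolding x_def cnorm_scale using b finJ t0 by (simp add: cnorm_mone t_def)
    have "t * cmod (T v k \<beta>) = cmod (mapply ?J M x k)"
      unfolding x_def mapply_scale mapply_basis[OF finJ b(1)] using b t0 by (simp add: M_def norm_mult)
    also have "\<dots> \<le> cnorm UNIV (mapply ?J M x)" by (rule cmod_le_cnorm) auto
    also have "\<dots> \<le> \<kappa> * cnorm UNIV (mapply ?J M y)" unfolding MT by (rule cond[OF x y nx])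
    also have "\<dots> \<le> \<kappa>" using mult_left_mono[OF My \<kappa>] by simp
    finally have "cmod (T v k \<beta>) * t \<le> \<kappa>" by (simp add: mult.commute)
    moreover have "cmod (L \<beta>' k') \<le> t" using cmod_le_cnorm[OF finJ b(2), of y] by (simp add: yL t_def)
    then have "cmod (T v k \<beta>) * cmod (L \<beta>' k') \<le> cmod (T v k \<beta>) * t" by (rule mult_left_mono) simp
    ultimately show "cmod (T v k \<beta>) * cmod (L \<beta>' k') \<le> \<kappa>" by linarith
  qed
qed

text \<open>The bound of \<open>gapped_if_bounded\<close> depends on the region only through its
  size, the degrees and \<kappa>. Degrees are bounded because neighbours are separated points at
  distance 1.\<close>

lemma bounded_regions_gapped:
  assumes cond: "uniformly_conditioned G E T"
  obtains \<gamma> where "0 < \<gamma>" "\<And>\<Lambda>. finite \<Lambda> \<Longrightarrow> \<Lambda> \<subseteq> G \<Longrightarrow> card \<Lambda> \<le> N \<Longrightarrow>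
    (\<And>v. v \<in> \<Lambda> \<Longrightarrow> \<exists>e\<in>inner_edges E \<Lambda>. v \<in> e) \<Longrightarrow> gapped \<Lambda> \<gamma>"
proof -
  obtain \<kappa>0 where \<kappa>0: "\<And>v x y. v \<in> G \<Longrightarrow> x \<in> cvecs (configs (incident E v)) \<Longrightarrow> y \<in> cvecs (configs (incident E v)) \<Longrightarrow>
        cnorm (configs (incident E v)) x = cnorm (configs (incident E v)) y \<Longrightarrow>
        cnorm UNIV (mapply (configs (incident E v)) (T v) x) \<le> \<kappa>0 * cnorm UNIV (mapply (configs (incident E v)) (T v) y)"
    using cond unfolding uniformly_conditioned_def by blast
  define \<kappa> where "\<kappa> = max \<kappa>0 1"
  have \<kappa>1: "1 \<le> \<kappa>" by (simp add: \<kappa>_def)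
  have \<kappa>: "cnorm UNIV (mapply (configs (incident E v)) (T v) x) \<le> \<kappa> * cnorm UNIV (mapply (configs (incident E v)) (T v) y)"
    if "v \<in> G" "x \<in> cvecs (configs (incident E v))" "y \<in> cvecs (configs (incident E v))"
      "cnorm (configs (incident E v)) x = cnorm (configs (incident E v)) y" for v x y
    using order_trans[OF \<kappa>0[OF that] mult_right_mono[of \<kappa>0 \<kappa>]] by (simp add: \<kappa>_def)
  have "\<forall>v\<in>G. \<exists>L. (\<forall>\<beta>\<in>configs (incident E v). \<forall>\<beta>'\<in>configs (incident E v).
      (\<Sum>k\<in>UNIV. L \<beta> k * T v k \<beta>') = (if \<beta> = \<beta>' then 1 else 0) \<and> (\<forall>k k'. cmod (T v k \<beta>) * cmod (L \<beta>' k') \<le> \<kappa>))"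
  proof
    fix v assume v: "v \<in> G"
    show "\<exists>L. (\<forall>\<beta>\<in>configs (incident E v). \<forall>\<beta>'\<in>configs (incident E v).
      (\<Sum>k\<in>UNIV. L \<beta> k * T v k \<beta>') = (if \<beta> = \<beta>' then 1 else 0) \<and> (\<forall>k k'. cmod (T v k \<beta>) * cmod (L \<beta>' k') \<le> \<kappa>))"
    proof (rule left_inverse_conditioned[OF v \<kappa>[OF v]])
      fix L
      assume L: "\<And>\<beta> \<beta>'. \<beta> \<in> configs (incident E v) \<Longrightarrow> \<beta>' \<in> configs (incident E v) \<Longrightarrow>
          (\<Sum>k\<in>UNIV. L \<beta> k * T v k \<beta>') = (if \<beta> = \<beta>' then 1 else 0)"
        "\<And>k k' \<beta> \<beta>'. \<beta> \<in> configs (incident E v) \<Longrightarrow> \<beta>' \<in> configs (incident E v) \<Longrightarrow> cmod (T v k \<beta>) * cmod (L \<beta>' k') \<le> \<kappa>"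
      show ?thesis by (intro exI[of _ L] ballI conjI allI L)
    qed (use \<kappa>1 in auto)
  qed
  then obtain L where L: "\<And>v \<beta> \<beta>'. v \<in> G \<Longrightarrow> \<beta> \<in> configs (incident E v) \<Longrightarrow> \<beta>' \<in> configs (incident E v) \<Longrightarrow>
      (\<Sum>k\<in>UNIV. L v \<beta> k * T v k \<beta>') = (if \<beta> = \<beta>' then 1 else 0) \<and> (\<forall>k k'. cmod (T v k \<beta>) * cmod (L v \<beta>' k') \<le> \<kappa>)"
    by metis
  define d where "d = cells 3"
  define b where "b = real CARD('b) ^ d"
  \<comment> \<open>Number of telescope steps times twice the bound for \<open>op_const\<close>; the
    final 1 makes it positive even for \<open>N\<close> = 0.\<close>
  define B where "B = (real N + real N * real d) * (2 * (real CARD('p) ^ N * real CARD('p) ^ N * (b ^ N * \<kappa> ^ N))) + 1"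
  have b1: "1 \<le> b" unfolding b_def by (rule one_le_power) simp
  have p1: "1 \<le> real CARD('p)" by simp
  have B0: "0 < B" unfolding B_def using b1 \<kappa>1 by (intro add_nonneg_pos) auto
  have main: "gapped \<Lambda> (1 / B\<^sup>2)" if \<Lambda>: "finite \<Lambda>" "\<Lambda> \<subseteq> G" "card \<Lambda> \<le> N" "\<And>v. v \<in> \<Lambda> \<Longrightarrow> \<exists>e\<in>inner_edges E \<Lambda>. v \<in> e" for \<Lambda>
  proof -
    interpret cr: covered_region G E T \<Lambda> L \<kappa>
    proof unfold_locales
      fix v assume v: "v \<in> \<Lambda>"
      then have vG: "v \<in> G" using \<Lambda>(2) by blast
      show "\<exists>e\<in>inner_edges E \<Lambda>. v \<in> e" by (rule \<Lambda>(4)[OF v])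
      fix \<beta> \<beta>' :: "edge \<Rightarrow> 'b" assume b: "\<beta> \<in> configs (incident E v)" "\<beta>' \<in> configs (incident E v)"
      show "(\<Sum>k\<in>UNIV. L v \<beta> k * T v k \<beta>') = (if \<beta> = \<beta>' then 1 else 0)" using L[OF vG b] by (rule conjunct1)
      show "cmod (T v k \<beta>) * cmod (L v \<beta>' k') \<le> \<kappa>" for k k' using L[OF vG b] by simp
    qed (use \<Lambda> \<kappa>1 in auto)
    have cQ: "real (card (Q \<Lambda>)) \<le> real CARD('p) ^ N"
    proof -
      have "real (card (Q \<Lambda>)) = real CARD('p) ^ card \<Lambda>" using \<Lambda> by (simp add: configs_def card_PiE)
      then show ?thesis using power_increasing[OF \<Lambda>(3) p1] by simp
    qed
    have cI: "real (card (configs (incident E v) :: (edge \<Rightarrow> 'b) set)) \<le> b" if "v \<in> \<Lambda>" for v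
    proof -
      have v: "finite (incident E v)" "card (incident E v) \<le> d" using incident_card[of v] that \<Lambda> by (auto simp: d_def)
      have "real (card (configs (incident E v) :: (edge \<Rightarrow> 'b) set)) = real CARD('b) ^ card (incident E v)"
        using v by (simp add: configs_def card_PiE)
      also have "\<dots> \<le> b" unfolding b_def by (rule power_increasing[OF v(2)]) simp
      finally show ?thesis .
    qed
    have cV: "real (card cr.VC) \<le> b ^ N"
    proof -
      have "real (card cr.VC) = (\<Prod>v\<in>\<Lambda>. real (card (configs (incident E v) :: (edge \<Rightarrow> 'b) set)))"
        unfolding cr.VC_def using \<Lambda> by (simp add: card_PiE)
      also have "\<dots> \<le> (\<Prod>v\<in>\<Lambda>. b)" by (rule prod_mono) (use cI in auto)
      also have "\<dots> \<le> b ^ N" using power_increasing[OF \<Lambda>(3) b1] by simp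
      finally show ?thesis .
    qed
    have cK: "\<kappa> ^ card \<Lambda> \<le> \<kappa> ^ N" by (rule power_increasing[OF \<Lambda>(3) \<kappa>1])
    have cE: "real (card (inner_edges E \<Lambda>)) \<le> real N * real d"
    proof -
      have "inner_edges E \<Lambda> \<subseteq> (\<Union>v\<in>\<Lambda>. incident E v)"
      proof
        fix e assume e: "e \<in> inner_edges E \<Lambda>"
        then have "e \<in> E" "e \<subseteq> \<Lambda>" by (auto simp: inner_edges_def)
        moreover have "e \<noteq> {}" using card_edge[OF \<open>e \<in> E\<close>] by auto
        ultimately show "e \<in> (\<Union>v\<in>\<Lambda>. incident E v)" by (auto simp: incident_def)
      qed
      then have "card (inner_edges E \<Lambda>) \<le> card (\<Union>v\<in>\<Lambda>. incident E v)"
        using \<Lambda> incident_card by (intro card_mono) auto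
      also have "\<dots> \<le> (\<Sum>v\<in>\<Lambda>. card (incident E v))" by (rule card_UN_le[OF \<Lambda>(1)])
      also have "\<dots> \<le> (\<Sum>v\<in>\<Lambda>. d)" by (rule sum_mono) (use \<Lambda> incident_card in \<open>auto simp: d_def\<close>)
      also have "\<dots> \<le> N * d" using \<Lambda>(3) by simp
      finally show ?thesis by (simp flip: of_nat_mult)
    qed
    have "cr.op_const \<le> real CARD('p) ^ N * real CARD('p) ^ N * (b ^ N * \<kappa> ^ N)"
      unfolding cr.op_const_def
      by (intro mult_mono cQ cV cK) (use \<kappa>1 b1 in auto)
    then have "real (card \<Lambda> + card (inner_edges E \<Lambda>)) * (2 * cr.op_const) \<le>
       (real N + real N * real d) * (2 * (real CARD('p) ^ N * real CARD('p) ^ N * (b ^ N * \<kappa> ^ N)))"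
      using cE \<Lambda>(3) cr.op_const_nonneg by (intro mult_mono) auto
    then have "real (card \<Lambda> + card (inner_edges E \<Lambda>)) * (2 * cr.op_const) \<le> B" by (simp add: B_def)
    then show ?thesis using cr.gapped_if_bounded B0 by blast
  qed
  show ?thesis by (rule that[of "1 / B\<^sup>2"]) (use B0 main in auto)
qed

end

section \<open>From form inequalities to eigenvalues\<close>

subsection \<open>Ground states and the spectral gap\<close>

context injective_network
begin

text \<open>The Hamiltonian is frustration free: the map of \<Lambda> factors through the map of
  every subregion, so its image is fixed by the local projection.\<close>

lemma ground_state_local:
  assumes \<Lambda>: "finite \<Lambda>" "\<Lambda> \<subseteq> G" and Y: "Y \<subseteq> \<Lambda>" and \<psi>: "\<psi> \<in> peps_image E T \<Lambda>"
  shows "mapply (Q \<Lambda>) (tensor_ext Y \<Lambda> (P Y)) \<psi> = \<psi>"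
proof (rule embed_eq_iff)
  obtain a where a: "\<psi> = mapply (D \<Lambda>) (V \<Lambda>) a" using \<psi> by (auto simp: peps_image_def)
  show "mapply (Q \<Lambda>) (tensor_ext Y \<Lambda> (P Y)) \<psi> \<in> cvecs (Q \<Lambda>)" by (rule mapply_in_cvecs) simp
  show "\<psi> \<in> cvecs (Q \<Lambda>)" unfolding a by (rule mapply_in_cvecs[OF peps_map_in_cmats])
  define Z where "Z = \<Lambda> - Y"
  define m where "m = bdry E Y \<inter> bdry E Z"
  have YZ: "Y \<inter> Z = {}" "Y \<union> Z = \<Lambda>" using Y by (auto simp: Z_def)
  have fin: "finite Y" "finite Z" and sub: "Y \<subseteq> G" "Z \<subseteq> G" using \<Lambda> Y finite_subset by (auto simp: Z_def)
  have bd: "bdry E \<Lambda> = (bdry E Y - m) \<union> (bdry E Z - m)"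
    using bdry_Un(1)[OF edges(2) YZ(1)] unfolding YZ(2) m_def by blast
  have bY: "(bdry E Y - m) \<union> m = bdry E Y" by (auto simp: m_def)
  define WZ where "WZ = (\<lambda>k u. complex_of_real (sqrt (real CARD('b))) ^ card m * V Z k u)"
  define f :: "(vertex, 'p, edge, 'b) state" where "f = (\<lambda>k x. a (restrict x (bdry E \<Lambda>)))"
  define g where "g = wop Z (bdry E Z - m) m WZ f"
  have f: "indep UNIV m f"
    unfolding indep_def f_def
  proof (intro allI impI arg_cong[of _ _ a] restrict_ext)
    fix x x' e assume "\<forall>e. e \<notin> m \<longrightarrow> x e = x' e" "e \<in> bdry E \<Lambda>"
    then show "x e = x' e" unfolding bd by blast
  qed
  have "embed \<Lambda> \<psi> = wop \<Lambda> (bdry E \<Lambda>) {} (V \<Lambda>) f"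
    unfolding a f_def embed_def
    by (intro ext) (simp add: wop_apply mapply_def restrict_override_self)
  also have "\<dots> = wop Y (bdry E Y) {} (V Y) g"
  proof -
    have "wop (Y \<union> Z) ((bdry E Y - m) \<union> (bdry E Z - m)) {} (V (Y \<union> Z)) f = wop Y ((bdry E Y - m) \<union> m) {} (V Y) g"
      unfolding g_def
    proof (rule wop_glue[OF YZ(1)])
      show "indep {} m f" by (rule indep_mono[OF f]) auto
      fix k :: "vertex \<Rightarrow> 'p" and u :: "edge \<Rightarrow> 'b"
      assume k: "k \<in> configs (Y \<union> Z)" and u: "u \<in> configs ((bdry E Y - m) \<union> (bdry E Z - m))"
      have "u \<in> configs (bdry E (Y \<union> Z))" using u unfolding bd[symmetric] YZ(2) .
      then show "V (Y \<union> Z) k u = (\<Sum>w\<in>configs m. WZ (restrict k Z) (override_on (restrict u (bdry E Z - m)) w m) *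
          V Y (restrict k Y) (override_on (restrict u (bdry E Y - m)) w m))"
        unfolding WZ_def m_def
        using peps_map_Un[OF edges(2) YZ(1) fin locally_finite[OF fin(1) sub(1)] locally_finite[OF fin(2) sub(2)] k] by blast
    qed (auto simp: m_def)
    then show ?thesis unfolding YZ(2) bd[symmetric] bY .
  qed
  finally have em: "embed \<Lambda> \<psi> = wop Y (bdry E Y) {} (V Y) g" .
  have g: "indep Y {} g"
    unfolding g_def by (rule indep_wop) (use YZ in \<open>auto intro: indep_mono[OF f]\<close>)
  note Gram = orthoproj_Gram[OF finite_bdry(4)[OF fin(1) sub(1)] finite_bdry(3)[OF fin(1) sub(1)] peps_map_in_cmats inj_V[OF fin(1) sub(1)]]
  have "pop Y (P Y) (wop Y (bdry E Y) {} (V Y) g) = wop Y (bdry E Y) {} (V Y) g"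
    unfolding P_def peps_image_def Gram(2) by (rule pop_projection_fixes[OF finite_bdry(1)[OF fin(1) sub(1)] Gram(1) g])
  then show "embed \<Lambda> (mapply (Q \<Lambda>) (tensor_ext Y \<Lambda> (P Y)) \<psi>) = (embed \<Lambda> \<psi> :: (vertex, 'p, edge, 'b) state)"
    unfolding embed_tensor_ext[OF \<Lambda>(1) Y] em .
qed

lemma hamiltonian_apply:
  "mapply (Q \<Lambda>) (parent_hamiltonian E T \<Lambda>) \<psi>
    = (\<lambda>k. \<Sum>e\<in>inner_edges E \<Lambda>. mapply (Q \<Lambda>) (tensor_ext e \<Lambda> (edge_projector E T e)) \<psi> k)"
  unfolding mapply_def parent_hamiltonian_def sum_distrib_right
  by (rule ext, rule sum.swap)

lemma energy_eq_form:
  assumes \<Lambda>: "finite \<Lambda>" "\<Lambda> \<subseteq> G"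
  shows "cinner (Q \<Lambda>) \<psi> (mapply (Q \<Lambda>) (parent_hamiltonian E T \<Lambda>) \<psi>) = of_real (energy \<Lambda> (inner_edges E \<Lambda>) \<psi>)"
proof -
  have "cinner (Q \<Lambda>) \<psi> (mapply (Q \<Lambda>) (parent_hamiltonian E T \<Lambda>) \<psi>)
    = (\<Sum>e\<in>inner_edges E \<Lambda>. cinner (Q \<Lambda>) \<psi> (mapply (Q \<Lambda>) (tensor_ext e \<Lambda> (edge_projector E T e)) \<psi>))"
    unfolding hamiltonian_apply cinner_def sum_distrib_left by (rule sum.swap)
  also have "\<dots> = (\<Sum>e\<in>inner_edges E \<Lambda>. of_real ((cnorm (Q \<Lambda>) (mapply (Q \<Lambda>) (tensor_ext e \<Lambda> (edge_projector E T e)) \<psi>))\<^sup>2))"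
  proof (rule sum.cong[OF refl])
    fix e assume "e \<in> inner_edges E \<Lambda>"
    then have e: "e \<in> E" "e \<subseteq> \<Lambda>" by (auto simp: inner_edges_def)
    let ?h = "tensor_ext e \<Lambda> (edge_projector E T e)"
    have h: "madjoint ?h = ?h" "mmult (Q \<Lambda>) ?h ?h = ?h"
      using is_orthoproj_tensor_ext[OF \<Lambda>(1) e(2) edge_projector_is_orthoproj[OF e(1)]] by (auto simp: is_orthoproj_def)
    show "cinner (Q \<Lambda>) \<psi> (mapply (Q \<Lambda>) ?h \<psi>) = of_real ((cnorm (Q \<Lambda>) (mapply (Q \<Lambda>) ?h \<psi>))\<^sup>2)"
      unfolding cinner_self[symmetric] cinner_mapply h(1) using \<Lambda> h(2) by (simp add: mapply_mmult[symmetric])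
  qed
  finally show ?thesis by (simp add: energy_def)
qed

lemma hamiltonian_hermitian: "madjoint (parent_hamiltonian E T \<Lambda>) = parent_hamiltonian E T \<Lambda>"
proof (intro ext)
  fix k k'
  have "cnj (tensor_ext e \<Lambda> (edge_projector E T e) k' k) = tensor_ext e \<Lambda> (edge_projector E T e) k k'"
    if "e \<in> inner_edges E \<Lambda>" for e
  proof -
    have "e \<in> E" using that by (simp add: inner_edges_def)
    then have "madjoint (edge_projector E T e) = edge_projector E T e"
      using edge_projector_is_orthoproj by (simp add: is_orthoproj_def)
    from madjoint_tensor_ext[OF this, of e \<Lambda>] show ?thesis by (metis madjoint_def)
  qed
  then show "madjoint (parent_hamiltonian E T \<Lambda>) k k' = parent_hamiltonian E T \<Lambda> k k'"
    by (simp add: madjoint_def parent_hamiltonian_def)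
qed

lemma hamiltonian_ground_state:
  assumes \<Lambda>: "finite \<Lambda>" "\<Lambda> \<subseteq> G" and \<psi>: "\<psi> \<in> peps_image E T \<Lambda>"
  shows "mapply (Q \<Lambda>) (parent_hamiltonian E T \<Lambda>) \<psi> = (\<lambda>_. 0)"
proof -
  have c: "\<psi> \<in> cvecs (Q \<Lambda>)"
    using \<psi> mapply_in_cvecs[OF peps_map_in_cmats] by (auto simp: peps_image_def)
  have "mapply (Q \<Lambda>) (tensor_ext e \<Lambda> (edge_projector E T e)) \<psi> = (\<lambda>_. 0)" if "e \<in> inner_edges E \<Lambda>" for e
  proof -
    have e: "e \<in> E" "e \<subseteq> \<Lambda>" using that by (auto simp: inner_edges_def)
    have "tensor_ext e \<Lambda> (edge_projector E T e) = mminus (tensor_ext e \<Lambda> (mone (Q e))) (tensor_ext e \<Lambda> (P e))"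
      unfolding edge_projector_eq[OF e(1)] by (auto simp: tensor_ext_def mminus_def fun_eq_iff)
    then have "mapply (Q \<Lambda>) (tensor_ext e \<Lambda> (edge_projector E T e)) \<psi> = \<psi> - \<psi>"
      using c \<Lambda> ground_state_local[OF \<Lambda> e(2) \<psi>]
      by (simp add: tensor_ext_mone[OF e(2)] mapply_mminus mapply_mone)
    then show ?thesis by auto
  qed
  then show ?thesis unfolding hamiltonian_apply by simp
qed

lemma ground_space_nontrivial:
  assumes \<Lambda>: "finite \<Lambda>" "\<Lambda> \<subseteq> G"
  obtains \<psi> where "\<psi> \<in> peps_image E T \<Lambda>" "\<exists>k\<in>Q \<Lambda>. \<psi> k \<noteq> 0"
proof -
  define u where "u = restrict (undefined :: edge \<Rightarrow> 'b) (bdry E \<Lambda>)"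
  have u: "u \<in> D \<Lambda>" by (simp add: u_def)
  let ?x = "mone (D \<Lambda>) u" and ?\<psi> = "mapply (D \<Lambda>) (V \<Lambda>) (mone (D \<Lambda>) u)"
  have "?x \<noteq> (\<lambda>_. 0)" using u by (auto simp: mone_def fun_eq_iff)
  moreover have "(\<lambda>_. 0) \<in> cvecs (D \<Lambda>)" by (simp add: cvecs_def)
  ultimately have "?\<psi> \<noteq> mapply (D \<Lambda>) (V \<Lambda>) (\<lambda>_. 0)"
    using inj_V[OF \<Lambda>] mone_in_cvecs[of "D \<Lambda>" u] unfolding inj_on_def by blast
  then have "?\<psi> \<noteq> (\<lambda>_. 0)" by simp
  moreover have "?\<psi> \<in> cvecs (Q \<Lambda>)" by (rule mapply_in_cvecs[OF peps_map_in_cmats])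
  ultimately have "\<exists>k\<in>Q \<Lambda>. ?\<psi> k \<noteq> 0" unfolding cvecs_def by (auto simp: fun_eq_iff)
  moreover have "?\<psi> \<in> peps_image E T \<Lambda>" unfolding peps_image_def by (intro imageI mone_in_cvecs)
  ultimately show ?thesis using that by blast
qed

text \<open>An eigenvector with nonzero eigenvalue is orthogonal to the image of the PEPS map, on
  which H vanishes, so there the form inequality reads \<gamma> \<le> \<mu>. Zero is an eigenvalue
  because injectivity keeps a nonzero boundary vector from being mapped to 0.\<close>

lemma spectral_gap_ge:
  assumes \<Lambda>: "finite \<Lambda>" "\<Lambda> \<subseteq> G" and g: "gapped \<Lambda> \<gamma>" and card: "2 \<le> card (energies E T \<Lambda>)"
  shows "\<gamma> \<le> spectral_gap E T \<Lambda>"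
proof -
  let ?H = "parent_hamiltonian E T \<Lambda>" and ?S = "energies E T \<Lambda>"
  have finQ: "finite (Q \<Lambda>)" using \<Lambda> by simp
  have finS: "finite ?S" using card by (auto intro: card_ge_0_finite)
  have eig: "\<mu> = 0 \<or> (\<gamma> \<le> \<mu> \<and> 0 \<le> \<mu>)" if \<mu>: "\<mu> \<in> ?S" for \<mu>
  proof (cases "\<mu> = 0")
    case False
    obtain x where x: "x \<in> cvecs (Q \<Lambda>)" "\<exists>k\<in>Q \<Lambda>. x k \<noteq> 0" "mapply (Q \<Lambda>) ?H x = (\<lambda>i. complex_of_real \<mu> * x i)"
      using \<mu> unfolding energies_def eigvals_def by blast
    have n: "cnorm (Q \<Lambda>) x > 0"
    proof -
      have "cnorm (Q \<Lambda>) x \<noteq> 0" using x(2) cnorm_eq_0[OF finQ] by blast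
      then show ?thesis using cnorm_nonneg[of "Q \<Lambda>" x] by linarith
    qed
    have sc: "cinner (Q \<Lambda>) z (\<lambda>i. complex_of_real \<mu> * x i) = of_real \<mu> * cinner (Q \<Lambda>) z x" for z
      by (simp add: cinner_def sum_distrib_left mult.left_commute)
    have "of_real (energy \<Lambda> (inner_edges E \<Lambda>) x) = complex_of_real (\<mu> * (cnorm (Q \<Lambda>) x)\<^sup>2)"
      unfolding energy_eq_form[OF \<Lambda>, symmetric] x(3) sc cinner_self by simp
    then have en: "energy \<Lambda> (inner_edges E \<Lambda>) x = \<mu> * (cnorm (Q \<Lambda>) x)\<^sup>2" by (simp only: of_real_eq_iff)
    let ?p = "mapply (Q \<Lambda>) (P \<Lambda>) x"
    have p: "?p \<in> peps_image E T \<Lambda>" using is_orthoproj_P[OF \<Lambda>] x(1) by (auto simp: is_orthoproj_def)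
    have Ph: "madjoint (P \<Lambda>) = P \<Lambda>" "mmult (Q \<Lambda>) (P \<Lambda>) (P \<Lambda>) = P \<Lambda>"
      using is_orthoproj_P[OF \<Lambda>] by (auto simp: is_orthoproj_def)
    \<comment> \<open>Orthogonality of eigenvectors for different eigenvalues, with P x as ground
      state.\<close>
    have "of_real \<mu> * cinner (Q \<Lambda>) ?p x = cinner (Q \<Lambda>) ?p (mapply (Q \<Lambda>) ?H x)" unfolding x(3) sc ..
    also have "\<dots> = cinner (Q \<Lambda>) (mapply (Q \<Lambda>) ?H ?p) x" by (simp add: cinner_mapply hamiltonian_hermitian)
    also have "\<dots> = 0" unfolding hamiltonian_ground_state[OF \<Lambda> p] by (simp add: cinner_def)
    finally have "cinner (Q \<Lambda>) ?p x = 0" using False by simp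
    moreover have "cinner (Q \<Lambda>) ?p ?p = cinner (Q \<Lambda>) ?p x"
      using finQ Ph by (simp add: cinner_mapply mapply_mmult[symmetric])
    ultimately have "cnorm (Q \<Lambda>) ?p = 0" by (simp add: cinner_self)
    moreover have "(cnorm (Q \<Lambda>) x)\<^sup>2 = (cnorm (Q \<Lambda>) ?p)\<^sup>2 + (cnorm (Q \<Lambda>) (x - ?p))\<^sup>2"
      by (rule cnorm_orthoproj_Pythagoras[OF finQ is_orthoproj_P[OF \<Lambda>]])
    ultimately have "(cnorm (Q \<Lambda>) (x - ?p))\<^sup>2 = (cnorm (Q \<Lambda>) x)\<^sup>2" by simp
    then have "\<gamma> * (cnorm (Q \<Lambda>) x)\<^sup>2 \<le> \<mu> * (cnorm (Q \<Lambda>) x)\<^sup>2"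
      using g x(1) en unfolding gapped_def by metis
    moreover have "0 \<le> \<mu> * (cnorm (Q \<Lambda>) x)\<^sup>2" using energy_nonneg en by metis
    moreover have "0 < (cnorm (Q \<Lambda>) x)\<^sup>2" using n by simp
    ultimately show ?thesis by (simp add: zero_le_mult_iff)
  qed simp
  have zero: "0 \<in> ?S"
  proof -
    obtain \<psi> where \<psi>: "\<psi> \<in> peps_image E T \<Lambda>" "\<exists>k\<in>Q \<Lambda>. \<psi> k \<noteq> 0" using ground_space_nontrivial[OF \<Lambda>] .
    have c: "\<psi> \<in> cvecs (Q \<Lambda>)" using \<psi>(1) mapply_in_cvecs[OF peps_map_in_cmats] by (auto simp: peps_image_def)
    show ?thesis unfolding energies_def eigvals_def using hamiltonian_ground_state[OF \<Lambda> \<psi>(1)] \<psi>(2) c by auto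
  qed
  have min: "Min ?S = 0" by (rule Min_eqI[OF finS _ zero]) (use eig in fastforce)
  have "?S - {0} \<noteq> {}"
  proof
    assume "?S - {0} = {}"
    then have "card ?S \<le> card {0::real}" by (intro card_mono) auto
    with card show False by simp
  qed
  then have "Min (?S - {0}) \<in> ?S - {0}" using finS by (intro Min_in) auto
  then show ?thesis unfolding spectral_gap_def min using eig by fastforce
qed

text \<open>Used in contraposition: two distinct eigenvalues force an edge, hence two vertices, in
  the region.\<close>

lemma energies_no_edges:
  assumes "inner_edges E \<Lambda> = {}"
  shows "card (energies E T \<Lambda>) \<le> 1"
proof -
  have "energies E T \<Lambda> \<subseteq> {0}"
    unfolding energies_def eigvals_def parent_hamiltonian_def assms
    by (auto simp: mapply_def fun_eq_iff)
  then show ?thesis using card_mono[of "{0::real}"] by fastforce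
qed

end

section \<open>The recursion over length scales\<close>

subsection \<open>The scales of the recursion\<close>

text \<open>The Weierstrass product inequality: it bounds the accumulated loss by the sum of the
  losses.\<close>

lemma prod_one_minus_ge:
  fixes s :: "nat \<Rightarrow> real"
  assumes "\<And>j. 0 \<le> s j" "\<And>j. s j \<le> 1"
  shows "1 - (\<Sum>j<k. s j) \<le> (\<Prod>j<k. 1 - s j)" "0 \<le> (\<Prod>j<k. 1 - s j)" "(\<Prod>j<k. 1 - s j) \<le> 1"
proof -
  show nn: "0 \<le> (\<Prod>j<k. 1 - s j)" for k by (rule prod_nonneg) (use assms in auto)
  show le: "(\<Prod>j<k. 1 - s j) \<le> 1" for k by (rule prod_le_1) (use assms in auto)
  show "1 - (\<Sum>j<k. s j) \<le> (\<Prod>j<k. 1 - s j)"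
  proof (induction k)
    case (Suc k)
    have "(\<Prod>j<k. 1 - s j) * s k \<le> 1 * s k" by (rule mult_right_mono[OF le assms(1)])
    with Suc show ?case by (simp add: algebra_simps)
  qed simp
qed

text \<open>Quadratic in k, so that the losses 1 / (n + 1) are summable while the overlaps shrink
  only polynomially relative to the scale. With this choice 1 / n telescopes, and the factor 4 makes
  the total at most 1/4.\<close>

definition cuts :: "nat \<Rightarrow> nat" where
  "cuts k = 4 * (k + 1) * (k + 2)"

lemma cuts_pos: "0 < cuts k"
  by (simp add: cuts_def)

lemma sum_cuts: "(\<Sum>j<k. 1 / (real (cuts j) + 1)) \<le> 1 / 4"
proof -
  have "(\<Sum>j<k. 1 / (real (cuts j) + 1)) \<le> (\<Sum>j<k. 1 / 4 * (1 / (real j + 1) - 1 / (real (Suc j) + 1)))"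
  proof (rule sum_mono)
    fix j
    have "0 < real (cuts j)" using cuts_pos by simp
    then have "1 / (real (cuts j) + 1) \<le> 1 / real (cuts j)" by (intro frac_le) auto
    also have "\<dots> = 1 / 4 * (1 / (real j + 1) - 1 / (real (Suc j) + 1))"
    proof -
      have "1 / (x + 1) - 1 / (x + 2) = 1 / ((x + 1) * (x + 2))" if "0 \<le> x" for x :: real
        using that by (simp add: diff_frac_eq)
      note this[of "real j", OF of_nat_0_le_iff]
      moreover have "real (cuts j) = 4 * ((real j + 1) * (real j + 2))" by (simp add: cuts_def algebra_simps)
      moreover have "real (Suc j) + 1 = real j + 2" by simp
      ultimately show ?thesis by (simp only:) simp
    qed
    finally show "1 / (real (cuts j) + 1) \<le> 1 / 4 * (1 / (real j + 1) - 1 / (real (Suc j) + 1))" .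
  qed
  also have "\<dots> = 1 / 4 * (\<Sum>j<k. 1 / (real j + 1) - 1 / (real (Suc j) + 1))"
    by (simp only: sum_distrib_left)
  also have "(\<Sum>j<k. 1 / (real j + 1) - 1 / (real (Suc j) + 1)) = 1 - 1 / (real k + 1)"
    using sum_lessThan_telescope'[of "\<lambda>j. 1 / (real j + 1)" k] by simp
  also have "1 / 4 * (1 - 1 / (real k + 1)) \<le> 1 / 4" by (simp add: field_simps)
  finally show ?thesis .
qed

text \<open>Write s = t^2. The quadratic growth of \<open>cuts\<close> is compared with the square
  of (k + 2) t^(k + 2), which is bounded since n t^n tends to 0.\<close>

lemma poly_times_geometric_bounded:
  fixes s :: real
  assumes "0 < s" "s < 1"
  obtains U where "\<And>k. real (cuts k) * s ^ k \<le> U"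
proof -
  define t where "t = sqrt s"
  have t: "0 < t" "t < 1" "t\<^sup>2 = s" using assms by (auto simp: t_def)
  have "(\<lambda>n. of_nat n * t ^ n) \<longlonglongrightarrow> 0" by (rule powser_times_n_limit_0) (use t in auto)
  then have "Bseq (\<lambda>n. of_nat n * t ^ n)" by (rule convergent_imp_Bseq[OF convergentI])
  then obtain K where K: "\<And>n. norm (of_nat n * t ^ n) \<le> K" unfolding Bseq_def by blast
  have "real (cuts k) * s ^ k \<le> 4 * (K\<^sup>2 / t ^ 4)" for k
  proof -
    have "(real (k + 2) * t ^ (k + 2))\<^sup>2 \<le> K\<^sup>2"
      by (rule power_mono) (use K[of "k + 2"] t in auto)
    moreover have "(real (k + 2) * t ^ (k + 2))\<^sup>2 = (real (k + 2))\<^sup>2 * (s ^ k * t ^ 4)"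
      unfolding t(3)[symmetric] by (simp add: power_mult_distrib power_add power_mult[symmetric] mult.commute power2_eq_square numeral_eq_Suc)
    ultimately have "(real (k + 2))\<^sup>2 * s ^ k \<le> K\<^sup>2 / t ^ 4" using t by (simp add: field_simps)
    moreover have "real (cuts k) \<le> 4 * (real (k + 2))\<^sup>2"
      by (simp add: cuts_def power2_eq_square) (simp add: algebra_simps)
    then have "real (cuts k) * s ^ k \<le> 4 * (real (k + 2))\<^sup>2 * s ^ k" by (rule mult_right_mono) (use assms in simp)
    ultimately show ?thesis by simp
  qed
  then show ?thesis by (rule that)
qed

lemma eventually_le_powr:
  fixes B d :: real
  assumes "0 < d"
  shows "eventually (\<lambda>x. B \<le> x powr d) at_top"
proof (rule eventually_mono[OF eventually_ge_at_top[of "(max B 1) powr (1 / d)"]])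
  fix x assume "(max B 1) powr (1 / d) \<le> x"
  then have "((max B 1) powr (1 / d)) powr d \<le> x powr d" using assms by (intro powr_mono2) auto
  then show "B \<le> x powr d" using assms by (simp add: powr_powr)
qed

text \<open>
  The regions of scale \<open>k\<close> have sides at most \<open>L (3/2)\<^sup>k\<close>, and the overlaps in the passage from
  scale \<open>k\<close> to scale \<open>k + 1\<close> have width at least \<open>L (3/2)\<^sup>k / (3 cuts k)\<close>.
\<close>

lemma scales_exist:
  fixes c \<alpha> \<beta> l\<^sub>0 :: real
  assumes c: "0 < c" and \<alpha>: "0 < \<alpha>" and \<beta>: "0 < \<beta>" "\<beta> < 1"
  obtains L where "0 < L"
    "\<And>k. max 1 l\<^sub>0 \<le> (L * (3/2) ^ Suc k) powr \<beta>"
    "\<And>k. (L * (3/2) ^ Suc k) powr \<beta> \<le> L * (3/2) ^ k / (3 * real (cuts k))"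
    "\<And>k. (\<Sum>j<k. 8 * (c * ((L * (3/2) ^ Suc j) powr \<beta>) powr (- \<alpha>))) \<le> 1 / 4"
proof -
  define q :: real where "q = 3 / 2"
  \<comment> \<open>\<open>s\<close> is the ratio by which the power \<beta> of the scale loses to
    the scale in one step, and \<open>r\<close>, defined next, is the ratio of successive error
    terms.\<close>
  define s where "s = q powr (\<beta> - 1)"
  define r where "r = q powr (- (\<alpha> * \<beta>))"
  have q: "1 < q" by (simp add: q_def)
  have s: "0 < s" "s < 1" using q \<beta> by (auto simp: s_def intro: powr_less_one)
  have r: "0 < r" "r < 1" using q \<beta> \<alpha> by (auto simp: r_def intro: powr_less_one)
  obtain U where U: "\<And>k. real (cuts k) * s ^ k \<le> U" using poly_times_geometric_bounded[OF s] by blast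
  have e1: "eventually (\<lambda>L::real. max 1 l\<^sub>0 \<le> L powr \<beta>) at_top"
    by (rule eventually_le_powr) fact
  have e2: "eventually (\<lambda>L::real. 3 * U * q powr \<beta> \<le> L powr (1 - \<beta>)) at_top"
    by (rule eventually_le_powr) (use \<beta> in simp)
  have "((\<lambda>L::real. L powr (- (\<alpha> * \<beta>))) \<longlongrightarrow> 0) at_top"
    by (rule tendsto_neg_powr[OF _ filterlim_ident]) (use \<alpha> \<beta> in simp)
  \<comment> \<open>The error terms sum to at most 8 c L^{-\<alpha>\<beta>} / (1 - r), so 32 = 8 * 4
    leaves 1/4.\<close>
  then have e3: "eventually (\<lambda>L::real. L powr (- (\<alpha> * \<beta>)) < (1 - r) / (32 * c)) at_top"
    by (rule order_tendstoD) (use r c in simp)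
  obtain L :: real where L: "max 1 l\<^sub>0 \<le> L powr \<beta>" "3 * U * q powr \<beta> \<le> L powr (1 - \<beta>)"
      "L powr (- (\<alpha> * \<beta>)) < (1 - r) / (32 * c)" "0 < L"
    using eventually_happens'[OF _ eventually_conj[OF e1 eventually_conj[OF e2 eventually_conj[OF e3 eventually_gt_at_top[of 0]]]]]
    by (auto simp: trivial_limit_at_top_linorder)
  have qk: "(q ^ k) powr x = (q powr x) ^ k" for k x
    using q by (induction k) (simp_all add: powr_mult)
  show ?thesis
  proof (rule that[of L], unfold q_def[symmetric])
    show "0 < L" by fact
    show "max 1 l\<^sub>0 \<le> (L * q ^ Suc k) powr \<beta>" for k
    proof -
      have "1 \<le> q ^ Suc k" using q by (intro one_le_power) simp
      then have "L \<le> L * q ^ Suc k" using L(4) by simp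
      then have "L powr \<beta> \<le> (L * q ^ Suc k) powr \<beta>" using L(4) \<beta> by (intro powr_mono2) auto
      with L(1) show ?thesis by linarith
    qed
    show "(L * q ^ Suc k) powr \<beta> \<le> L * q ^ k / (3 * real (cuts k))" for k
    proof -
      have n: "0 < real (cuts k)" using cuts_pos by simp
      have L1: "L = L powr \<beta> * L powr (1 - \<beta>)" using L(4) by (simp add: powr_add[symmetric])
      have q1: "(q powr \<beta>) ^ k = s ^ k * q ^ k"
      proof -
        have "q powr \<beta> = s * q" using q powr_add[of q "\<beta> - 1" 1] by (simp add: s_def)
        then show ?thesis by (simp add: power_mult_distrib)
      qed
      have "(L * q ^ Suc k) powr \<beta> * (3 * real (cuts k)) = L powr \<beta> * (3 * (real (cuts k) * s ^ k) * q powr \<beta>) * q ^ k"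
        using L(4) q by (simp add: powr_mult qk q1 algebra_simps)
      also have "\<dots> \<le> L powr \<beta> * (3 * U * q powr \<beta>) * q ^ k"
        using U[of k] q by (intro mult_right_mono mult_left_mono) auto
      also have "\<dots> \<le> L powr \<beta> * L powr (1 - \<beta>) * q ^ k"
        using L(2) q by (intro mult_right_mono mult_left_mono) auto
      also have "\<dots> = L * q ^ k" using L1 by simp
      finally show ?thesis using n by (simp add: field_simps)
    qed
    show "(\<Sum>j<k. 8 * (c * ((L * q ^ Suc j) powr \<beta>) powr (- \<alpha>))) \<le> 1 / 4" for k
    proof -
      have "((L * q ^ Suc j) powr \<beta>) powr (- \<alpha>) = L powr (- (\<alpha> * \<beta>)) * r ^ Suc j" for j
      proof -
        have "((L * q ^ Suc j) powr \<beta>) powr (- \<alpha>) = (L * q ^ Suc j) powr (- (\<alpha> * \<beta>))"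
          by (simp add: powr_powr mult.commute del: power_Suc)
        also have "\<dots> = L powr (- (\<alpha> * \<beta>)) * (q ^ Suc j) powr (- (\<alpha> * \<beta>))"
          using L(4) q by (intro powr_mult)
        finally show ?thesis unfolding qk r_def .
      qed
      then have "(\<Sum>j<k. 8 * (c * ((L * q ^ Suc j) powr \<beta>) powr (- \<alpha>))) = 8 * c * L powr (- (\<alpha> * \<beta>)) * (\<Sum>j<k. r ^ Suc j)"
        by (simp add: sum_distrib_left mult.assoc del: power_Suc)
      also have "(\<Sum>j<k. r ^ Suc j) \<le> 1 / (1 - r)"
      proof -
        have "(\<Sum>j<k. r ^ Suc j) \<le> (\<Sum>j<k. r ^ j)" by (rule sum_mono) (use r in \<open>simp add: mult_left_le_one_le\<close>)
        also have "\<dots> = (1 - r ^ k) / (1 - r)" using r by (simp add: sum_gp_strict)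
        also have "\<dots> \<le> 1 / (1 - r)" using r by (intro divide_right_mono) auto
        finally show ?thesis .
      qed
      then have "8 * c * L powr (- (\<alpha> * \<beta>)) * (\<Sum>j<k. r ^ Suc j) \<le> 8 * c * L powr (- (\<alpha> * \<beta>)) * (1 / (1 - r))"
        using c by (intro mult_left_mono) auto
      also have "\<dots> \<le> 8 * c * ((1 - r) / (32 * c)) * (1 / (1 - r))"
        using c r L(3) by (intro mult_right_mono mult_left_mono) auto
      also have "\<dots> = 1 / 4" using c r by simp
      finally show ?thesis .
    qed
  qed
qed

subsection \<open>The recursion\<close>

context isometric_network
begin

text \<open>Sides are bounded from above only, so the pieces of a cut rectangle are covered as well;
  both values of \<open>p\<close> give the symmetry in the two sides. Fewer than two vertices are
  excluded: a single vertex has no energy, yet its map need not be surjective.\<close>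

definition all_gapped :: "real \<Rightarrow> real \<Rightarrow> real \<Rightarrow> bool" where
  "all_gapped a b \<gamma> \<longleftrightarrow> (\<forall>p\<in>{id, prod.swap}. \<forall>x y w h. w \<le> a \<longrightarrow> h \<le> b \<longrightarrow>
     2 \<le> card (rectangle G p x w y h) \<longrightarrow> gapped (rectangle G p x w y h) \<gamma>)"

lemma all_gapped_commute: "all_gapped a b \<gamma> \<Longrightarrow> all_gapped b a \<gamma>"
  unfolding all_gapped_def
proof (intro ballI allI impI)
  fix p x y w h
  assume g: "\<forall>p\<in>{id, prod.swap}. \<forall>x y w h. w \<le> a \<longrightarrow> h \<le> b \<longrightarrow>
     2 \<le> card (rectangle G p x w y h) \<longrightarrow> gapped (rectangle G p x w y h) \<gamma>"
    and p: "p \<in> {id, prod.swap}" and w: "w \<le> b" "h \<le> a" and c: "2 \<le> card (rectangle G p x w y h)"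
  have "prod.swap \<circ> p \<in> {id, prod.swap}" using p by auto
  with g w c show "gapped (rectangle G p x w y h) \<gamma>" unfolding rectangle_swap[of p x w y h] by blast
qed

lemma all_gapped_mono: "all_gapped a b \<gamma> \<Longrightarrow> \<gamma>' \<le> \<gamma> \<Longrightarrow> all_gapped a b \<gamma>'"
  unfolding all_gapped_def using gapped_mono by blast

text \<open>Only the side along the first coordinate grows; the other stays below \<open>b\<close>.
  \<open>M\<close> is a common lower bound for the overlap widths, so the hypothesis applies to all
  of them with the error evaluated at \<open>M\<close>. Rectangles with w \<le> a need no
  cut.\<close>

lemma recursion_step:
  fixes n :: nat and M :: real
  assumes small: "all_gapped a b \<gamma>" and \<gamma>: "0 \<le> \<gamma>" and n: "0 < n" and ab: "b \<le> 3 / 2 * a"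
    and c: "0 < c" and \<alpha>: "0 < \<alpha>" and \<beta>: "0 < \<beta>"
    and M: "max 1 l\<^sub>0 \<le> M" "M \<le> a / (3 * real n)" "(3 / 2 * a) powr \<beta> \<le> M" "8 * (c * M powr (- \<alpha>)) \<le> 1"
    and fact: "\<And>\<Lambda> p x l\<^sub>A l\<^sub>B l\<^sub>C l\<^sub>V A B C.
         \<lbrakk>square_region G \<Lambda>; adjacent_rectangles G E p x l\<^sub>A l\<^sub>B l\<^sub>C l\<^sub>V A B C; A \<union> B \<union> C \<subseteq> \<Lambda>;
          l\<^sub>B \<ge> l\<^sub>0; l\<^sub>B \<ge> Max {l\<^sub>V, l\<^sub>A, l\<^sub>C} powr \<beta>\<rbrakk>
         \<Longrightarrow> \<exists>\<epsilon> \<le> c * l\<^sub>B powr (- \<alpha>). rectangles_factorizable E T \<epsilon> p x l\<^sub>A l\<^sub>B A B C"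
  shows "all_gapped (3 / 2 * a) b (\<gamma> * ((1 - 8 * (c * M powr (- \<alpha>))) * (real n / (real n + 1))))"
    (is "all_gapped _ _ ?\<gamma>")
  unfolding all_gapped_def
proof (intro ballI allI impI)
  fix p x y w h
  assume p: "p \<in> {id, prod.swap}" and w: "w \<le> 3 / 2 * a" and h: "h \<le> b" and card: "2 \<le> card (rectangle G p x w y h)"
  let ?\<eta> = "c * M powr (- \<alpha>)"
  have \<eta>: "0 \<le> ?\<eta>" using c by simp
  show "gapped (rectangle G p x w y h) ?\<gamma>"
  proof (cases "w \<le> a")
    case True
    have "(1 - 8 * ?\<eta>) * (real n / (real n + 1)) \<le> 1 * 1"
      using M(4) \<eta> by (intro mult_mono) auto
    from mult_left_mono[OF this \<gamma>] have "?\<gamma> \<le> \<gamma>" by simp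
    moreover have "gapped (rectangle G p x w y h) \<gamma>" using small p True h card unfolding all_gapped_def by blast
    ultimately show ?thesis using gapped_mono by blast
  next
    case False
    then have wa: "a < w" by simp
    have Mw: "M \<le> w / (3 * real n)"
      by (rule order_trans[OF M(2) divide_right_mono]) (use wa in auto)
    show ?thesis
    proof (rule cut_rectangle[OF p card n \<gamma>])
      show "?\<eta> \<le> 1" "8 * ?\<eta> \<le> 1" "0 \<le> ?\<eta>" using M(4) \<eta> by auto
      have "1 \<le> w / (3 * real n)" using M(1) Mw by simp
      then show "3 * real n \<le> w" using n by (simp add: field_simps)
      show "gapped (rectangle G p x' w' y h) \<gamma>" if "w' \<le> 2 / 3 * w" "2 \<le> card (rectangle G p x' w' y h)" for x' w'
      proof -
        have "w' \<le> a" using that(1) w by simp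
        then show ?thesis using small p h that(2) unfolding all_gapped_def by blast
      qed
      fix lA lC A B C
      assume l: "lA \<le> w" "lC \<le> w" and adj: "adjacent_rectangles G E p x lA (w / (3 * real n)) lC h A B C"
      have pos: "0 < lA" "0 < lC" "0 < h" using adj by (auto simp: adjacent_rectangles_def)
      obtain y' where y': "A = rectangle G p x lA y' h" "B = rectangle G p (x + lA) (w / (3 * real n)) y' h"
        "C = rectangle G p (x + lA + w / (3 * real n)) lC y' h"
        using adj unfolding adjacent_rectangles_def by blast
      have b0: "0 < w / (3 * real n)" using adj by (simp add: adjacent_rectangles_def)
      have sub: "A \<union> B \<union> C \<subseteq> rectangle G p x (lA + w / (3 * real n) + lC) y' h"
        using pos b0 unfolding y' by (auto simp: rectangle_def)
      obtain \<Lambda> where \<Lambda>: "square_region G \<Lambda>" "rectangle G p x (lA + w / (3 * real n) + lC) y' h \<subseteq> \<Lambda>"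
        using rectangle_in_square[OF p] by blast
      \<comment> \<open>The bound on \<open>b\<close> makes the height obey the same bound as the
        widths.\<close>
      have "Max {h, lA, lC} \<le> 3 / 2 * a" using l w h ab by simp
      moreover have "0 < Max {h, lA, lC}" using pos by (simp add: less_max_iff_disj)
      ultimately have "Max {h, lA, lC} powr \<beta> \<le> (3 / 2 * a) powr \<beta>" using \<beta> by (intro powr_mono2) auto
      then have Mx: "Max {h, lA, lC} powr \<beta> \<le> w / (3 * real n)" using M(3) Mw by linarith
      have "l\<^sub>0 \<le> w / (3 * real n)" using M(1) Mw by simp
      then obtain \<epsilon> where \<epsilon>: "\<epsilon> \<le> c * (w / (3 * real n)) powr (- \<alpha>)" "rectangles_factorizable E T \<epsilon> p x lA (w / (3 * real n)) A B C"
        using fact[OF \<Lambda>(1) adj _ _ Mx] sub \<Lambda>(2) by (meson order_trans)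
      have "(w / (3 * real n)) powr (- \<alpha>) \<le> M powr (- \<alpha>)"
        using M(1) Mw \<alpha> by (intro powr_mono2') auto
      then have "c * (w / (3 * real n)) powr (- \<alpha>) \<le> ?\<eta>" using c by (intro mult_left_mono) auto
      with \<epsilon> show "\<exists>\<epsilon>\<le>?\<eta>. rectangles_factorizable E T \<epsilon> p x lA (w / (3 * real n)) A B C"
        by (meson order_trans)
    qed
  qed
qed

text \<open>The loss \<open>s\<close> of a scale collects the error of the factorization and that of
  the averaging. Each sums to at most 1/4, so the product of the factors 1 - s stays above 1/2, and
  its square above 1/4.\<close>

lemma rectangles_uniformly_gapped:
  assumes cond: "uniformly_conditioned G E T"
    and constants: "0 < c" "0 < \<alpha>" "0 < \<beta>" "\<beta> < 1"
    and fact: "\<And>\<Lambda> p x l\<^sub>A l\<^sub>B l\<^sub>C l\<^sub>V A B C.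
         \<lbrakk>square_region G \<Lambda>; adjacent_rectangles G E p x l\<^sub>A l\<^sub>B l\<^sub>C l\<^sub>V A B C; A \<union> B \<union> C \<subseteq> \<Lambda>;
          l\<^sub>B \<ge> l\<^sub>0; l\<^sub>B \<ge> Max {l\<^sub>V, l\<^sub>A, l\<^sub>C} powr \<beta>\<rbrakk>
         \<Longrightarrow> \<exists>\<epsilon> \<le> c * l\<^sub>B powr (- \<alpha>). rectangles_factorizable E T \<epsilon> p x l\<^sub>A l\<^sub>B A B C"
  shows "\<exists>\<gamma>>0. \<forall>l. all_gapped l l \<gamma>"
proof -
  obtain L where L: "0 < L" and S1: "\<And>k. max 1 l\<^sub>0 \<le> (L * (3/2) ^ Suc k) powr \<beta>"
    and S2: "\<And>k. (L * (3/2) ^ Suc k) powr \<beta> \<le> L * (3/2) ^ k / (3 * real (cuts k))"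
    and S3: "\<And>k. (\<Sum>j<k. 8 * (c * ((L * (3/2) ^ Suc j) powr \<beta>) powr (- \<alpha>))) \<le> 1 / 4"
    using scales_exist[OF constants] by metis
  define \<eta> where "\<eta> j = 8 * (c * ((L * (3/2) ^ Suc j) powr \<beta>) powr (- \<alpha>))" for j
  define s where "s j = \<eta> j + 1 / (real (cuts j) + 1)" for j
  have \<eta>0: "0 \<le> \<eta> j" for j using constants by (simp add: \<eta>_def)
  have \<eta>1: "\<eta> j \<le> 1 / 4" for j
  proof -
    have "\<eta> j \<le> (\<Sum>i<Suc j. \<eta> i)" by (rule member_le_sum) (use \<eta>0 in auto)
    then show ?thesis using S3[of "Suc j"] unfolding \<eta>_def[symmetric] by linarith
  qed
  have s0: "0 \<le> s j" for j using \<eta>0[of j] by (simp add: s_def)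
  have sum_s: "(\<Sum>j<k. s j) \<le> 1 / 2" for k
    using S3[of k] sum_cuts[of k] unfolding s_def \<eta>_def[symmetric] by (simp add: sum.distrib)
  have s1: "s j \<le> 1" for j
  proof -
    have "s j \<le> (\<Sum>i<Suc j. s i)" by (rule member_le_sum) (use s0 in auto)
    then show ?thesis using sum_s[of "Suc j"] by linarith
  qed
  note pr = prod_one_minus_ge[of s, OF s0 s1]
  obtain \<gamma>0 where \<gamma>0: "0 < \<gamma>0" "\<And>\<Lambda>. finite \<Lambda> \<Longrightarrow> \<Lambda> \<subseteq> G \<Longrightarrow> card \<Lambda> \<le> cells L \<Longrightarrow>
    (\<And>v. v \<in> \<Lambda> \<Longrightarrow> \<exists>e\<in>inner_edges E \<Lambda>. v \<in> e) \<Longrightarrow> gapped \<Lambda> \<gamma>0"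
    using bounded_regions_gapped[OF cond, of "cells L"] by metis
  have base: "all_gapped L L \<gamma>0"
    unfolding all_gapped_def
  proof (intro ballI allI impI)
    fix p x y w h
    assume p: "p \<in> {id, prod.swap}" and wh: "w \<le> L" "h \<le> L" and card: "2 \<le> card (rectangle G p x w y h)"
    show "gapped (rectangle G p x w y h) \<gamma>0"
      by (rule \<gamma>0(2)[OF rectangle_card(1)[OF p wh] rectangle_subset rectangle_card(2)[OF p wh]])
         (use rectangle_vertex_covered[OF p card] in metis)
  qed
  have all: "all_gapped (L * (3/2) ^ k) (L * (3/2) ^ k) (\<gamma>0 * (\<Prod>j<k. 1 - s j)\<^sup>2)" for k
  proof (induction k)
    case 0
    then show ?case using base by simp
  next
    case (Suc k)
    let ?a = "L * (3/2) ^ k" and ?M = "(L * (3/2) ^ Suc k) powr \<beta>" and ?g = "\<gamma>0 * (\<Prod>j<k. 1 - s j)\<^sup>2"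
    define f where "f = (1 - 8 * (c * ?M powr (- \<alpha>))) * (real (cuts k) / (real (cuts k) + 1))"
    have a0: "0 < ?a" using L by simp
    have n: "0 < cuts k" by (rule cuts_pos)
    have Sa: "3 / 2 * ?a = L * (3/2) ^ Suc k" by simp
    have g0: "0 \<le> ?g" using \<gamma>0(1) by simp
    have M4: "8 * (c * ?M powr (- \<alpha>)) \<le> 1" using \<eta>1[of k] unfolding \<eta>_def by simp
    have f0: "0 \<le> f" unfolding f_def using M4 by simp
    \<comment> \<open>(1 - x) (1 - y) \<ge> 1 - (x + y) for x, y \<ge> 0.\<close>
    have f1: "1 - s k \<le> f"
    proof -
      have "real (cuts k) / (real (cuts k) + 1) = 1 - 1 / (real (cuts k) + 1)" by (simp add: field_simps)
      then have "f = (1 - \<eta> k) * (1 - 1 / (real (cuts k) + 1))" unfolding f_def \<eta>_def by simp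
      also have "\<dots> = 1 - s k + \<eta> k * (1 / (real (cuts k) + 1))"
      proof -
        have "(1 - x) * (1 - y) = 1 - (x + y) + x * y" for x y :: real by (simp add: algebra_simps)
        then show ?thesis unfolding s_def .
      qed
      finally show ?thesis using \<eta>0[of k] by simp
    qed
    have step: "all_gapped (3 / 2 * ?a) b (\<gamma> * f)" if "all_gapped ?a b \<gamma>" "0 \<le> \<gamma>" "b \<le> 3 / 2 * ?a" for b \<gamma>
      unfolding f_def
    proof (rule recursion_step[OF that(1,2) n that(3) constants(1-3) S1[of k] S2[of k] _ M4])
      show "(3 / 2 * ?a) powr \<beta> \<le> ?M" by (simp only: Sa order_refl)
    qed (rule fact; assumption)
    \<comment> \<open>One side first; after exchanging the roles of the sides the same step enlarges
      the other, which is why the loss factor appears squared.\<close>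
    have "all_gapped (3 / 2 * ?a) ?a (?g * f)" by (rule step[OF Suc.IH g0]) (use a0 in simp)
    then have "all_gapped ?a (3 / 2 * ?a) (?g * f)" by (rule all_gapped_commute)
    then have "all_gapped (3 / 2 * ?a) (3 / 2 * ?a) (?g * f * f)" by (rule step) (use g0 f0 in auto)
    moreover have "\<gamma>0 * (\<Prod>j<Suc k. 1 - s j)\<^sup>2 \<le> ?g * f * f"
    proof -
      have "(1 - s k)\<^sup>2 \<le> f\<^sup>2" by (rule power_mono[OF f1]) (use s1[of k] in simp)
      from mult_left_mono[OF this g0] show ?thesis by (simp add: power_mult_distrib power2_eq_square mult_ac)
    qed
    ultimately show ?case unfolding Sa by (rule all_gapped_mono)
  qed
  show ?thesis
  proof (intro exI[of _ "\<gamma>0 / 4"] conjI allI)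
    show "0 < \<gamma>0 / 4" using \<gamma>0(1) by simp
    fix l :: real
    \<comment> \<open>Every square is covered by some scale, and the constant \<gamma>0 / 4 does not
      depend on which.\<close>
    obtain k where k: "l / L < (3/2) ^ k" using real_arch_pow[of "3/2" "l / L"] by auto
    then have lk: "l \<le> L * (3/2) ^ k" using L by (simp add: field_simps)
    have "1 / 2 \<le> (\<Prod>j<k. 1 - s j)" using pr(1)[of k] sum_s[of k] by linarith
    then have "(1 / 2)\<^sup>2 \<le> (\<Prod>j<k. 1 - s j)\<^sup>2" by (rule power_mono) simp
    from mult_left_mono[OF this, of \<gamma>0] have "\<gamma>0 / 4 \<le> \<gamma>0 * (\<Prod>j<k. 1 - s j)\<^sup>2"
      using \<gamma>0(1) by (simp add: power2_eq_square)
    from all_gapped_mono[OF all[of k] this] lk show "all_gapped l l (\<gamma>0 / 4)"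
      unfolding all_gapped_def by (meson order_trans)
  qed
qed

end

theorem mainTheorem1:
  fixes G :: "vertex set" and E :: "edge set"
    and T :: "('p::finite, 'b::finite) peps"
    and c \<alpha> \<beta> l\<^sub>0 :: real
  assumes graph: "isometric_planar_graph G E"
    and injective: "injective_peps G E T"
    and conditioned: "uniformly_conditioned G E T"
    and constants: "0 < c" "0 < \<alpha>" "0 < \<beta>" "\<beta> < 1"
    and factorizable:
      "\<And>\<Lambda> p x l\<^sub>A l\<^sub>B l\<^sub>C l\<^sub>V A B C.
         \<lbrakk>square_region G \<Lambda>;
          adjacent_rectangles G E p x l\<^sub>A l\<^sub>B l\<^sub>C l\<^sub>V A B C;
          A \<union> B \<union> C \<subseteq> \<Lambda>;
          l\<^sub>B \<ge> l\<^sub>0;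
          l\<^sub>B \<ge> Max {l\<^sub>V, l\<^sub>A, l\<^sub>C} powr \<beta>\<rbrakk>
         \<Longrightarrow> \<exists>\<epsilon> \<le> c * l\<^sub>B powr (- \<alpha>). rectangles_factorizable E T \<epsilon> p x l\<^sub>A l\<^sub>B A B C"
  shows "\<exists>\<gamma>>0. \<forall>\<Lambda>. square_region G \<Lambda> \<and> 2 \<le> card (energies E T \<Lambda>) \<longrightarrow>
           \<gamma> \<le> spectral_gap E T \<Lambda>"
proof -
  interpret isometric_network G E T
    by unfold_locales (fact graph injective)+
  have "\<exists>\<gamma>>0. \<forall>l. all_gapped l l \<gamma>"
    by (rule rectangles_uniformly_gapped[OF conditioned constants]) (rule factorizable; assumption)
  then obtain \<gamma> where \<gamma>: "0 < \<gamma>" "\<And>l. all_gapped l l \<gamma>" by blast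
  have "\<gamma> \<le> spectral_gap E T \<Lambda>" if \<Lambda>: "square_region G \<Lambda>" and two: "2 \<le> card (energies E T \<Lambda>)" for \<Lambda>
  proof -
    obtain x y l where l: "\<Lambda> = rectangle G id x l y l" using \<Lambda> unfolding square_region_def by blast
    have fin: "finite \<Lambda>" "\<Lambda> \<subseteq> G" unfolding l using rectangle_card(1)[of id l l l] rectangle_subset by auto
    \<comment> \<open>The form inequality is available only for regions with at least two vertices,
      which the second eigenvalue guarantees.\<close>
    have "inner_edges E \<Lambda> \<noteq> {}" using energies_no_edges[of \<Lambda>] two by linarith
    then obtain e where e: "e \<in> E" "e \<subseteq> \<Lambda>" by (auto simp: inner_edges_def)
    have "2 \<le> card \<Lambda>" using card_mono[OF fin(1) e(2)] card_edge[OF e(1)] by simp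
    then have "gapped \<Lambda> \<gamma>" using \<gamma>(2)[of l] unfolding all_gapped_def l by blast
    then show ?thesis using spectral_gap_ge[OF fin] two by blast
  qed
  then show ?thesis using \<gamma>(1) by blast
qed

end
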